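(* For any complete simplicial fan $\Phi$ in a finite-dimensional real vector space, $$\operatorname{sign}(\Phi)=\varepsilon(\Phi),\qquad \text{where } \varepsilon(\Phi):=\sum_i(-1)^i\dim H^{2i}(\Phi).$$
   Context: Let $V$ be a real vector space of dimension $n$. A cone in $V$ is a closed convex polyhedral cone with vertex at the origin (so $\{0\}$ is a face). A fan in $V$ is a finite set of cones closed under taking faces such that any two cones intersect along a common face. It is complete if its cones cover $V$, and simplicial if every $k$-dimensional cone has exactly $k$ rays (one-dimensional faces). $\Phi(n)$ is the set of $n$-dimensional cones. Cohomology. $A=\operatorname{S}(V^\vee)$ is the algebra of polynomial functions on $V$, graded so that linear functions have degree $2$; $A^+$ is its ideal of elements of positive degree. $\mathcal A_\Phi(\Phi)$ is the graded $A$-algebra of continuous functions on $V$ whose restriction to each cone of $\Phi$ is polynomial (cone-wise linear functions have degree $2$). $H(\Phi):=\mathcal A_\Phi(\Phi)/A^+\mathcal A_\Phi(\Phi)$, a graded ring; $H^{2i}(\Phi)$ is its component of degree $2i$. Integral. Fix a volume form $\Omega_V$ on $V$. A Courant function of a ray $\rho\in\Phi$ is a cone-wise linear function $\phi_\rho$ which is positive on $\rho\smallsetminus\{0\}$ and zero on all other rays of $\Phi$. For $\sigma\in\Phi(n)$ with rays $\rho_1,\dots,\rho_n$ and $v_{\rho_i}\in\rho_i$ with $\phi_{\rho_i}(v_{\rho_i})=1$, let $F_\sigma\in A$ be the polynomial agreeing with $|\Omega_V(v_{\rho_1},\dots,v_{\rho_n})|\cdot\phi_{\rho_1}\cdots\phi_{\rho_n}$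 on $\sigma$. For $f\in\mathcal A_\Phi(\Phi)$ with $f_\sigma\in A$ the polynomial agreeing with $f$ on $\sigma$, set $\zeta_\Phi(f)=\sum_{\sigma\in\Phi(n)}f_\sigma/F_\sigma$. It is a theorem of Brion that $\zeta_\Phi(f)\in A$ and that $\zeta_\Phi$ is $A$-linear; it lowers degree by $2n$. It therefore induces $\int_\Phi\colon H(\Phi)\to\mathbb R$, which vanishes outside degree $2n$. $\operatorname{sign}(\Phi)$ is the signature of the nondegenerate symmetric bilinear Poincaré pairing $H(\Phi)\times H(\Phi)\to\mathbb R$, $(\alpha,\beta)\mapsto\int_\Phi\alpha\cdot\beta$. *)

theory Defs
  imports
    "HOL-Analysis.Analysis"
    "HOL-Algebra.Embedded_Algebras"
    "HOL-Algebra.QuotRing"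
begin

text \<open>
  The ambient space is the whole of a type \<open>'a::real_normed_vector\<close> that is assumed to be
  finite-dimensional. The norm serves only to provide the canonical topology. Unlike
  \<open>euclidean_space\<close>, this class does not exclude the zero space.
\<close>

definition finite_dimensional :: "'a::real_vector itself \<Rightarrow> bool" where
  "finite_dimensional _ \<longleftrightarrow> (\<exists>B::'a set. finite B \<and> span B = UNIV)"


section \<open>Cones and fans\<close>

text \<open>
  Polyhedral means finitely generated; such cones are closed in a finite-dimensional space.
  That \<open>{0}\<close> is a face says that the cone has its vertex at the origin (it contains no line).
\<close>

definition polyhedral_cone :: "'a::real_vector set \<Rightarrow> bool" where
  "polyhedral_cone \<sigma> \<longleftrightarrow> (\<exists>S. finite S \<and> \<sigma> = convex_cone hull S) \<and> {0} face_of \<sigma>"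

text \<open>The library relation \<open>face_of\<close> also admits the empty set, which is not a face of a cone.\<close>

definition cone_face :: "'a::real_vector set \<Rightarrow> 'a set \<Rightarrow> bool" where
  "cone_face \<tau> \<sigma> \<longleftrightarrow> \<tau> face_of \<sigma> \<and> \<tau> \<noteq> {}"

definition fan :: "'a::real_vector set set \<Rightarrow> bool" where
  "fan \<Phi> \<longleftrightarrow>
     finite \<Phi> \<and>
     (\<forall>\<sigma>\<in>\<Phi>. polyhedral_cone \<sigma>) \<and>
     (\<forall>\<sigma>\<in>\<Phi>. \<forall>\<tau>. cone_face \<tau> \<sigma> \<longrightarrow> \<tau> \<in> \<Phi>) \<and>
     (\<forall>\<sigma>\<in>\<Phi>. \<forall>\<tau>\<in>\<Phi>. cone_face (\<sigma> \<inter> \<tau>) \<sigma> \<and> cone_face (\<sigma> \<inter> \<tau>) \<tau>)"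

definition complete_fan :: "'a::real_vector set set \<Rightarrow> bool" where
  "complete_fan \<Phi> \<longleftrightarrow> fan \<Phi> \<and> \<Union>\<Phi> = UNIV"

text \<open>The dimension of a cone is that of its linear span, which is what \<open>dim\<close> computes.\<close>

definition cone_rays :: "'a::real_vector set \<Rightarrow> 'a set set" where
  "cone_rays \<sigma> = {\<rho>. cone_face \<rho> \<sigma> \<and> dim \<rho> = 1}"

definition fan_rays :: "'a::real_vector set set \<Rightarrow> 'a set set" where
  "fan_rays \<Phi> = {\<rho>\<in>\<Phi>. dim \<rho> = 1}"

definition simplicial_fan :: "'a::real_vector set set \<Rightarrow> bool" where
  "simplicial_fan \<Phi> \<longleftrightarrow> fan \<Phi> \<and> (\<forall>\<sigma>\<in>\<Phi>. card (cone_rays \<sigma>) = dim \<sigma>)"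

definition max_cones :: "'a::real_vector set set \<Rightarrow> 'a set set" where
  "max_cones \<Phi> = {\<sigma>\<in>\<Phi>. dim \<sigma> = dim (UNIV :: 'a set)}"


section \<open>Cone-wise polynomial functions and cohomology\<close>

text \<open>
  The polynomial functions on \<open>V\<close> are the library's \<open>real_polynomial_function\<close>: the algebra
  generated by the (bounded) linear functionals and the constants. All degrees below are
  polynomial degrees, that is, half of the degree in the grading where linear functions have
  degree 2.
\<close>

definition homogeneous_poly :: "nat \<Rightarrow> ('a::real_normed_vector \<Rightarrow> real) \<Rightarrow> bool" where
  "homogeneous_poly k p \<longleftrightarrow>
     real_polynomial_function p \<and> (\<forall>t x. p (t *\<^sub>R x) = t ^ k * p x)"

definition cw_poly :: "'a::real_normed_vector set set \<Rightarrow> ('a \<Rightarrow> real) set" where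
  "cw_poly \<Phi> = {f. continuous_on UNIV f \<and>
     (\<forall>\<sigma>\<in>\<Phi>. \<exists>p. real_polynomial_function p \<and> (\<forall>x\<in>\<sigma>. f x = p x))}"

definition cw_homogeneous :: "'a::real_normed_vector set set \<Rightarrow> nat \<Rightarrow> ('a \<Rightarrow> real) set" where
  "cw_homogeneous \<Phi> k = {f \<in> cw_poly \<Phi>.
     \<forall>\<sigma>\<in>\<Phi>. \<exists>p. homogeneous_poly k p \<and> (\<forall>x\<in>\<sigma>. f x = p x)}"

definition cw_poly_ring :: "'a::real_normed_vector set set \<Rightarrow> ('a \<Rightarrow> real) ring" where
  "cw_poly_ring \<Phi> =
     \<lparr>carrier = cw_poly \<Phi>, monoid.mult = (\<lambda>f g x. f x * g x), one = (\<lambda>x. 1),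
      zero = (\<lambda>x. 0), add = (\<lambda>f g x. f x + g x)\<rparr>"

text \<open>The polynomials all of whose homogeneous components have positive degree.\<close>

definition poly_plus :: "('a::real_normed_vector \<Rightarrow> real) set" where
  "poly_plus = {p. real_polynomial_function p \<and> p 0 = 0}"

definition coh_ideal :: "'a::real_normed_vector set set \<Rightarrow> ('a \<Rightarrow> real) set" where
  "coh_ideal \<Phi> = Idl\<^bsub>cw_poly_ring \<Phi>\<^esub> poly_plus"

definition coh :: "'a::real_normed_vector set set \<Rightarrow> ('a \<Rightarrow> real) set ring" where
  "coh \<Phi> = cw_poly_ring \<Phi> Quot coh_ideal \<Phi>"

definition coh_class :: "'a::real_normed_vector set set \<Rightarrow> ('a \<Rightarrow> real) \<Rightarrow> ('a \<Rightarrow> real) set" where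
  "coh_class \<Phi> f = coh_ideal \<Phi> +>\<^bsub>cw_poly_ring \<Phi>\<^esub> f"

text \<open>
  The copy of \<open>\<real>\<close> inside the cohomology ring, over which the library's notions of dimension
  and subspace (theory \<open>Embedded_Algebras\<close>) are taken.
\<close>

definition coh_scalars :: "'a::real_normed_vector set set \<Rightarrow> ('a \<Rightarrow> real) set set" where
  "coh_scalars \<Phi> = range (\<lambda>c. coh_class \<Phi> (\<lambda>x. c))"

text \<open>\<open>coh_comp \<Phi> i\<close> is the component $H^{2i}(\Phi)$.\<close>

definition coh_comp :: "'a::real_normed_vector set set \<Rightarrow> nat \<Rightarrow> ('a \<Rightarrow> real) set set" where
  "coh_comp \<Phi> i = coh_class \<Phi> ` cw_homogeneous \<Phi> i"

definition coh_dim :: "'a::real_normed_vector set set \<Rightarrow> nat \<Rightarrow> nat" where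
  "coh_dim \<Phi> i = ring.dim (coh \<Phi>) (coh_scalars \<Phi>) (coh_comp \<Phi> i)"

text \<open>The sum ranges over all nonzero components, since an infinite \<open>sum\<close> would be 0.\<close>

definition fan_epsilon :: "'a::real_normed_vector set set \<Rightarrow> int" where
  "fan_epsilon \<Phi> = (\<Sum>i | coh_comp \<Phi> i \<noteq> {\<zero>\<^bsub>coh \<Phi>\<^esub>}. (- 1) ^ i * int (coh_dim \<Phi> i))"


section \<open>The integral\<close>

text \<open>
  An \<open>n\<close>-tuple of vectors is a function on \<open>nat\<close> of which only the values at \<open>i < n\<close> matter,
  with \<open>n\<close> the dimension of the space.
\<close>

definition volume_form :: "((nat \<Rightarrow> 'a::real_vector) \<Rightarrow> real) \<Rightarrow> bool" where
  "volume_form \<Omega> \<longleftrightarrow> (let n = dim (UNIV :: 'a set) in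
     (\<forall>v w. (\<forall>i<n. v i = w i) \<longrightarrow> \<Omega> v = \<Omega> w) \<and>
     (\<forall>v. \<forall>i<n. linear (\<lambda>x. \<Omega> (v(i := x)))) \<and>
     (\<forall>v. \<forall>i<n. \<forall>j<n. i \<noteq> j \<longrightarrow> v i = v j \<longrightarrow> \<Omega> v = 0) \<and>
     (\<exists>v. \<Omega> v \<noteq> 0))"

definition courant_function ::
    "'a::real_normed_vector set set \<Rightarrow> 'a set \<Rightarrow> ('a \<Rightarrow> real) \<Rightarrow> bool" where
  "courant_function \<Phi> \<rho> f \<longleftrightarrow>
     f \<in> cw_homogeneous \<Phi> 1 \<and>
     (\<forall>x\<in>\<rho> - {0}. f x > 0) \<and>
     (\<forall>\<rho>'\<in>fan_rays \<Phi>. \<rho>' \<noteq> \<rho> \<longrightarrow> (\<forall>x\<in>\<rho>'. f x = 0))"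

definition ray_vector :: "('a::real_vector set \<Rightarrow> 'a \<Rightarrow> real) \<Rightarrow> 'a set \<Rightarrow> 'a" where
  "ray_vector \<phi> \<rho> = (THE v. v \<in> \<rho> \<and> \<phi> \<rho> v = 1)"

text \<open>
  \<open>F_poly \<Omega> \<phi> \<sigma>\<close> is the polynomial $F_\sigma$, for a choice \<open>\<phi>\<close> of a Courant function for each ray.
  Its value does not depend on the enumeration \<open>\<rho>\<close> of the rays of \<open>\<sigma>\<close>.
\<close>

definition F_poly ::
    "((nat \<Rightarrow> 'a::real_normed_vector) \<Rightarrow> real) \<Rightarrow> ('a set \<Rightarrow> 'a \<Rightarrow> real) \<Rightarrow> 'a set \<Rightarrow> 'a \<Rightarrow> real" where
  "F_poly \<Omega> \<phi> \<sigma> = (THE F. real_polynomial_function F \<and>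
     (let n = dim (UNIV :: 'a set) in
      \<forall>\<rho>. bij_betw \<rho> {..<n} (cone_rays \<sigma>) \<longrightarrow>
        (\<forall>x\<in>\<sigma>. F x = \<bar>\<Omega> (\<lambda>i. ray_vector \<phi> (\<rho> i))\<bar> * (\<Prod>i<n. \<phi> (\<rho> i) x))))"

definition poly_on :: "('a::real_normed_vector \<Rightarrow> real) \<Rightarrow> 'a set \<Rightarrow> 'a \<Rightarrow> real" where
  "poly_on f \<sigma> = (THE p. real_polynomial_function p \<and> (\<forall>x\<in>\<sigma>. p x = f x))"

text \<open>
  The polynomial that equals the rational function $\sum_\sigma f_\sigma / F_\sigma$, that is,
  agrees with it wherever no denominator vanishes. It exists by Brion's theorem.
\<close>

definition brion_zeta ::
    "((nat \<Rightarrow> 'a::real_normed_vector) \<Rightarrow> real) \<Rightarrow> ('a set \<Rightarrow> 'a \<Rightarrow> real) \<Rightarrow> 'a set set \<Rightarrow>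
     ('a \<Rightarrow> real) \<Rightarrow> 'a \<Rightarrow> real" where
  "brion_zeta \<Omega> \<phi> \<Phi> f = (THE p. real_polynomial_function p \<and>
     (\<forall>x. (\<forall>\<sigma>\<in>max_cones \<Phi>. F_poly \<Omega> \<phi> \<sigma> x \<noteq> 0) \<longrightarrow>
        p x = (\<Sum>\<sigma>\<in>max_cones \<Phi>. poly_on f \<sigma> x / F_poly \<Omega> \<phi> \<sigma> x)))"

text \<open>
  The map induced by \<open>brion_zeta\<close> from the cohomology ring to $A / A^+ = \mathbb{R}$. The class in
  $A / A^+$ of a polynomial is its constant term, that is, its value at 0.
\<close>

definition fan_integral ::
    "((nat \<Rightarrow> 'a::real_normed_vector) \<Rightarrow> real) \<Rightarrow> ('a set \<Rightarrow> 'a \<Rightarrow> real) \<Rightarrow> 'a set set \<Rightarrow>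
     ('a \<Rightarrow> real) set \<Rightarrow> real" where
  "fan_integral \<Omega> \<phi> \<Phi> \<alpha> = the_elem ((\<lambda>f. brion_zeta \<Omega> \<phi> \<Phi> f 0) ` \<alpha>)"


section \<open>Signature\<close>

text \<open>
  Here \<open>R\<close> is a ring with a subfield \<open>K\<close> isomorphic to \<open>\<real>\<close>, and \<open>b\<close> a symmetric \<open>K\<close>-bilinear
  form on \<open>R\<close>. The predicate \<open>ring.dimension R d K W\<close> includes that \<open>W\<close> is a \<open>K\<close>-subspace of \<open>R\<close>.
\<close>

definition positive_index :: "('b, 'c) ring_scheme \<Rightarrow> 'b set \<Rightarrow> ('b \<Rightarrow> 'b \<Rightarrow> real) \<Rightarrow> nat" where
  "positive_index R K b =
     Max {d. \<exists>W. ring.dimension R d K W \<and> (\<forall>w\<in>W. w \<noteq> \<zero>\<^bsub>R\<^esub> \<longrightarrow> b w w > 0)}"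

definition form_signature :: "('b, 'c) ring_scheme \<Rightarrow> 'b set \<Rightarrow> ('b \<Rightarrow> 'b \<Rightarrow> real) \<Rightarrow> int" where
  "form_signature R K b =
     int (positive_index R K b) - int (positive_index R K (\<lambda>x y. - b x y))"

definition poincare_pairing ::
    "((nat \<Rightarrow> 'a::real_normed_vector) \<Rightarrow> real) \<Rightarrow> ('a set \<Rightarrow> 'a \<Rightarrow> real) \<Rightarrow> 'a set set \<Rightarrow>
     ('a \<Rightarrow> real) set \<Rightarrow> ('a \<Rightarrow> real) set \<Rightarrow> real" where
  "poincare_pairing \<Omega> \<phi> \<Phi> \<alpha> \<beta> = fan_integral \<Omega> \<phi> \<Phi> (\<alpha> \<otimes>\<^bsub>coh \<Phi>\<^esub> \<beta>)"

definition fan_signature ::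
    "((nat \<Rightarrow> 'a::real_normed_vector) \<Rightarrow> real) \<Rightarrow> ('a set \<Rightarrow> 'a \<Rightarrow> real) \<Rightarrow> 'a set set \<Rightarrow> int" where
  "fan_signature \<Omega> \<phi> \<Phi> = form_signature (coh \<Phi>) (coh_scalars \<Phi>) (poincare_pairing \<Omega> \<phi> \<Phi>)"

end

theory Submission
  imports Defs "HOL-Library.Function_Algebras" "HOL-Combinatorics.Permutations"
begin

text \<open>
  The form \<open>(f, g) \<mapsto> \<zeta>(f g)\<close> on cone-wise polynomials is bilinear over the polynomial ring. At a
  generic point \<open>x\<close> it becomes the diagonal form with entries \<open>1 / F\<^sub>\<sigma>(x)\<close>, one for each maximal cone;
  at \<open>0\<close> it becomes the Poincare pairing. Since the cone-wise polynomials form a free module, both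
  live on spaces of dimension \<open>|\<Phi>(n)|\<close>. A subspace that is definite at \<open>0\<close> stays definite at \<open>t x\<close> for
  small \<open>t > 0\<close>, so the nondegenerate Poincare pairing has as many positive (negative) squares as
  there are cones with \<open>F\<^sub>\<sigma>(x) > 0\<close> (\<open>< 0\<close>). The sign of \<open>F\<^sub>\<sigma>(x)\<close> is \<open>(-1)\<^sup>k\<close> with \<open>k\<close> the number of
  negative coordinates of \<open>x\<close> with respect to \<open>\<sigma>\<close>, and counting monomials shows that exactly
  \<open>dim H\<^sup>2\<^sup>k\<close> cones have \<open>k\<close> negative coordinates.

  Freeness amounts to the statement that a cone-wise polynomial whose polynomials all vanish at \<open>x\<close> is a
  combination of linear forms vanishing at \<open>x\<close>. For a projective fan this follows by ordering the
  cones by the values at \<open>x\<close> of a strictly convex function. The statement descends along star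
  subdivisions, and every fan becomes projective after star subdivisions of two-dimensional cones.
\<close>

section \<open>Bases and coordinates\<close>

text \<open>Two facts that the statement takes for granted are proved as well: that the localized
  sum is a polynomial, and that the pairing is nondegenerate. The first holds because the numerator
  over a square-free common denominator cancels, on every hyperplane, between the two cones on
  either side of a wall. The second is a dimension count. Sections are replaced by their vectors of
  values at a generic \<open>x\<close>, filtered by degree. Values from degrees below
  \<open>k\<close> and below \<open>n + 1 - k\<close> are orthogonal for the diagonal form, and
  their dimensions must add up to the number of maximal cones. The count uses that \<open>x\<close>
  and \<open>- x\<close> give the same filtration, while a cone with \<open>j\<close> negative
  coordinates for \<open>x\<close> has \<open>n - j\<close> for \<open>- x\<close>; this is why
  reducibility is wanted at both points. The obstacle is that a general fan need not carry a
  strictly convex function, so its cones cannot be ordered directly; the point \<open>x\<close> is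
  therefore chosen generic for an auxiliary refinement too. A basis containing \<open>x\<close>
  turns the linear forms vanishing at \<open>x\<close> into coordinates; the empty basis accounts
  for the zero space.\<close>

definition is_basis :: "'a::real_vector set \<Rightarrow> bool" where
  "is_basis S \<longleftrightarrow> finite S \<and> independent S \<and> span S = UNIV"

lemma is_basisD:
  assumes "is_basis S"
  shows "finite S" "independent S" "span S = UNIV"
  using assms by (auto simp: is_basis_def)

lemma rep_add: "is_basis S \<Longrightarrow> representation S (x + y) v = representation S x v + representation S y v"
  by (simp add: is_basis_def representation_add)

lemma rep_scale: "is_basis S \<Longrightarrow> representation S (t *\<^sub>R x) v = t * representation S x v"
  by (simp add: is_basis_def representation_scale)

lemma rep_minus: "is_basis S \<Longrightarrow> representation S (- y) v = - representation S y v"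
  by (simp add: is_basis_def representation_neg)

lemma rep_linear: "is_basis S \<Longrightarrow> linear (\<lambda>y. representation S y v)"
  by (intro linearI) (simp_all add: rep_add rep_scale)

lemma rep_outside: "v \<notin> S \<Longrightarrow> representation S y v = 0"
  using representation_ne_zero by blast

lemma rep_sum: "is_basis S \<Longrightarrow> (\<Sum>v\<in>S. representation S y v *\<^sub>R v) = y"
  by (rule sum_representation_eq) (auto simp: is_basis_def)

lemma rep_lincomb:
  assumes "is_basis S" "R \<subseteq> S"
  shows "representation S (\<Sum>v\<in>R. t v *\<^sub>R v) w = (if w \<in> R then t w else 0)"
proof -
  have fR: "finite R" using assms finite_subset by (auto simp: is_basis_def)
  have "representation S (\<Sum>v\<in>R. t v *\<^sub>R v) w = (\<Sum>v\<in>R. t v * representation S v w)"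
    using assms by (simp add: linear_sum[OF rep_linear] rep_scale)
  also have "\<dots> = (\<Sum>v\<in>R. if w = v then t v else 0)"
    using assms by (intro sum.cong) (auto simp: representation_basis is_basis_def)
  finally show ?thesis using fR by simp
qed

lemma rep_basis: "is_basis S \<Longrightarrow> v \<in> S \<Longrightarrow> representation S v w = (if w = v then 1 else 0)"
  by (simp add: representation_basis is_basis_def)

lemma linear_expand:
  assumes "is_basis S" "linear f"
  shows "f y = (\<Sum>v\<in>S. representation S y v *\<^sub>R f v)"
proof -
  have "f y = f (\<Sum>v\<in>S. representation S y v *\<^sub>R v)"
    using assms by (simp add: rep_sum)
  thus ?thesis using assms by (simp add: linear_sum linear_scale)
qed

lemma is_basis_dim: "is_basis (S::'a::real_vector set) \<Longrightarrow> card S = dim (UNIV::'a set)"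
  by (metis dim_eq_card is_basis_def span_UNIV)

text \<open>Used for two minimum arguments: the comparison of norms and the lower bound of a
  definite form. Values off \<open>S\<close> are fixed to 0, so that the set is a closed part of a
  product of compact intervals over the whole index type.\<close>

lemma compact_l1_sphere:
  fixes S :: "'b set"
  assumes fS: "finite S"
  shows "compact {u :: 'b \<Rightarrow> real. (\<forall>v. v \<notin> S \<longrightarrow> u v = 0) \<and> (\<Sum>v\<in>S. \<bar>u v\<bar>) = 1}"
proof -
  define A :: "('b \<Rightarrow> real) set" where "A = PiE UNIV (\<lambda>v. if v \<in> S then {-1..1} else {0})"
  have "compactin (product_topology (\<lambda>i. euclidean) UNIV) A"
    unfolding A_def by (subst compactin_PiE) auto
  hence cA: "compact A" by (simp add: euclidean_product_topology)
  have cl: "closed {u. (\<Sum>v\<in>S. \<bar>u v\<bar>) = (1::real)}"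
    by (intro closed_Collect_eq continuous_intros continuous_on_product_coordinates)
  have "{u. (\<forall>v. v \<notin> S \<longrightarrow> u v = 0) \<and> (\<Sum>v\<in>S. \<bar>u v\<bar>) = 1} = A \<inter> {u. (\<Sum>v\<in>S. \<bar>u v\<bar>) = (1::real)}"
  proof (intro equalityI subsetI)
    fix u :: "'b \<Rightarrow> real" assume u: "u \<in> {u. (\<forall>v. v \<notin> S \<longrightarrow> u v = 0) \<and> (\<Sum>v\<in>S. \<bar>u v\<bar>) = 1}"
    have "\<bar>u v\<bar> \<le> 1" if "v \<in> S" for v
      using u member_le_sum[of v S "\<lambda>v. \<bar>u v\<bar>"] that fS by simp
    hence "- 1 \<le> u v \<and> u v \<le> 1" if "v \<in> S" for v using that by (simp add: abs_le_iff minus_le_iff)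
    thus "u \<in> A \<inter> {u. (\<Sum>v\<in>S. \<bar>u v\<bar>) = 1}" using u by (auto simp: A_def PiE_def Pi_def)
  next
    fix u :: "'b \<Rightarrow> real" assume u: "u \<in> A \<inter> {u. (\<Sum>v\<in>S. \<bar>u v\<bar>) = 1}"
    have "u v = 0" if "v \<notin> S" for v
    proof -
      have "u v \<in> (if v \<in> S then {-1..1} else {0})" using u by (auto simp: A_def PiE_def Pi_def)
      thus ?thesis using that by simp
    qed
    thus "u \<in> {u. (\<forall>v. v \<notin> S \<longrightarrow> u v = 0) \<and> (\<Sum>v\<in>S. \<bar>u v\<bar>) = 1}" using u by auto
  qed
  thus ?thesis using compact_Int_closed[OF cA cl] by simp
qed

text \<open>The norm of a linear combination attains its minimum on the compact sphere of
  coefficients, independence makes the minimum positive, and homogeneity does the rest. This yields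
  continuity of coordinates without an inner product.\<close>

lemma basis_norm_bound:
  fixes S :: "'a::real_normed_vector set"
  assumes S: "is_basis S"
  shows "\<exists>c>0. \<forall>y. c * (\<Sum>v\<in>S. \<bar>representation S y v\<bar>) \<le> norm y"
proof (cases "S = {}")
  case True then show ?thesis by (intro exI[of _ 1]) auto
next
  case False
  have fS: "finite S" using S by (simp add: is_basis_def)
  define K where "K = {u :: 'a \<Rightarrow> real. (\<forall>v. v \<notin> S \<longrightarrow> u v = 0) \<and> (\<Sum>v\<in>S. \<bar>u v\<bar>) = 1}"
  have cK: "compact K" unfolding K_def by (rule compact_l1_sphere[OF fS])
  obtain s where s: "s \<in> S" using False by auto
  have "(\<lambda>v. if v = s then 1 else 0) \<in> K"
    using s fS by (auto simp: K_def if_distrib cong: if_cong)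
  hence neK: "K \<noteq> {}" by auto
  have "continuous_on K (\<lambda>u. norm (\<Sum>v\<in>S. u v *\<^sub>R v))"
    by (intro continuous_intros continuous_on_subset[OF continuous_on_product_coordinates]) auto
  from continuous_attains_inf[OF cK neK this] obtain u where
    u: "u \<in> K" "\<And>w. w \<in> K \<Longrightarrow> norm (\<Sum>v\<in>S. u v *\<^sub>R v) \<le> norm (\<Sum>v\<in>S. w v *\<^sub>R v)" by blast
  define c where "c = norm (\<Sum>v\<in>S. u v *\<^sub>R v)"
  have "c \<noteq> 0"
  proof
    assume "c = 0"
    hence "(\<Sum>v\<in>S. u v *\<^sub>R v) = 0" by (simp add: c_def)
    hence "\<forall>v\<in>S. u v = 0"
      using S fS by (metis independent_explicit_finite_subsets is_basis_def order_refl)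
    hence "(\<Sum>v\<in>S. \<bar>u v\<bar>) = 0" by simp
    thus False using u(1) by (simp add: K_def)
  qed
  hence c: "c > 0" by (simp add: c_def)
  moreover have "c * (\<Sum>v\<in>S. \<bar>representation S y v\<bar>) \<le> norm y" for y
  proof (cases "(\<Sum>v\<in>S. \<bar>representation S y v\<bar>) = 0")
    case True thus ?thesis by simp
  next
    case False
    define N where "N = (\<Sum>v\<in>S. \<bar>representation S y v\<bar>)"
    have "N \<ge> 0" unfolding N_def by (intro sum_nonneg) auto
    hence N: "N > 0" using False unfolding N_def by linarith
    define w where "w = (\<lambda>v. representation S y v / N)"
    have "w v = 0" if "v \<notin> S" for v using that by (simp add: w_def rep_outside)
    moreover have "(\<Sum>v\<in>S. \<bar>w v\<bar>) = 1" using N by (simp add: w_def N_def sum_divide_distrib[symmetric])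
    ultimately have "w \<in> K" by (simp add: K_def)
    hence "c \<le> norm (\<Sum>v\<in>S. w v *\<^sub>R v)" using u by (simp add: c_def)
    also have "(\<Sum>v\<in>S. w v *\<^sub>R v) = (1/N) *\<^sub>R (\<Sum>v\<in>S. representation S y v *\<^sub>R v)"
      by (simp add: w_def scaleR_sum_right)
    also have "\<dots> = (1/N) *\<^sub>R y" by (simp add: rep_sum[OF S])
    finally have "c \<le> norm y / N" using N by simp
    thus ?thesis using N unfolding N_def[symmetric] by (simp add: field_simps)
  qed
  ultimately show ?thesis by blast
qed

text \<open>\<open>real_polynomial_function\<close> starts from bounded linear functionals, so this
  is what makes every coordinate a polynomial function.\<close>

lemma linear_bounded_linear:
  fixes f :: "'a::real_normed_vector \<Rightarrow> real"
  assumes S: "is_basis (S :: 'a set)" and f: "linear f"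
  shows "bounded_linear f"
proof -
  obtain c where c: "c > 0" "\<And>y. c * (\<Sum>v\<in>S. \<bar>representation S y v\<bar>) \<le> norm y"
    using basis_norm_bound[OF S] by blast
  define M where "M = (\<Sum>v\<in>S. \<bar>f v\<bar>)"
  have fS: "finite S" using S by (simp add: is_basis_def)
  have "norm (f y) \<le> norm y * (M / c)" for y
  proof -
    have "norm (f y) \<le> (\<Sum>v\<in>S. \<bar>representation S y v\<bar> * \<bar>f v\<bar>)"
      unfolding linear_expand[OF S f, of y] by (auto intro: order_trans[OF sum_abs] simp: abs_mult)
    also have "\<dots> \<le> (\<Sum>v\<in>S. \<bar>representation S y v\<bar> * M)"
      using fS by (intro sum_mono mult_left_mono) (auto simp: M_def intro: member_le_sum)
    also have "\<dots> = (\<Sum>v\<in>S. \<bar>representation S y v\<bar>) * M" by (simp add: sum_distrib_right)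
    also have "\<dots> \<le> (norm y / c) * M"
      using c by (intro mult_right_mono) (auto simp: M_def sum_nonneg field_simps)
    finally show ?thesis by simp
  qed
  thus ?thesis using f by (intro bounded_linear_intro[where K = "M / c"]) (auto simp: linear_add linear_scale)
qed

lemma rep_bounded_linear:
  "is_basis (S :: 'a::real_normed_vector set) \<Longrightarrow> bounded_linear (\<lambda>y. representation S y v)"
  by (metis linear_bounded_linear rep_linear)

lemma rep_continuous_on [continuous_intros]:
  "is_basis (S :: 'a::real_normed_vector set) \<Longrightarrow> continuous_on X g \<Longrightarrow> continuous_on X (\<lambda>y. representation S (g y) v)"
  by (rule bounded_linear.continuous_on[OF rep_bounded_linear])

lemma rep_poly: "is_basis S \<Longrightarrow> real_polynomial_function (\<lambda>y. representation S y v)"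
  by (intro real_polynomial_function.intros(1) rep_bounded_linear)


section \<open>Polynomials in coordinates\<close>

definition mon :: "'a::real_vector set \<Rightarrow> ('a \<Rightarrow> nat) \<Rightarrow> 'a \<Rightarrow> real" where
  "mon S a y = (\<Prod>v\<in>S. representation S y v ^ a v)"

definition supported :: "'a set \<Rightarrow> ('a \<Rightarrow> nat) set" where
  "supported S = {a. \<forall>v. v \<notin> S \<longrightarrow> a v = 0}"

definition expo :: "'a set \<Rightarrow> nat \<Rightarrow> ('a \<Rightarrow> nat) set" where
  "expo S k = {a \<in> supported S. sum a S = k}"

lemma finite_expo: assumes "finite S" shows "finite (expo S k)"
proof (rule finite_subset)
  show "expo S k \<subseteq> {a. \<forall>v. (v \<in> S \<longrightarrow> a v \<in> {..k}) \<and> (v \<notin> S \<longrightarrow> a v = 0)}"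
    using assms by (auto simp: expo_def supported_def intro: member_le_sum)
  show "finite {a::'a\<Rightarrow>nat. \<forall>v. (v \<in> S \<longrightarrow> a v \<in> {..k}) \<and> (v \<notin> S \<longrightarrow> a v = 0)}"
    using finite_set_of_finite_funs[OF assms finite_atMost[of k]] by simp
qed

lemma mon_scale: "is_basis S \<Longrightarrow> mon S a (t *\<^sub>R y) = t ^ sum a S * mon S a y"
  by (simp add: mon_def rep_scale power_mult_distrib prod.distrib power_sum)

lemma mon_poly: "is_basis S \<Longrightarrow> real_polynomial_function (mon S a)"
  unfolding mon_def
  by (intro real_polynomial_function_prod real_polynomial_function_power rep_poly) (auto simp: is_basis_def)

lemma mon_homogeneous: "is_basis S \<Longrightarrow> a \<in> expo S k \<Longrightarrow> homogeneous_poly k (mon S a)"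
  by (simp add: homogeneous_poly_def mon_poly mon_scale expo_def)

definition fscale :: "real \<Rightarrow> ('b \<Rightarrow> real) \<Rightarrow> 'b \<Rightarrow> real" where
  "fscale c f = (\<lambda>x. c * f x)"

global_interpretation fv: vector_space fscale
  by unfold_locales (auto simp: fscale_def fun_eq_iff algebra_simps)

lemma fun_sum_apply: "(sum f A) x = (\<Sum>i\<in>A. f i x)" for f :: "'i \<Rightarrow> 'b \<Rightarrow> real"
  by (induction A rule: infinite_finite_induct) auto

lemma poly_in_span_mon:
  fixes p :: "'a::real_normed_vector \<Rightarrow> real"
  assumes S: "is_basis S" and p: "real_polynomial_function p"
  shows "p \<in> fv.span (mon S ` supported S)"
  using p
proof induction
  case (linear f)
  have "f = (\<Sum>v\<in>S. fscale (f v) (mon S (\<lambda>w. if w = v then 1 else 0)))"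
  proof
    fix y
    have "mon S (\<lambda>w. if w = v then 1 else 0) y = representation S y v" if "v \<in> S" for v
      using that S unfolding mon_def
      by (subst prod.remove[of _ v]) (auto simp: is_basis_def intro: prod.neutral)
    thus "f y = (\<Sum>v\<in>S. fscale (f v) (mon S (\<lambda>w. if w = v then 1 else 0))) y"
      using linear_expand[OF S bounded_linear.linear[OF linear], of y]
      by (simp add: fun_sum_apply fscale_def mult.commute)
  qed
  moreover have "(\<Sum>v\<in>S. fscale (f v) (mon S (\<lambda>w. if w = v then 1 else 0))) \<in> fv.span (mon S ` supported S)"
    by (intro fv.span_sum fv.span_scale fv.span_base imageI) (auto simp: supported_def)
  ultimately show ?case by simp
next
  case (const c)
  have "(\<lambda>x. c) = fscale c (mon S (\<lambda>v. 0))" by (simp add: fscale_def mon_def)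
  moreover have "\<dots> \<in> fv.span (mon S ` supported S)"
    by (intro fv.span_scale fv.span_base imageI) (auto simp: supported_def)
  ultimately show ?case by simp
next
  case (add f g)
  then show ?case using fv.span_add[of f _ g] by (simp add: plus_fun_def)
next
  case (mult f g)
  have 1: "mon S a * g \<in> fv.span (mon S ` supported S)" if a: "a \<in> supported S" for a
    using mult.IH(2)
  proof (induction rule: fv.span_induct_alt)
    case base then show ?case using fv.span_zero by (simp add: zero_fun_def)
  next
    case (step c h z)
    then obtain b where b: "b \<in> supported S" "h = mon S b" by auto
    have "mon S a * (fscale c h + z) = fscale c (mon S (\<lambda>v. a v + b v)) + mon S a * z"
      by (auto simp: fun_eq_iff b fscale_def mon_def algebra_simps power_add prod.distrib)
    moreover have "(\<lambda>v. a v + b v) \<in> supported S" using a b by (simp add: supported_def)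
    hence "fscale c (mon S (\<lambda>v. a v + b v)) + mon S a * z \<in> fv.span (mon S ` supported S)"
      by (intro fv.span_add[OF fv.span_scale[OF fv.span_base[OF imageI]]] step(2))
    ultimately show ?case by (simp only:)
  qed
  have "f * g \<in> fv.span (mon S ` supported S)"
    using mult.IH(1)
  proof (induction rule: fv.span_induct_alt)
    case base then show ?case using fv.span_zero by (simp add: zero_fun_def)
  next
    case (step c h z)
    have "(fscale c h + z) * g = fscale c (h * g) + z * g"
      by (auto simp: fun_eq_iff fscale_def algebra_simps)
    moreover have "h * g \<in> fv.span (mon S ` supported S)" using step(1) 1 by blast
    hence "fscale c (h * g) + z * g \<in> fv.span (mon S ` supported S)"
      by (intro fv.span_add[OF fv.span_scale] step(2))
    ultimately show ?case by (simp only:)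
  qed
  then show ?case by (simp add: times_fun_def)
qed

lemma poly_expand:
  fixes p :: "'a::real_normed_vector \<Rightarrow> real"
  assumes S: "is_basis S" and p: "real_polynomial_function p"
  obtains c A where "finite A" "A \<subseteq> supported S" "\<And>y. p y = (\<Sum>a\<in>A. c a * mon S a y)"
proof -
  from poly_in_span_mon[OF assms] obtain t r where t: "finite t" "t \<subseteq> mon S ` supported S"
    "p = (\<Sum>m\<in>t. fscale (r m) m)"
    unfolding fv.span_explicit by blast
  then obtain A where A: "A \<subseteq> supported S" "t = mon S ` A" "inj_on (mon S) A"
    by (meson subset_image_inj)
  have fA: "finite A" using A t finite_imageD by blast
  have "p y = (\<Sum>a\<in>A. r (mon S a) * mon S a y)" for y
    unfolding t(3) A(2) sum.reindex[OF A(3)] fun_sum_apply by (simp add: fscale_def)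
  from that[OF fA A(1) this] show ?thesis .
qed

lemma poly_graded_expand:
  fixes p :: "'a::real_normed_vector \<Rightarrow> real"
  assumes S: "is_basis S" and p: "real_polynomial_function p"
  obtains c K where "\<And>y. p y = (\<Sum>k\<le>K. \<Sum>a\<in>expo S k. c a * mon S a y)"
proof -
  obtain c A where A: "finite A" "A \<subseteq> supported S" "\<And>y. p y = (\<Sum>a\<in>A. c a * mon S a y)"
    using poly_expand[OF assms] by metis
  define K where "K = (\<Sum>a\<in>A. sum a S)"
  have fS: "finite S" using S by (simp add: is_basis_def)
  define c' where "c' = (\<lambda>a. if a \<in> A then c a else 0)"
  have "p y = (\<Sum>k\<le>K. \<Sum>a\<in>expo S k. c' a * mon S a y)" for y
  proof -
    have "(\<Sum>k\<le>K. \<Sum>a\<in>expo S k. c' a * mon S a y) = (\<Sum>a\<in>(\<Union>k\<le>K. expo S k). c' a * mon S a y)"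
      using finite_expo[OF fS] by (intro sum.UNION_disjoint[symmetric]) (auto simp: expo_def)
    also have "\<dots> = (\<Sum>a\<in>A. c a * mon S a y)"
    proof (rule sum.mono_neutral_cong_right)
      show "A \<subseteq> (\<Union>k\<le>K. expo S k)"
        using A by (auto simp: expo_def K_def intro: member_le_sum)
    qed (use finite_expo[OF fS] in \<open>auto simp: c'_def\<close>)
    finally show ?thesis using A by simp
  qed
  thus ?thesis using that by blast
qed

text \<open>For fixed \<open>y\<close> both expansions of \<open>p\<close> at \<open>t\<close> times
  \<open>y\<close> are polynomials in \<open>t\<close>; comparing coefficients isolates the part of
  degree \<open>k\<close>.\<close>

lemma hom_expand:
  fixes p :: "'a::real_normed_vector \<Rightarrow> real"
  assumes S: "is_basis S" and p: "homogeneous_poly k p"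
  obtains c where "\<And>y. p y = (\<Sum>a\<in>expo S k. c a * mon S a y)"
proof -
  obtain c K where K: "\<And>y. p y = (\<Sum>k\<le>K. \<Sum>a\<in>expo S k. c a * mon S a y)"
    using poly_graded_expand[OF S] p unfolding homogeneous_poly_def by metis
  define P where "P = (\<lambda>j y. if j \<le> K then \<Sum>a\<in>expo S j. c a * mon S a y else 0)"
  have "p y = P k y" for y
  proof -
    have "(\<Sum>j\<le>K + k. P j y * t ^ j) = (\<Sum>j\<le>K + k. (if j = k then p y else 0) * t ^ j)" for t :: real
    proof -
      have "(\<Sum>j\<le>K + k. P j y * t ^ j) = (\<Sum>j\<le>K. (\<Sum>a\<in>expo S j. c a * mon S a y) * t ^ j)"
        by (rule sum.mono_neutral_cong_right) (auto simp: P_def)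
      also have "\<dots> = p (t *\<^sub>R y)"
        unfolding K by (intro sum.cong refl) (auto simp: sum_distrib_right mon_scale[OF S] expo_def intro!: sum.cong)
      also have "\<dots> = t ^ k * p y" using p by (simp add: homogeneous_poly_def)
      finally show ?thesis by (simp add: if_distrib[of "\<lambda>x. x * _"] cong: if_cong)
    qed
    hence "\<forall>j\<le>K+k. P j y = (if j = k then p y else 0)"
      by (subst polyfun_eq_coeffs[symmetric]) blast
    thus ?thesis by simp
  qed
  \<comment> \<open>The degree \<open>k\<close> may exceed the bound \<open>K\<close> of the
    expansion; then \<open>p\<close> is zero and so are the coefficients chosen here.\<close>
  hence "p y = (\<Sum>a\<in>expo S k. (if k \<le> K then c a else 0) * mon S a y)" for y
    by (simp add: P_def)
  from that[OF this] show ?thesis .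
qed

section \<open>Independence of monomials, tested on positive arguments\<close>

lemma poly_zero_of_pos:
  fixes c :: "nat \<Rightarrow> real"
  assumes "\<And>t. t > 0 \<Longrightarrow> (\<Sum>i\<le>n. c i * t ^ i) = 0" "i \<le> n"
  shows "c i = 0"
proof (rule ccontr)
  assume "c i \<noteq> 0"
  hence "finite {z::real. (\<Sum>i\<le>n. c i * z ^ i) = 0}"
    using assms(2) by (intro polyfun_roots_finite) auto
  moreover have "{0<..<1} \<subseteq> {z::real. (\<Sum>i\<le>n. c i * z ^ i) = 0}" using assms(1) by auto
  ultimately have "finite {0<..<1::real}" by (rule rev_finite_subset)
  thus False using infinite_Ioo[of 0 "1::real"] by simp
qed

text \<open>Induction on the variables, separating the powers of one of them. Only positive
  arguments are tested, because relations will be known only inside cones.\<close>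

lemma monomials_independent:
  fixes c :: "('a \<Rightarrow> nat) \<Rightarrow> real"
  assumes "finite S" "finite A" "A \<subseteq> supported S"
    "\<And>t. (\<And>v. v \<in> S \<Longrightarrow> t v > 0) \<Longrightarrow> (\<Sum>a\<in>A. c a * (\<Prod>v\<in>S. t v ^ a v)) = 0"
    "a \<in> A"
  shows "c a = 0"
  using assms
proof (induction S arbitrary: A c a rule: finite_induct)
  case empty
  hence "\<And>b. b \<in> A \<Longrightarrow> b = (\<lambda>_. 0)" by (auto simp: supported_def fun_eq_iff)
  hence "A = {a}" using empty.prems(4) by blast
  thus ?case using empty.prems(3)[of "\<lambda>_. 1"] by simp
next
  case (insert w S)
  define N where "N = (\<Sum>a\<in>A. a w)"
  have N: "a w \<le> N" if "a \<in> A" for a using that insert.prems by (auto simp: N_def intro: member_le_sum)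
  \<comment> \<open>The exponents occurring in the coefficient of the \<open>i\<close>-th power of
    the variable \<open>w\<close>, read as exponents in the remaining variables.\<close>
  define B where "B = (\<lambda>i. (\<lambda>a. a(w := 0)) ` {a\<in>A. a w = i})"
  have inj: "inj_on (\<lambda>a. a(w := 0)) {a\<in>A. a w = i}" for i
  proof (rule inj_onI)
    fix x y assume "x \<in> {a\<in>A. a w = i}" "y \<in> {a\<in>A. a w = i}" "x(w := 0) = y(w := 0)"
    thus "x = y" by (metis (mono_tags, lifting) fun_upd_triv fun_upd_upd mem_Collect_eq)
  qed
  have main: "(\<Sum>b\<in>B i. c (b(w := i)) * (\<Prod>v\<in>S. t v ^ b v)) = 0"
    if t: "\<And>v. v \<in> S \<Longrightarrow> t v > 0" and i: "i \<le> N" for i t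
  proof (rule poly_zero_of_pos[where n = N and c = "\<lambda>i. \<Sum>b\<in>B i. c (b(w := i)) * (\<Prod>v\<in>S. t v ^ b v)", OF _ i])
    fix s :: real assume s: "s > 0"
    define t' where "t' = t(w := s)"
    have "(\<Sum>i\<le>N. (\<Sum>b\<in>B i. c (b(w := i)) * (\<Prod>v\<in>S. t v ^ b v)) * s ^ i)
        = (\<Sum>i\<le>N. \<Sum>a\<in>{a\<in>A. a w = i}. c a * (\<Prod>v\<in>insert w S. t' v ^ a v))"
    proof (rule sum.cong[OF refl])
      fix i
      have "(\<Sum>b\<in>B i. c (b(w := i)) * (\<Prod>v\<in>S. t v ^ b v)) * s ^ i
          = (\<Sum>a\<in>{a\<in>A. a w = i}. c (a(w := i)) * (\<Prod>v\<in>S. t v ^ (a(w := 0)) v) * s ^ i)"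
        unfolding B_def by (subst sum.reindex[OF inj]) (simp add: sum_distrib_right)
      also have "\<dots> = (\<Sum>a\<in>{a\<in>A. a w = i}. c a * (\<Prod>v\<in>insert w S. t' v ^ a v))"
      proof (rule sum.cong[OF refl])
        fix a assume a: "a \<in> {a\<in>A. a w = i}"
        have "(\<Prod>v\<in>insert w S. t' v ^ a v) = s ^ i * (\<Prod>v\<in>S. t' v ^ a v)"
          using insert.hyps a by (simp add: t'_def)
        also have "(\<Prod>v\<in>S. t' v ^ a v) = (\<Prod>v\<in>S. t v ^ (a(w := 0)) v)"
          using insert.hyps by (intro prod.cong) (auto simp: t'_def)
        finally show "c (a(w := i)) * (\<Prod>v\<in>S. t v ^ (a(w := 0)) v) * s ^ i = c a * (\<Prod>v\<in>insert w S. t' v ^ a v)"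
          using a by auto
      qed
      finally show "(\<Sum>b\<in>B i. c (b(w := i)) * (\<Prod>v\<in>S. t v ^ b v)) * s ^ i = (\<Sum>a\<in>{a\<in>A. a w = i}. c a * (\<Prod>v\<in>insert w S. t' v ^ a v))" .
    qed
    also have "\<dots> = (\<Sum>a\<in>A. c a * (\<Prod>v\<in>insert w S. t' v ^ a v))"
      using insert.prems(1) N by (intro sum.group) auto
    also have "\<dots> = 0" using t s by (intro insert.prems(3)) (auto simp: t'_def)
    finally show "(\<Sum>i\<le>N. (\<Sum>b\<in>B i. c (b(w := i)) * (\<Prod>v\<in>S. t v ^ b v)) * s ^ i) = 0" .
  qed
  have "c ((a(w := 0))(w := a w)) = 0"
  proof (rule insert.IH[of "B (a w)" "\<lambda>b. c (b(w := a w))"])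
    show "finite (B (a w))" using insert.prems by (simp add: B_def)
    show "B (a w) \<subseteq> supported S" using insert.prems by (auto simp: B_def supported_def)
    show "a(w := 0) \<in> B (a w)" using insert.prems by (auto simp: B_def)
    show "\<And>t. (\<And>v. v \<in> S \<Longrightarrow> 0 < t v) \<Longrightarrow> (\<Sum>b\<in>B (a w). c (b(w := a w)) * (\<Prod>v\<in>S. t v ^ b v)) = 0"
      using main N[OF insert.prems(4)] by blast
  qed
  thus ?case by simp
qed

section \<open>Simplicial fans given by bases\<close>

definition bcone :: "'a::real_vector set \<Rightarrow> 'a set" where
  "bcone S = {y. \<forall>v\<in>S. representation S y v \<ge> 0}"

lemma bcone_scale: "is_basis S \<Longrightarrow> y \<in> bcone S \<Longrightarrow> t \<ge> 0 \<Longrightarrow> t *\<^sub>R y \<in> bcone S"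
  by (simp add: bcone_def rep_scale)

lemma bcone_lincomb: "is_basis S \<Longrightarrow> R \<subseteq> S \<Longrightarrow> (\<And>v. v \<in> R \<Longrightarrow> t v \<ge> 0) \<Longrightarrow> (\<Sum>v\<in>R. t v *\<^sub>R v) \<in> bcone S"
  by (auto simp: bcone_def rep_lincomb)

lemma bcone_rep_nonneg: "y \<in> bcone S \<Longrightarrow> representation S y v \<ge> 0"
  by (cases "v \<in> S") (auto simp: bcone_def rep_outside)

lemma mon_face:
  assumes S: "is_basis S" and R: "R \<subseteq> S" and a: "a \<in> supported S"
  shows "mon S a (\<Sum>v\<in>R. t v *\<^sub>R v) = (if a \<in> supported R then \<Prod>v\<in>R. t v ^ a v else 0)"
proof (cases "a \<in> supported R")
  case True
  have "mon S a (\<Sum>v\<in>R. t v *\<^sub>R v) = (\<Prod>v\<in>S. (if v \<in> R then t v else 0) ^ a v)"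
    by (simp add: mon_def rep_lincomb[OF S R])
  also have "\<dots> = (\<Prod>v\<in>R. t v ^ a v)"
    using S R True by (intro prod.mono_neutral_cong_right) (auto simp: is_basis_def supported_def)
  finally show ?thesis using True by simp
next
  case False
  then obtain v where v: "v \<notin> R" "a v \<noteq> 0" by (auto simp: supported_def)
  hence vS: "v \<in> S" using a by (auto simp: supported_def)
  have "mon S a (\<Sum>v\<in>R. t v *\<^sub>R v) = 0"
    unfolding mon_def rep_lincomb[OF S R] using S vS v
    by (intro prod_zero) (auto simp: is_basis_def intro!: bexI[of _ v])
  thus ?thesis using False by simp
qed

text \<open>On the span of the face only monomials supported in \<open>R\<close> survive, and their
  coefficients vanish by independence on positive arguments. In use, an identity on a common wall
  spreads to the hyperplane through it.\<close>

lemma poly_vanish_span: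
  assumes S: "is_basis (S :: 'a::real_normed_vector set)" and R: "R \<subseteq> S" and p: "real_polynomial_function p"
    and z: "\<And>t. (\<And>v. v \<in> R \<Longrightarrow> t v > 0) \<Longrightarrow> p (\<Sum>v\<in>R. t v *\<^sub>R v) = 0"
  shows "p (\<Sum>v\<in>R. t v *\<^sub>R v) = 0"
proof -
  obtain c A where A: "finite A" "A \<subseteq> supported S" "\<And>y. p y = (\<Sum>a\<in>A. c a * mon S a y)"
    using poly_expand[OF S p] by metis
  have fR: "finite R" using S R finite_subset by (auto simp: is_basis_def)
  have eq: "p (\<Sum>v\<in>R. t v *\<^sub>R v) = (\<Sum>a\<in>A \<inter> supported R. c a * (\<Prod>v\<in>R. t v ^ a v))" for t
    unfolding A(3)
  proof (rule sum.mono_neutral_cong_right)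
    show "\<forall>i\<in>A - A \<inter> supported R. c i * mon S i (\<Sum>v\<in>R. t v *\<^sub>R v) = 0"
      using A(2) by (auto simp: mon_face[OF S R] subset_iff)
    show "\<And>a. a \<in> A \<inter> supported R \<Longrightarrow> c a * mon S a (\<Sum>v\<in>R. t v *\<^sub>R v) = c a * (\<Prod>v\<in>R. t v ^ a v)"
      using A(2) by (auto simp: mon_face[OF S R] subset_iff)
  qed (use A in auto)
  have "c a = 0" if "a \<in> A \<inter> supported R" for a
  proof (rule monomials_independent[OF fR _ _ _ that])
    show "\<And>t. (\<And>v. v \<in> R \<Longrightarrow> 0 < t v) \<Longrightarrow> (\<Sum>a\<in>A \<inter> supported R. c a * (\<Prod>v\<in>R. t v ^ a v)) = 0"
      using z unfolding eq by blast
  qed (use A in auto)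
  thus ?thesis unfolding eq by (intro sum.neutral) auto
qed

lemma poly_eq_on_bcone:
  assumes S: "is_basis (S :: 'a::real_normed_vector set)" and p: "real_polynomial_function p" "real_polynomial_function q"
    and eq: "\<And>y. y \<in> bcone S \<Longrightarrow> p y = q y"
  shows "p = q"
proof
  fix y
  have "p (\<Sum>v\<in>S. representation S y v *\<^sub>R v) - q (\<Sum>v\<in>S. representation S y v *\<^sub>R v) = 0"
  proof (rule poly_vanish_span[OF S order_refl, where p = "\<lambda>y. p y - q y"])
    show "real_polynomial_function (\<lambda>y. p y - q y)" using p by (rule real_polynomial_function_diff)
    show "p (\<Sum>v\<in>S. t v *\<^sub>R v) - q (\<Sum>v\<in>S. t v *\<^sub>R v) = 0" if "\<And>v. v \<in> S \<Longrightarrow> 0 < t v" for t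
      using that eq[OF bcone_lincomb[OF S order_refl]] by (simp add: less_imp_le)
  qed
  thus "p y = q y" by (simp add: rep_sum[OF S])
qed

text \<open>The elements are functions on the whole space, so the pieces agree on overlaps by
  construction; continuity then follows from closedness of the cones, see
  \<open>PP_FB_continuous\<close>.\<close>

definition PP :: "'a::real_normed_vector set set \<Rightarrow> ('a \<Rightarrow> real) set" where
  "PP SS = {f. \<forall>S\<in>SS. \<exists>p. real_polynomial_function p \<and> (\<forall>y\<in>bcone S. f y = p y)}"

definition PPh :: "'a::real_normed_vector set set \<Rightarrow> nat \<Rightarrow> ('a \<Rightarrow> real) set" where
  "PPh SS k = {f. \<forall>S\<in>SS. \<exists>p. homogeneous_poly k p \<and> (\<forall>y\<in>bcone S. f y = p y)}"

abbreviation pc :: "('a::real_normed_vector \<Rightarrow> real) \<Rightarrow> 'a set \<Rightarrow> 'a \<Rightarrow> real" where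
  "pc f S \<equiv> poly_on f (bcone S)"

lemma homogeneous_poly_poly: "homogeneous_poly k p \<Longrightarrow> real_polynomial_function p"
  by (simp add: homogeneous_poly_def)

lemma PPh_PP: "f \<in> PPh SS k \<Longrightarrow> f \<in> PP SS"
  unfolding PPh_def PP_def using homogeneous_poly_poly by blast

lemma pc_eq:
  assumes "is_basis (S :: 'a::real_normed_vector set)" "real_polynomial_function p" "\<And>y. y \<in> bcone S \<Longrightarrow> f y = p y"
  shows "pc f S = p"
  unfolding poly_on_def
proof (rule the_equality)
  show "real_polynomial_function p \<and> (\<forall>x\<in>bcone S. p x = f x)" using assms by simp
  show "\<And>q. real_polynomial_function q \<and> (\<forall>x\<in>bcone S. q x = f x) \<Longrightarrow> q = p"
    using assms by (intro poly_eq_on_bcone) auto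
qed

lemma pc_PP:
  assumes "f \<in> PP SS" "S \<in> SS" "is_basis S"
  shows "real_polynomial_function (pc f S)" "y \<in> bcone S \<Longrightarrow> pc f S y = f y"
proof -
  obtain p where "real_polynomial_function p" "\<And>y. y \<in> bcone S \<Longrightarrow> f y = p y"
    using assms by (auto simp: PP_def)
  moreover from pc_eq[OF assms(3) this] have "pc f S = p" .
  ultimately show "real_polynomial_function (pc f S)" "y \<in> bcone S \<Longrightarrow> pc f S y = f y" by auto
qed

lemma pc_PPh:
  assumes "f \<in> PPh SS k" "S \<in> SS" "is_basis S"
  shows "homogeneous_poly k (pc f S)"
proof -
  obtain p where "homogeneous_poly k p" "\<And>y. y \<in> bcone S \<Longrightarrow> f y = p y"
    using assms by (auto simp: PPh_def)
  moreover from pc_eq[OF assms(3) homogeneous_poly_poly[OF this(1)] this(2)] have "pc f S = p" .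
  ultimately show ?thesis by auto
qed

lemma homogeneous_poly_add: "homogeneous_poly k p \<Longrightarrow> homogeneous_poly k q \<Longrightarrow> homogeneous_poly k (\<lambda>x. p x + q x)"
  by (auto simp: homogeneous_poly_def algebra_simps)

lemma homogeneous_poly_mult: "homogeneous_poly k p \<Longrightarrow> homogeneous_poly l q \<Longrightarrow> homogeneous_poly (k + l) (\<lambda>x. p x * q x)"
  by (auto simp: homogeneous_poly_def algebra_simps power_add)

lemma homogeneous_poly_cmult: "homogeneous_poly k p \<Longrightarrow> homogeneous_poly k (\<lambda>x. c * p x)"
  by (auto simp: homogeneous_poly_def algebra_simps)

lemma homogeneous_poly_zero: "homogeneous_poly k (\<lambda>x. 0)"
  by (auto simp: homogeneous_poly_def)

lemma homogeneous_poly_const: "homogeneous_poly 0 (\<lambda>x. c)"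
  by (auto simp: homogeneous_poly_def)

lemma homogeneous_poly_rep: "is_basis S \<Longrightarrow> homogeneous_poly 1 (\<lambda>y. representation S y v)"
  by (auto simp: homogeneous_poly_def rep_poly rep_scale)

lemma homogeneous_poly_PPh: "homogeneous_poly k p \<Longrightarrow> p \<in> PPh SS k"
  by (auto simp: PPh_def)

lemma PPh_zero: "(\<lambda>x. 0) \<in> PPh SS k"
  by (intro homogeneous_poly_PPh homogeneous_poly_zero)

lemma PPh_add: assumes "f \<in> PPh SS k" "g \<in> PPh SS k" shows "(\<lambda>x. f x + g x) \<in> PPh SS k"
  unfolding PPh_def
proof (intro CollectI ballI)
  fix S assume S: "S \<in> SS"
  obtain p q where "homogeneous_poly k p" "homogeneous_poly k q" "\<forall>y\<in>bcone S. f y = p y" "\<forall>y\<in>bcone S. g y = q y"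
    using assms S by (force simp: PPh_def)
  thus "\<exists>p. homogeneous_poly k p \<and> (\<forall>y\<in>bcone S. f y + g y = p y)"
    by (intro exI[of _ "\<lambda>x. p x + q x"]) (auto simp: homogeneous_poly_add)
qed

lemma PPh_mult: assumes "f \<in> PPh SS k" "g \<in> PPh SS l" shows "(\<lambda>x. f x * g x) \<in> PPh SS (k + l)"
  unfolding PPh_def
proof (intro CollectI ballI)
  fix S assume S: "S \<in> SS"
  obtain p q where "homogeneous_poly k p" "homogeneous_poly l q" "\<forall>y\<in>bcone S. f y = p y" "\<forall>y\<in>bcone S. g y = q y"
    using assms S by (force simp: PPh_def)
  thus "\<exists>p. homogeneous_poly (k + l) p \<and> (\<forall>y\<in>bcone S. f y * g y = p y)"
    by (intro exI[of _ "\<lambda>x. p x * q x"]) (auto simp: homogeneous_poly_mult)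
qed

lemma PPh_cmult: "f \<in> PPh SS k \<Longrightarrow> (\<lambda>x. c * f x) \<in> PPh SS k"
  using PPh_mult[OF homogeneous_poly_PPh[OF homogeneous_poly_const]] by fastforce

lemma PPh_diff: "f \<in> PPh SS k \<Longrightarrow> g \<in> PPh SS k \<Longrightarrow> (\<lambda>x. f x - g x) \<in> PPh SS k"
  using PPh_add[of f SS k "\<lambda>x. (-1) * g x"] PPh_cmult[of g SS k "-1"] by simp

lemma PPh_sum: "(\<And>i. i \<in> I \<Longrightarrow> f i \<in> PPh SS k) \<Longrightarrow> (\<lambda>x. \<Sum>i\<in>I. f i x) \<in> PPh SS k"
  by (induction I rule: infinite_finite_induct) (auto intro: PPh_zero PPh_add)

lemma PPh_prod: "finite I \<Longrightarrow> (\<And>i. i \<in> I \<Longrightarrow> f i \<in> PPh SS (d i)) \<Longrightarrow> (\<lambda>x. \<Prod>i\<in>I. f i x) \<in> PPh SS (\<Sum>i\<in>I. d i)"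
  by (induction I rule: finite_induct) (auto intro: PPh_mult homogeneous_poly_PPh homogeneous_poly_const)

lemma PPh_power: "f \<in> PPh SS k \<Longrightarrow> (\<lambda>x. f x ^ m) \<in> PPh SS (m * k)"
  by (induction m) (auto intro: PPh_mult homogeneous_poly_PPh homogeneous_poly_const)

lemma PPh_scale_point:
  assumes "f \<in> PPh SS k" "S \<in> SS" "is_basis S" "y \<in> bcone S" "t \<ge> 0"
  shows "f (t *\<^sub>R y) = t ^ k * f y"
proof -
  obtain p where "homogeneous_poly k p" "\<And>y. y \<in> bcone S \<Longrightarrow> f y = p y"
    using assms by (auto simp: PPh_def)
  thus ?thesis using bcone_scale[OF assms(3-5)] assms(4) by (simp add: homogeneous_poly_def)
qed

text \<open>A complete simplicial fan is encoded by the set of bases that generate its maximal cones. The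
  generators are normalised, so that on overlapping cones the coordinates agree; \<open>crt SS v\<close> is the
  Courant function of the ray through \<open>v\<close>.\<close>

definition sfan :: "'a::real_normed_vector set set \<Rightarrow> bool" where
  "sfan SS \<longleftrightarrow> finite SS \<and> (\<forall>S\<in>SS. is_basis S) \<and> (\<forall>y. \<exists>S\<in>SS. y \<in> bcone S) \<and>
     (\<forall>S\<in>SS. \<forall>T\<in>SS. \<forall>y\<in>bcone S \<inter> bcone T. representation S y = representation T y)"

lemma sfanD:
  assumes "sfan SS"
  shows "finite SS" "S \<in> SS \<Longrightarrow> is_basis S" "\<exists>S\<in>SS. y \<in> bcone S"
    "S \<in> SS \<Longrightarrow> T \<in> SS \<Longrightarrow> y \<in> bcone S \<Longrightarrow> y \<in> bcone T \<Longrightarrow> representation S y v = representation T y v"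
    "S \<in> SS \<Longrightarrow> finite S" "finite (\<Union>SS)"
proof -
  show 1: "finite SS" using assms by (simp add: sfan_def)
  show 2: "S \<in> SS \<Longrightarrow> is_basis S" for S using assms by (simp add: sfan_def)
  show "\<exists>S\<in>SS. y \<in> bcone S" using assms unfolding sfan_def by blast
  show "S \<in> SS \<Longrightarrow> T \<in> SS \<Longrightarrow> y \<in> bcone S \<Longrightarrow> y \<in> bcone T \<Longrightarrow> representation S y v = representation T y v"
    using assms unfolding sfan_def by (metis IntI)
  show 3: "S \<in> SS \<Longrightarrow> finite S" for S using 2 is_basisD(1) by blast
  show "finite (\<Union>SS)" using 1 3 by blast
qed

definition crt :: "'a::real_normed_vector set set \<Rightarrow> 'a \<Rightarrow> 'a \<Rightarrow> real" where
  "crt SS v y = representation (SOME S. S \<in> SS \<and> y \<in> bcone S) y v"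

lemma crt_eq:
  assumes "sfan SS" "S \<in> SS" "y \<in> bcone S"
  shows "crt SS v y = representation S y v"
proof -
  define T where "T = (SOME S. S \<in> SS \<and> y \<in> bcone S)"
  have "T \<in> SS \<and> y \<in> bcone T" unfolding T_def by (rule someI[where P = "\<lambda>S. S \<in> SS \<and> y \<in> bcone S" and x = S]) (simp add: assms)
  hence "T \<in> SS" "y \<in> bcone T" by auto
  from sfanD(4)[OF assms(1) this(1) assms(2) this(2) assms(3)]
  show ?thesis unfolding crt_def T_def[symmetric] .
qed

lemma crt_PPh: "sfan SS \<Longrightarrow> crt SS v \<in> PPh SS 1"
  unfolding PPh_def using crt_eq homogeneous_poly_rep sfanD(2) by blast

lemma sfan_ext:
  assumes "sfan SS" "\<And>S y. S \<in> SS \<Longrightarrow> y \<in> bcone S \<Longrightarrow> f y = g y"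
  shows "f = g"
  using assms sfanD(3)[OF assms(1)] by blast

section \<open>Monomials in the Courant functions: the standard basis of the face ring
  (Stanley-Reisner ring)\<close>

definition Mon :: "'a set set \<Rightarrow> nat \<Rightarrow> ('a \<Rightarrow> nat) set" where
  "Mon SS k = (\<Union>S\<in>SS. expo S k)"

definition fmon :: "'a::real_normed_vector set set \<Rightarrow> ('a \<Rightarrow> nat) \<Rightarrow> 'a \<Rightarrow> real" where
  "fmon SS a y = (\<Prod>v\<in>\<Union>SS. crt SS v y ^ a v)"

lemma finite_Mon: "sfan SS \<Longrightarrow> finite (Mon SS k)"
  by (auto simp: Mon_def sfanD finite_expo)

lemma fmon_on:
  assumes "sfan SS" "S \<in> SS" "y \<in> bcone S" "a \<in> supported (\<Union>SS)"
  shows "fmon SS a y = (if a \<in> supported S then mon S a y else 0)"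
proof (cases "a \<in> supported S")
  case True
  have "fmon SS a y = (\<Prod>v\<in>\<Union>SS. representation S y v ^ a v)"
    by (simp add: fmon_def crt_eq[OF assms(1-3)])
  also have "\<dots> = mon S a y" unfolding mon_def
    using assms True sfanD(6)[OF assms(1)]
    by (intro prod.mono_neutral_right) (auto simp: supported_def)
  finally show ?thesis using True by simp
next
  case False
  then obtain v where v: "v \<notin> S" "a v \<noteq> 0" unfolding supported_def by blast
  have "\<forall>w. w \<notin> \<Union>SS \<longrightarrow> a w = 0" using assms(4) by (simp only: supported_def mem_Collect_eq)
  hence v': "v \<in> \<Union>SS" using v(2) by metis
  have "fmon SS a y = 0" unfolding fmon_def
    using v v' sfanD(6)[OF assms(1)] by (intro prod_zero) (auto simp: crt_eq[OF assms(1-3)] rep_outside intro!: bexI[of _ v])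
  thus ?thesis using False by simp
qed

lemma Mon_supported: "a \<in> Mon SS k \<Longrightarrow> a \<in> supported (\<Union>SS)"
  by (auto simp: Mon_def expo_def supported_def)

lemma supported_sum: "finite T \<Longrightarrow> finite S \<Longrightarrow> a \<in> supported S \<Longrightarrow> a \<in> supported T \<Longrightarrow> sum a S = sum a T"
  by (rule sum.mono_neutral_cong) (auto simp: supported_def)

lemma Mon_inter_supported: "sfan SS \<Longrightarrow> S \<in> SS \<Longrightarrow> Mon SS k \<inter> supported S = expo S k"
proof -
  assume F: "sfan SS" "S \<in> SS"
  have "sum a S = sum a T" if "T \<in> SS" "a \<in> supported S" "a \<in> supported T" for a T
    using supported_sum[OF sfanD(5)[OF F(1) that(1)] sfanD(5)[OF F] that(2,3)] .
  thus ?thesis using F(2) by (auto simp: Mon_def expo_def)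
qed

lemma fmon_PPh:
  assumes "sfan SS" "a \<in> Mon SS k" shows "fmon SS a \<in> PPh SS k"
  unfolding PPh_def
proof (intro CollectI ballI)
  fix S assume S: "S \<in> SS"
  show "\<exists>p. homogeneous_poly k p \<and> (\<forall>y\<in>bcone S. fmon SS a y = p y)"
  proof (cases "a \<in> supported S")
    case True
    hence "a \<in> expo S k" using Mon_inter_supported[OF assms(1) S] assms(2) by auto
    thus ?thesis using fmon_on[OF assms(1) S _ Mon_supported[OF assms(2)]] True
      by (intro exI[of _ "mon S a"]) (auto intro: mon_homogeneous sfanD(2)[OF assms(1)] S)
  next
    case False
    thus ?thesis using fmon_on[OF assms(1) S _ Mon_supported[OF assms(2)]]
      by (intro exI[of _ "\<lambda>x. 0"]) (auto intro: homogeneous_poly_zero)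
  qed
qed

text \<open>On each cone the polynomial is expanded in the coordinates of that cone. The coefficient
  of a monomial can be read off on any face that supports it, hence is the same for all cones
  through this face.\<close>

lemma PPh_fmon_expand:
  assumes F: "sfan SS" and f: "f \<in> PPh SS k"
  obtains c where "f = (\<lambda>y. \<Sum>a\<in>Mon SS k. c a * fmon SS a y)"
proof -
  have "\<exists>c. \<forall>y. pc f S y = (\<Sum>a\<in>expo S k. c a * mon S a y)" if "S \<in> SS" for S
    using hom_expand[OF sfanD(2)[OF F that] pc_PPh[OF f that sfanD(2)[OF F that]]] by metis
  then obtain cS where cS: "\<And>S y. S \<in> SS \<Longrightarrow> pc f S y = (\<Sum>a\<in>expo S k. cS S a * mon S a y)" by metis
  have f_eq: "f y = (\<Sum>a\<in>expo S k. cS S a * mon S a y)" if "S \<in> SS" "y \<in> bcone S" for S y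
    using cS[OF that(1), of y] pc_PP(2)[OF PPh_PP[OF f] that(1) sfanD(2)[OF F that(1)] that(2)] by simp
  have cons: "cS S a = cS T a" if ST: "S \<in> SS" "T \<in> SS" and a: "a \<in> expo S k" "a \<in> expo T k" for S T a
  proof -
    \<comment> \<open>An exponent that occurs on both cones is supported on the common generators,
      and the two expansions agree on the face they span.\<close>
    define R where "R = S \<inter> T"
    have bS: "is_basis S" "is_basis T" using sfanD(2)[OF F] ST by auto
    have fR: "finite R" using ST sfanD(5)[OF F] by (auto simp: R_def)
    have aR: "a \<in> expo R k"
    proof -
      have "a \<in> supported R" using a by (auto simp: expo_def supported_def R_def)
      thus ?thesis using a supported_sum[OF fR, of S a] sfanD(5)[OF F ST(1)] by (auto simp: expo_def)
    qed
    have sub: "expo R k = expo S k \<inter> supported R" "expo R k = expo T k \<inter> supported R"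
      using supported_sum[OF fR sfanD(5)[OF F ST(1)]] supported_sum[OF fR sfanD(5)[OF F ST(2)]]
      by (auto simp: expo_def supported_def R_def)
    have face: "f (\<Sum>v\<in>R. t v *\<^sub>R v) = (\<Sum>a\<in>expo R k. cS U a * (\<Prod>v\<in>R. t v ^ a v))"
      if t: "\<And>v. v \<in> R \<Longrightarrow> t v > 0" and U: "U \<in> {S, T}" for U t
    proof -
      have U': "U \<in> SS" "is_basis U" "R \<subseteq> U" "expo R k = expo U k \<inter> supported R"
        using U ST bS sub by (auto simp: R_def)
      have "f (\<Sum>v\<in>R. t v *\<^sub>R v) = (\<Sum>a\<in>expo U k. cS U a * mon U a (\<Sum>v\<in>R. t v *\<^sub>R v))"
        by (intro f_eq bcone_lincomb U') (simp add: t less_imp_le)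
      also have "\<dots> = (\<Sum>a\<in>expo R k. cS U a * (\<Prod>v\<in>R. t v ^ a v))"
        unfolding U'(4) using U'(1-3) sfanD(5)[OF F]
        by (intro sum.mono_neutral_cong_right) (auto simp: mon_face expo_def finite_expo[unfolded expo_def])
      finally show ?thesis .
    qed
    have "cS S a - cS T a = 0"
    proof (rule monomials_independent[OF fR finite_expo[OF fR] _ _ aR, where c = "\<lambda>a. cS S a - cS T a"])
      show "expo R k \<subseteq> supported R" by (auto simp: expo_def)
      fix t assume t: "\<And>v. v \<in> R \<Longrightarrow> 0 < (t v::real)"
      show "(\<Sum>a\<in>expo R k. (cS S a - cS T a) * (\<Prod>v\<in>R. t v ^ a v)) = 0"
        using face[of t S] face[of t T] t by (simp add: left_diff_distrib sum_subtractf)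
    qed
    thus ?thesis by simp
  qed
  define c where "c = (\<lambda>a. cS (SOME S. S \<in> SS \<and> a \<in> expo S k) a)"
  have c: "c a = cS S a" if "S \<in> SS" "a \<in> expo S k" for S a
  proof -
    have "(SOME S. S \<in> SS \<and> a \<in> expo S k) \<in> SS \<and> a \<in> expo (SOME S. S \<in> SS \<and> a \<in> expo S k) k"
      by (rule someI[where P = "\<lambda>S. S \<in> SS \<and> a \<in> expo S k" and x = S]) (simp add: that)
    thus ?thesis unfolding c_def using cons that by blast
  qed
  have "f = (\<lambda>y. \<Sum>a\<in>Mon SS k. c a * fmon SS a y)"
  proof (rule sfan_ext[OF F])
    fix S y assume S: "S \<in> SS" "y \<in> bcone S"
    have "(\<Sum>a\<in>Mon SS k. c a * fmon SS a y) = (\<Sum>a\<in>Mon SS k \<inter> supported S. cS S a * mon S a y)"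
    proof (rule sum.mono_neutral_cong_right)
      fix a assume a: "a \<in> Mon SS k \<inter> supported S"
      hence "a \<in> expo S k" using Mon_inter_supported[OF F S(1)] by blast
      moreover have "fmon SS a y = mon S a y" using fmon_on[OF F S Mon_supported] a by auto
      ultimately show "c a * fmon SS a y = cS S a * mon S a y" using c[OF S(1)] by simp
    next
      show "\<forall>i\<in>Mon SS k - Mon SS k \<inter> supported S. c i * fmon SS i y = 0"
        using fmon_on[OF F S Mon_supported] by (auto split: if_splits)
    qed (use finite_Mon[OF F] in auto)
    thus "f y = (\<Sum>a\<in>Mon SS k. c a * fmon SS a y)"
      using f_eq[OF S] Mon_inter_supported[OF F S(1)] by simp
  qed
  from that[OF this] show ?thesis .
qed

lemma fmon_independent:
  assumes F: "sfan SS" and z: "\<And>y. (\<Sum>a\<in>Mon SS k. c a * fmon SS a y) = 0" and a: "a \<in> Mon SS k"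
  shows "c a = 0"
proof -
  obtain S where S: "S \<in> SS" "a \<in> expo S k" using a by (auto simp: Mon_def)
  have fS: "finite S" "is_basis S" using sfanD[OF F] S by auto
  show ?thesis
  proof (rule monomials_independent[OF fS(1) finite_expo[OF fS(1)] _ _ S(2)])
    show "expo S k \<subseteq> supported S" by (auto simp: expo_def)
    fix t :: "'a \<Rightarrow> real" assume t: "\<And>v. v \<in> S \<Longrightarrow> t v > 0"
    define y where "y = (\<Sum>v\<in>S. t v *\<^sub>R v)"
    have y: "y \<in> bcone S" unfolding y_def using t fS by (intro bcone_lincomb) (auto simp: less_imp_le)
    have "(\<Sum>a\<in>Mon SS k. c a * fmon SS a y) = (\<Sum>a\<in>Mon SS k \<inter> supported S. c a * mon S a y)"
    proof (rule sum.mono_neutral_cong_right)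
      show "\<And>a. a \<in> Mon SS k \<inter> supported S \<Longrightarrow> c a * fmon SS a y = c a * mon S a y"
        using fmon_on[OF F S(1) y Mon_supported] by (auto split: if_splits)
      show "\<forall>i\<in>Mon SS k - Mon SS k \<inter> supported S. c i * fmon SS i y = 0"
        using fmon_on[OF F S(1) y Mon_supported] by (auto split: if_splits)
    qed (use finite_Mon[OF F] in auto)
    also have "\<dots> = (\<Sum>a\<in>expo S k. c a * (\<Prod>v\<in>S. t v ^ a v))"
      unfolding Mon_inter_supported[OF F S(1)] y_def using mon_face[OF fS(2) order_refl]
      by (intro sum.cong) (auto simp: expo_def)
    finally show "(\<Sum>a\<in>expo S k. c a * (\<Prod>v\<in>S. t v ^ a v)) = 0" using z by simp
  qed
qed

subsection \<open>Stars and walls\<close>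

text \<open>A small step from the sum of the generators of \<tau> in the direction \<open>x\<close>
  ends in the interior of both cones. There the coordinates agree, and their supports are all of
  \<open>S\<close> and all of \<open>T\<close>.\<close>

lemma star_unique:
  assumes F: "sfan SS" and S: "S \<in> SS" "T \<in> SS" "\<tau> \<subseteq> S" "\<tau> \<subseteq> T"
    and pos: "\<And>v. v \<in> S - \<tau> \<Longrightarrow> representation S x v > 0" "\<And>v. v \<in> T - \<tau> \<Longrightarrow> representation T x v > 0"
  shows "S = T"
proof -
  have b: "is_basis S" "is_basis T" using S sfanD[OF F] by auto
  have fin: "finite S" "finite T" using b by (auto simp: is_basis_def)
  \<comment> \<open>A strict bound for all coordinates of \<open>x\<close> in both bases; a step of
    length \<open>1 / N\<close> keeps the coordinates on \<tau>, which start at 1, positive.\<close>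
  define N where "N = 1 + (\<Sum>v\<in>S. \<bar>representation S x v\<bar>) + (\<Sum>v\<in>T. \<bar>representation T x v\<bar>)"
  have N: "N > 0" unfolding N_def by (auto intro!: add_pos_nonneg sum_nonneg)
  have le: "\<bar>representation S x v\<bar> < N" if "v \<in> S" for v
  proof -
    have "\<bar>representation S x v\<bar> \<le> (\<Sum>v\<in>S. \<bar>representation S x v\<bar>)" using that fin by (intro member_le_sum) auto
    moreover have "(\<Sum>v\<in>T. \<bar>representation T x v\<bar>) \<ge> 0" by (simp add: sum_nonneg)
    ultimately show ?thesis unfolding N_def by linarith
  qed
  have le': "\<bar>representation T x v\<bar> < N" if "v \<in> T" for v
  proof -
    have "\<bar>representation T x v\<bar> \<le> (\<Sum>v\<in>T. \<bar>representation T x v\<bar>)" using that fin by (intro member_le_sum) auto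
    moreover have "(\<Sum>v\<in>S. \<bar>representation S x v\<bar>) \<ge> 0" by (simp add: sum_nonneg)
    ultimately show ?thesis unfolding N_def by linarith
  qed
  define y where "y = (\<Sum>v\<in>\<tau>. 1 *\<^sub>R v) + (1 / N) *\<^sub>R x"
  have pS: "representation S y v > 0" if "v \<in> S" for v
  proof (cases "v \<in> \<tau>")
    case True
    have "representation S y v = 1 + representation S x v / N"
      using True by (simp only: y_def rep_add[OF b(1)] rep_lincomb[OF b(1) S(3)] rep_scale[OF b(1)]) simp
    moreover have "representation S x v / N > -1" using le[OF that] N by (simp add: field_simps abs_if split: if_splits)
    ultimately show ?thesis by linarith
  next
    case False
    have "representation S y v = representation S x v / N"
      using False by (simp only: y_def rep_add[OF b(1)] rep_lincomb[OF b(1) S(3)] rep_scale[OF b(1)]) simp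
    thus ?thesis using pos(1)[of v] False that N by simp
  qed
  have pT: "representation T y v > 0" if "v \<in> T" for v
  proof (cases "v \<in> \<tau>")
    case True
    have "representation T y v = 1 + representation T x v / N"
      using True by (simp only: y_def rep_add[OF b(2)] rep_lincomb[OF b(2) S(4)] rep_scale[OF b(2)]) simp
    moreover have "representation T x v / N > -1" using le'[OF that] N by (simp add: field_simps abs_if split: if_splits)
    ultimately show ?thesis by linarith
  next
    case False
    have "representation T y v = representation T x v / N"
      using False by (simp only: y_def rep_add[OF b(2)] rep_lincomb[OF b(2) S(4)] rep_scale[OF b(2)]) simp
    thus ?thesis using pos(2)[of v] False that N by simp
  qed
  have "y \<in> bcone S" "y \<in> bcone T" using pS pT by (auto simp: bcone_def less_imp_le)
  hence eq: "representation S y v = representation T y v" for v using sfanD(4)[OF F S(1,2)] by blast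
  have "v \<in> T" if "v \<in> S" for v using pS[OF that] eq[of v] rep_outside[of v T y] by fastforce
  moreover have "v \<in> S" if "v \<in> T" for v using pT[OF that] eq[of v] rep_outside[of v S y] by fastforce
  ultimately show ?thesis by blast
qed

text \<open>Points approach the sum of the generators of \<tau> from the direction \<open>x\<close>.
  One of the finitely many cones contains infinitely many of them, hence also the limit, which
  forces \<tau> to be one of its faces.\<close>

lemma star_exists:
  assumes F: "sfan SS" and S0: "S0 \<in> SS" "\<tau> \<subseteq> S0"
  shows "\<exists>S\<in>SS. \<tau> \<subseteq> S \<and> (\<forall>v\<in>S - \<tau>. representation S x v \<ge> 0)"
proof -
  define y0 where "y0 = (\<Sum>v\<in>\<tau>. 1 *\<^sub>R v)"
  define Y where "Y = (\<lambda>m::nat. y0 + (1 / real (Suc m)) *\<^sub>R x)"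
  define g where "g = (\<lambda>m. SOME S. S \<in> SS \<and> Y m \<in> bcone S)"
  have g: "g m \<in> SS \<and> Y m \<in> bcone (g m)" for m
    unfolding g_def using sfanD(3)[OF F, of "Y m"] by (metis (mono_tags, lifting) someI_ex)
  have "finite (range g)" using g sfanD(1)[OF F] by (meson finite_subset image_subsetI)
  then obtain S where S: "infinite (g -` {S})"
    using inf_img_fin_dom'[of g UNIV] by auto
  have gS: "\<exists>m\<ge>k. g m = S" for k
    using S unfolding infinite_nat_iff_unbounded_le by auto
  have SS: "S \<in> SS" using gS[of 0] g by auto
  have b: "is_basis S" "is_basis S0" using SS S0 sfanD[OF F] by auto
  have nn: "representation S y0 v + (1 / real (Suc m)) * representation S x v \<ge> 0" if "g m = S" for m v
  proof -
    have "Y m \<in> bcone S" using g[of m] that by simp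
    from bcone_rep_nonneg[OF this, of v] show ?thesis by (simp add: Y_def rep_add[OF b(1)] rep_scale[OF b(1)])
  qed
  have y0nn: "representation S y0 v \<ge> 0" for v
  proof (rule ccontr)
    assume neg: "\<not> ?thesis"
    define d where "d = - representation S y0 v"
    have d: "d > 0" using neg by (simp add: d_def)
    obtain k :: nat where k: "real k > representation S x v / d" using reals_Archimedean2 by blast
    obtain m where m: "m \<ge> k" "g m = S" using gS by blast
    have "representation S x v / d < real (Suc m)" using k m by simp
    hence "representation S x v < d * real (Suc m)" using d by (simp add: field_simps)
    hence "(1 / real (Suc m)) * representation S x v < d" by (simp add: field_simps)
    thus False using nn[OF m(2), of v] by (simp add: d_def)
  qed
  \<comment> \<open>Since \<open>y0\<close> lies in both cones, its coordinates in \<open>S\<close>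
    are those in \<open>S0\<close>: 1 on \<tau> and 0 elsewhere. So off \<tau> the sign of a
    coordinate of nearby points is that of \<open>x\<close>.\<close>
  have "y0 \<in> bcone S" using y0nn by (simp add: bcone_def)
  moreover have "y0 \<in> bcone S0" unfolding y0_def using S0 b by (intro bcone_lincomb) auto
  ultimately have eq: "representation S y0 v = (if v \<in> \<tau> then 1 else 0)" for v
    using sfanD(4)[OF F SS S0(1), of y0 v] rep_lincomb[OF b(2) S0(2), of "\<lambda>_. 1" v] by (simp add: y0_def)
  have "\<tau> \<subseteq> S" using eq rep_outside by (metis subsetI zero_neq_one)
  moreover have "representation S x v \<ge> 0" if "v \<in> S - \<tau>" for v
  proof -
    obtain m where "g m = S" using gS by blast
    from nn[OF this, of v] eq[of v] that show ?thesis by (simp add: zero_le_divide_iff)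
  qed
  ultimately show ?thesis using SS by blast
qed

lemma basis_exchange_rep_ne0:
  assumes S: "is_basis S" "v \<in> S" and T: "is_basis T" "u \<in> T" "T - {u} = S - {v}"
  shows "representation T v u \<noteq> 0"
proof
  assume 0: "representation T v u = 0"
  have "v = (\<Sum>w\<in>T. representation T v w *\<^sub>R w)" using rep_sum[OF T(1)] by simp
  also have "\<dots> = (\<Sum>w\<in>T - {u}. representation T v w *\<^sub>R w)"
    using T 0 by (intro sum.mono_neutral_right) (auto simp: is_basis_def)
  also have "\<dots> \<in> span (S - {v})"
    unfolding T(3)[symmetric] by (intro span_sum span_scale span_base)
  finally have "v \<in> span (S - {v})" .
  thus False using S by (auto simp: is_basis_def dependent_def)
qed

lemma basis_card_extend:
  assumes "is_basis S" "is_basis T" "v \<in> S" "S - {v} \<subseteq> T"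
  shows "\<exists>u\<in>T. T - {u} = S - {v}"
proof -
  have c: "card S = card T" "finite S" "finite T"
    using is_basis_dim[OF assms(1)] is_basis_dim[OF assms(2)] is_basisD(1)[OF assms(1)] is_basisD(1)[OF assms(2)] by auto
  have "card S > 0" using assms(3) c by (auto simp: card_gt_0_iff)
  hence "card (T - (S - {v})) = 1" using assms c by (subst card_Diff_subset) auto
  then obtain u where "T - (S - {v}) = {u}" using card_1_singletonE by blast
  thus ?thesis using assms(4) by (intro bexI[of _ u]) auto
qed

text \<open>The star of the wall \<open>S - {v}\<close> in the direction \<open>- v\<close> contains
  a cone on the other side of the wall.\<close>

lemma wall_exists:
  assumes F: "sfan SS" and S: "S \<in> SS" "v \<in> S"
  obtains T u where "T \<in> SS" "u \<in> T" "T - {u} = S - {v}" "T \<noteq> S" "representation T v u < 0"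
proof -
  obtain T where T: "T \<in> SS" "S - {v} \<subseteq> T" "\<forall>w\<in>T - (S - {v}). representation T (-v) w \<ge> 0"
    using star_exists[OF F S(1), of "S - {v}" "-v"] by auto
  have b: "is_basis S" "is_basis T" using S T sfanD[OF F] by auto
  obtain u where u: "u \<in> T" "T - {u} = S - {v}" using basis_card_extend[OF b S(2) T(2)] by auto
  have "representation T v u \<noteq> 0" by (rule basis_exchange_rep_ne0[OF b(1) S(2) b(2) u])
  moreover have "u \<in> T - (S - {v})" using u by blast
  hence "representation T v u \<le> 0" using T(3) by (auto simp: rep_minus[OF b(2)])
  moreover have "T \<noteq> S"
  proof
    assume "T = S"
    hence "u = v" using u S by auto
    hence "representation T v u = 1" using \<open>T = S\<close> rep_basis[OF b(1) S(2)] by simp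
    thus False using \<open>representation T v u \<le> 0\<close> by simp
  qed
  ultimately show ?thesis using that T(1) u by force
qed

text \<open>If both cones were on the same side of their wall, uniqueness of the star in the
  direction \<open>v\<close> would identify them.\<close>

lemma wall_opposite:
  assumes F: "sfan SS" and S: "S \<in> SS" "v \<in> S" and T: "T \<in> SS" "u \<in> T" "T - {u} = S - {v}" "T \<noteq> S"
  shows "representation T v u < 0"
proof (rule ccontr)
  assume nneg: "\<not> ?thesis"
  have b: "is_basis S" "is_basis T" using S T sfanD[OF F] by auto
  have "representation T v u \<noteq> 0" by (rule basis_exchange_rep_ne0[OF b(1) S(2) b(2) T(2,3)])
  hence pos: "representation T v u > 0" using nneg by linarith
  have "S = T"
  proof (rule star_unique[OF F S(1) T(1), of "S - {v}" v])
    show "\<And>w. w \<in> S - (S - {v}) \<Longrightarrow> 0 < representation S v w" using rep_basis[OF b(1) S(2)] by auto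
    show "\<And>w. w \<in> T - (S - {v}) \<Longrightarrow> 0 < representation T v w" using pos T by auto
  qed (use T in auto)
  thus False using T by simp
qed

lemma wall_unique:
  assumes F: "sfan SS" and S: "S \<in> SS" "v \<in> S" and T: "T \<in> SS" "u \<in> T" "T - {u} = S - {v}" "T \<noteq> S"
    and T': "T' \<in> SS" "u' \<in> T'" "T' - {u'} = S - {v}" "T' \<noteq> S"
  shows "T = T'"
proof (rule star_unique[OF F T(1) T'(1), of "S - {v}" "-v"])
  have b: "is_basis T" "is_basis T'" using T T' sfanD[OF F] by auto
  show "\<And>w. w \<in> T - (S - {v}) \<Longrightarrow> 0 < representation T (-v) w"
    using wall_opposite[OF F S T] T by (auto simp: rep_minus[OF b(1)])
  show "\<And>w. w \<in> T' - (S - {v}) \<Longrightarrow> 0 < representation T' (-v) w"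
    using wall_opposite[OF F S T'] T' by (auto simp: rep_minus[OF b(2)])
qed (use T T' in auto)

section \<open>Divisibility of homogeneous polynomials\<close>

lemma poly_line_zeros:
  assumes p: "real_polynomial_function p" and s0: "p (z + s0 *\<^sub>R w) \<noteq> 0"
  shows "finite {s. p (z + s *\<^sub>R w) = 0}"
proof -
  have "polynomial_function (\<lambda>s::real. z + s *\<^sub>R w)"
    by (intro polynomial_function_add polynomial_function_const polynomial_function_bounded_linear bounded_linear_scaleR_left)
  hence "real_polynomial_function (p \<circ> (\<lambda>s. z + s *\<^sub>R w))"
    by (intro real_polynomial_function_compose p)
  then obtain c n where c: "p \<circ> (\<lambda>s. z + s *\<^sub>R w) = (\<lambda>s. \<Sum>i\<le>n. c i * s ^ i)"
    unfolding real_polynomial_function_iff_sum by blast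
  have c': "p (z + s *\<^sub>R w) = (\<Sum>i\<le>n. c i * s ^ i)" for s using fun_cong[OF c, of s] by simp
  have "\<exists>i\<le>n. c i \<noteq> 0" using s0 unfolding c' by (metis (no_types, lifting) atMost_iff mult_zero_left sum.neutral)
  thus ?thesis unfolding c' by (subst polyfun_finite_roots) auto
qed

text \<open>Polynomial functions on a subspace have no zero divisors: on the line from
  \<open>x\<close> to \<open>y\<close> each factor would have only finitely many zeros.\<close>

lemma poly_mult_zero:
  assumes P: "real_polynomial_function P" and X: "real_polynomial_function X"
    and U: "subspace U" and z: "\<And>y. y \<in> U \<Longrightarrow> P y * X y = 0" and x: "x \<in> U" "X x \<noteq> 0" and y: "y \<in> U"
  shows "P y = 0"
proof (rule ccontr)
  assume ny: "P y \<noteq> 0"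
  have "finite {s. P (x + s *\<^sub>R (y - x)) = 0}" by (rule poly_line_zeros[OF P, of x 1]) (simp add: ny)
  moreover have "finite {s. X (x + s *\<^sub>R (y - x)) = 0}" by (rule poly_line_zeros[OF X, of x 0]) (simp add: x)
  moreover have "UNIV \<subseteq> {s. P (x + s *\<^sub>R (y - x)) = 0} \<union> {s. X (x + s *\<^sub>R (y - x)) = 0}"
  proof
    fix s :: real
    have "x + s *\<^sub>R (y - x) \<in> U" using U x y by (intro subspace_add subspace_scale subspace_diff)
    from z[OF this] show "s \<in> {s. P (x + s *\<^sub>R (y - x)) = 0} \<union> {s. X (x + s *\<^sub>R (y - x)) = 0}" by auto
  qed
  ultimately have "finite (UNIV :: real set)" using finite_subset by blast
  thus False by (simp add: infinite_UNIV_char_0)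
qed

text \<open>The forms are added one at a time. On the line through the point found so far, in a
  direction where the new form is nonzero, each form has at most one zero.\<close>

lemma generic_exists:
  fixes L :: "('a::real_vector \<Rightarrow> real) set"
  assumes "finite L" "\<And>l. l \<in> L \<Longrightarrow> linear l" "\<And>l. l \<in> L \<Longrightarrow> \<exists>z\<in>U. l z \<noteq> 0" "subspace U"
  shows "\<exists>x\<in>U. \<forall>l\<in>L. l x \<noteq> 0"
  using assms(1-3)
proof (induction L rule: finite_induct)
  case empty
  then show ?case using subspace_0[OF assms(4)] by auto
next
  case (insert l L)
  obtain x where x: "x \<in> U" "\<forall>l\<in>L. l x \<noteq> 0" using insert.IH insert.prems by auto
  obtain z where z: "z \<in> U" "l z \<noteq> 0" using insert.prems(2) by auto
  have fin: "finite {s. m (x + s *\<^sub>R z) = 0}" if m: "m \<in> insert l L" for m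
  proof -
    have lm: "linear m" using insert.prems(1) m by auto
    have eq: "m (x + s *\<^sub>R z) = m x + s * m z" for s by (simp add: linear_add[OF lm] linear_scale[OF lm])
    show ?thesis
    proof (cases "m z = 0")
      case True
      hence "m \<in> L" using m z by auto
      thus ?thesis using True x eq by simp
    next
      case False
      hence "{s. m (x + s *\<^sub>R z) = 0} \<subseteq> {- m x / m z}" unfolding eq by (auto simp: field_simps)
      thus ?thesis using finite_subset by blast
    qed
  qed
  have "finite (\<Union>m\<in>insert l L. {s. m (x + s *\<^sub>R z) = 0})" using insert.hyps fin by blast
  then obtain s where s: "s \<notin> (\<Union>m\<in>insert l L. {s. m (x + s *\<^sub>R z) = 0})"
    using ex_new_if_finite infinite_UNIV_char_0 by blast
  have "x + s *\<^sub>R z \<in> U" using assms(4) x z by (intro subspace_add subspace_scale)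
  thus ?case using s by blast
qed

lemma mon_dec:
  assumes "finite B" "v \<in> B" "a v > 0"
  shows "mon B a y = representation B y v * mon B (a(v := a v - 1)) y"
proof -
  have "mon B a y = representation B y v ^ a v * (\<Prod>w\<in>B - {v}. representation B y w ^ a w)"
    unfolding mon_def using assms by (simp add: prod.remove)
  also have "representation B y v ^ a v = representation B y v * representation B y v ^ (a v - 1)"
    using assms(3) by (metis Suc_pred' power_Suc)
  also have "(\<Prod>w\<in>B - {v}. representation B y w ^ a w) = (\<Prod>w\<in>B - {v}. representation B y w ^ (a(v := a v - 1)) w)"
    by (intro prod.cong) auto
  also have "representation B y v * representation B y v ^ (a v - 1) * \<dots> = representation B y v * mon B (a(v := a v - 1)) y"
    unfolding mon_def using assms by (simp add: prod.remove[of B v])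
  finally show ?thesis .
qed

text \<open>The index is shifted by one so that \<open>hpm 0\<close>, like \<open>PPm SS 0\<close> below, is the zero space: these are
  the possible cofactors of linear forms in degree \<open>k\<close>.\<close>

definition hpm :: "nat \<Rightarrow> ('a::real_normed_vector \<Rightarrow> real) \<Rightarrow> bool" where
  "hpm k q \<longleftrightarrow> (if k = 0 then q = (\<lambda>_. 0) else homogeneous_poly (k - 1) q)"

lemma homogeneous_poly_sum: "(\<And>i. i \<in> I \<Longrightarrow> homogeneous_poly k (f i)) \<Longrightarrow> homogeneous_poly k (\<lambda>y. \<Sum>i\<in>I. f i y)"
  by (induction I rule: infinite_finite_induct) (auto intro: homogeneous_poly_zero homogeneous_poly_add)

text \<open>The only monomial that is nonzero at the basis vector \<open>x\<close> is a power of the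
  coordinate of \<open>x\<close>; its coefficient is \<open>p x\<close>, hence 0. Every other
  monomial contains another coordinate. For empty \<open>B\<close> the only monomial is
  constant.\<close>

lemma hom_vanish_point:
  fixes B :: "'a::real_normed_vector set"
  assumes B: "is_basis B" and x: "x \<in> B \<or> B = {}" and p: "homogeneous_poly k p" "p x = 0"
  obtains q where "\<And>v. v \<in> B - {x} \<Longrightarrow> hpm k (q v)" "p = (\<lambda>y. \<Sum>v\<in>B - {x}. representation B y v * q v y)"
proof -
  have fB: "finite B" using B by (simp add: is_basis_def)
  obtain c where c: "\<And>y. p y = (\<Sum>a\<in>expo B k. c a * mon B a y)" using hom_expand[OF B p(1)] by metis
  define E where "E = {a \<in> expo B k. \<exists>v\<in>B - {x}. a v > 0}"
  have fE: "finite E" "finite (expo B k)" using finite_expo[OF fB] by (auto simp: E_def)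
  have repx: "representation B x v = (if v = x then 1 else 0)" if "v \<in> B" for v
    using x that rep_basis[OF B] by auto
  have m1: "mon B a x = 1" if "a \<in> expo B k - E" for a
    unfolding mon_def using that by (intro prod.neutral) (auto simp: repx E_def)
  have m0: "mon B a x = 0" if a: "a \<in> E" for a
  proof -
    obtain v where v: "v \<in> B - {x}" "a v > 0" using a by (auto simp: E_def)
    thus ?thesis unfolding mon_def using fB by (intro prod_zero) (auto simp: repx intro!: bexI[of _ v])
  qed
  have uniq: "a = a'" if "a \<in> expo B k - E" "a' \<in> expo B k - E" for a a'
  proof
    fix v
    have z: "b v = (if v = x \<and> x \<in> B then k else 0)" if b: "b \<in> expo B k - E" for b
    proof (cases "v = x \<and> x \<in> B")
      case True
      have "k = sum b B" using b by (auto simp: expo_def)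
      also have "\<dots> = b x + sum b (B - {x})" using True fB by (simp add: sum.remove)
      also have "sum b (B - {x}) = 0" using b by (intro sum.neutral) (auto simp: E_def)
      finally show ?thesis using True by simp
    next
      case False
      show ?thesis
      proof (cases "v \<in> B")
        case True
        hence "v \<in> B - {x}" using False x by auto
        hence "b v = 0" using b by (auto simp: E_def)
        thus ?thesis using False by auto
      next
        case False
        hence "b v = 0" using b by (auto simp: expo_def supported_def)
        thus ?thesis using False by auto
      qed
    qed
    show "a v = a' v" using z[OF that(1)] z[OF that(2)] by simp
  qed
  have c0: "c a = 0" if a: "a \<in> expo B k - E" for a
  proof -
    have "p x = (\<Sum>b\<in>{a}. c b * mon B b x)"
      unfolding c
    proof (rule sum.mono_neutral_right)
      show "\<forall>i\<in>expo B k - {a}. c i * mon B i x = 0"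
      proof
        fix i assume "i \<in> expo B k - {a}"
        hence "i \<in> E" using uniq[OF a, of i] by auto
        thus "c i * mon B i x = 0" using m0 by simp
      qed
    qed (use fE a in auto)
    thus ?thesis using m1[OF a] p(2) by simp
  qed
  \<comment> \<open>Choosing one admissible coordinate per monomial distributes the monomials over
    the cofactors.\<close>
  define sel where "sel = (\<lambda>a::'a\<Rightarrow>nat. SOME v. v \<in> B - {x} \<and> a v > 0)"
  have sel: "sel a \<in> B - {x} \<and> a (sel a) > 0" if a: "a \<in> E" for a
  proof -
    have "\<exists>v. v \<in> B - {x} \<and> a v > 0" using a by (auto simp: E_def)
    from someI_ex[OF this] show ?thesis unfolding sel_def .
  qed
  define q where "q = (\<lambda>v y. \<Sum>a\<in>{a\<in>E. sel a = v}. c a * mon B (a(v := a v - 1)) y)"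
  have "p = (\<lambda>y. \<Sum>v\<in>B - {x}. representation B y v * q v y)"
  proof
    fix y
    have "p y = (\<Sum>a\<in>E. c a * mon B a y)"
      unfolding c using fE c0 by (intro sum.mono_neutral_right) (auto simp: E_def)
    also have "\<dots> = (\<Sum>v\<in>B - {x}. \<Sum>a\<in>{a\<in>E. sel a = v}. c a * mon B a y)"
      using fE fB sel by (intro sum.group[symmetric]) auto
    also have "\<dots> = (\<Sum>v\<in>B - {x}. representation B y v * q v y)"
      unfolding q_def sum_distrib_left
    proof (intro sum.cong refl)
      fix v a assume v: "v \<in> B - {x}" and a: "a \<in> {a \<in> E. sel a = v}"
      have "a v > 0" using sel a by auto
      from mon_dec[where a = a, OF fB _ this, of y] v
      show "c a * mon B a y = representation B y v * (c a * mon B (a(v := a v - 1)) y)" by simp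
    qed
    finally show "p y = (\<Sum>v\<in>B - {x}. representation B y v * q v y)" .
  qed
  moreover have "hpm k (q v)" if v: "v \<in> B - {x}" for v
  proof (cases "k = 0")
    case True
    have "a w = 0" if "a \<in> expo B k" "w \<in> B" for a w
      using that True fB by (auto simp: expo_def)
    hence "E = {}" by (auto simp: E_def)
    thus ?thesis using True by (simp add: hpm_def q_def)
  next
    case False
    have "homogeneous_poly (k - 1) (q v)"
      unfolding q_def
    proof (intro homogeneous_poly_sum homogeneous_poly_cmult mon_homogeneous[OF B])
      fix a assume a: "a \<in> {a \<in> E. sel a = v}"
      have av: "a v > 0" using sel a by auto
      have "k = a v + sum a (B - {v})" using a v fB by (auto simp: E_def expo_def sum.remove)
      moreover have "sum (a(v := a v - 1)) B = (a v - 1) + sum a (B - {v})"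
        using v fB by (simp add: sum.remove[of B v])
      ultimately show "a(v := a v - 1) \<in> expo B (k - 1)"
        using a av v by (auto simp: expo_def E_def supported_def)
    qed
    thus ?thesis using False by (simp add: hpm_def)
  qed
  ultimately show ?thesis using that by metis
qed

text \<open>A monomial without the coordinate \<open>v\<close> survives on its zero set, so its
  coefficient vanishes; the remaining monomials are divisible by all of \<open>R\<close>. The clause
  for \<open>k < card R\<close> is there because the truncated difference would otherwise admit
  nonzero constants.\<close>

lemma hom_divide_prod:
  fixes S :: "'a::real_normed_vector set"
  assumes S: "is_basis S" and R: "R \<subseteq> S" and p: "homogeneous_poly k p"
    and z: "\<And>v y. v \<in> R \<Longrightarrow> representation S y v = 0 \<Longrightarrow> p y = 0"
  shows "\<exists>q. homogeneous_poly (k - card R) q \<and> (k < card R \<longrightarrow> q = (\<lambda>_. 0)) \<and>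
    p = (\<lambda>y. (\<Prod>v\<in>R. representation S y v) * q y)"
proof -
  have fS: "finite S" "finite R" using S R finite_subset by (auto simp: is_basis_def)
  obtain c where c: "\<And>y. p y = (\<Sum>a\<in>expo S k. c a * mon S a y)" using hom_expand[OF S p] by metis
  have c0: "c a = 0" if a: "a \<in> expo S k" "v \<in> R" "a v = 0" for a v
  proof -
    have a': "a \<in> expo S k \<inter> supported (S - {v})"
      using a R by (auto simp: expo_def supported_def)
    show ?thesis
    proof (rule monomials_independent[OF _ _ _ _ a', of "S - {v}" c])
      fix t :: "'a \<Rightarrow> real" assume t: "\<And>w. w \<in> S - {v} \<Longrightarrow> t w > 0"
      define y where "y = (\<Sum>w\<in>S - {v}. t w *\<^sub>R w)"
      have "representation S y v = 0" unfolding y_def by (subst rep_lincomb[OF S]) auto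
      hence "0 = p y" using z a(2) by simp
      also have "\<dots> = (\<Sum>a\<in>expo S k \<inter> supported (S - {v}). c a * (\<Prod>w\<in>S - {v}. t w ^ a w))"
        unfolding c
      proof (rule sum.mono_neutral_cong_right)
        show "\<forall>i\<in>expo S k - expo S k \<inter> supported (S - {v}). c i * mon S i y = 0"
          unfolding y_def by (auto simp: mon_face[OF S] expo_def)
        show "\<And>a. a \<in> expo S k \<inter> supported (S - {v}) \<Longrightarrow> c a * mon S a y = c a * (\<Prod>w\<in>S - {v}. t w ^ a w)"
          unfolding y_def by (auto simp: mon_face[OF S] expo_def)
      qed (use finite_expo[OF fS(1)] in auto)
      finally show "(\<Sum>a\<in>expo S k \<inter> supported (S - {v}). c a * (\<Prod>w\<in>S - {v}. t w ^ a w)) = 0" by simp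
    qed (use fS finite_expo[OF fS(1)] in auto)
  qed
  define E where "E = {a \<in> expo S k. \<forall>v\<in>R. a v > 0}"
  define dec where "dec = (\<lambda>(a::'a\<Rightarrow>nat) w. a w - (if w \<in> R then 1 else 0))"
  define q where "q = (\<lambda>y. \<Sum>a\<in>E. c a * mon S (dec a) y)"
  have fE: "finite E" "finite (expo S k)" using finite_expo[OF fS(1)] by (auto simp: E_def)
  have deg: "sum (dec a) S + card R = k" "dec a \<in> supported S" if a: "a \<in> E" for a
  proof -
    have "k = (\<Sum>w\<in>S. a w)" using a by (simp add: E_def expo_def)
    also have "\<dots> = (\<Sum>w\<in>S. dec a w + (if w \<in> R then 1 else 0))"
    proof (intro sum.cong refl)
      fix w assume "w \<in> S"
      have "w \<in> R \<Longrightarrow> a w > 0" using a by (auto simp: E_def)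
      thus "a w = dec a w + (if w \<in> R then 1 else 0)" by (auto simp: dec_def)
    qed
    also have "\<dots> = sum (dec a) S + card (S \<inter> R)" using fS by (simp add: sum.distrib sum.If_cases)
    finally show "sum (dec a) S + card R = k" using R by (simp add: Int_absorb1)
    show "dec a \<in> supported S" using a by (auto simp: E_def expo_def supported_def dec_def)
  qed
  have mondec: "mon S a y = (\<Prod>v\<in>R. representation S y v) * mon S (dec a) y" if a: "a \<in> E" for a y
  proof -
    have "mon S a y = (\<Prod>w\<in>S. (if w \<in> R then representation S y w else 1) * representation S y w ^ dec a w)"
      unfolding mon_def
    proof (intro prod.cong refl)
      fix w assume "w \<in> S"
      have "w \<in> R \<Longrightarrow> a w > 0" using a by (auto simp: E_def)
      thus "representation S y w ^ a w = (if w \<in> R then representation S y w else 1) * representation S y w ^ dec a w"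
        by (auto simp: dec_def power_eq_if)
    qed
    also have "\<dots> = (\<Prod>w\<in>S. if w \<in> R then representation S y w else 1) * mon S (dec a) y"
      by (simp add: prod.distrib mon_def)
    also have "(\<Prod>w\<in>S. if w \<in> R then representation S y w else 1) = (\<Prod>v\<in>R. representation S y v)"
      using fS R by (simp add: prod.If_cases Int_absorb1)
    finally show ?thesis .
  qed
  have "p y = (\<Prod>v\<in>R. representation S y v) * q y" for y
  proof -
    have "p y = (\<Sum>a\<in>E. c a * mon S a y)"
      unfolding c using fE c0 by (intro sum.mono_neutral_right) (auto simp: E_def)
    thus ?thesis by (simp add: q_def sum_distrib_left mondec mult_ac)
  qed
  moreover have "homogeneous_poly (k - card R) q"
    unfolding q_def
  proof (intro homogeneous_poly_sum homogeneous_poly_cmult mon_homogeneous[OF S])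
    fix a assume a: "a \<in> E"
    show "dec a \<in> expo S (k - card R)" using deg[OF a] by (auto simp: expo_def)
  qed
  moreover have "q = (\<lambda>_. 0)" if "k < card R"
  proof -
    have "E = {}" using deg(1) that by fastforce
    thus ?thesis by (simp add: q_def)
  qed
  ultimately show ?thesis by blast
qed

text \<open>Solving the expansion of \<open>c\<close> for \<open>a\<close> and substituting gives
  the new coordinates.\<close>

lemma exchange_basis:
  fixes S :: "'a::real_vector set"
  assumes S: "is_basis S" "a \<in> S" and c: "representation S c a \<noteq> 0"
  shows "is_basis (insert c (S - {a}))" "c \<notin> S - {a}"
    "representation (insert c (S - {a})) y w =
      (if w = c then representation S y a / representation S c a
       else if w \<in> S - {a} then representation S y w - representation S y a / representation S c a * representation S c w
       else 0)"
proof -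
  define T where "T = insert c (S - {a})"
  define r where "r = representation S c a"
  have fS: "finite S" using S by (simp add: is_basis_def)
  have z: "representation S y a = 0" if "y \<in> span (S - {a})" for y
    using that
  proof (induction rule: span_induct_alt)
    case base thus ?case by (simp add: representation_zero)
  next
    case (step c x y)
    thus ?case using S by (auto simp: rep_add rep_scale rep_basis)
  qed
  have cn: "c \<notin> span (S - {a})" using z[of c] c by blast
  thus cS: "c \<notin> S - {a}" using span_base[of c "S - {a}"] by blast
  have ind: "independent T" unfolding T_def
    using S cn independent_mono[of S "S - {a}"] by (auto simp: independent_insert is_basis_def)
  have csum: "c = r *\<^sub>R a + (\<Sum>w\<in>S - {a}. representation S c w *\<^sub>R w)"
    using rep_sum[OF S(1), of c] S fS by (simp add: sum.remove[of S a] r_def)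
  have ysum: "y = (\<Sum>w\<in>T. (if w = c then representation S y a / r
       else representation S y w - representation S y a / r * representation S c w) *\<^sub>R w)" for y
  proof -
    have "(\<Sum>w\<in>T. (if w = c then representation S y a / r
       else representation S y w - representation S y a / r * representation S c w) *\<^sub>R w)
      = (representation S y a / r) *\<^sub>R c + (\<Sum>w\<in>S - {a}. (representation S y w - representation S y a / r * representation S c w) *\<^sub>R w)"
    proof -
      have "(\<Sum>w\<in>S - {a}. (if w = c then representation S y a / r
         else representation S y w - representation S y a / r * representation S c w) *\<^sub>R w)
        = (\<Sum>w\<in>S - {a}. (representation S y w - representation S y a / r * representation S c w) *\<^sub>R w)"
      proof (intro sum.cong refl)
        fix w assume "w \<in> S - {a}"
        hence "w \<noteq> c" using cS by blast
        thus "(if w = c then representation S y a / r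
         else representation S y w - representation S y a / r * representation S c w) *\<^sub>R w
         = (representation S y w - representation S y a / r * representation S c w) *\<^sub>R w" by simp
      qed
      thus ?thesis unfolding T_def using fS cS by (subst sum.insert) simp_all
    qed
    also have "(\<Sum>w\<in>S - {a}. (representation S y w - representation S y a / r * representation S c w) *\<^sub>R w)
      = (\<Sum>w\<in>S - {a}. representation S y w *\<^sub>R w) - (representation S y a / r) *\<^sub>R (\<Sum>w\<in>S - {a}. representation S c w *\<^sub>R w)"
      by (simp add: scaleR_diff_left sum_subtractf scaleR_sum_right)
    also have "(\<Sum>w\<in>S - {a}. representation S c w *\<^sub>R w) = c - r *\<^sub>R a" using csum by (simp add: algebra_simps)
    also have "(\<Sum>w\<in>S - {a}. representation S y w *\<^sub>R w) = y - representation S y a *\<^sub>R a"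
      using rep_sum[OF S(1), of y] S fS by (simp add: sum.remove[of S a] algebra_simps)
    finally show ?thesis using c by (simp add: r_def algebra_simps)
  qed
  have "y \<in> span T" for y
    by (subst ysum[of y]) (intro span_sum span_scale span_base)
  hence T: "is_basis T" using ind fS by (auto simp: is_basis_def T_def)
  thus "is_basis (insert c (S - {a}))" by (simp add: T_def)
  have "representation T y w = (if w \<in> T then (if w = c then representation S y a / r
       else representation S y w - representation S y a / r * representation S c w) else 0)"
    by (subst ysum[of y]) (rule rep_lincomb[OF T order_refl])
  thus "representation (insert c (S - {a})) y w =
      (if w = c then representation S y a / representation S c a
       else if w \<in> S - {a} then representation S y w - representation S y a / representation S c a * representation S c w
       else 0)" by (auto simp: T_def r_def)
qed

section \<open>Reduction modulo linear forms\<close>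

definition PPm :: "'a::real_normed_vector set set \<Rightarrow> nat \<Rightarrow> ('a \<Rightarrow> real) set" where
  "PPm SS k = (if k = 0 then {\<lambda>x. 0} else PPh SS (k - 1))"

lemma PPm_zero: "(\<lambda>x. 0) \<in> PPm SS k"
  by (simp add: PPm_def PPh_zero)

lemma PPm_add: "f \<in> PPm SS k \<Longrightarrow> g \<in> PPm SS k \<Longrightarrow> (\<lambda>x. f x + g x) \<in> PPm SS k"
  by (auto simp: PPm_def PPh_add split: if_splits)

lemma PPm_cmult: "f \<in> PPm SS k \<Longrightarrow> (\<lambda>x. c * f x) \<in> PPm SS k"
  by (auto simp: PPm_def PPh_cmult split: if_splits)

lemma PPm_sum: "(\<And>i. i \<in> I \<Longrightarrow> f i \<in> PPm SS k) \<Longrightarrow> (\<lambda>x. \<Sum>i\<in>I. f i x) \<in> PPm SS k"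
  by (induction I rule: infinite_finite_induct) (auto intro: PPm_zero PPm_add)

lemma PPm_mult:
  assumes "f \<in> PPm SS k" "g \<in> PPh SS l" shows "(\<lambda>x. f x * g x) \<in> PPm SS (k + l)"
proof (cases "k = 0")
  case True
  hence "f = (\<lambda>x. 0)" using assms(1) by (simp add: PPm_def)
  thus ?thesis by (simp add: PPm_zero)
next
  case False
  hence "f \<in> PPh SS (k - 1)" using assms(1) by (simp add: PPm_def)
  from PPh_mult[OF this assms(2)] show ?thesis using False by (simp add: PPm_def)
qed

lemma PPm_linear_mult:
  assumes "f \<in> PPm SS k" "g \<in> PPh SS 1" shows "(\<lambda>x. g x * f x) \<in> PPh SS k"
proof (cases "k = 0")
  case True
  hence "f = (\<lambda>x. 0)" using assms(1) by (simp add: PPm_def)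
  thus ?thesis by (simp add: PPh_zero)
next
  case False
  hence "f \<in> PPh SS (k - 1)" using assms(1) by (simp add: PPm_def)
  from PPh_mult[OF assms(2) this] show ?thesis using False by simp
qed

lemma hpm_PPm: "hpm k q \<Longrightarrow> q \<in> PPm SS k"
  by (auto simp: hpm_def PPm_def intro: homogeneous_poly_PPh split: if_splits)

text \<open>The degree \<open>k\<close> part of the ideal generated by the coordinates \<open>V\<close> of the basis \<open>B\<close>. It is used for
  \<open>x \<in> B\<close> and \<open>V = B - {x}\<close>, when these coordinates span the linear forms vanishing at \<open>x\<close>.\<close>

definition LI :: "'a::real_normed_vector set set \<Rightarrow> 'a set \<Rightarrow> 'a set \<Rightarrow> nat \<Rightarrow> ('a \<Rightarrow> real) set" where
  "LI SS B V k = {f. \<exists>g. (\<forall>v\<in>V. g v \<in> PPm SS k) \<and> f = (\<lambda>y. \<Sum>v\<in>V. representation B y v * g v y)}"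

lemma LI_zero: "(\<lambda>x. 0) \<in> LI SS B V k"
  unfolding LI_def by (intro CollectI exI[of _ "\<lambda>v x. 0"]) (simp add: PPm_zero)

lemma LI_add: assumes "f \<in> LI SS B V k" "g \<in> LI SS B V k" shows "(\<lambda>x. f x + g x) \<in> LI SS B V k"
proof -
  obtain u w where "\<forall>v\<in>V. u v \<in> PPm SS k" "f = (\<lambda>y. \<Sum>v\<in>V. representation B y v * u v y)"
     "\<forall>v\<in>V. w v \<in> PPm SS k" "g = (\<lambda>y. \<Sum>v\<in>V. representation B y v * w v y)"
    using assms by (auto simp: LI_def)
  thus ?thesis unfolding LI_def
    by (intro CollectI exI[of _ "\<lambda>v x. u v x + w v x"]) (simp add: PPm_add sum.distrib algebra_simps)
qed

lemma LI_mult: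
  assumes "f \<in> LI SS B V k" "h \<in> PPh SS l" shows "(\<lambda>x. f x * h x) \<in> LI SS B V (k + l)"
proof -
  obtain u where "\<forall>v\<in>V. u v \<in> PPm SS k" "f = (\<lambda>y. \<Sum>v\<in>V. representation B y v * u v y)"
    using assms by (auto simp: LI_def)
  thus ?thesis unfolding LI_def using PPm_mult[OF _ assms(2)]
    by (intro CollectI exI[of _ "\<lambda>v x. u v x * h x"]) (simp add: sum_distrib_right mult.assoc)
qed

text \<open>Injectivity of evaluation: modulo the linear forms vanishing at \<open>x\<close>, a
  section is determined by the values of its polynomials at \<open>x\<close>.\<close>

definition reducible_at :: "'a::real_normed_vector set set \<Rightarrow> 'a set \<Rightarrow> 'a \<Rightarrow> bool" where
  "reducible_at SS B x \<longleftrightarrow> (\<forall>k f. f \<in> PPh SS k \<longrightarrow> (\<forall>S\<in>SS. pc f S x = 0) \<longrightarrow> f \<in> LI SS B (B - {x}) k)"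

definition generic :: "'a::real_vector set set \<Rightarrow> 'a \<Rightarrow> bool" where
  "generic SS x \<longleftrightarrow> (\<forall>S\<in>SS. \<forall>v\<in>S. representation S x v \<noteq> 0)"

text \<open>The parity of its cardinality is the sign of the denominator at \<open>x\<close>; for a
  polytopal fan the cardinality is the index of a vertex in a generic sweep of the dual simple
  polytope.\<close>

definition neg :: "'a::real_vector \<Rightarrow> 'a set \<Rightarrow> 'a set" where
  "neg x S = {v\<in>S. representation S x v < 0}"

lemma pc_add:
  assumes "f \<in> PP SS" "g \<in> PP SS" "S \<in> SS" "is_basis S"
  shows "pc (\<lambda>x. f x + g x) S = (\<lambda>x. pc f S x + pc g S x)"
  using pc_PP[OF assms(1,3,4)] pc_PP[OF assms(2,3,4)] by (intro pc_eq[OF assms(4)]) auto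

lemma pc_diff:
  assumes "f \<in> PP SS" "g \<in> PP SS" "S \<in> SS" "is_basis S"
  shows "pc (\<lambda>x. f x - g x) S = (\<lambda>x. pc f S x - pc g S x)"
  using pc_PP[OF assms(1,3,4)] pc_PP[OF assms(2,3,4)] by (intro pc_eq[OF assms(4)]) auto

lemma pc_mult:
  assumes "f \<in> PP SS" "g \<in> PP SS" "S \<in> SS" "is_basis S"
  shows "pc (\<lambda>x. f x * g x) S = (\<lambda>x. pc f S x * pc g S x)"
  using pc_PP[OF assms(1,3,4)] pc_PP[OF assms(2,3,4)] by (intro pc_eq[OF assms(4)]) auto

lemma pc_poly:
  assumes "real_polynomial_function p" "is_basis S"
  shows "pc p S = p"
  using assms by (intro pc_eq) auto

lemma poly_PP: "real_polynomial_function p \<Longrightarrow> p \<in> PP SS"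
  by (auto simp: PP_def)

text \<open>A total preorder of the cones compatible with stars of negative faces: peeling off the
  cones from the top makes the products of the negative Courant functions a triangular basis.\<close>

lemma reducible_of_order:
  fixes SS :: "'a::real_normed_vector set set" and \<psi> :: "'a set \<Rightarrow> real"
  assumes F: "sfan SS" and g: "generic SS x" and B: "is_basis B" "x \<in> B \<or> B = {}"
    and ord: "\<And>S T. S \<in> SS \<Longrightarrow> T \<in> SS \<Longrightarrow> neg x S \<subseteq> T \<Longrightarrow> S \<noteq> T \<Longrightarrow> \<psi> T < \<psi> S"
  shows "reducible_at SS B x"
proof -
  note bas = sfanD(2)[OF F]
  \<comment> \<open>Induction on the number of cones where \<open>f\<close> may be nonzero; these
    form a set \<open>U\<close> that is closed downwards for \<psi>.\<close>
  have main: "f \<in> LI SS B (B - {x}) k"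
    if "card U = n" "U \<subseteq> SS" "\<And>S T. S \<in> U \<Longrightarrow> T \<in> SS \<Longrightarrow> \<psi> T < \<psi> S \<Longrightarrow> T \<in> U"
      "f \<in> PPh SS k" "\<And>S. S \<in> SS \<Longrightarrow> pc f S x = 0" "\<And>S. S \<in> SS \<Longrightarrow> S \<notin> U \<Longrightarrow> pc f S = (\<lambda>_. 0)"
    for U f k n
    using that
  proof (induction n arbitrary: U f)
    case 0
    have "finite U" using finite_subset[OF 0(2) sfanD(1)[OF F]] .
    hence "U = {}" using 0(1) by simp
    have "f = (\<lambda>x. 0)"
    proof (rule sfan_ext[OF F])
      fix S y assume S: "S \<in> SS" "y \<in> bcone S"
      have "pc f S = (\<lambda>_. 0)" using 0 S \<open>U = {}\<close> by auto
      thus "f y = 0" using pc_PP(2)[OF PPh_PP[OF 0(4)] S(1) bas[OF S(1)] S(2)] by simp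
    qed
    thus ?case by (simp add: LI_zero)
  next
    case (Suc n)
    note fP = Suc.prems(4)
    note fPP = PPh_PP[OF fP]
    have finU: "finite U" using Suc.prems(2) sfanD(1)[OF F] finite_subset by auto
    have neU: "U \<noteq> {}" using Suc.prems(1) by auto
    have "Max (\<psi> ` U) \<in> \<psi> ` U" using finU neU by (intro Max_in) auto
    then obtain S where S0: "S \<in> U" "Max (\<psi> ` U) = \<psi> S" by auto
    have S: "S \<in> U" "\<And>T. T \<in> U \<Longrightarrow> \<psi> T \<le> \<psi> S"
      using S0 finU by (auto simp flip: S0(2))
    have SS: "S \<in> SS" using S Suc.prems(2) by auto
    have bS: "is_basis S" using bas[OF SS] .
    define R where "R = neg x S"
    have RS: "R \<subseteq> S" by (auto simp: R_def neg_def)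
    have fR: "finite R" using RS bS finite_subset by (auto simp: is_basis_def)
    \<comment> \<open>Across the wall opposite to a negative generator lies a cone whose negative
      face is contained in \<open>S\<close>. It is higher than the top cone \<open>S\<close> of
      \<open>U\<close>, so \<open>f\<close> vanishes there and therefore on the hyperplane of the
      wall.\<close>
    have hz: "pc f S y = 0" if v: "v \<in> R" and y: "representation S y v = 0" for v y
    proof -
      have vS: "v \<in> S" "representation S x v < 0" using v by (auto simp: R_def neg_def)
      obtain T u where T: "T \<in> SS" "u \<in> T" "T - {u} = S - {v}" "T \<noteq> S" "representation T v u < 0"
        using wall_exists[OF F SS vS(1)] by metis
      have bT: "is_basis T" using bas T by auto
      have uS: "u \<notin> S - {v}" using T(3) by blast
      have xu: "representation T x u = representation S x v * representation T v u"
      proof -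
        have "representation T x u = (\<Sum>w\<in>S. representation S x w *\<^sub>R representation T w u)"
          by (rule linear_expand[OF bS rep_linear[OF bT]])
        also have "\<dots> = (\<Sum>w\<in>{v}. representation S x w *\<^sub>R representation T w u)"
        proof (rule sum.mono_neutral_right)
          show "\<forall>i\<in>S - {v}. representation S x i *\<^sub>R representation T i u = 0"
          proof
            fix i assume i: "i \<in> S - {v}"
            hence "i \<in> T" "i \<noteq> u" using T(3) uS by auto
            thus "representation S x i *\<^sub>R representation T i u = 0" using rep_basis[OF bT] by simp
          qed
        qed (use vS bS in \<open>auto simp: is_basis_def\<close>)
        finally show ?thesis by simp
      qed
      hence "representation T x u > 0" using vS T(5) by (simp add: mult_neg_neg)
      hence "neg x T \<subseteq> T - {u}" by (auto simp: neg_def)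
      hence "neg x T \<subseteq> S" using T(3) by blast
      from ord[OF T(1) SS this T(4)] have "\<psi> S < \<psi> T" .
      hence "T \<notin> U" using S(2)[of T] by auto
      hence pT: "pc f T = (\<lambda>_. 0)" using Suc.prems(6) T(1) by auto
      have 0: "pc f S (\<Sum>w\<in>S - {v}. t w *\<^sub>R w) = 0" for t
      proof (rule poly_vanish_span[OF bS _ pc_PP(1)[OF fPP SS bS]])
        fix t :: "'a \<Rightarrow> real" assume t: "\<And>w. w \<in> S - {v} \<Longrightarrow> t w > 0"
        define z where "z = (\<Sum>w\<in>S - {v}. t w *\<^sub>R w)"
        have "z \<in> bcone S" unfolding z_def using t by (intro bcone_lincomb bS) (auto simp: less_imp_le)
        moreover have "z \<in> bcone T" unfolding z_def T(3)[symmetric] using t T(3) by (intro bcone_lincomb bT) (auto simp: less_imp_le)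
        ultimately have "pc f S z = pc f T z"
          using pc_PP(2)[OF fPP SS bS] pc_PP(2)[OF fPP T(1) bT] by simp
        thus "pc f S (\<Sum>w\<in>S - {v}. t w *\<^sub>R w) = 0" using pT by (simp add: z_def)
      qed auto
      have "y = (\<Sum>w\<in>S - {v}. representation S y w *\<^sub>R w)"
        using rep_sum[OF bS, of y] y vS bS by (simp add: sum.remove[of S v] is_basis_def)
      thus ?thesis using 0[of "representation S y"] by simp
    qed
    have "\<exists>q. homogeneous_poly (k - card R) q \<and> (k < card R \<longrightarrow> q = (\<lambda>_. 0)) \<and>
        pc f S = (\<lambda>y. (\<Prod>v\<in>R. representation S y v) * q y)"
      by (rule hom_divide_prod[OF bS RS pc_PPh[OF fP SS bS]]) (rule hz)
    then obtain q where q: "homogeneous_poly (k - card R) q" "k < card R \<longrightarrow> q = (\<lambda>_. 0)"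
      "pc f S = (\<lambda>y. (\<Prod>v\<in>R. representation S y v) * q y)"
      by blast
    \<comment> \<open>This product is zero on every cone that does not contain \<open>R\<close>, and
      the other cones through \<open>R\<close> are lower than \<open>S\<close>. Subtracting a
      multiple of it therefore keeps the zeros of \<open>f\<close> outside \<open>U\<close>.\<close>
    define e where "e = (\<lambda>y. \<Prod>v\<in>R. crt SS v y)"
    have e: "e \<in> PPh SS (card R)"
      using PPh_prod[OF fR, of "crt SS" SS "\<lambda>_. 1"] crt_PPh[OF F] by (simp add: e_def)
    have pce: "pc e T = (\<lambda>y. \<Prod>v\<in>R. representation T y v)" if T: "T \<in> SS" for T
    proof (rule pc_eq[OF bas[OF T]])
      show "real_polynomial_function (\<lambda>y. \<Prod>v\<in>R. representation T y v)"
        using fR by (intro real_polynomial_function_prod rep_poly bas T)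
      show "\<And>y. y \<in> bcone T \<Longrightarrow> e y = (\<Prod>v\<in>R. representation T y v)"
        unfolding e_def by (intro prod.cong refl crt_eq[OF F T])
    qed
    \<comment> \<open>The divided coordinates are negative at \<open>x\<close>, so the vanishing of
      \<open>f\<close> at \<open>x\<close> passes to the quotient, which is then a combination of
      the linear forms vanishing at \<open>x\<close>.\<close>
    have qx: "q x = 0"
    proof -
      have "(\<Prod>v\<in>R. representation S x v) * q x = 0" using Suc.prems(5)[OF SS] q(3) by simp
      moreover have "(\<Prod>v\<in>R. representation S x v) \<noteq> 0" using fR by (auto simp: R_def neg_def)
      ultimately show ?thesis by simp
    qed
    have qeP: "(\<lambda>y. q y * e y) \<in> PPh SS k"
    proof (cases "k < card R")
      case True
      thus ?thesis using q(2) by (simp add: PPh_zero)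
    next
      case False
      thus ?thesis using PPh_mult[OF homogeneous_poly_PPh[OF q(1)] e] by simp
    qed
    have qeL: "(\<lambda>y. q y * e y) \<in> LI SS B (B - {x}) k"
    proof (cases "k < card R")
      case True
      thus ?thesis using q(2) by (simp add: LI_zero)
    next
      case False
      obtain r where r: "\<And>v. v \<in> B - {x} \<Longrightarrow> hpm (k - card R) (r v)" "q = (\<lambda>y. \<Sum>v\<in>B - {x}. representation B y v * r v y)"
        using hom_vanish_point[OF B q(1) qx] by metis
      have "q \<in> LI SS B (B - {x}) (k - card R)" unfolding LI_def using r hpm_PPm by blast
      from LI_mult[OF this e] show ?thesis using False by simp
    qed
    define f' where "f' = (\<lambda>y. f y - q y * e y)"
    have pcqe: "pc (\<lambda>y. q y * e y) T = (\<lambda>y. q y * (\<Prod>v\<in>R. representation T y v))" if T: "T \<in> SS" for T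
      using pc_mult[OF poly_PP[OF homogeneous_poly_poly[OF q(1)]] PPh_PP[OF e] T bas[OF T]]
        pc_poly[OF homogeneous_poly_poly[OF q(1)] bas[OF T]] pce[OF T] by simp
    have pcf': "pc f' T = (\<lambda>y. pc f T y - q y * (\<Prod>v\<in>R. representation T y v))" if T: "T \<in> SS" for T
      unfolding f'_def using pc_diff[OF fPP PPh_PP[OF qeP] T bas[OF T]] pcqe[OF T] by simp
    have "f' \<in> LI SS B (B - {x}) k"
    proof (rule Suc.IH[of "U - {S}"])
      show "card (U - {S}) = n" using Suc.prems(1) S(1) finU by simp
      show "U - {S} \<subseteq> SS" using Suc.prems(2) by auto
      show "\<And>S' T. S' \<in> U - {S} \<Longrightarrow> T \<in> SS \<Longrightarrow> \<psi> T < \<psi> S' \<Longrightarrow> T \<in> U - {S}"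
        using Suc.prems(3) S(2) by force
      show "f' \<in> PPh SS k" unfolding f'_def by (intro PPh_diff fP qeP)
      show "pc f' T x = 0" if "T \<in> SS" for T using pcf'[OF that] Suc.prems(5)[OF that] qx by simp
      show "pc f' T = (\<lambda>_. 0)" if T: "T \<in> SS" "T \<notin> U - {S}" for T
      proof (cases "T = S")
        case True
        thus ?thesis using pcf'[OF SS] q(3) by (auto simp: fun_eq_iff)
      next
        case False
        hence TU: "T \<notin> U" using T by auto
        have "\<not> R \<subseteq> T"
        proof
          assume "R \<subseteq> T"
          hence "\<psi> T < \<psi> S" using ord[OF SS T(1)] False by (auto simp: R_def)
          thus False using Suc.prems(3)[OF S(1) T(1)] TU by blast
        qed
        then obtain v where "v \<in> R" "v \<notin> T" by auto
        hence "(\<Prod>v\<in>R. representation T y v) = 0" for y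
          using fR by (intro prod_zero) (auto simp: rep_outside intro!: bexI[of _ v])
        thus ?thesis using pcf'[OF T(1)] Suc.prems(6)[OF T(1) TU] by simp
      qed
    qed
    from LI_add[OF this qeL] show ?case by (simp add: f'_def)
  qed
  show ?thesis unfolding reducible_at_def
  proof (intro allI impI)
    fix k f assume f: "f \<in> PPh SS k" "\<forall>S\<in>SS. pc f S x = 0"
    show "f \<in> LI SS B (B - {x}) k"
      by (rule main[where U = SS and n = "card SS"]) (use f in auto)
  qed
qed

section \<open>Star subdivisions along two-dimensional cones\<close>

locale star_subdivision =
  fixes SS :: "'a::real_normed_vector set set" and a b :: 'a and \<alpha> \<beta> :: real and c :: 'a and S0 :: "'a set"
  assumes F: "sfan SS" and ab: "a \<noteq> b" and S0: "S0 \<in> SS" "a \<in> S0" "b \<in> S0"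
    and pos: "\<alpha> > 0" "\<beta> > 0" and c_def: "c = \<alpha> *\<^sub>R a + \<beta> *\<^sub>R b"
begin

definition SD :: "'a set set" where
  "SD = {S\<in>SS. \<not> (a \<in> S \<and> b \<in> S)} \<union> (\<lambda>S. insert c (S - {a})) ` {S\<in>SS. a \<in> S \<and> b \<in> S}
      \<union> (\<lambda>S. insert c (S - {b})) ` {S\<in>SS. a \<in> S \<and> b \<in> S}"

lemma SD_cases:
  assumes "T \<in> SD"
  obtains "T \<in> SS" "\<not> (a \<in> T \<and> b \<in> T)"
  | S where "S \<in> SS" "a \<in> S" "b \<in> S" "T = insert c (S - {a})"
  | S where "S \<in> SS" "a \<in> S" "b \<in> S" "T = insert c (S - {b})"
  using assms unfolding SD_def by blast

text \<open>The coordinates on the subdivided fan; \<open>m\<close> is the Courant function of the new ray.\<close>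

definition nc :: "'a \<Rightarrow> 'a \<Rightarrow> real" where
  "nc y w = (let m = min (crt SS a y / \<alpha>) (crt SS b y / \<beta>) in
     if w = c then m else if w = a then crt SS a y - \<alpha> * m else if w = b then crt SS b y - \<beta> * m
     else crt SS w y)"

lemma rep_c: "is_basis S \<Longrightarrow> a \<in> S \<Longrightarrow> b \<in> S \<Longrightarrow>
    representation S c w = (if w = a then \<alpha> else if w = b then \<beta> else 0)"
  using ab by (simp add: c_def rep_add rep_scale rep_basis)

lemma c_bcone: "is_basis S \<Longrightarrow> a \<in> S \<Longrightarrow> b \<in> S \<Longrightarrow> c \<in> bcone S"
  using pos by (auto simp: bcone_def rep_c)

text \<open>A generator has a single nonzero coordinate in its cone, whereas \<open>c\<close> has
  two in \<open>S0\<close>; the coordinates of a common point must agree.\<close>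

lemma c_new: "T \<in> SS \<Longrightarrow> c \<notin> T"
proof
  assume T: "T \<in> SS" "c \<in> T"
  have b: "is_basis T" "is_basis S0" using sfanD(2)[OF F] T S0 by auto
  have "c \<in> bcone T" using rep_basis[OF b(1) T(2)] by (auto simp: bcone_def)
  from sfanD(4)[OF F T(1) S0(1) this c_bcone[OF b(2) S0(2,3)]]
  have eq: "representation T c w = representation S0 c w" for w .
  have "a = c" using eq[of a] rep_basis[OF b(1) T(2), of a] rep_c[OF b(2) S0(2,3), of a] pos by (auto split: if_splits)
  moreover have "b = c" using eq[of b] rep_basis[OF b(1) T(2), of b] rep_c[OF b(2) S0(2,3), of b] pos ab by (auto split: if_splits)
  ultimately show False using ab by simp
qed

lemma c_ne: "c \<noteq> a" "c \<noteq> b"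
  using c_new[OF S0(1)] S0 by auto

lemma sub_basis:
  assumes S: "S \<in> SS" "a \<in> S" "b \<in> S"
  shows "is_basis (insert c (S - {a}))"
    "representation (insert c (S - {a})) y w =
      (if w = c then representation S y a / \<alpha>
       else if w = b then representation S y b - \<beta> * (representation S y a / \<alpha>)
       else if w = a then 0 else representation S y w)"
proof -
  have b: "is_basis S" using sfanD(2)[OF F] S by auto
  have ca: "representation S c a = \<alpha>" using rep_c[OF b S(2,3)] by simp
  hence ne: "representation S c a \<noteq> 0" using pos by simp
  show "is_basis (insert c (S - {a}))" by (rule exchange_basis(1)[OF b S(2) ne])
  show "representation (insert c (S - {a})) y w =
      (if w = c then representation S y a / \<alpha>
       else if w = b then representation S y b - \<beta> * (representation S y a / \<alpha>)
       else if w = a then 0 else representation S y w)"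
    unfolding exchange_basis(3)[OF b S(2) ne] ca rep_c[OF b S(2,3)] using S ab c_ne
    by (auto simp: rep_outside)
qed

text \<open>The two halves of a subdivided cone are separated by the coordinates at \<open>a\<close>
  and \<open>b\<close>, scaled so that \<open>c\<close> lies on the separating hyperplane.\<close>

lemma sub_bcone:
  assumes S: "S \<in> SS" "a \<in> S" "b \<in> S"
  shows "y \<in> bcone (insert c (S - {a})) \<longleftrightarrow> y \<in> bcone S \<and> representation S y a / \<alpha> \<le> representation S y b / \<beta>"
proof -
  have cS: "c \<notin> S" using c_new S by auto
  have e: "representation S y a / \<alpha> \<le> representation S y b / \<beta> \<longleftrightarrow> 0 \<le> representation S y b - \<beta> * (representation S y a / \<alpha>)"
    using pos by (simp add: field_simps)
  have e2: "0 \<le> representation S y a / \<alpha> \<longleftrightarrow> 0 \<le> representation S y a" using pos by (simp add: zero_le_divide_iff)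
  have 1: "y \<in> bcone (insert c (S - {a})) \<longleftrightarrow> 0 \<le> representation S y a \<and>
     0 \<le> representation S y b - \<beta> * (representation S y a / \<alpha>) \<and> (\<forall>w\<in>S - {a,b}. 0 \<le> representation S y w)"
    unfolding bcone_def sub_basis(2)[OF S] using S ab c_ne cS e2 by auto
  have 2: "y \<in> bcone S \<longleftrightarrow> 0 \<le> representation S y a \<and> 0 \<le> representation S y b \<and> (\<forall>w\<in>S - {a,b}. 0 \<le> representation S y w)"
    unfolding bcone_def using S by auto
  have 3: "0 \<le> representation S y a \<Longrightarrow> 0 \<le> representation S y b - \<beta> * (representation S y a / \<alpha>) \<Longrightarrow> 0 \<le> representation S y b"
    using pos by (smt (verit, best) divide_nonneg_pos mult_nonneg_nonneg)
  show ?thesis unfolding 1 2 e using 3 by blast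
qed

lemma rep_nc:
  assumes S: "S \<in> SS" "a \<in> S" "b \<in> S" and y: "y \<in> bcone (insert c (S - {a}))"
  shows "representation (insert c (S - {a})) y w = nc y w"
proof -
  have yS: "y \<in> bcone S" and le: "representation S y a / \<alpha> \<le> representation S y b / \<beta>"
    using y sub_bcone[OF S] by auto
  show ?thesis
    unfolding sub_basis(2)[OF S] nc_def Let_def crt_eq[OF F S(1) yS] min_absorb1[OF le]
    using pos ab by auto
qed

text \<open>On a cone that lacks \<open>a\<close> or \<open>b\<close> one of the two Courant
  functions is zero, hence so is their scaled minimum, and nothing changes.\<close>

lemma rep_nc_old:
  assumes S: "S \<in> SS" "\<not> (a \<in> S \<and> b \<in> S)" and y: "y \<in> bcone S"
  shows "representation S y w = nc y w"
proof -
  have z: "representation S y a = 0 \<or> representation S y b = 0" using S rep_outside by metis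
  have n: "representation S y a \<ge> 0" "representation S y b \<ge> 0" using bcone_rep_nonneg[OF y] by auto
  have m: "min (representation S y a / \<alpha>) (representation S y b / \<beta>) = 0"
    using z n pos by (auto simp: min_def divide_simps mult_le_0_iff)
  show ?thesis unfolding nc_def Let_def crt_eq[OF F S(1) y] m using c_new[OF S(1)] by (auto simp: rep_outside)
qed

text \<open>Exchanging \<open>a\<close> and \<open>b\<close> carries every statement about one half
  of a subdivided cone to the other half.\<close>

lemma sym: "star_subdivision SS b a \<beta> \<alpha> c S0"
  using F ab S0 pos c_def by unfold_locales (auto simp: add.commute)

lemma nc_sym: "star_subdivision.nc SS b a \<beta> \<alpha> c = nc"
  using ab unfolding fun_eq_iff star_subdivision.nc_def[OF sym] nc_def Let_def by (auto simp: min.commute)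

lemma rep_SD:
  assumes T: "T \<in> SD" and y: "y \<in> bcone T"
  shows "representation T y w = nc y w"
  using T
proof (cases rule: SD_cases)
  case 1 thus ?thesis using rep_nc_old y by blast
next
  case (2 S) thus ?thesis using rep_nc y by blast
next
  case (3 S) thus ?thesis using star_subdivision.rep_nc[OF sym, unfolded nc_sym] y by blast
qed

lemma SD_basis: "T \<in> SD \<Longrightarrow> is_basis T"
  by (erule SD_cases) (use sfanD(2)[OF F] sub_basis(1) star_subdivision.sub_basis(1)[OF sym] in auto)

lemma SD_refines: assumes "T \<in> SD" shows "\<exists>S\<in>SS. bcone T \<subseteq> bcone S"
  using assms
proof (cases rule: SD_cases)
  case 1 thus ?thesis by auto
next
  case (2 S) thus ?thesis using sub_bcone[OF 2(1-3)] by (intro bexI[of _ S]) auto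
next
  case (3 S) thus ?thesis using star_subdivision.sub_bcone[OF sym 3(1,3,2)] by (intro bexI[of _ S]) auto
qed

lemma sfan_SD: "sfan SD"
  unfolding sfan_def
proof (intro conjI ballI allI)
  show "finite SD" using sfanD(1)[OF F] by (simp add: SD_def)
  show "\<And>S. S \<in> SD \<Longrightarrow> is_basis S" by (rule SD_basis)
  fix y
  obtain S where S: "S \<in> SS" "y \<in> bcone S" using sfanD(3)[OF F] by blast
  show "\<exists>S\<in>SD. y \<in> bcone S"
  proof (cases "a \<in> S \<and> b \<in> S")
    case False
    thus ?thesis using S by (intro bexI[of _ S]) (auto simp: SD_def)
  next
    case True
    have "y \<in> bcone (insert c (S - {a})) \<or> y \<in> bcone (insert c (S - {b}))"
      using sub_bcone[of S y] star_subdivision.sub_bcone[OF sym, of S y] S True linear by blast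
    moreover have "insert c (S - {a}) \<in> SD" "insert c (S - {b}) \<in> SD" using S True by (auto simp: SD_def)
    ultimately show ?thesis by blast
  qed
next
  fix S T y assume "S \<in> SD" "T \<in> SD" "y \<in> bcone S \<inter> bcone T"
  thus "representation S y = representation T y" using rep_SD by (intro ext) auto
qed

lemma crt_SD: "crt SD w y = nc y w"
proof -
  obtain T where "T \<in> SD" "y \<in> bcone T" using sfanD(3)[OF sfan_SD] by blast
  thus ?thesis using crt_eq[OF sfan_SD] rep_SD by metis
qed

definition \<kappa> :: "'a \<Rightarrow> real" where "\<kappa> = crt SD c"

lemma kappa_eq: "\<kappa> y = min (crt SS a y / \<alpha>) (crt SS b y / \<beta>)"
  by (simp add: \<kappa>_def crt_SD nc_def Let_def)

text \<open>The minimum equals one of its two arguments, so the product of the two differences is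
  zero. This quadratic relation bounds the powers of \<kappa> that are required.\<close>

lemma kappa_square: "\<kappa> y * \<kappa> y = \<kappa> y * (crt SS a y / \<alpha> + crt SS b y / \<beta>) - (1 / (\<alpha> * \<beta>)) * (crt SS a y * crt SS b y)"
proof -
  have "(crt SS a y / \<alpha> - \<kappa> y) * (crt SS b y / \<beta> - \<kappa> y) = 0" by (auto simp: kappa_eq min_def)
  thus ?thesis by (simp add: algebra_simps)
qed

lemma PPh_SD: assumes f: "f \<in> PPh SS k" shows "f \<in> PPh SD k"
  unfolding PPh_def
proof (intro CollectI ballI)
  fix T assume "T \<in> SD"
  then obtain S where S: "S \<in> SS" "bcone T \<subseteq> bcone S" using SD_refines by blast
  then obtain p where "homogeneous_poly k p" "\<forall>y\<in>bcone S. f y = p y" using f unfolding PPh_def by blast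
  thus "\<exists>p. homogeneous_poly k p \<and> (\<forall>y\<in>bcone T. f y = p y)" using S(2) by blast
qed

lemma pc_SD:
  assumes "f \<in> PP SS" "T \<in> SD" "S \<in> SS" "bcone T \<subseteq> bcone S"
  shows "pc f T = pc f S"
  using pc_PP[OF assms(1,3) sfanD(2)[OF F assms(3)]] assms(4)
  by (intro pc_eq SD_basis assms(2)) auto

text \<open>The degree \<open>k\<close> part of the module generated by 1 and \<kappa> over the
  sections of the unrefined fan: the analogue of the blow-up formula for a centre of codimension
  two.\<close>

definition G :: "nat \<Rightarrow> ('a \<Rightarrow> real) set" where
  "G k = {f. \<exists>g h. g \<in> PPh SS k \<and> h \<in> PPm SS k \<and> f = (\<lambda>y. g y + \<kappa> y * h y)}"

lemma GI: "g \<in> PPh SS k \<Longrightarrow> h \<in> PPm SS k \<Longrightarrow> (\<And>y. f y = g y + \<kappa> y * h y) \<Longrightarrow> f \<in> G k"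
  unfolding G_def mem_Collect_eq by (rule exI[of _ g], rule exI[of _ h], simp add: fun_eq_iff)

lemma GE: assumes "f \<in> G k" obtains g h where "g \<in> PPh SS k" "h \<in> PPm SS k" "f = (\<lambda>y. g y + \<kappa> y * h y)"
  using assms unfolding G_def by auto

lemma G_add: assumes "f \<in> G k" "f' \<in> G k" shows "(\<lambda>x. f x + f' x) \<in> G k"
proof -
  obtain g h g' h' where gh: "g \<in> PPh SS k" "h \<in> PPm SS k" "f = (\<lambda>y. g y + \<kappa> y * h y)"
    "g' \<in> PPh SS k" "h' \<in> PPm SS k" "f' = (\<lambda>y. g' y + \<kappa> y * h' y)" using assms by (auto elim!: GE)
  show ?thesis by (rule GI[OF PPh_add[OF gh(1,4)] PPm_add[OF gh(2,5)]]) (simp add: gh algebra_simps)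
qed

lemma G_cmult: assumes "f \<in> G k" shows "(\<lambda>x. d * f x) \<in> G k"
proof -
  obtain g h where gh: "g \<in> PPh SS k" "h \<in> PPm SS k" "f = (\<lambda>y. g y + \<kappa> y * h y)" using assms by (auto elim!: GE)
  show ?thesis by (rule GI[OF PPh_cmult[OF gh(1), of d] PPm_cmult[OF gh(2), of d]]) (simp add: gh algebra_simps)
qed

lemma G_PPh: "g \<in> PPh SS k \<Longrightarrow> g \<in> G k"
  by (rule GI[OF _ PPm_zero]) auto

lemma G_sum: "(\<And>i. i \<in> I \<Longrightarrow> f i \<in> G k) \<Longrightarrow> (\<lambda>x. \<Sum>i\<in>I. f i x) \<in> G k"
  by (induction I rule: infinite_finite_induct) (auto intro: G_PPh PPh_zero G_add)

lemma G_mult: assumes "f \<in> G k" "f' \<in> G l" shows "(\<lambda>x. f x * f' x) \<in> G (k + l)"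
proof -
  obtain g h g' h' where gh: "g \<in> PPh SS k" "h \<in> PPm SS k" "f = (\<lambda>y. g y + \<kappa> y * h y)"
    "g' \<in> PPh SS l" "h' \<in> PPm SS l" "f' = (\<lambda>y. g' y + \<kappa> y * h' y)" using assms by (auto elim!: GE)
  have A: "crt SS a \<in> PPh SS 1" "crt SS b \<in> PPh SS 1" using crt_PPh[OF F] by auto
  define u where "u = (\<lambda>y. (1/\<alpha>) * crt SS a y + (1/\<beta>) * crt SS b y)"
  have u: "u \<in> PPh SS 1" unfolding u_def by (intro PPh_add PPh_cmult A)
  define p where "p = (\<lambda>y. g y * g' y - (1 / (\<alpha> * \<beta>)) * ((crt SS a y * h y) * (crt SS b y * h' y)))"
  have p: "p \<in> PPh SS (k + l)" unfolding p_def
    by (intro PPh_diff PPh_mult PPh_cmult PPm_linear_mult gh A)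
  define q where "q = (\<lambda>y. h' y * g y + h y * g' y + h y * (u y * h' y))"
  have q: "q \<in> PPm SS (k + l)" unfolding q_def
    by (intro PPm_add PPm_mult PPm_linear_mult gh u PPm_mult[of h' SS l g k, unfolded add.commute[of l k]])
  show ?thesis
  proof (rule GI[OF p q])
    fix y
    have "f y * f' y = g y * g' y + \<kappa> y * (h' y * g y + h y * g' y) + (\<kappa> y * \<kappa> y) * (h y * h' y)"
      unfolding gh by (simp add: algebra_simps)
    also have "\<dots> = p y + \<kappa> y * q y"
      unfolding kappa_square p_def q_def u_def by (simp add: algebra_simps)
    finally show "f y * f' y = p y + \<kappa> y * q y" .
  qed
qed

lemma G_prod: "finite I \<Longrightarrow> (\<And>i. i \<in> I \<Longrightarrow> f i \<in> G (d i)) \<Longrightarrow> (\<lambda>x. \<Prod>i\<in>I. f i x) \<in> G (\<Sum>i\<in>I. d i)"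
  by (induction I rule: finite_induct) (auto intro: G_mult G_PPh homogeneous_poly_PPh homogeneous_poly_const)

lemma G_power: "f \<in> G 1 \<Longrightarrow> (\<lambda>x. f x ^ m) \<in> G m"
proof (induction m)
  case 0 thus ?case by (auto intro: G_PPh homogeneous_poly_PPh homogeneous_poly_const)
next
  case (Suc m) thus ?case using G_mult[of f 1 "\<lambda>x. f x ^ m" m] by simp
qed

lemma kappa_G: "\<kappa> \<in> G 1"
  by (rule GI[OF PPh_zero, of "\<lambda>_. 1"]) (auto simp: PPm_def intro: homogeneous_poly_PPh homogeneous_poly_const)

lemma crt_G: "crt SD w \<in> G 1"
proof -
  have A: "crt SS v \<in> G 1" for v using G_PPh crt_PPh[OF F] by auto
  consider "w = c" | "w = a" | "w = b" | "w \<noteq> a" "w \<noteq> b" "w \<noteq> c" by blast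
  thus ?thesis
  proof cases
    case 1 thus ?thesis using kappa_G by (simp add: \<kappa>_def)
  next
    case 2
    have "crt SD w = (\<lambda>y. crt SS a y + (-\<alpha>) * \<kappa> y)"
      using 2 c_ne by (auto simp: crt_SD nc_def kappa_eq Let_def)
    thus ?thesis by (simp only: G_add[OF A G_cmult[OF kappa_G]])
  next
    case 3
    have "crt SD w = (\<lambda>y. crt SS b y + (-\<beta>) * \<kappa> y)"
      using 3 c_ne ab by (auto simp: crt_SD nc_def kappa_eq Let_def)
    thus ?thesis by (simp only: G_add[OF A G_cmult[OF kappa_G]])
  next
    case 4
    have "crt SD w = crt SS w" using 4 by (auto simp: crt_SD nc_def Let_def)
    thus ?thesis using A by simp
  qed
qed

text \<open>Sections of the subdivided fan are combinations of monomials in its Courant functions.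
  Each of these is an old one, \<kappa>, or an old one minus a multiple of \<kappa>, and the module
  is closed under products.\<close>

lemma PPh_SD_G: assumes "f \<in> PPh SD k" shows "f \<in> G k"
proof -
  obtain d where d: "f = (\<lambda>y. \<Sum>e\<in>Mon SD k. d e * fmon SD e y)" using PPh_fmon_expand[OF sfan_SD assms] by metis
  have "fmon SD e \<in> G k" if e: "e \<in> Mon SD k" for e
  proof -
    obtain T where T: "T \<in> SD" "e \<in> expo T k" using e by (auto simp: Mon_def)
    have fin: "finite (\<Union>SD)" "finite T" using sfanD(6)[OF sfan_SD] sfanD(5)[OF sfan_SD] T by auto
    have "(\<lambda>y. \<Prod>v\<in>\<Union>SD. crt SD v y ^ e v) \<in> G (\<Sum>v\<in>\<Union>SD. e v)"
      by (intro G_prod fin G_power crt_G)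
    moreover have "(\<Sum>v\<in>\<Union>SD. e v) = k"
      using supported_sum[OF fin(1) fin(2) _ Mon_supported[OF e]] T by (auto simp: expo_def)
    ultimately show ?thesis by (simp add: fmon_def[abs_def])
  qed
  thus ?thesis unfolding d by (intro G_sum G_cmult)
qed

text \<open>On a subdivided cone the relation holds for both linear pieces of \<kappa>; their
  difference is a nonzero linear form, so \<open>h\<close> and then \<open>g\<close> vanish there.
  Elsewhere \<kappa> is zero, so \<open>h\<close> is left undetermined and uniqueness is claimed for
  \<open>g\<close> alone.\<close>

lemma G_unique:
  assumes g: "g \<in> PPh SS k" and h: "h \<in> PPm SS k" and z: "\<And>y. g y + \<kappa> y * h y = 0"
  shows "g = (\<lambda>_. 0)"
proof (rule sfan_ext[OF F])
  fix S y assume S: "S \<in> SS" "y \<in> bcone S"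
  have bS: "is_basis S" using sfanD(2)[OF F S(1)] .
  have hP: "h \<in> PP SS" using h PPh_PP PPh_zero[of SS k] by (fastforce simp: PPm_def split: if_splits)
  have gP: "g \<in> PP SS" using g PPh_PP by auto
  show "g y = 0"
  proof (cases "a \<in> S \<and> b \<in> S")
    case False
    have "\<kappa> y = 0"
      using rep_nc_old[OF S(1) False S(2), of c] rep_outside[OF c_new[OF S(1)]] by (simp add: kappa_eq nc_def Let_def)
    thus ?thesis using z[of y] by simp
  next
    case True
    have eq1: "(\<lambda>y. pc g S y + representation S y a / \<alpha> * pc h S y) = (\<lambda>_. 0)"
      if A: "a \<in> S" "b \<in> S" "\<alpha> > 0" "\<beta> > 0" "is_basis T"
        "\<And>y. y \<in> bcone T \<longleftrightarrow> y \<in> bcone S \<and> representation S y a / \<alpha> \<le> representation S y b / \<beta>"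
        "\<And>y. \<kappa> y = min (crt SS a y / \<alpha>) (crt SS b y / \<beta>)" for a b \<alpha> \<beta> T
    proof (rule poly_eq_on_bcone[OF A(5)])
      show "real_polynomial_function (\<lambda>y. pc g S y + representation S y a / \<alpha> * pc h S y)"
        by (intro real_polynomial_function.intros(3,4) pc_PP(1)[OF gP S(1) bS] pc_PP(1)[OF hP S(1) bS]
          real_polynomial_function_divide rep_poly bS)
      fix y assume "y \<in> bcone T"
      hence y: "y \<in> bcone S" "representation S y a / \<alpha> \<le> representation S y b / \<beta>" using A by auto
      have "\<kappa> y = representation S y a / \<alpha>" using y A(7)[of y] crt_eq[OF F S(1) y(1)] by simp
      thus "pc g S y + representation S y a / \<alpha> * pc h S y = 0"
        using z[of y] pc_PP(2)[OF gP S(1) bS y(1)] pc_PP(2)[OF hP S(1) bS y(1)] by simp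
    qed auto
    have ea: "pc g S y + representation S y a / \<alpha> * pc h S y = 0" for y
      using fun_cong[OF eq1[of a b \<alpha> \<beta> "insert c (S - {a})"]] True pos sub_basis(1)[OF S(1)] sub_bcone[OF S(1)] kappa_eq by auto
    have eb: "pc g S y + representation S y b / \<beta> * pc h S y = 0" for y
      using fun_cong[OF eq1[of b a \<beta> \<alpha> "insert c (S - {b})"]] True pos star_subdivision.sub_basis(1)[OF sym S(1)]
        star_subdivision.sub_bcone[OF sym S(1)] kappa_eq by (auto simp: min.commute)
    have "pc h S y = 0" for y
    proof (rule poly_mult_zero[OF pc_PP(1)[OF hP S(1) bS] _ subspace_UNIV])
      show "real_polynomial_function (\<lambda>y. representation S y a / \<alpha> - representation S y b / \<beta>)"
        by (intro real_polynomial_function_diff real_polynomial_function_divide rep_poly bS)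
      show "pc h S y * (representation S y a / \<alpha> - representation S y b / \<beta>) = 0" for y
        using ea[of y] eb[of y] by (simp add: algebra_simps)
      show "representation S a a / \<alpha> - representation S a b / \<beta> \<noteq> 0"
        using True rep_basis[OF bS] ab pos by simp
    qed auto
    hence "pc g S y = 0" using ea[of y] by simp
    thus ?thesis using pc_PP(2)[OF gP S(1) bS S(2)] by simp
  qed
qed

text \<open>The cofactors found on the subdivision are split into a part from the old fan and a
  multiple of \<kappa>. By uniqueness of the first part, the old parts alone already represent
  \<open>f\<close>.\<close>

lemma reducible_transfer:
  assumes B: "is_basis B" and R: "reducible_at SD B x"
  shows "reducible_at SS B x"
  unfolding reducible_at_def
proof (intro allI impI)
  fix k f assume f: "f \<in> PPh SS k" and fx: "\<forall>S\<in>SS. pc f S x = 0"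
  have "pc f T x = 0" if "T \<in> SD" for T
    using SD_refines[OF that] pc_SD[OF PPh_PP[OF f] that] fx by fastforce
  hence "f \<in> LI SD B (B - {x}) k" using R PPh_SD[OF f] by (auto simp: reducible_at_def)
  then obtain u where u: "\<And>v. v \<in> B - {x} \<Longrightarrow> u v \<in> PPm SD k" "f = (\<lambda>y. \<Sum>v\<in>B - {x}. representation B y v * u v y)"
    by (auto simp: LI_def)
  show "f \<in> LI SS B (B - {x}) k"
  proof (cases "k = 0")
    case True
    have "f = (\<lambda>y. 0)" unfolding u(2) using u(1) True by (auto simp: PPm_def intro!: sum.neutral)
    thus ?thesis by (simp add: LI_zero)
  next
    case False
    have "\<exists>g h. g \<in> PPh SS (k - 1) \<and> h \<in> PPm SS (k - 1) \<and> u v = (\<lambda>y. g y + \<kappa> y * h y)" if "v \<in> B - {x}" for v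
      using PPh_SD_G[of "u v" "k - 1"] u(1)[OF that] False by (auto simp: PPm_def G_def)
    then obtain g h where gh: "\<And>v. v \<in> B - {x} \<Longrightarrow> g v \<in> PPh SS (k - 1) \<and> h v \<in> PPm SS (k - 1) \<and> u v = (\<lambda>y. g v y + \<kappa> y * h v y)"
      by metis
    have gm: "g v \<in> PPm SS k" if "v \<in> B - {x}" for v using gh[OF that] False by (simp add: PPm_def)
    have r1: "(\<lambda>y. representation B y v) \<in> PPh SS 1" for v
      by (intro homogeneous_poly_PPh homogeneous_poly_rep B)
    define p where "p = (\<lambda>y. f y - (\<Sum>v\<in>B - {x}. representation B y v * g v y))"
    have p: "p \<in> PPh SS k" unfolding p_def
      by (intro PPh_diff f PPh_sum PPm_linear_mult[OF gm r1])
    \<comment> \<open>The representation of \<open>f\<close> becomes the relation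
      \<open>p + \<kappa> q = 0\<close>, to which uniqueness applies.\<close>
    define q where "q = (\<lambda>y. - 1 * (\<Sum>v\<in>B - {x}. h v y * representation B y v))"
    have "(\<lambda>y. h v y * representation B y v) \<in> PPm SS k" if "v \<in> B - {x}" for v
      using PPm_mult[of "h v" SS "k - 1", OF _ r1] gh[OF that] False by fastforce
    hence q: "q \<in> PPm SS k" unfolding q_def by (intro PPm_cmult PPm_sum)
    have "p y + \<kappa> y * q y = 0" for y
    proof -
      have "f y = (\<Sum>v\<in>B - {x}. representation B y v * (g v y + \<kappa> y * h v y))"
        by (subst u(2)) (intro sum.cong refl, use gh in auto)
      thus ?thesis unfolding p_def q_def
        by (simp add: sum.distrib sum_distrib_left sum_negf algebra_simps)
    qed
    from G_unique[OF p q this] have "p = (\<lambda>_. 0)" .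
    hence "f = (\<lambda>y. \<Sum>v\<in>B - {x}. representation B y v * g v y)" unfolding p_def by (auto simp: fun_eq_iff)
    thus ?thesis unfolding LI_def using gm by blast
  qed
qed

end

section \<open>Projective refinements\<close>

definition lin :: "'a::real_vector set \<Rightarrow> ('a \<Rightarrow> real) \<Rightarrow> 'a \<Rightarrow> real" where
  "lin S h y = (\<Sum>w\<in>S. representation S y w * h w)"

lemma lin_linear: "is_basis S \<Longrightarrow> linear (lin S h)"
  by (intro linearI) (auto simp: lin_def rep_add rep_scale algebra_simps sum.distrib sum_distrib_left)

lemma lin_vertex: assumes "is_basis S" "v \<in> S" shows "lin S h v = h v"
proof -
  have "lin S h v = (\<Sum>w\<in>S. if w = v then h v else 0)"
    unfolding lin_def using assms by (intro sum.cong refl) (auto simp: rep_basis)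
  thus ?thesis using assms by (simp add: is_basis_def)
qed

text \<open>A function \<open>h\<close> on the generators extends to a cone-wise linear function, equal to \<open>lin S h\<close> on \<open>S\<close>;
  the condition is strict convexity. In the relative version it is only required within each cone
  of the coarser fan \<open>QQ\<close>.\<close>

definition proj :: "'a::real_vector set set \<Rightarrow> ('a \<Rightarrow> real) \<Rightarrow> bool" where
  "proj SS h \<longleftrightarrow> (\<forall>S\<in>SS. \<forall>v\<in>\<Union>SS. v \<notin> S \<longrightarrow> lin S h v < h v)"

definition relproj :: "'a::real_vector set set \<Rightarrow> 'a set set \<Rightarrow> ('a \<Rightarrow> real) \<Rightarrow> bool" where
  "relproj QQ SS h \<longleftrightarrow> (\<forall>S\<in>SS. \<exists>Q\<in>QQ. bcone S \<subseteq> bcone Q \<and>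
      (\<forall>v\<in>\<Union>SS. v \<in> bcone Q \<longrightarrow> v \<notin> S \<longrightarrow> lin S h v < h v))"

text \<open>The cones are ordered by the values at \<open>x\<close> of their linear functions.
  Expanding \<open>x\<close> in \<open>S\<close>, a generator in \<open>T\<close> contributes
  equally to both functions, and a generator outside \<open>T\<close> has a positive coordinate and
  lies strictly above the function of \<open>T\<close>.\<close>

lemma reducible_of_proj:
  assumes F: "sfan SS" and g: "generic SS x" and B: "is_basis B" "x \<in> B \<or> B = {}" and p: "proj SS h"
  shows "reducible_at SS B x"
proof (rule reducible_of_order[OF F g B])
  fix S T assume ST: "S \<in> SS" "T \<in> SS" "neg x S \<subseteq> T" "S \<noteq> T"
  have b: "is_basis S" "is_basis T" using sfanD(2)[OF F] ST by auto
  have fS: "finite S" using b by (simp add: is_basis_def)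
  have "\<not> S \<subseteq> T"
  proof
    assume "S \<subseteq> T"
    moreover have "card S = card T" using is_basis_dim b by metis
    ultimately show False using card_subset_eq[of T S] b ST(4) by (auto simp: is_basis_def)
  qed
  then obtain u where u: "u \<in> S" "u \<notin> T" by auto
  have le: "representation S x v * lin T h v \<le> representation S x v * h v" if v: "v \<in> S" for v
  proof (cases "v \<in> T")
    case True thus ?thesis using lin_vertex[OF b(2)] by simp
  next
    case False
    hence "v \<notin> neg x S" using ST(3) by auto
    hence "representation S x v \<ge> 0" using v by (simp add: neg_def)
    moreover have "lin T h v < h v" using p ST v False by (auto simp: proj_def)
    ultimately show ?thesis by (simp add: mult_left_mono)
  qed
  \<comment> \<open>The negative generators of \<open>S\<close> lie in \<open>T\<close> and no
    coordinate of \<open>x\<close> is zero, so \<open>u\<close> has a positive coordinate.\<close>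
  have lt: "representation S x u * lin T h u < representation S x u * h u"
  proof -
    have "u \<notin> neg x S" using ST(3) u by auto
    moreover have "representation S x u \<noteq> 0" using g ST u by (auto simp: generic_def)
    ultimately have "representation S x u > 0" using u by (simp add: neg_def)
    moreover have "lin T h u < h u" using p ST u by (auto simp: proj_def)
    ultimately show ?thesis by simp
  qed
  have "lin T h x = (\<Sum>v\<in>S. representation S x v * lin T h v)"
    using linear_expand[OF b(1) lin_linear[OF b(2)], of h x] by simp
  also have "\<dots> < (\<Sum>v\<in>S. representation S x v * h v)"
    by (rule sum_strict_mono_ex1[OF fS]) (use le lt u in blast)+
  finally show "lin T h x < lin S h x" by (simp add: lin_def)
qed

lemma lower_eventually:
  fixes p q r :: real assumes "p < q"
  shows "\<forall>\<^sub>F \<delta> in at_right 0. p - \<delta> * r < q"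
proof -
  have "((\<lambda>\<delta>. p - \<delta> * r) \<longlongrightarrow> p - 0 * r) (at_right 0)" by (intro tendsto_intros)
  thus ?thesis using assms by (intro order_tendstoD(2)[where a = q and y = p]) auto
qed

context star_subdivision
begin

text \<open>Lowering the value on the new ray slightly makes the function bend along the subdivision.\<close>

definition hh :: "('a \<Rightarrow> real) \<Rightarrow> real \<Rightarrow> 'a \<Rightarrow> real" where
  "hh h \<delta> = h(c := \<alpha> * h a + \<beta> * h b - \<delta>)"

lemma hh_sym: "star_subdivision.hh b a \<beta> \<alpha> c = hh"
  unfolding star_subdivision.hh_def[OF sym] hh_def fun_eq_iff by (auto simp: add.commute)

lemma lin_sub:
  assumes S: "S \<in> SS" "a \<in> S" "b \<in> S"
  shows "lin (insert c (S - {a})) (hh h \<delta>) v = lin S h v - \<delta> * (representation S v a / \<alpha>)"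
proof -
  define R where "R = S - {a, b}"
  have bS: "is_basis S" using sfanD(2)[OF F] S by auto
  have fR: "finite R" using bS by (simp add: R_def is_basis_def)
  have cn: "c \<notin> S" using c_new S by auto
  have S_eq: "S = insert a (insert b R)" "insert c (S - {a}) = insert c (insert b R)" "a \<notin> insert b R" "b \<notin> R" "c \<notin> insert b R" "c \<noteq> b"
    using S ab cn c_ne by (auto simp: R_def)
  have "lin (insert c (S - {a})) (hh h \<delta>) v = (\<Sum>w\<in>insert c (insert b R).
      (if w = c then representation S v a / \<alpha>
       else if w = b then representation S v b - \<beta> * (representation S v a / \<alpha>)
       else if w = a then 0 else representation S v w) * hh h \<delta> w)"
    unfolding lin_def by (simp only: sub_basis(2)[OF S]) (simp only: S_eq(2))
  also have "\<dots> = (representation S v a / \<alpha>) * (\<alpha> * h a + \<beta> * h b - \<delta>)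
      + (representation S v b - \<beta> * (representation S v a / \<alpha>)) * h b
      + (\<Sum>w\<in>R. (if w = c then representation S v a / \<alpha>
       else if w = b then representation S v b - \<beta> * (representation S v a / \<alpha>)
       else if w = a then 0 else representation S v w) * hh h \<delta> w)"
    using fR S_eq(3-6) by (simp add: hh_def)
  also have "(\<Sum>w\<in>R. (if w = c then representation S v a / \<alpha>
       else if w = b then representation S v b - \<beta> * (representation S v a / \<alpha>)
       else if w = a then 0 else representation S v w) * hh h \<delta> w) = (\<Sum>w\<in>R. representation S v w * h w)"
    using S_eq(3-5) by (intro sum.cong refl) (auto simp: hh_def)
  finally have l: "lin (insert c (S - {a})) (hh h \<delta>) v = (representation S v a / \<alpha>) * (\<alpha> * h a + \<beta> * h b - \<delta>)
      + (representation S v b - \<beta> * (representation S v a / \<alpha>)) * h b + (\<Sum>w\<in>R. representation S v w * h w)" .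
  have "lin S h v = representation S v a * h a + (representation S v b * h b + (\<Sum>w\<in>R. representation S v w * h w))"
  proof -
    have "lin S h v = (\<Sum>w\<in>insert a (insert b R). representation S v w * h w)"
      unfolding lin_def by (intro sum.cong S_eq(1) refl)
    thus ?thesis using fR S_eq(3,4) by simp
  qed
  thus ?thesis unfolding l using pos by (simp add: field_simps)
qed

text \<open>At the removed generator \<open>a\<close> the inequality comes from the lowered value at
  \<open>c\<close>; at all other vertices it was strict before and survives small changes.\<close>

lemma relproj_sub_star:
  assumes S: "S \<in> SS" "a \<in> S" "b \<in> S" and Q: "Q \<in> QQ" "bcone S \<subseteq> bcone Q"
    and st: "\<And>v. v \<in> \<Union>SS \<Longrightarrow> v \<in> bcone Q \<Longrightarrow> v \<notin> S \<Longrightarrow> lin S h v < h v"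
    and v: "v \<in> insert c (\<Union>SS)" "v \<in> bcone Q" "v \<notin> insert c (S - {a})"
  shows "\<forall>\<^sub>F \<delta> in at_right 0. lin (insert c (S - {a})) (hh h \<delta>) v < hh h \<delta> v"
proof -
  have bS: "is_basis S" using sfanD(2)[OF F] S by auto
  have vc: "v \<noteq> c" "v \<in> \<Union>SS" using v by auto
  have hv: "hh h \<delta> v = h v" for \<delta> using vc by (simp add: hh_def)
  show ?thesis
  proof (cases "v = a")
    case True
    have "lin S h v - \<delta> * (representation S v a / \<alpha>) < h v" if "\<delta> > 0" for \<delta>
      using that pos True lin_vertex[OF bS S(2)] rep_basis[OF bS S(2)] by simp
    thus ?thesis unfolding lin_sub[OF S] hv by (auto simp: eventually_at_filter)
  next
    case False
    hence "v \<notin> S" using v by auto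
    from lower_eventually[OF st[OF vc(2) v(2) this]] show ?thesis unfolding lin_sub[OF S] hv .
  qed
qed

lemma SD_vertices: "\<Union>SD \<subseteq> insert c (\<Union>SS)"
  by (auto simp: SD_def)

text \<open>Each new cone keeps the coarse cone of its parent. The inequalities are finite in number
  and hold for all small parameters, so one parameter serves them all.\<close>

lemma relproj_step:
  assumes FQ: "sfan QQ" and r: "relproj QQ SS h"
  shows "\<exists>h'. relproj QQ SD h'"
proof -
  have ex: "\<exists>Q. Q \<in> QQ \<and> bcone T \<subseteq> bcone Q \<and> (\<forall>v\<in>\<Union>SD. v \<in> bcone Q \<longrightarrow> v \<notin> T \<longrightarrow>
     (\<forall>\<^sub>F \<delta> in at_right 0. lin T (hh h \<delta>) v < hh h \<delta> v))" if T: "T \<in> SD" for T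
    using T
  proof (cases rule: SD_cases)
    case 1
    obtain Q where Q: "Q \<in> QQ" "bcone T \<subseteq> bcone Q"
      "\<And>v. v \<in> \<Union>SS \<Longrightarrow> v \<in> bcone Q \<Longrightarrow> v \<notin> T \<Longrightarrow> lin T h v < h v"
      using r 1(1) unfolding relproj_def by metis
    have bT: "is_basis T" using sfanD(2)[OF F 1(1)] .
    have cT: "c \<notin> T" using c_new 1 by auto
    have lT: "lin T (hh h \<delta>) v = lin T h v" for \<delta> v
      unfolding lin_def using cT by (intro sum.cong) (auto simp: hh_def)
    have "\<forall>\<^sub>F \<delta> in at_right 0. lin T (hh h \<delta>) v < hh h \<delta> v"
      if v: "v \<in> \<Union>SD" "v \<in> bcone Q" "v \<notin> T" for v
    proof (cases "v = c")
      case False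
      hence "v \<in> \<Union>SS" using v(1) SD_vertices by auto
      from Q(3)[OF this v(2,3)] have "lin T (hh h \<delta>) v < hh h \<delta> v" for \<delta>
        unfolding lT using False by (simp add: hh_def)
      thus ?thesis by simp
    next
      case True
      obtain Q1 where Q1: "Q1 \<in> QQ" "bcone S0 \<subseteq> bcone Q1" using r S0(1) unfolding relproj_def by metis
      have b0: "is_basis S0" "is_basis Q1" "is_basis Q" using sfanD(2)[OF F S0(1)] sfanD(2)[OF FQ] Q1 Q by auto
      have ab1: "a \<in> bcone S0" "b \<in> bcone S0" using rep_basis[OF b0(1) S0(2)] rep_basis[OF b0(1) S0(3)] by (auto simp: bcone_def)
      hence ab2: "a \<in> bcone Q1" "b \<in> bcone Q1" using Q1 by auto
      have c1: "c \<in> bcone Q1" using c_bcone[OF b0(1) S0(2,3)] Q1 by auto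
      \<comment> \<open>The point \<open>c\<close> is a positive combination of \<open>a\<close> and
        \<open>b\<close>. If it lies in the coarse cone of \<open>Q\<close>, nonnegativity of their
        coordinates puts \<open>a\<close> and \<open>b\<close> in that cone as well.\<close>
      have z: "representation Q1 a w = 0 \<and> representation Q1 b w = 0" if w: "w \<notin> Q" for w
      proof -
        have "representation Q1 c w = 0"
          using sfanD(4)[OF FQ Q1(1) Q(1) c1, of w] v(2) True rep_outside[OF w] by simp
        hence "\<alpha> * representation Q1 a w + \<beta> * representation Q1 b w = 0"
          by (simp add: c_def rep_add[OF b0(2)] rep_scale[OF b0(2)])
        moreover have "\<alpha> * representation Q1 a w \<ge> 0" "\<beta> * representation Q1 b w \<ge> 0"
          using pos bcone_rep_nonneg[OF ab2(1), of w] bcone_rep_nonneg[OF ab2(2), of w] by auto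
        ultimately have "\<alpha> * representation Q1 a w = 0 \<and> \<beta> * representation Q1 b w = 0" by linarith
        thus ?thesis using pos by simp
      qed
      have inQ: "u \<in> bcone Q" if u: "u \<in> bcone Q1" "\<And>w. w \<notin> Q \<Longrightarrow> representation Q1 u w = 0" for u
      proof -
        have fin: "finite Q1" "finite Q" using b0 by (auto simp: is_basis_def)
        have "u = (\<Sum>w\<in>Q1. representation Q1 u w *\<^sub>R w)" using rep_sum[OF b0(2)] by simp
        also have "\<dots> = (\<Sum>w\<in>Q1 \<inter> Q. representation Q1 u w *\<^sub>R w)"
          using u(2) fin by (intro sum.mono_neutral_right) auto
        also have "\<dots> \<in> bcone Q"
          using bcone_rep_nonneg[OF u(1)] by (intro bcone_lincomb b0) auto
        finally show ?thesis .
      qed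
      have abQ: "a \<in> bcone Q" "b \<in> bcone Q" using inQ ab2 z by auto
      have abS: "a \<in> \<Union>SS" "b \<in> \<Union>SS" using S0 by auto
      have la: "lin T h a < h a \<or> a \<in> T \<and> lin T h a = h a" using Q(3)[OF abS(1) abQ(1)] lin_vertex[OF bT] by blast
      have lb: "lin T h b < h b \<or> b \<in> T \<and> lin T h b = h b" using Q(3)[OF abS(2) abQ(2)] lin_vertex[OF bT] by blast
      have "lin T h c = \<alpha> * lin T h a + \<beta> * lin T h b"
        unfolding c_def by (simp add: linear_add[OF lin_linear[OF bT]] linear_scale[OF lin_linear[OF bT]])
      \<comment> \<open>Since \<open>a\<close> and \<open>b\<close> are not both in
        \<open>T\<close>, one of the two inequalities is strict.\<close>
      moreover have "\<alpha> * lin T h a + \<beta> * lin T h b < \<alpha> * h a + \<beta> * h b"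
        using la lb 1(2) pos by (auto intro: add_strict_mono add_less_le_mono add_le_less_mono)
      ultimately have "lin T h c < \<alpha> * h a + \<beta> * h b" by simp
      from lower_eventually[OF this, of "-1"]
      have "\<forall>\<^sub>F \<delta> in at_right 0. lin T h c + \<delta> < \<alpha> * h a + \<beta> * h b" by simp
      thus ?thesis unfolding lT True by (rule eventually_mono) (simp add: hh_def)
    qed
    thus ?thesis using Q by blast
  next
    case (2 S)
    obtain Q where Q: "Q \<in> QQ" "bcone S \<subseteq> bcone Q"
      "\<And>v. v \<in> \<Union>SS \<Longrightarrow> v \<in> bcone Q \<Longrightarrow> v \<notin> S \<Longrightarrow> lin S h v < h v"
      using r 2(1) unfolding relproj_def by metis
    have "bcone T \<subseteq> bcone S" using sub_bcone[OF 2(1-3)] 2(4) by auto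
    moreover have "\<forall>\<^sub>F \<delta> in at_right 0. lin T (hh h \<delta>) v < hh h \<delta> v"
      if v: "v \<in> \<Union>SD" "v \<in> bcone Q" "v \<notin> T" for v
      unfolding 2(4) using v SD_vertices 2(4) by (intro relproj_sub_star[OF 2(1-3) Q]) auto
    ultimately show ?thesis using Q(1,2) by blast
  next
    case (3 S)
    obtain Q where Q: "Q \<in> QQ" "bcone S \<subseteq> bcone Q"
      "\<And>v. v \<in> \<Union>SS \<Longrightarrow> v \<in> bcone Q \<Longrightarrow> v \<notin> S \<Longrightarrow> lin S h v < h v"
      using r 3(1) unfolding relproj_def by metis
    have "bcone T \<subseteq> bcone S" using star_subdivision.sub_bcone[OF sym 3(1,3,2)] 3(4) by auto
    moreover have "\<forall>\<^sub>F \<delta> in at_right 0. lin T (hh h \<delta>) v < hh h \<delta> v"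
      if v: "v \<in> \<Union>SD" "v \<in> bcone Q" "v \<notin> T" for v
      unfolding 3(4) using v SD_vertices 3(4)
      by (intro star_subdivision.relproj_sub_star[OF sym 3(1,3,2) Q, unfolded hh_sym]) auto
    ultimately show ?thesis using Q(1,2) by blast
  qed
  define q where "q = (\<lambda>T. SOME Q. Q \<in> QQ \<and> bcone T \<subseteq> bcone Q \<and> (\<forall>v\<in>\<Union>SD. v \<in> bcone Q \<longrightarrow> v \<notin> T \<longrightarrow>
     (\<forall>\<^sub>F \<delta> in at_right 0. lin T (hh h \<delta>) v < hh h \<delta> v)))"
  have q: "q T \<in> QQ \<and> bcone T \<subseteq> bcone (q T) \<and> (\<forall>v\<in>\<Union>SD. v \<in> bcone (q T) \<longrightarrow> v \<notin> T \<longrightarrow>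
     (\<forall>\<^sub>F \<delta> in at_right 0. lin T (hh h \<delta>) v < hh h \<delta> v))" if "T \<in> SD" for T
    unfolding q_def by (rule someI_ex[OF ex[OF that]])
  have "\<forall>\<^sub>F \<delta> in at_right 0. \<forall>T\<in>SD. \<forall>v\<in>\<Union>SD. v \<in> bcone (q T) \<longrightarrow> v \<notin> T \<longrightarrow> lin T (hh h \<delta>) v < hh h \<delta> v"
  proof (rule eventually_ball_finite[OF sfanD(1)[OF sfan_SD]], rule ballI,
      rule eventually_ball_finite[OF sfanD(6)[OF sfan_SD]], rule ballI)
    fix T v assume "T \<in> SD" "v \<in> \<Union>SD"
    thus "\<forall>\<^sub>F \<delta> in at_right 0. v \<in> bcone (q T) \<longrightarrow> v \<notin> T \<longrightarrow> lin T (hh h \<delta>) v < hh h \<delta> v"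
      using q[of T] by (cases "v \<in> bcone (q T) \<and> v \<notin> T") auto
  qed
  from eventually_happens'[OF _ this] obtain \<delta> where
    "\<forall>T\<in>SD. \<forall>v\<in>\<Union>SD. v \<in> bcone (q T) \<longrightarrow> v \<notin> T \<longrightarrow> lin T (hh h \<delta>) v < hh h \<delta> v"
    by (auto simp: trivial_limit_at_right_real)
  hence "relproj QQ SD (hh h \<delta>)" unfolding relproj_def using q by blast
  thus ?thesis by blast
qed

end

section \<open>Refinement until no cone crosses the given hyperplanes\<close>

definition onesided :: "('a::real_vector \<Rightarrow> real) \<Rightarrow> 'a set \<Rightarrow> bool" where
  "onesided l S \<longleftrightarrow> (\<forall>y\<in>bcone S. l y \<ge> 0) \<or> (\<forall>y\<in>bcone S. l y \<le> 0)"

text \<open>Edges with ends strictly on opposite sides, listed with the positive end first; their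
  number is the measure of progress.\<close>

definition crossing :: "'a::real_vector set set \<Rightarrow> ('a \<Rightarrow> real) \<Rightarrow> ('a \<times> 'a) set" where
  "crossing SS l = {(a, b). \<exists>S\<in>SS. a \<in> S \<and> b \<in> S \<and> l a > 0 \<and> l b < 0}"

lemma onesided_of_no_crossing:
  assumes S: "is_basis S" "S \<in> SS" and l: "linear l" and e: "crossing SS l = {}"
  shows "onesided l S"
proof -
  have ex: "l y = (\<Sum>v\<in>S. representation S y v * l v)" for y using linear_expand[OF S(1) l, of y] by simp
  have "(\<forall>v\<in>S. l v \<ge> 0) \<or> (\<forall>v\<in>S. l v \<le> 0)"
    using e S(2) unfolding crossing_def by (force simp: not_le)
  thus ?thesis
  proof
    assume "\<forall>v\<in>S. l v \<ge> 0"
    hence "l y \<ge> 0" if "y \<in> bcone S" for y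
      using that by (subst ex, intro sum_nonneg mult_nonneg_nonneg) (auto simp: bcone_def)
    thus ?thesis by (simp add: onesided_def)
  next
    assume "\<forall>v\<in>S. l v \<le> 0"
    hence "l y \<le> 0" if "y \<in> bcone S" for y
      using that by (subst ex, intro sum_nonpos mult_nonneg_nonpos) (auto simp: bcone_def)
    thus ?thesis by (simp add: onesided_def)
  qed
qed

text \<open>Subdividing a crossing edge at its point on the hyperplane removes this edge and creates
  no crossing one, because the new vertex lies on the hyperplane.\<close>

lemma refine_one:
  assumes FQ: "sfan QQ" and l: "linear l" and F: "sfan SS" and r: "relproj QQ SS h"
  shows "\<exists>SS' h'. sfan SS' \<and> relproj QQ SS' h' \<and> (\<forall>B x. is_basis B \<longrightarrow> reducible_at SS' B x \<longrightarrow> reducible_at SS B x) \<and>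
    (\<forall>S'\<in>SS'. \<exists>S\<in>SS. bcone S' \<subseteq> bcone S) \<and> (\<forall>S\<in>SS'. onesided l S)"
  using F r
proof (induction "card (crossing SS l)" arbitrary: SS h rule: less_induct)
  case less
  note F = less.prems(1)
  show ?case
  proof (cases "crossing SS l = {}")
    case True
    hence "\<forall>S\<in>SS. onesided l S" using onesided_of_no_crossing[OF sfanD(2)[OF F] _ l] by blast
    thus ?thesis using less.prems by blast
  next
    case False
    then obtain a b S0 where edge: "S0 \<in> SS" "a \<in> S0" "b \<in> S0" "l a > 0" "l b < 0" by (auto simp: crossing_def)
    \<comment> \<open>The coefficients are positive and make the form \<open>l\<close> vanish at
      \<open>c\<close>.\<close>
    define c where "c = (- l b) *\<^sub>R a + l a *\<^sub>R b"
    interpret star_subdivision SS a b "- l b" "l a" c S0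
      using F edge by unfold_locales (auto simp: c_def)
    have lc: "l c = 0" by (simp add: c_def linear_add[OF l] linear_scale[OF l] linear_diff[OF l])
    have fin: "finite (crossing SS l)"
      by (rule finite_subset[of _ "\<Union>SS \<times> \<Union>SS"]) (use sfanD(6)[OF F] in \<open>auto simp: crossing_def\<close>)
    have "crossing SD l \<subset> crossing SS l"
    proof
      show "crossing SD l \<subseteq> crossing SS l"
      proof
        fix e assume "e \<in> crossing SD l"
        then obtain u v T where e: "e = (u, v)" "T \<in> SD" "u \<in> T" "v \<in> T" "l u > 0" "l v < 0" by (auto simp: crossing_def)
        have "u \<noteq> c" "v \<noteq> c" using lc e by auto
        from e(2) have "\<exists>S\<in>SS. u \<in> S \<and> v \<in> S"
          by (cases rule: SD_cases) (use e \<open>u \<noteq> c\<close> \<open>v \<noteq> c\<close> in auto)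
        thus "e \<in> crossing SS l" using e by (auto simp: crossing_def)
      qed
      have "\<not> (a \<in> T \<and> b \<in> T)" if "T \<in> SD" for T
        using that by (cases rule: SD_cases) (use c_ne in auto)
      hence "\<forall>T\<in>SD. a \<in> T \<longrightarrow> b \<notin> T" by blast
      hence "(a, b) \<notin> crossing SD l" by (simp add: crossing_def) blast
      moreover have "\<exists>S\<in>SS. a \<in> S \<and> b \<in> S" using edge(1-3) by (intro bexI[of _ S0] conjI)
      hence "(a, b) \<in> crossing SS l" using edge(4,5) by (simp add: crossing_def)
      ultimately show "crossing SD l \<noteq> crossing SS l" by metis
    qed
    hence lt: "card (crossing SD l) < card (crossing SS l)" using fin by (rule psubset_card_mono[rotated])
    obtain h1 where h1: "relproj QQ SD h1" using relproj_step[OF FQ less.prems(2)] by blast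
    from less.hyps[OF lt sfan_SD h1] obtain SS' h' where
      SS': "sfan SS' \<and> relproj QQ SS' h' \<and> (\<forall>B x. is_basis B \<longrightarrow> reducible_at SS' B x \<longrightarrow> reducible_at SD B x) \<and>
        (\<forall>S'\<in>SS'. \<exists>S\<in>SD. bcone S' \<subseteq> bcone S) \<and> (\<forall>S\<in>SS'. onesided l S)"
      by (elim exE) (rule that)
    have "reducible_at SS B x" if "is_basis B" "reducible_at SS' B x" for B x
      using SS' that reducible_transfer[OF that(1)] by simp
    moreover have "\<exists>S\<in>SS. bcone S' \<subseteq> bcone S" if S': "S' \<in> SS'" for S'
    proof -
      obtain T where T: "T \<in> SD" "bcone S' \<subseteq> bcone T" using SS' S' by blast
      obtain S where "S \<in> SS" "bcone T \<subseteq> bcone S" using SD_refines[OF T(1)] by blast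
      thus ?thesis using T(2) by blast
    qed
    ultimately show ?thesis using SS' by (intro exI[of _ SS'] exI[of _ h'] conjI) simp_all
  qed
qed

text \<open>A cone of the fan contains no generators besides its own, so the strict inequalities are
  vacuous for any function.\<close>

lemma relproj_self:
  assumes F: "sfan QQ" shows "relproj QQ QQ (\<lambda>_. 0)"
  unfolding relproj_def
proof (intro ballI)
  fix S assume S: "S \<in> QQ"
  have "v \<in> S" if v: "v \<in> \<Union>QQ" "v \<in> bcone S" for v
  proof -
    obtain T where T: "T \<in> QQ" "v \<in> T" using v by auto
    have bT: "is_basis T" using sfanD(2)[OF F T(1)] .
    have "v \<in> bcone T" using rep_basis[OF bT T(2)] by (auto simp: bcone_def)
    from sfanD(4)[OF F S T(1) v(2) this, of v] have "representation S v v = 1"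
      using rep_basis[OF bT T(2)] by simp
    thus ?thesis using rep_outside[of v S v] by force
  qed
  thus "\<exists>Q\<in>QQ. bcone S \<subseteq> bcone Q \<and> (\<forall>v\<in>\<Union>QQ. v \<in> bcone Q \<longrightarrow> v \<notin> S \<longrightarrow> lin S (\<lambda>_. 0) v < 0)"
    using S by blast
qed

lemma refine:
  assumes FQ: "sfan QQ" and L: "finite L" "\<And>l. l \<in> L \<Longrightarrow> linear l"
  shows "\<exists>SS h. sfan SS \<and> relproj QQ SS h \<and> (\<forall>B x. is_basis B \<longrightarrow> reducible_at SS B x \<longrightarrow> reducible_at QQ B x) \<and>
    (\<forall>l\<in>L. \<forall>S\<in>SS. onesided l S)"
  using L
proof (induction L rule: finite_induct)
  case empty
  show ?case using FQ relproj_self[OF FQ] by blast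
next
  case (insert l L)
  have "\<exists>SS h. sfan SS \<and> relproj QQ SS h \<and> (\<forall>B x. is_basis B \<longrightarrow> reducible_at SS B x \<longrightarrow> reducible_at QQ B x) \<and>
    (\<forall>l\<in>L. \<forall>S\<in>SS. onesided l S)" using insert.IH insert.prems by simp
  then obtain SS h where SS0: "sfan SS \<and> relproj QQ SS h \<and> (\<forall>B x. is_basis B \<longrightarrow> reducible_at SS B x \<longrightarrow> reducible_at QQ B x) \<and>
    (\<forall>l\<in>L. \<forall>S\<in>SS. onesided l S)" by (elim exE) (rule that)
  hence SS: "sfan SS" "relproj QQ SS h" "\<And>B x. is_basis B \<Longrightarrow> reducible_at SS B x \<Longrightarrow> reducible_at QQ B x"
    "\<And>l S. l \<in> L \<Longrightarrow> S \<in> SS \<Longrightarrow> onesided l S" by simp_all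
  have "linear l" using insert.prems by simp
  from refine_one[OF FQ this SS(1,2)] obtain SS' h' where
    SS0': "sfan SS' \<and> relproj QQ SS' h' \<and> (\<forall>B x. is_basis B \<longrightarrow> reducible_at SS' B x \<longrightarrow> reducible_at SS B x) \<and>
        (\<forall>S'\<in>SS'. \<exists>S\<in>SS. bcone S' \<subseteq> bcone S) \<and> (\<forall>S\<in>SS'. onesided l S)" by (elim exE) (rule that)
  hence SS': "sfan SS'" "relproj QQ SS' h'" "\<And>B x. is_basis B \<Longrightarrow> reducible_at SS' B x \<Longrightarrow> reducible_at SS B x"
    "\<And>S'. S'\<in>SS' \<Longrightarrow> \<exists>S\<in>SS. bcone S' \<subseteq> bcone S" "\<And>S. S\<in>SS' \<Longrightarrow> onesided l S" by simp_all
  have os: "onesided m S" if "m \<in> insert l L" "S \<in> SS'" for m S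
  proof (cases "m = l")
    case True thus ?thesis using SS'(5) that by simp
  next
    case False
    have mL: "m \<in> L" using that(1) False by simp
    from SS'(4)[OF that(2)] obtain T where T: "T \<in> SS" "bcone S \<subseteq> bcone T" by blast
    thus ?thesis using SS(4)[OF mL T(1)] unfolding onesided_def by blast
  qed
  show ?case
    using SS' SS(3) os by (intro exI[of _ SS'] exI[of _ h'] conjI) simp_all
qed

text \<open>The walls of \<open>QQ\<close> span unions of cones of \<open>SS\<close>, so the sum of the absolute values of the coordinates of
  \<open>QQ\<close> is linear on the cones of \<open>SS\<close> and bends at every wall of \<open>QQ\<close>. A large multiple of it,
  added to a relatively convex function, gives a convex one.\<close>

lemma proj_of_relproj:
  fixes QQ :: "'a::real_normed_vector set set"
  assumes FQ: "sfan QQ" and F: "sfan SS" and r: "relproj QQ SS h"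
    and o1: "\<And>Q u S. Q \<in> QQ \<Longrightarrow> u \<in> Q \<Longrightarrow> S \<in> SS \<Longrightarrow> onesided (\<lambda>y. representation Q y u) S"
  shows "\<exists>H. proj SS H"
proof -
  define I where "I = Sigma QQ (\<lambda>Q. Q)"
  have finI: "finite I" unfolding I_def using sfanD(1,5)[OF FQ] by auto
  define l where "l = (\<lambda>(Q :: 'a set, u) y. representation Q y u)"
  define \<psi> where "\<psi> = (\<lambda>y. \<Sum>i\<in>I. \<bar>l i y\<bar>)"
  have ll: "linear (l i)" if "i \<in> I" for i
    using that rep_linear sfanD(2)[OF FQ] by (auto simp: I_def l_def)
  have lo: "onesided (l i) S" if "i \<in> I" "S \<in> SS" for i S using that o1 by (auto simp: I_def l_def)
  have vert: "w \<in> bcone S" if "w \<in> S" "S \<in> SS" for w S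
    using rep_basis[OF sfanD(2)[OF F that(2)] that(1)] by (auto simp: bcone_def)
  have ll': "lin S (l i) v = l i v" if "i \<in> I" "S \<in> SS" for i S v
    using linear_expand[OF sfanD(2)[OF F that(2)] ll[OF that(1)], of v] by (simp add: lin_def)
  have lpos: "lin S (\<lambda>y. \<bar>l i y\<bar>) v = l i v" if "i \<in> I" "S \<in> SS" "\<forall>y\<in>bcone S. l i y \<ge> 0" for i S v
  proof -
    have "lin S (\<lambda>y. \<bar>l i y\<bar>) v = lin S (l i) v"
      unfolding lin_def using that vert by (intro sum.cong refl) simp
    thus ?thesis using ll' that by simp
  qed
  have lneg: "lin S (\<lambda>y. \<bar>l i y\<bar>) v = - l i v" if "i \<in> I" "S \<in> SS" "\<forall>y\<in>bcone S. l i y \<le> 0" for i S v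
  proof -
    have "lin S (\<lambda>y. \<bar>l i y\<bar>) v = lin S (\<lambda>y. - l i y) v"
      unfolding lin_def using that vert by (intro sum.cong refl) simp
    also have "\<dots> = - lin S (l i) v" by (simp add: lin_def sum_negf)
    finally show ?thesis using ll' that by simp
  qed
  have lle: "lin S (\<lambda>y. \<bar>l i y\<bar>) v \<le> \<bar>l i v\<bar>" if "i \<in> I" "S \<in> SS" for i S v
    using lo[OF that] lpos[OF that, of v] lneg[OF that, of v] unfolding onesided_def by (auto intro: abs_ge_minus_self)
  have lsum: "lin S \<psi> v = (\<Sum>i\<in>I. lin S (\<lambda>y. \<bar>l i y\<bar>) v)" for S v
    unfolding lin_def \<psi>_def sum_distrib_left by (rule sum.swap)
  have ple: "lin S \<psi> v \<le> \<psi> v" if "S \<in> SS" for S v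
    unfolding lsum unfolding \<psi>_def by (intro sum_mono lle that)
  define q where "q = (\<lambda>S. SOME Q. Q \<in> QQ \<and> bcone S \<subseteq> bcone Q \<and>
      (\<forall>v\<in>\<Union>SS. v \<in> bcone Q \<longrightarrow> v \<notin> S \<longrightarrow> lin S h v < h v))"
  have q: "q S \<in> QQ \<and> bcone S \<subseteq> bcone (q S) \<and>
      (\<forall>v\<in>\<Union>SS. v \<in> bcone (q S) \<longrightarrow> v \<notin> S \<longrightarrow> lin S h v < h v)" if S: "S \<in> SS" for S
  proof -
    have "\<exists>Q. Q \<in> QQ \<and> bcone S \<subseteq> bcone Q \<and> (\<forall>v\<in>\<Union>SS. v \<in> bcone Q \<longrightarrow> v \<notin> S \<longrightarrow> lin S h v < h v)"
      using r S unfolding relproj_def by blast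
    from someI_ex[OF this] show ?thesis unfolding q_def .
  qed
  \<comment> \<open>Outside the coarse cone some coordinate of that cone is negative at
    \<open>v\<close> but nonnegative on \<open>S\<close>, so the absolute value of this coordinate
    bends between them.\<close>
  have plt: "lin S \<psi> v < \<psi> v" if S: "S \<in> SS" and v: "v \<notin> bcone (q S)" for S v
  proof -
    obtain u where u: "u \<in> q S" "representation (q S) v u < 0" using v by (auto simp: bcone_def not_le)
    have i: "(q S, u) \<in> I" using u q[OF S] by (simp add: I_def)
    have "\<forall>y\<in>bcone S. l (q S, u) y \<ge> 0" using q[OF S] bcone_rep_nonneg by (auto simp: l_def)
    from lpos[OF i S this, of v] have "lin S (\<lambda>y. \<bar>l (q S, u) y\<bar>) v < \<bar>l (q S, u) v\<bar>" using u by (simp add: l_def)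
    thus ?thesis unfolding lsum unfolding \<psi>_def using lle[OF _ S] i
      by (intro sum_strict_mono_ex1 finI) auto
  qed
  define H where "H = (\<lambda>K v. h v + K * \<psi> v)"
  have linH: "lin S (H K) v = lin S h v + K * lin S \<psi> v" for S K v
    by (simp add: lin_def H_def algebra_simps sum.distrib sum_distrib_left)
  have "\<forall>\<^sub>F K in at_top. \<forall>S\<in>SS. \<forall>v\<in>\<Union>SS. v \<notin> S \<longrightarrow> lin S (H K) v < H K v"
  proof (rule eventually_ball_finite[OF sfanD(1)[OF F]], rule ballI,
      rule eventually_ball_finite[OF sfanD(6)[OF F]], rule ballI)
    fix S v assume Sv: "S \<in> SS" "v \<in> \<Union>SS"
    show "\<forall>\<^sub>F K in at_top. v \<notin> S \<longrightarrow> lin S (H K) v < H K v"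
    proof (cases "v \<in> bcone (q S)")
      case True
      have "v \<notin> S \<longrightarrow> lin S (H K) v < H K v" if "K \<ge> 0" for K
      proof
        assume "v \<notin> S"
        hence "lin S h v < h v" using q[OF Sv(1)] Sv(2) True by blast
        moreover have "K * lin S \<psi> v \<le> K * \<psi> v" using ple[OF Sv(1)] that by (rule mult_left_mono)
        ultimately show "lin S (H K) v < H K v" unfolding linH unfolding H_def by linarith
      qed
      thus ?thesis by (intro eventually_mono[OF eventually_ge_at_top[of 0]]) auto
    next
      case False
      \<comment> \<open>The amount of bending; a large multiple of it outweighs any failure of
        \<open>h\<close> outside the coarse cone.\<close>
      define d where "d = \<psi> v - lin S \<psi> v"
      have d: "d > 0" using plt[OF Sv(1) False] by (simp add: d_def)
      have "lin S (H K) v < H K v" if K: "K > (lin S h v - h v) / d" for K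
      proof -
        have "lin S h v - h v < K * d" using K d by (simp add: field_simps)
        thus ?thesis unfolding linH unfolding H_def d_def by (simp add: algebra_simps)
      qed
      thus ?thesis by (intro eventually_mono[OF eventually_gt_at_top]) auto
    qed
  qed
  from eventually_happens'[OF _ this] obtain K where "\<forall>S\<in>SS. \<forall>v\<in>\<Union>SS. v \<notin> S \<longrightarrow> lin S (H K) v < H K v" by auto
  thus ?thesis unfolding proj_def by blast
qed

lemma basis_containing:
  assumes S: "is_basis S" and x: "\<And>v. v \<in> S \<Longrightarrow> representation S x v \<noteq> 0"
  shows "\<exists>B. is_basis B \<and> (x \<in> B \<or> B = {})"
proof (cases "S = {}")
  case True thus ?thesis using S by blast
next
  case False
  then obtain v where "v \<in> S" by auto
  from exchange_basis(1)[OF S this x[OF this]] show ?thesis by blast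
qed

lemma generic_minus: "sfan SS \<Longrightarrow> generic SS x \<Longrightarrow> generic SS (- x)"
  using sfanD(2) by (fastforce simp: generic_def rep_minus)

text \<open>One refinement, by all hyperplanes of walls, and one convex function on it serve both
  points, because genericity is invariant under the sign. Only the auxiliary bases differ.\<close>

theorem reducible_exists:
  fixes QQ :: "'a::real_normed_vector set set"
  assumes F: "sfan QQ"
  shows "\<exists>x B B'. generic QQ x \<and> is_basis B \<and> (x \<in> B \<or> B = {}) \<and> reducible_at QQ B x \<and>
    is_basis B' \<and> (- x \<in> B' \<or> B' = {}) \<and> reducible_at QQ B' (- x)"
proof -
  define L where "L = (\<lambda>(Q :: 'a set, u) y. representation Q y u) ` Sigma QQ (\<lambda>Q. Q)"
  have finL: "finite L" unfolding L_def using sfanD(1,5)[OF F] by auto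
  have linL: "linear l" if "l \<in> L" for l using that rep_linear sfanD(2)[OF F] by (auto simp: L_def)
  have "\<exists>SS h. sfan SS \<and> relproj QQ SS h \<and> (\<forall>B x. is_basis B \<longrightarrow> reducible_at SS B x \<longrightarrow> reducible_at QQ B x) \<and>
    (\<forall>l\<in>L. \<forall>S\<in>SS. onesided l S)" by (rule refine[OF F finL linL])
  then obtain SS h where SS0: "sfan SS \<and> relproj QQ SS h \<and> (\<forall>B x. is_basis B \<longrightarrow> reducible_at SS B x \<longrightarrow> reducible_at QQ B x) \<and>
    (\<forall>l\<in>L. \<forall>S\<in>SS. onesided l S)" by (elim exE) (rule that)
  hence SS: "sfan SS" "relproj QQ SS h" "\<And>B x. is_basis B \<Longrightarrow> reducible_at SS B x \<Longrightarrow> reducible_at QQ B x"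
    "\<And>l S. l \<in> L \<Longrightarrow> S \<in> SS \<Longrightarrow> onesided l S" by simp_all
  have "onesided (\<lambda>y. representation Q y u) S" if "Q \<in> QQ" "u \<in> Q" "S \<in> SS" for Q u S
    by (rule SS(4)) (use that in \<open>auto simp: L_def\<close>)
  from proj_of_relproj[OF F SS(1,2) this] obtain H where H: "proj SS H" by blast
  \<comment> \<open>Genericity for the refinement is what the ordering argument uses; genericity for
    the original fan is what the later evaluation at \<open>x\<close> uses.\<close>
  define M where "M = L \<union> (\<lambda>(Q :: 'a set, u) y. representation Q y u) ` Sigma SS (\<lambda>Q. Q)"
  have finM: "finite M" unfolding M_def using finL sfanD(1,5)[OF SS(1)] by auto
  have linM: "linear l" if "l \<in> M" for l using that linL rep_linear sfanD(2)[OF SS(1)] by (auto simp: M_def)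
  have nzM: "\<exists>z\<in>UNIV. l z \<noteq> 0" if l: "l \<in> M" for l
  proof -
    obtain Q u where Q: "Q \<in> QQ \<union> SS" "u \<in> Q" "l = (\<lambda>y. representation Q y u)"
      using l by (auto simp: M_def L_def)
    have "is_basis Q" using Q sfanD(2)[OF F] sfanD(2)[OF SS(1)] by blast
    from rep_basis[OF this Q(2), of u] have "l u \<noteq> 0" by (simp add: Q(3))
    thus ?thesis by blast
  qed
  obtain x where x: "\<And>l. l \<in> M \<Longrightarrow> l x \<noteq> 0"
    using generic_exists[of M UNIV, OF finM linM nzM subspace_UNIV] by auto
  have gQ: "generic QQ x" using x unfolding generic_def M_def L_def by fastforce
  have gS: "generic SS x" using x unfolding generic_def M_def by fastforce
  obtain S where S: "S \<in> SS" using sfanD(3)[OF SS(1)] by blast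
  have bS: "is_basis S" using sfanD(2)[OF SS(1) S] .
  obtain B where B: "is_basis B" "x \<in> B \<or> B = {}"
    using basis_containing[OF bS, of x] gS S by (auto simp: generic_def)
  obtain B' where B': "is_basis B'" "- x \<in> B' \<or> B' = {}"
    using basis_containing[OF bS, of "-x"] generic_minus[OF SS(1) gS] S by (auto simp: generic_def)
  have "reducible_at QQ B x" "reducible_at QQ B' (- x)"
    using SS(3)[OF B(1) reducible_of_proj[OF SS(1) gS B H]]
      SS(3)[OF B'(1) reducible_of_proj[OF SS(1) generic_minus[OF SS(1) gS] B' H]] by auto
  thus ?thesis using gQ B B' by blast
qed

section \<open>Freeness over the polynomial ring\<close>

definition ev :: "'a::real_normed_vector set set \<Rightarrow> 'a \<Rightarrow> ('a \<Rightarrow> real) \<Rightarrow> 'a set \<Rightarrow> real" where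
  "ev SS x f = (\<lambda>S. if S \<in> SS then pc f S x else 0)"

lemma ev_add: "sfan SS \<Longrightarrow> f \<in> PP SS \<Longrightarrow> g \<in> PP SS \<Longrightarrow> ev SS x (\<lambda>y. f y + g y) = ev SS x f + ev SS x g"
  by (auto simp: ev_def fun_eq_iff pc_add sfanD(2))

lemma ev_diff: "sfan SS \<Longrightarrow> f \<in> PP SS \<Longrightarrow> g \<in> PP SS \<Longrightarrow> ev SS x (\<lambda>y. f y - g y) = ev SS x f - ev SS x g"
  by (auto simp: ev_def fun_eq_iff pc_diff sfanD(2))

lemma ev_poly_mult:
  "sfan SS \<Longrightarrow> real_polynomial_function p \<Longrightarrow> f \<in> PP SS \<Longrightarrow> ev SS x (\<lambda>y. p y * f y) = fscale (p x) (ev SS x f)"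
  by (auto simp: ev_def fun_eq_iff fscale_def pc_mult pc_poly poly_PP sfanD(2))

lemma ev_cmult: "sfan SS \<Longrightarrow> f \<in> PP SS \<Longrightarrow> ev SS x (\<lambda>y. c * f y) = fscale c (ev SS x f)"
  by (rule ev_poly_mult[OF _ real_polynomial_function.intros(2)])

lemma ev_zero: "sfan SS \<Longrightarrow> ev SS x (\<lambda>y. 0) = 0"
  by (auto simp: ev_def fun_eq_iff pc_poly[OF real_polynomial_function.intros(2)] sfanD(2))

lemma ev_sum:
  assumes "sfan SS" "\<And>i. i \<in> I \<Longrightarrow> f i \<in> PPh SS k"
  shows "ev SS x (\<lambda>y. \<Sum>i\<in>I. f i y) = (\<Sum>i\<in>I. ev SS x (f i))"
  using assms(2)
proof (induction I rule: infinite_finite_induct)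
  case (insert i I)
  have "ev SS x (\<lambda>y. f i y + (\<Sum>i\<in>I. f i y)) = ev SS x (f i) + ev SS x (\<lambda>y. \<Sum>i\<in>I. f i y)"
    using insert.prems by (intro ev_add assms(1) PPh_PP[of _ _ k] PPh_sum) auto
  thus ?case using insert by simp
qed (auto simp: ev_zero[OF assms(1)])

text \<open>The values at \<open>x\<close> of sections of degree less than \<open>k\<close>. Evaluation turns the
  multiplication by a polynomial \<open>p\<close> into scaling by \<open>p x\<close>, so the graded pieces of this filtration
  correspond to the components of the cohomology.\<close>

definition Elt :: "'a::real_normed_vector set set \<Rightarrow> 'a \<Rightarrow> nat \<Rightarrow> ('a set \<Rightarrow> real) set" where
  "Elt SS x k = fv.span (\<Union>j<k. ev SS x ` PPh SS j)"

lemma Elt_mono: "k \<le> l \<Longrightarrow> Elt SS x k \<subseteq> Elt SS x l"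
  unfolding Elt_def by (intro fv.span_mono) force

lemma ev_Elt: "f \<in> PPh SS j \<Longrightarrow> j < k \<Longrightarrow> ev SS x f \<in> Elt SS x k"
  unfolding Elt_def by (intro fv.span_base) auto

lemma Elt_expand:
  assumes F: "sfan SS" and u: "u \<in> Elt SS x k"
  shows "\<exists>g. (\<forall>j<k. g j \<in> PPh SS j) \<and> u = (\<Sum>j<k. ev SS x (g j))"
  using u unfolding Elt_def
proof (induction rule: fv.span_induct_alt)
  case base
  show ?case by (intro exI[of _ "\<lambda>j y. 0"]) (auto simp: PPh_zero ev_zero[OF F])
next
  case (step c v y)
  obtain i f where i: "i < k" "f \<in> PPh SS i" "v = ev SS x f" using step(1) by auto
  obtain g where g: "\<forall>j<k. g j \<in> PPh SS j" "y = (\<Sum>j<k. ev SS x (g j))" using step(2) by auto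
  define g' where "g' = g(i := \<lambda>y. c * f y + g i y)"
  have gi: "g i \<in> PPh SS i" using g i by auto
  have "ev SS x (g' i) = fscale c v + ev SS x (g i)"
    unfolding g'_def i(3) using ev_add[OF F PPh_PP[OF PPh_cmult[OF i(2)]] PPh_PP[OF gi]] ev_cmult[OF F PPh_PP[OF i(2)]] by simp
  moreover have "(\<Sum>j\<in>{..<k} - {i}. ev SS x (g' j)) = (\<Sum>j\<in>{..<k} - {i}. ev SS x (g j))"
    by (intro sum.cong) (auto simp: g'_def)
  ultimately have "(\<Sum>j<k. ev SS x (g' j)) = fscale c v + y"
    unfolding g(2) using i(1) by (subst (1 2) sum.remove[of _ i]) (auto simp: add.assoc)
  moreover have "\<forall>j<k. g' j \<in> PPh SS j"
    using g(1) gi i(2) by (auto simp: g'_def intro: PPh_add PPh_cmult)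
  ultimately show ?case by metis
qed

lemma exponent_incr:
  assumes "finite B" "v \<in> B" "a \<in> expo B k"
  shows "a(v := Suc (a v)) \<in> expo B (Suc k)" "mon B (a(v := Suc (a v))) y = representation B y v * mon B a y"
proof -
  have "sum (a(v := Suc (a v))) B = Suc (a v) + sum a (B - {v})"
    using assms by (simp add: sum.remove[of B v])
  moreover have "k = a v + sum a (B - {v})" using assms by (simp add: expo_def sum.remove)
  ultimately show "a(v := Suc (a v)) \<in> expo B (Suc k)"
    using assms by (auto simp: expo_def supported_def)
  show "mon B (a(v := Suc (a v))) y = representation B y v * mon B a y"
    using mon_dec[OF assms(1,2), of "a(v := Suc (a v))" y] by simp
qed

text \<open>Restricting to a line through the point and cancelling the common power of the parameter
  shows that sections whose values at one point are linearly independent satisfy no polynomial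
  relation.\<close>

lemma polynomial_relation_zero:
  fixes p :: "'u \<Rightarrow> 'a::real_normed_vector \<Rightarrow> real"
  assumes U: "finite U" and p: "\<And>u. u \<in> U \<Longrightarrow> real_polynomial_function (p u)"
    and q: "\<And>u S. u \<in> U \<Longrightarrow> S \<in> SS \<Longrightarrow> real_polynomial_function (q u S)"
    and z: "\<And>S y. S \<in> SS \<Longrightarrow> (\<Sum>u\<in>U. p u y * q u S y) = 0"
    and ind: "\<And>c u. (\<And>S. S \<in> SS \<Longrightarrow> (\<Sum>u\<in>U. c u * q u S x) = 0) \<Longrightarrow> u \<in> U \<Longrightarrow> c u = (0::real)"
    and u: "u \<in> U"
  shows "p u y = 0"
proof -
  define w where "w = y - x"
  have pl: "polynomial_function (\<lambda>s::real. x + s *\<^sub>R w)"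
    by (intro polynomial_function_add polynomial_function_const polynomial_function_bounded_linear bounded_linear_scaleR_left)
  have "\<exists>c n. \<forall>s. p u (x + s *\<^sub>R w) = (\<Sum>i\<le>n. c i * s ^ i)" if "u \<in> U" for u
  proof -
    have "real_polynomial_function (p u \<circ> (\<lambda>s. x + s *\<^sub>R w))" by (intro real_polynomial_function_compose pl p that)
    then obtain c n where "p u \<circ> (\<lambda>s. x + s *\<^sub>R w) = (\<lambda>s. \<Sum>i\<le>n. c i * s ^ i)"
      unfolding real_polynomial_function_iff_sum by blast
    thus ?thesis by (metis comp_apply)
  qed
  then obtain c n where cn: "\<And>u s. u \<in> U \<Longrightarrow> p u (x + s *\<^sub>R w) = (\<Sum>i\<le>n u. c u i * s ^ i)" by metis
  define N where "N = (\<Sum>u\<in>U. n u)"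
  define c' where "c' = (\<lambda>u i. if i \<le> n u then c u i else 0)"
  have c': "p u (x + s *\<^sub>R w) = (\<Sum>i\<le>N. c' u i * s ^ i)" if u: "u \<in> U" for u s
  proof -
    have "n u \<le> N" unfolding N_def using U u by (intro member_le_sum) auto
    hence "(\<Sum>i\<le>N. c' u i * s ^ i) = (\<Sum>i\<le>n u. c u i * s ^ i)"
      by (intro sum.mono_neutral_cong_right) (auto simp: c'_def)
    thus ?thesis using cn[OF u] by simp
  qed
  \<comment> \<open>The first power of the parameter that could have a nonzero coefficient is
    divided out; letting the parameter tend to 0 leaves a linear relation between the values at
    \<open>x\<close>.\<close>
  have "\<forall>u\<in>U. c' u i = 0" if "i \<le> N" for i
    using that
  proof (induction i rule: less_induct)
    case (less i)
    define Q where "Q = (\<lambda>u s. \<Sum>j\<le>N - i. c' u (j + i) * s ^ j)"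
    have pQ: "p u (x + s *\<^sub>R w) = s ^ i * Q u s" if u: "u \<in> U" for u s
    proof -
      have "(\<Sum>j\<le>N. c' u j * s ^ j) = (\<Sum>j\<in>{i..N}. c' u j * s ^ j)"
        using less u by (intro sum.mono_neutral_right) (auto simp: not_le)
      also have "\<dots> = (\<Sum>j\<le>N - i. c' u (j + i) * s ^ (j + i))"
        using less.prems by (intro sum.reindex_bij_witness[of _ "\<lambda>j. j + i" "\<lambda>j. j - i"]) auto
      finally show ?thesis unfolding c'[OF u] Q_def by (simp add: sum_distrib_left power_add mult_ac)
    qed
    have lim: "(\<Sum>u\<in>U. Q u 0 * q u S x) = 0" if S: "S \<in> SS" for S
    proof -
      define h where "h = (\<lambda>s. \<Sum>u\<in>U. Q u s * q u S (x + s *\<^sub>R w))"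
      have contq: "continuous_on UNIV (\<lambda>s. q u S (x + s *\<^sub>R w))" if "u \<in> U" for u
      proof -
        have "real_polynomial_function (q u S \<circ> (\<lambda>s. x + s *\<^sub>R w))"
          by (intro real_polynomial_function_compose pl q that S)
        hence "continuous_on UNIV (q u S \<circ> (\<lambda>s. x + s *\<^sub>R w))"
          by (intro continuous_on_polymonial_function) (simp add: real_polynomial_function_eq)
        thus ?thesis by (simp add: o_def)
      qed
      have "continuous_on UNIV h" unfolding h_def Q_def by (intro continuous_intros contq)
      hence "(h \<longlongrightarrow> h 0) (at 0)" by (simp add: continuous_on_def)
      moreover have "h s = 0" if "s \<noteq> 0" for s
      proof -
        have "s ^ i * h s = (\<Sum>u\<in>U. p u (x + s *\<^sub>R w) * q u S (x + s *\<^sub>R w))"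
          unfolding h_def sum_distrib_left by (intro sum.cong refl) (simp add: pQ)
        thus ?thesis using z[OF S] that by simp
      qed
      hence "\<forall>\<^sub>F s in at 0. h s = 0" by (auto simp: eventually_at_filter)
      hence "(h \<longlongrightarrow> 0) (at 0)" by (rule tendsto_eventually)
      ultimately have "h 0 = 0" using tendsto_unique[OF trivial_limit_at] by blast
      thus ?thesis by (simp add: h_def)
    qed
    have Q0: "Q u 0 = c' u i" for u
      unfolding Q_def by (simp add: power_0_left if_distrib[of "\<lambda>x. _ * x"] cong: if_cong)
    show ?case using ind[of "\<lambda>u. Q u 0", OF lim] Q0 by simp
  qed
  hence "p u (x + 1 *\<^sub>R w) = 0" unfolding c'[OF u] using u by simp
  thus ?thesis by (simp add: w_def)
qed

definition delta :: "'b \<Rightarrow> 'b \<Rightarrow> real" where "delta S = (\<lambda>T. if T = S then 1 else 0)"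

lemma delta_span:
  assumes "finite X" "\<And>S. S \<notin> X \<Longrightarrow> u S = 0"
  shows "u \<in> fv.span (delta ` X)"
proof -
  have "u = (\<Sum>S\<in>X. fscale (u S) (delta S))"
    using assms by (auto simp: fun_eq_iff fun_sum_apply fscale_def delta_def if_distrib cong: if_cong)
  also have "\<dots> \<in> fv.span (delta ` X)" by (intro fv.span_sum fv.span_scale fv.span_base) auto
  finally show ?thesis .
qed

lemma delta_independent: "finite X \<Longrightarrow> fv.independent (delta ` X)"
proof -
  assume X: "finite X"
  have inj: "inj_on delta X" by (auto simp: inj_on_def delta_def fun_eq_iff split: if_splits)
  show ?thesis
  proof (subst fv.independent_explicit_finite_subsets, intro allI impI ballI)
    fix A u v assume A: "A \<subseteq> delta ` X" "finite A" "(\<Sum>v\<in>A. fscale (u v) v) = 0" "v \<in> A"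
    obtain S where S: "S \<in> X" "v = delta S" using A by auto
    have "0 = (\<Sum>w\<in>A. fscale (u w) w) S" using A by simp
    also have "\<dots> = (\<Sum>w\<in>A. u w * w S)" by (simp add: fun_sum_apply fscale_def)
    also have "\<dots> = (\<Sum>w\<in>A. if w = v then u v else 0)"
    proof (intro sum.cong refl)
      fix w assume "w \<in> A"
      then obtain T where "T \<in> X" "w = delta T" using A by auto
      thus "u w * w S = (if w = v then u v else 0)" using S inj by (auto simp: delta_def inj_on_def)
    qed
    finally show "u v = 0" using A by simp
  qed
qed

section \<open>A basis of the space of values adapted to the degree filtration\<close>

locale reduction =
  fixes SS :: "'a::real_normed_vector set set" and B :: "'a set" and x :: 'a
  assumes F: "sfan SS" and B: "is_basis B" and xB: "x \<in> B \<or> B = {}" and R: "reducible_at SS B x" and gen: "generic SS x"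
begin

text \<open>If the values of \<open>f\<close> at \<open>x\<close> already come from lower degrees,
  those sections are raised to degree \<open>k\<close> by the coordinate of \<open>x\<close>, which
  is 1 at \<open>x\<close>. The difference vanishes at \<open>x\<close>, and both parts lie in the
  ideal of the linear forms.\<close>

lemma low_degree_values_reducible:
  assumes f: "f \<in> PPh SS k" and e: "ev SS x f \<in> Elt SS x k"
  shows "f \<in> LI SS B B k"
proof -
  have fB: "finite B" using B by (simp add: is_basis_def)
  have sub: "g \<in> LI SS B B k" if g: "g \<in> PPh SS k" "ev SS x g = 0" for g
  proof -
    have "pc g S x = 0" if "S \<in> SS" for S using fun_cong[OF g(2), of S] that by (simp add: ev_def)
    hence "g \<in> LI SS B (B - {x}) k" using R g(1) by (simp add: reducible_at_def)
    then obtain u where u: "\<And>v. v \<in> B - {x} \<Longrightarrow> u v \<in> PPm SS k" "g = (\<lambda>y. \<Sum>v\<in>B - {x}. representation B y v * u v y)"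
      by (auto simp: LI_def)
    define u' where "u' = (\<lambda>v. if v = x then (\<lambda>y. 0) else u v)"
    have "g = (\<lambda>y. \<Sum>v\<in>B. representation B y v * u' v y)"
      unfolding u(2) using fB by (intro ext sum.mono_neutral_cong_left) (auto simp: u'_def)
    moreover have "\<forall>v\<in>B. u' v \<in> PPm SS k" using u(1) by (auto simp: u'_def PPm_zero)
    ultimately show ?thesis unfolding LI_def by blast
  qed
  obtain g where g: "\<forall>j<k. g j \<in> PPh SS j" "ev SS x f = (\<Sum>j<k. ev SS x (g j))" using Elt_expand[OF F e] by blast
  show ?thesis
  proof (cases "k = 0")
    case True
    thus ?thesis using sub[OF f] g(2) by simp
  next
    case False
    show ?thesis
    proof (cases "x \<in> B")
      case True
      define l where "l = (\<lambda>y. representation B y x)"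
      have l: "l \<in> PPh SS 1" "l x = 1" "real_polynomial_function l"
        unfolding l_def using homogeneous_poly_PPh[OF homogeneous_poly_rep[OF B]] rep_basis[OF B True] rep_poly[OF B] by simp_all
      \<comment> \<open>The powers of \<open>l\<close> bring all summands to the common degree
        \<open>k - 1\<close> without changing their values at \<open>x\<close>; one factor
        \<open>l\<close> is kept back as the cofactor.\<close>
      define q where "q = (\<lambda>y. \<Sum>j<k. l y ^ (k - 1 - j) * g j y)"
      have q: "q \<in> PPh SS (k - 1)" unfolding q_def
      proof (intro PPh_sum)
        fix j assume j: "j \<in> {..<k}"
        have "(\<lambda>y. l y ^ (k - 1 - j) * g j y) \<in> PPh SS ((k - 1 - j) * 1 + j)"
          using g(1) j by (intro PPh_mult PPh_power l) auto
        thus "(\<lambda>y. l y ^ (k - 1 - j) * g j y) \<in> PPh SS (k - 1)" using j by simp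
      qed
      have lq: "(\<lambda>y. l y * q y) \<in> PPh SS k" using PPh_mult[OF l(1) q] False by simp
      have pl: "real_polynomial_function (\<lambda>y. l y ^ m)" for m using l(3) by (rule real_polynomial_function_power)
      have "ev SS x q = ev SS x f"
      proof -
        have "ev SS x q = (\<Sum>j<k. ev SS x (\<lambda>y. l y ^ (k - 1 - j) * g j y))"
          unfolding q_def
        proof (rule ev_sum[OF F])
          fix j assume j: "j \<in> {..<k}"
          have "(\<lambda>y. l y ^ (k - 1 - j) * g j y) \<in> PPh SS ((k - 1 - j) * 1 + j)"
            using g(1) j by (intro PPh_mult PPh_power l) auto
          thus "(\<lambda>y. l y ^ (k - 1 - j) * g j y) \<in> PPh SS (k - 1)" using j by simp
        qed
        also have "\<dots> = (\<Sum>j<k. ev SS x (g j))"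
          using g(1) by (intro sum.cong refl) (auto simp: ev_poly_mult[OF F pl PPh_PP] l(2) fscale_def)
        finally show ?thesis using g(2) by simp
      qed
      hence "ev SS x (\<lambda>y. f y - l y * q y) = 0"
        using ev_diff[OF F PPh_PP[OF f] PPh_PP[OF lq]] ev_poly_mult[OF F l(3) PPh_PP[OF q]] l(2) by (simp add: fscale_def)
      from sub[OF PPh_diff[OF f lq] this] have 1: "(\<lambda>y. f y - l y * q y) \<in> LI SS B B k" .
      have "(\<lambda>y. l y * q y) = (\<lambda>y. \<Sum>v\<in>B. representation B y v * (if v = x then q else (\<lambda>y. 0)) y)"
      proof
        fix y
        have "(\<Sum>v\<in>B. representation B y v * (if v = x then q else (\<lambda>y. 0)) y) = (\<Sum>v\<in>B. if v = x then l y * q y else 0)"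
          by (intro sum.cong) (auto simp: l_def)
        thus "l y * q y = (\<Sum>v\<in>B. representation B y v * (if v = x then q else (\<lambda>y. 0)) y)" using True fB by simp
      qed
      hence 2: "(\<lambda>y. l y * q y) \<in> LI SS B B k" unfolding LI_def
        using q False by (intro CollectI exI[of _ "\<lambda>v. if v = x then q else (\<lambda>y. 0)"]) (auto simp: PPm_def PPh_zero)
      from LI_add[OF 1 2] show ?thesis by simp
    next
      case xn: False
      \<comment> \<open>In the zero space a section of positive degree is zero.\<close>
      hence "B = {}" using xB by auto
      hence U: "y = 0" for y :: 'a using B by (auto simp: is_basis_def)
      obtain S where S: "S \<in> SS" "0 \<in> bcone S" using sfanD(3)[OF F] by blast
      have "f y = 0" for y
      proof -
        have "f (0 *\<^sub>R 0) = 0 ^ k * f 0" using PPh_scale_point[OF f S(1) sfanD(2)[OF F S(1)] S(2), of 0] by simp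
        hence "f 0 = 0" using \<open>k \<noteq> 0\<close> by (simp add: zero_power)
        thus ?thesis using U[of y] by simp
      qed
      hence "f = (\<lambda>y. 0)" by auto
      thus ?thesis by (simp add: LI_zero)
    qed
  qed
qed

text \<open>Independent sets are extended degree by degree, the new vectors being taken among values
  of sections of exactly the current degree. Thus each basis vector has a homogeneous lift.\<close>

lemma flag_exists:
  "\<exists>BB. \<forall>k. (fv.independent (BB k) \<and> BB k \<subseteq> Elt SS x k \<and> Elt SS x k \<subseteq> fv.span (BB k) \<and> (k = 0 \<longrightarrow> BB k = {})) \<and>
     (BB k \<subseteq> BB (Suc k) \<and> BB (Suc k) - BB k \<subseteq> ev SS x ` PPh SS k)"
proof (rule dependent_nat_choice)
  show "\<exists>b. fv.independent b \<and> b \<subseteq> Elt SS x 0 \<and> Elt SS x 0 \<subseteq> fv.span b \<and> (0 = (0::nat) \<longrightarrow> b = {})"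
    by (intro exI[of _ "{}"]) (auto simp: Elt_def fv.independent_empty)
next
  fix b k assume b: "fv.independent b \<and> b \<subseteq> Elt SS x k \<and> Elt SS x k \<subseteq> fv.span b \<and> (k = 0 \<longrightarrow> b = {})"
  obtain b' where b': "b \<subseteq> b'" "b' \<subseteq> b \<union> ev SS x ` PPh SS k" "fv.independent b'" "b \<union> ev SS x ` PPh SS k \<subseteq> fv.span b'"
    using fv.maximal_independent_subset_extend[of b "b \<union> ev SS x ` PPh SS k"] b by auto
  have "b' \<subseteq> Elt SS x (Suc k)"
  proof
    fix u assume "u \<in> b'"
    hence "u \<in> b \<or> u \<in> ev SS x ` PPh SS k" using b'(2) by blast
    thus "u \<in> Elt SS x (Suc k)"
    proof
      assume "u \<in> b" thus ?thesis using b Elt_mono[of k "Suc k"] by auto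
    qed (auto intro: ev_Elt)
  qed
  moreover have "Elt SS x (Suc k) \<subseteq> fv.span b'"
    unfolding Elt_def[of _ _ "Suc k"]
  proof (rule fv.span_minimal[OF _ fv.subspace_span])
    have "Elt SS x k \<subseteq> fv.span b'" using b fv.span_mono[OF b'(1)] by auto
    moreover have "(\<Union>j<k. ev SS x ` PPh SS j) \<subseteq> Elt SS x k" unfolding Elt_def by (rule fv.span_superset)
    ultimately have "(\<Union>j<k. ev SS x ` PPh SS j) \<subseteq> fv.span b'" by (rule order_trans[rotated])
    thus "(\<Union>j<Suc k. ev SS x ` PPh SS j) \<subseteq> fv.span b'" using b'(4) unfolding lessThan_Suc by simp
  qed
  ultimately show "\<exists>y. (fv.independent y \<and> y \<subseteq> Elt SS x (Suc k) \<and> Elt SS x (Suc k) \<subseteq> fv.span y \<and> (Suc k = 0 \<longrightarrow> y = {})) \<and>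
      (b \<subseteq> y \<and> y - b \<subseteq> ev SS x ` PPh SS k)"
    using b' by (intro exI[of _ b']) auto
qed

text \<open>A basis adapted to the filtration; \<open>\<beta>\<close> is its union, \<open>d u\<close> the degree in which \<open>u\<close> first appears,
  and the lifts \<open>lf u\<close> turn out to be a free basis of the cone-wise polynomials.\<close>

definition BB :: "nat \<Rightarrow> ('a set \<Rightarrow> real) set" where
  "BB = (SOME BB. \<forall>k. (fv.independent (BB k) \<and> BB k \<subseteq> Elt SS x k \<and> Elt SS x k \<subseteq> fv.span (BB k) \<and> (k = 0 \<longrightarrow> BB k = {})) \<and>
     (BB k \<subseteq> BB (Suc k) \<and> BB (Suc k) - BB k \<subseteq> ev SS x ` PPh SS k))"

lemma BB: "fv.independent (BB k)" "BB k \<subseteq> Elt SS x k" "Elt SS x k \<subseteq> fv.span (BB k)" "BB 0 = {}"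
    "BB k \<subseteq> BB (Suc k)" "BB (Suc k) - BB k \<subseteq> ev SS x ` PPh SS k"
  using someI_ex[OF flag_exists, folded BB_def] by auto

lemma BB_mono: "k \<le> l \<Longrightarrow> BB k \<subseteq> BB l"
  using lift_Suc_mono_le[of BB] BB(5) by auto

definition \<beta> :: "('a set \<Rightarrow> real) set" where "\<beta> = (\<Union>k. BB k)"

definition d :: "('a set \<Rightarrow> real) \<Rightarrow> nat" where "d u = (LEAST k. u \<in> BB (Suc k))"

lemma d_props: assumes "u \<in> \<beta>" shows "u \<in> BB (Suc (d u))" "u \<notin> BB (d u)"
proof -
  obtain k where "u \<in> BB k" using assms by (auto simp: \<beta>_def)
  hence "u \<in> BB (Suc k)" using BB(5) by auto
  thus 1: "u \<in> BB (Suc (d u))" unfolding d_def by (rule LeastI)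
  show "u \<notin> BB (d u)"
  proof (cases "d u")
    case 0 thus ?thesis using BB(4) by simp
  next
    case (Suc j)
    hence "j < (LEAST k. u \<in> BB (Suc k))" by (simp add: d_def)
    from not_less_Least[OF this] Suc show ?thesis by simp
  qed
qed

lemma BB_eq: "BB k = {u\<in>\<beta>. d u < k}"
proof
  show "{u\<in>\<beta>. d u < k} \<subseteq> BB k" using d_props(1) BB_mono[of "Suc _" k] by (auto simp: Suc_le_eq)
  show "BB k \<subseteq> {u\<in>\<beta>. d u < k}"
  proof
    fix u assume u: "u \<in> BB k"
    hence "u \<in> \<beta>" by (auto simp: \<beta>_def)
    moreover have "d u < k" using d_props(2)[OF \<open>u \<in> \<beta>\<close>] u BB_mono[of k "d u"] by (meson not_le subsetD)
    ultimately show "u \<in> {u\<in>\<beta>. d u < k}" by simp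
  qed
qed

definition lf :: "('a set \<Rightarrow> real) \<Rightarrow> 'a \<Rightarrow> real" where
  "lf u = (SOME f. f \<in> PPh SS (d u) \<and> ev SS x f = u)"

lemma lf: assumes "u \<in> \<beta>" shows "lf u \<in> PPh SS (d u)" "ev SS x (lf u) = u"
proof -
  have "u \<in> ev SS x ` PPh SS (d u)" using d_props[OF assms] BB(6) by blast
  hence "\<exists>f. f \<in> PPh SS (d u) \<and> ev SS x f = u" by auto
  from someI_ex[OF this] show "lf u \<in> PPh SS (d u)" "ev SS x (lf u) = u" unfolding lf_def by auto
qed

lemma beta_zero: "u \<in> \<beta> \<Longrightarrow> S \<notin> SS \<Longrightarrow> u S = 0"
  using lf(2)[of u] by (metis ev_def)

lemma BB_finite: "finite (BB k)"
proof -
  have "BB k \<subseteq> fv.span (delta ` SS)"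
  proof
    fix u assume "u \<in> BB k"
    hence "u \<in> \<beta>" by (auto simp: \<beta>_def)
    thus "u \<in> fv.span (delta ` SS)" using delta_span[OF sfanD(1)[OF F], of u] beta_zero by blast
  qed
  from fv.independent_span_bound[OF _ BB(1) this] show ?thesis using sfanD(1)[OF F] by auto
qed

text \<open>The product of the Courant functions of all generators of \<open>S\<close> vanishes on
  every other cone and is nonzero at the generic point. The successor appears because
  \<open>Elt\<close> counts degrees strictly below its index.\<close>

lemma delta_Elt:
  assumes S: "S \<in> SS" shows "delta S \<in> Elt SS x (Suc (card S))"
proof -
  have fS: "finite S" using sfanD(5)[OF F S] .
  define e where "e = (\<lambda>y. \<Prod>v\<in>S. crt SS v y)"
  have e: "e \<in> PPh SS (card S)"
    using PPh_prod[OF fS, of "crt SS" SS "\<lambda>_. 1"] crt_PPh[OF F] by (simp add: e_def)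
  have pce: "pc e T = (\<lambda>y. \<Prod>v\<in>S. representation T y v)" if T: "T \<in> SS" for T
  proof (rule pc_eq[OF sfanD(2)[OF F T]])
    show "real_polynomial_function (\<lambda>y. \<Prod>v\<in>S. representation T y v)"
      using fS by (intro real_polynomial_function_prod rep_poly sfanD(2)[OF F] T)
    show "\<And>y. y \<in> bcone T \<Longrightarrow> e y = (\<Prod>v\<in>S. representation T y v)"
      unfolding e_def by (intro prod.cong refl crt_eq[OF F T])
  qed
  define r where "r = (\<Prod>v\<in>S. representation S x v)"
  have r: "r \<noteq> 0" unfolding r_def using fS gen S by (auto simp: generic_def)
  have "ev SS x e = fscale r (delta S)"
  proof
    fix T
    show "ev SS x e T = fscale r (delta S) T"
    proof (cases "T \<in> SS \<and> T \<noteq> S")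
      case F1: False
      show ?thesis
      proof (cases "T = S")
        case True
        thus ?thesis using S pce[OF S] by (simp add: ev_def fscale_def delta_def r_def)
      next
        case False
        hence "T \<notin> SS" using F1 by blast
        thus ?thesis using False by (simp add: ev_def fscale_def delta_def)
      qed
    next
      case True
      have "\<not> S \<subseteq> T"
      proof
        assume "S \<subseteq> T"
        moreover have "card S = card T"
          using is_basis_dim[OF sfanD(2)[OF F S]] is_basis_dim[OF sfanD(2)[OF F, of T]] True by simp
        ultimately show False using card_subset_eq[of T S] sfanD(5)[OF F] True by auto
      qed
      then obtain v where "v \<in> S" "v \<notin> T" by auto
      hence "(\<Prod>v\<in>S. representation T x v) = 0" using fS by (intro prod_zero) (auto simp: rep_outside intro!: bexI[of _ v])
      thus ?thesis using True pce[of T] by (simp add: ev_def fscale_def delta_def)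
    qed
  qed
  hence "fscale (1 / r) (ev SS x e) = delta S" using r by (auto simp: fscale_def)
  moreover have "fscale (1 / r) (ev SS x e) \<in> Elt SS x (Suc (card S))"
    unfolding Elt_def by (intro fv.span_scale fv.span_base) (use e in auto)
  ultimately show ?thesis by simp
qed

definition n :: nat where "n = dim (UNIV :: 'a set)"

lemma card_cone: "S \<in> SS \<Longrightarrow> card S = n"
  using is_basis_dim[OF sfanD(2)[OF F]] by (simp add: n_def)

lemma Elt_top: assumes "\<And>S. S \<notin> SS \<Longrightarrow> u S = 0" shows "u \<in> Elt SS x (Suc n)"
proof -
  have "delta ` SS \<subseteq> Elt SS x (Suc n)" using delta_Elt card_cone by force
  hence "fv.span (delta ` SS) \<subseteq> Elt SS x (Suc n)" unfolding Elt_def by (rule fv.span_minimal[OF _ fv.subspace_span])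
  moreover have "u \<in> fv.span (delta ` SS)" by (rule delta_span[OF sfanD(1)[OF F]]) (rule assms)
  ultimately show ?thesis by blast
qed

text \<open>All values are reached in degrees up to \<open>n\<close>, so a vector appearing later
  would depend on earlier ones.\<close>

lemma beta_eq: "\<beta> = BB (Suc n)"
proof
  show "BB (Suc n) \<subseteq> \<beta>" by (auto simp: \<beta>_def)
  show "\<beta> \<subseteq> BB (Suc n)"
  proof
    fix u assume u: "u \<in> \<beta>"
    show "u \<in> BB (Suc n)"
    proof (rule ccontr)
      assume nu: "u \<notin> BB (Suc n)"
      have "u \<in> fv.span (BB (Suc n))" using Elt_top[of u] beta_zero[OF u] BB(3) by blast
      moreover have "u \<in> BB (Suc (d u))" using d_props u by blast
      moreover have "BB (Suc n) \<subseteq> BB (Suc (d u)) - {u}"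
        using nu u BB_mono[of "Suc n" "Suc (d u)"] unfolding BB_eq[of "Suc n"] by (auto simp: BB_eq)
      ultimately have "fv.dependent (BB (Suc (d u)))" unfolding fv.dependent_def using fv.span_mono by blast
      thus False using BB(1) by blast
    qed
  qed
qed

lemma beta_finite: "finite \<beta>" by (simp add: beta_eq BB_finite)

lemma beta_independent: "fv.independent \<beta>" by (simp add: beta_eq BB(1))

lemma beta_d: "u \<in> \<beta> \<Longrightarrow> d u \<le> n"
proof -
  assume "u \<in> \<beta>"
  hence "u \<in> BB (Suc n)" using beta_eq by blast
  hence "u \<in> {u\<in>\<beta>. d u < Suc n}" using BB_eq by blast
  thus ?thesis by simp
qed

lemma beta_comb_zero: "(\<Sum>u\<in>V. fscale (c u) u) = 0 \<Longrightarrow> V \<subseteq> \<beta> \<Longrightarrow> u \<in> V \<Longrightarrow> c u = 0"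
  using fv.independent_explicit_finite_subsets[THEN iffD1, OF beta_independent] finite_subset[OF _ beta_finite] by blast

lemma dim_Elt: "fv.dim (Elt SS x k) = card {u\<in>\<beta>. d u < k}"
  using fv.dim_unique[OF BB(2,3,1) refl] BB_eq by auto

text \<open>The rank of the free module is the number of maximal cones, because the values at a
  generic point fill the whole space of functions on these cones.\<close>

lemma card_beta: "card \<beta> = card SS"
proof (rule antisym)
  have "\<beta> \<subseteq> fv.span (delta ` SS)" using delta_span[OF sfanD(1)[OF F]] beta_zero by blast
  from fv.independent_span_bound[OF _ beta_independent this]
  have "card \<beta> \<le> card (delta ` SS)" using sfanD(1)[OF F] by auto
  thus "card \<beta> \<le> card SS" using card_image_le[OF sfanD(1)[OF F], of delta] by linarith
  have inj: "inj_on delta SS" by (auto simp: inj_on_def delta_def fun_eq_iff split: if_splits)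
  have "delta S \<in> fv.span \<beta>" if "S \<in> SS" for S
  proof -
    have "delta S \<in> Elt SS x (Suc n)" by (rule Elt_top) (use that in \<open>auto simp: delta_def\<close>)
    from subsetD[OF BB(3) this] show ?thesis by (simp only: beta_eq)
  qed
  from fv.independent_span_bound[OF beta_finite delta_independent[OF sfanD(1)[OF F]], of ] this
  have "card (delta ` SS) \<le> card \<beta>" by blast
  thus "card SS \<le> card \<beta>" by (simp add: card_image[OF inj])
qed

section \<open>Freeness: lifts times monomials as a real basis in each degree\<close>

definition TI :: "nat \<Rightarrow> (('a set \<Rightarrow> real) \<times> ('a \<Rightarrow> nat)) set" where
  "TI k = Sigma {u\<in>\<beta>. d u \<le> k} (\<lambda>u. expo B (k - d u))"

definition tf :: "('a set \<Rightarrow> real) \<times> ('a \<Rightarrow> nat) \<Rightarrow> 'a \<Rightarrow> real" where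
  "tf i = (\<lambda>y. mon B (snd i) y * lf (fst i) y)"

lemma finite_B: "finite B" using B by (simp add: is_basis_def)

lemma TI_finite: "finite (TI k)"
  unfolding TI_def by (intro finite_SigmaI finite_expo finite_B) (use beta_finite in auto)

lemma tf_step:
  assumes "g \<in> fv.span (tf ` TI k)" "v \<in> B"
  shows "(\<lambda>y. representation B y v * g y) \<in> fv.span (tf ` TI (Suc k))"
  using assms(1)
proof (induction rule: fv.span_induct_alt)
  case base
  have "(\<lambda>y. representation B y v * (0::'a\<Rightarrow>real) y) = 0" by auto
  thus ?case by (simp only: fv.span_zero)
next
  case (step c h g)
  obtain u a where ua: "u \<in> \<beta>" "d u \<le> k" "a \<in> expo B (k - d u)" "h = tf (u, a)" using step(1) by (auto simp: TI_def)
  note inc = exponent_incr[OF finite_B assms(2) ua(3)]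
  have "(u, a(v := Suc (a v))) \<in> TI (Suc k)" using ua inc(1) by (auto simp: TI_def Suc_diff_le)
  moreover have "(\<lambda>y. representation B y v * (fscale c h + g) y) = fscale c (tf (u, a(v := Suc (a v)))) + (\<lambda>y. representation B y v * g y)"
    by (auto simp: fun_eq_iff fscale_def ua(4) tf_def inc(2) algebra_simps)
  moreover have "fscale c (tf (u, a(v := Suc (a v)))) + (\<lambda>y. representation B y v * g y) \<in> fv.span (tf ` TI (Suc k))"
    by (intro fv.span_add[OF fv.span_scale[OF fv.span_base[OF imageI]]] calculation(1) step(2))
  ultimately show ?case by (simp only:)
qed

text \<open>Subtracting the lifts of the new basis vectors leaves a section whose values at
  \<open>x\<close> come from lower degrees, hence an element of the ideal.\<close>

lemma lift_top_part:
  assumes f: "f \<in> PPh SS k"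
  obtains c where "(\<lambda>y. f y - (\<Sum>u\<in>{u\<in>\<beta>. d u = k}. c u * lf u y)) \<in> LI SS B B k"
proof -
  have "ev SS x f \<in> fv.span (BB (Suc k))" using ev_Elt[OF f, of "Suc k"] BB(3) by blast
  then obtain c where c: "ev SS x f = (\<Sum>u\<in>BB (Suc k). fscale (c u) u)"
    using fv.span_finite[OF BB_finite] by auto
  have fin: "finite {u\<in>\<beta>. d u = k}" using beta_finite by simp
  have lk: "lf u \<in> PPh SS k" if "u \<in> {u\<in>\<beta>. d u = k}" for u using lf(1) that by auto
  define g where "g = (\<lambda>y. \<Sum>u\<in>{u\<in>\<beta>. d u = k}. c u * lf u y)"
  have g: "g \<in> PPh SS k" unfolding g_def by (intro PPh_sum PPh_cmult lk)
  have evg: "ev SS x g = (\<Sum>u\<in>{u\<in>\<beta>. d u = k}. fscale (c u) u)"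
  proof -
    have "ev SS x g = (\<Sum>u\<in>{u\<in>\<beta>. d u = k}. ev SS x (\<lambda>y. c u * lf u y))"
      unfolding g_def by (rule ev_sum[OF F, where k = k]) (intro PPh_cmult lk)
    also have "\<dots> = (\<Sum>u\<in>{u\<in>\<beta>. d u = k}. fscale (c u) u)"
      using ev_cmult[OF F PPh_PP[OF lk]] lf(2) by (intro sum.cong refl) auto
    finally show ?thesis .
  qed
  have "BB (Suc k) = BB k \<union> {u\<in>\<beta>. d u = k}" "BB k \<inter> {u\<in>\<beta>. d u = k} = {}" by (auto simp: BB_eq)
  hence "ev SS x f = (\<Sum>u\<in>BB k. fscale (c u) u) + ev SS x g"
    unfolding c evg using fin BB_finite by (simp add: sum.union_disjoint)
  hence "ev SS x (\<lambda>y. f y - g y) = (\<Sum>u\<in>BB k. fscale (c u) u)"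
    using ev_diff[OF F PPh_PP[OF f] PPh_PP[OF g]] by simp
  also have "\<dots> \<in> Elt SS x k"
    using BB(2)[of k] unfolding Elt_def by (intro fv.span_sum fv.span_scale) auto
  finally have "(\<lambda>y. f y - g y) \<in> LI SS B B k" by (rule low_degree_values_reducible[OF PPh_diff[OF f g]])
  thus ?thesis using that unfolding g_def by blast
qed

text \<open>Graded Nakayama argument: modulo lifts of degree \<open>k\<close>, a section is a
  combination of coordinates with cofactors of lower degree.\<close>

lemma generated: "f \<in> PPh SS k \<Longrightarrow> f \<in> fv.span (tf ` TI k)"
proof (induction k arbitrary: f rule: less_induct)
  case (less k)
  obtain c where c: "(\<lambda>y. f y - (\<Sum>u\<in>{u\<in>\<beta>. d u = k}. c u * lf u y)) \<in> LI SS B B k" using lift_top_part[OF less.prems] by blast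
  then obtain g where g: "\<And>v. v \<in> B \<Longrightarrow> g v \<in> PPm SS k"
    "(\<lambda>y. f y - (\<Sum>u\<in>{u\<in>\<beta>. d u = k}. c u * lf u y)) = (\<lambda>y. \<Sum>v\<in>B. representation B y v * g v y)" by (auto simp: LI_def)
  have m0: "mon B (\<lambda>_. 0) y = 1" for y by (simp add: mon_def)
  have feq: "f = (\<Sum>u\<in>{u\<in>\<beta>. d u = k}. fscale (c u) (tf (u, \<lambda>_. 0))) + (\<Sum>v\<in>B. (\<lambda>y. representation B y v * g v y))"
    using fun_cong[OF g(2)] by (auto simp: fun_eq_iff fun_sum_apply fscale_def tf_def m0 algebra_simps)
  have 1: "(\<Sum>u\<in>{u\<in>\<beta>. d u = k}. fscale (c u) (tf (u, \<lambda>_. 0))) \<in> fv.span (tf ` TI k)"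
    by (intro fv.span_sum fv.span_scale fv.span_base imageI) (auto simp: TI_def expo_def supported_def)
  have 2: "(\<lambda>y. representation B y v * g v y) \<in> fv.span (tf ` TI k)" if v: "v \<in> B" for v
  proof (cases k)
    case 0
    hence "(\<lambda>y. representation B y v * g v y) = 0" using g(1)[OF v] by (auto simp: PPm_def)
    thus ?thesis by (simp only: fv.span_zero)
  next
    case (Suc j)
    hence "g v \<in> PPh SS j" using g(1)[OF v] by (simp add: PPm_def)
    from tf_step[OF less.IH[OF _ this] v] Suc show ?thesis by simp
  qed
  show ?case by (subst feq) (intro fv.span_add 1 fv.span_sum 2)
qed

text \<open>Collecting the terms of each lift gives a relation with polynomial coefficients, and the
  values of the lifts at \<open>x\<close> are independent vectors.\<close>

lemma tf_independent:
  assumes z: "\<And>y. (\<Sum>i\<in>TI k. c i * tf i y) = 0" and i: "i \<in> TI k"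
  shows "c i = 0"
proof -
  define U where "U = {u\<in>\<beta>. d u \<le> k}"
  have fU: "finite U" using beta_finite by (simp add: U_def)
  define p where "p = (\<lambda>u y. \<Sum>a\<in>expo B (k - d u). c (u, a) * mon B a y)"
  have pp: "real_polynomial_function (p u)" for u
    unfolding p_def by (intro real_polynomial_function_sum finite_expo finite_B real_polynomial_function.intros(2,4) mon_poly B)
  have lP: "lf u \<in> PP SS" if "u \<in> U" for u using lf(1)[of u] that PPh_PP by (auto simp: U_def)
  have sum0: "(\<Sum>u\<in>U. p u y * lf u y) = 0" for y
  proof -
    have "(\<Sum>u\<in>U. p u y * lf u y) = (\<Sum>u\<in>U. \<Sum>a\<in>expo B (k - d u). c (u, a) * tf (u, a) y)"
      unfolding p_def tf_def by (simp add: sum_distrib_left sum_distrib_right mult_ac)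
    also have "\<dots> = (\<Sum>i\<in>TI k. c i * tf i y)"
      unfolding TI_def U_def[symmetric] by (subst sum.Sigma) (use fU finite_expo[OF finite_B] in auto)
    finally show ?thesis using z by simp
  qed
  have pz: "p u y = 0" if u: "u \<in> U" for u y
  proof (rule polynomial_relation_zero[OF fU pp _ _ _ u, where SS = SS and q = "\<lambda>u S. pc (lf u) S" and x = x])
    show "real_polynomial_function (pc (lf u) S)" if "u \<in> U" "S \<in> SS" for u S
      using pc_PP(1)[OF lP[OF that(1)] that(2) sfanD(2)[OF F that(2)]] .
    show "(\<Sum>u\<in>U. p u y * pc (lf u) S y) = 0" if S: "S \<in> SS" for S y
    proof -
      have bS: "is_basis S" using sfanD(2)[OF F S] .
      have "(\<lambda>y. \<Sum>u\<in>U. p u y * pc (lf u) S y) = (\<lambda>_. 0)"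
      proof (rule poly_eq_on_bcone[OF bS])
        show "real_polynomial_function (\<lambda>y. \<Sum>u\<in>U. p u y * pc (lf u) S y)"
          using pc_PP(1)[OF lP S bS] by (intro real_polynomial_function_sum fU real_polynomial_function.intros(4) pp) auto
        fix y assume y: "y \<in> bcone S"
        have "(\<Sum>u\<in>U. p u y * pc (lf u) S y) = (\<Sum>u\<in>U. p u y * lf u y)"
          using pc_PP(2)[OF lP S bS y] by (intro sum.cong) auto
        thus "(\<Sum>u\<in>U. p u y * pc (lf u) S y) = 0" using sum0 by simp
      qed auto
      thus ?thesis by meson
    qed
    show "c u = 0" if c: "\<And>S. S \<in> SS \<Longrightarrow> (\<Sum>u\<in>U. c u * pc (lf u) S x) = 0" and u: "u \<in> U" for c u
    proof (rule beta_comb_zero[OF _ _ u])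
      show "U \<subseteq> \<beta>" by (auto simp: U_def)
      show "(\<Sum>u\<in>U. fscale (c u) u) = 0"
      proof
        fix S
        have uS: "u S = (if S \<in> SS then pc (lf u) S x else 0)" if "u \<in> U" for u
          using fun_cong[OF lf(2)[of u], of S] that by (simp add: U_def ev_def)
        have "(\<Sum>u\<in>U. fscale (c u) u) S = (\<Sum>u\<in>U. c u * u S)" by (simp add: fun_sum_apply fscale_def)
        also have "\<dots> = (\<Sum>u\<in>U. c u * (if S \<in> SS then pc (lf u) S x else 0))" using uS by (intro sum.cong) auto
        also have "\<dots> = 0" using c by (cases "S \<in> SS") auto
        finally show "(\<Sum>u\<in>U. fscale (c u) u) S = 0 S" by simp
      qed
    qed
  qed
  obtain u a where ua: "i = (u, a)" "u \<in> U" "a \<in> expo B (k - d u)" using i by (auto simp: TI_def U_def)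
  show ?thesis unfolding ua(1)
  proof (rule monomials_independent[OF finite_B finite_expo[OF finite_B] _ _ ua(3), where c = "\<lambda>a. c (u, a)"])
    show "expo B (k - d u) \<subseteq> supported B" by (auto simp: expo_def)
    fix t :: "'a \<Rightarrow> real"
    have "p u (\<Sum>v\<in>B. t v *\<^sub>R v) = (\<Sum>a\<in>expo B (k - d u). c (u, a) * (\<Prod>v\<in>B. t v ^ a v))"
      unfolding p_def using mon_face[OF B order_refl] by (intro sum.cong) (auto simp: expo_def)
    thus "(\<Sum>a\<in>expo B (k - d u). c (u, a) * (\<Prod>v\<in>B. t v ^ a v)) = 0" using pz[OF ua(2)] by simp
  qed
qed

end

text \<open>Independence in the indexed sense makes the family injective, so the cardinalities of
  the index sets themselves can be compared.\<close>

lemma card_le_of_independent_family: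
  fixes f :: "'i \<Rightarrow> 'b \<Rightarrow> real"
  assumes I: "finite I" and J: "finite J" and sp: "\<And>i. i \<in> I \<Longrightarrow> f i \<in> fv.span (g ` J)"
    and ind: "\<And>c i. (\<And>y. (\<Sum>i\<in>I. c i * f i y) = 0) \<Longrightarrow> i \<in> I \<Longrightarrow> c i = 0"
  shows "card I \<le> card J"
proof -
  have inj: "inj_on f I"
  proof (rule inj_onI, rule ccontr)
    fix i j assume ij: "i \<in> I" "j \<in> I" "f i = f j" "i \<noteq> j"
    define c where "c = (\<lambda>k. if k = i then 1 else if k = j then -1 else (0::real))"
    have "(\<Sum>k\<in>I. c k * f k y) = 0" for y
    proof -
      have "(\<Sum>k\<in>I. c k * f k y) = (\<Sum>k\<in>{i, j}. c k * f k y)"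
        using ij I by (intro sum.mono_neutral_right) (auto simp: c_def)
      thus ?thesis using ij by (simp add: c_def)
    qed
    from ind[OF this ij(1)] show False by (simp add: c_def)
  qed
  have "fv.independent (f ` I)"
  proof (subst fv.independent_explicit_finite_subsets, intro allI impI ballI)
    fix A u v assume A: "A \<subseteq> f ` I" "finite A" "(\<Sum>v\<in>A. fscale (u v) v) = 0" "v \<in> A"
    define c where "c = (\<lambda>i. if f i \<in> A then u (f i) else 0)"
    have "(\<Sum>i\<in>I. c i * f i y) = 0" for y
    proof -
      have "(\<Sum>i\<in>I. c i * f i y) = (\<Sum>i\<in>{i\<in>I. f i \<in> A}. u (f i) * f i y)"
        using I by (intro sum.mono_neutral_cong_right) (auto simp: c_def)
      also have "\<dots> = (\<Sum>v\<in>f ` {i\<in>I. f i \<in> A}. u v * v y)"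
        using inj by (subst sum.reindex) (auto simp: inj_on_def)
      also have "f ` {i\<in>I. f i \<in> A} = A" using A by auto
      also have "(\<Sum>v\<in>A. u v * v y) = (\<Sum>v\<in>A. fscale (u v) v) y" by (simp add: fun_sum_apply fscale_def)
      finally show ?thesis using A by simp
    qed
    moreover obtain i where i: "i \<in> I" "v = f i" using A by auto
    ultimately have "c i = 0" using ind by blast
    thus "u v = 0" using i A by (simp add: c_def)
  qed
  moreover have "f ` I \<subseteq> fv.span (g ` J)" using sp by auto
  ultimately have "card (f ` I) \<le> card (g ` J)" using fv.independent_span_bound[of "g ` J"] J by auto
  thus ?thesis using card_image[OF inj] card_image_le[OF J, of g] by linarith
qed

section \<open>The Hilbert function\<close>

lemma card_expo_le:
  assumes "finite S" "finite T" "card S = card T"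
  shows "card (expo T j) \<le> card (expo S j)"
proof -
  obtain h where h: "bij_betw h S T" using finite_same_card_bij[OF assms] by blast
  define g where "g = (\<lambda>(a::'b \<Rightarrow> nat) v. if v \<in> S then a (h v) else 0)"
  show ?thesis
  proof (rule card_inj_on_le[of g])
    show "inj_on g (expo T j)"
    proof (rule inj_onI, rule ext)
      fix a a' w assume a: "a \<in> expo T j" "a' \<in> expo T j" "g a = g a'"
      show "a w = a' w"
      proof (cases "w \<in> T")
        case True
        then obtain v where "v \<in> S" "w = h v" using h by (auto simp: bij_betw_def)
        thus ?thesis using fun_cong[OF a(3), of v] by (simp add: g_def)
      next
        case False thus ?thesis using a by (simp add: expo_def supported_def)
      qed
    qed
    show "g ` expo T j \<subseteq> expo S j"
    proof
      fix b assume "b \<in> g ` expo T j"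
      then obtain a where a: "a \<in> expo T j" "b = g a" by auto
      have "sum b S = (\<Sum>v\<in>S. a (h v))" by (simp add: a(2) g_def)
      also have "\<dots> = sum a T" by (rule sum.reindex_bij_betw[OF h])
      finally show "b \<in> expo S j" using a by (simp add: expo_def supported_def g_def)
    qed
  qed (rule finite_expo[OF assms(1)])
qed

lemma card_expo_cong: "finite S \<Longrightarrow> finite T \<Longrightarrow> card S = card T \<Longrightarrow> card (expo S j) = card (expo T j)"
  by (intro antisym card_expo_le) auto

lemma card_expo_0: "card (expo S 0) = 1" if "finite S"
proof -
  have "expo S 0 = {\<lambda>_. 0}" using that by (fastforce simp: expo_def supported_def)
  thus ?thesis by simp
qed

text \<open>Lowering the exponents in \<open>R\<close> by one is a bijection onto the exponents of
  the smaller degree.\<close>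

lemma card_expo_pos:
  assumes S: "finite S" and R: "R \<subseteq> S"
  shows "card {a \<in> expo S k. \<forall>v\<in>R. a v > 0} = (if card R \<le> k then card (expo S (k - card R)) else 0)"
proof -
  have fR: "finite R" using S R finite_subset by auto
  define up where "up = (\<lambda>(b::'a \<Rightarrow> nat) v. b v + (if v \<in> R then 1 else 0))"
  have up_sum: "sum (up b) S = sum b S + card R" for b
    using S R by (simp add: up_def sum.distrib sum.If_cases Int_absorb1)
  define dn where "dn = (\<lambda>(b::'a \<Rightarrow> nat) v. b v - (if v \<in> R then 1 else 0))"
  have ud: "up (dn a) = a" if "\<forall>v\<in>R. a v > 0" for a using that by (auto simp: up_def dn_def fun_eq_iff)
  have du: "dn (up a) = a" for a by (auto simp: up_def dn_def fun_eq_iff)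
  have dnk: "dn a \<in> supported S" "sum (dn a) S + card R = k" if a: "a \<in> expo S k" "\<forall>v\<in>R. a v > 0" for a
    using up_sum[of "dn a"] ud[OF a(2)] a(1) by (auto simp: expo_def supported_def dn_def)
  show ?thesis
  proof (cases "card R \<le> k")
    case True
    have "bij_betw up (expo S (k - card R)) {a \<in> expo S k. \<forall>v\<in>R. a v > 0}"
    proof (rule bij_betw_byWitness[where f' = dn])
      show "\<forall>a\<in>expo S (k - card R). dn (up a) = a" using du by simp
      show "\<forall>a'\<in>{a \<in> expo S k. \<forall>v\<in>R. 0 < a v}. up (dn a') = a'" using ud by simp
      show "up ` expo S (k - card R) \<subseteq> {a \<in> expo S k. \<forall>v\<in>R. 0 < a v}"
        using up_sum True R by (auto simp: expo_def supported_def) (auto simp: up_def)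
      show "dn ` {a \<in> expo S k. \<forall>v\<in>R. 0 < a v} \<subseteq> expo S (k - card R)"
        using dnk by (fastforce simp: expo_def)
    qed
    from bij_betw_same_card[OF this] show ?thesis using True by simp
  next
    case False
    hence e: "{a \<in> expo S k. \<forall>v\<in>R. a v > 0} = {}" using dnk(2) by fastforce
    show ?thesis unfolding e using False by simp
  qed
qed

text \<open>Two generating functions have the same product with a series of constant term 1, hence
  agree; the induction solves for the last coefficient.\<close>

lemma count_from_convolution:
  fixes N :: "nat \<Rightarrow> nat"
  assumes fin: "finite X" "finite Y" and N0: "N 0 = 1"
    and eq: "\<And>k. (\<Sum>a\<in>X. if f a \<le> k then N (k - f a) else 0) = (\<Sum>b\<in>Y. if g b \<le> k then N (k - g b) else 0)"
  shows "card {a\<in>X. f a = k} = card {b\<in>Y. g b = k}"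
proof (induction k rule: less_induct)
  case (less k)
  have conv: "(\<Sum>a\<in>X. if f a \<le> k then N (k - f a) else 0) = (\<Sum>j\<le>k. card {a\<in>X. f a = j} * N (k - j))"
    if X: "finite X" for X :: "'x set" and f
  proof -
    have "(\<Sum>a\<in>X. if f a \<le> k then N (k - f a) else 0) = (\<Sum>a\<in>{a\<in>X. f a \<le> k}. N (k - f a))"
      using X by (intro sum.mono_neutral_cong_right) auto
    also have "\<dots> = (\<Sum>j\<le>k. \<Sum>a\<in>{a\<in>{a\<in>X. f a \<le> k}. f a = j}. N (k - f a))"
      using X by (intro sum.group[symmetric]) auto
    also have "\<dots> = (\<Sum>j\<le>k. card {a\<in>X. f a = j} * N (k - j))"
    proof (intro sum.cong refl)
      fix j assume "j \<in> {..k}"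
      hence "{a\<in>{a\<in>X. f a \<le> k}. f a = j} = {a\<in>X. f a = j}" by auto
      thus "(\<Sum>a\<in>{a\<in>{a\<in>X. f a \<le> k}. f a = j}. N (k - f a)) = card {a\<in>X. f a = j} * N (k - j)" by simp
    qed
    finally show ?thesis .
  qed
  have split: "(\<Sum>j\<le>k. h j * N (k - j)) = h k + (\<Sum>j<k. h j * N (k - j))" for h
    using N0 by (simp add: lessThan_Suc_atMost[symmetric])
  have "card {a\<in>X. f a = k} + (\<Sum>j<k. card {a\<in>X. f a = j} * N (k - j)) =
        card {b\<in>Y. g b = k} + (\<Sum>j<k. card {b\<in>Y. g b = j} * N (k - j))"
    using eq[of k] unfolding conv[OF fin(1)] conv[OF fin(2)] split .
  moreover have "(\<Sum>j<k. card {a\<in>X. f a = j} * N (k - j)) = (\<Sum>j<k. card {b\<in>Y. g b = j} * N (k - j))"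
    using less.IH by (intro sum.cong) auto
  ultimately show ?case by linarith
qed

text \<open>The support of a monomial spans a face, and the star of this face in the generic
  direction \<open>x\<close> singles out one cone. The monomial is assigned to that cone, whose
  negative generators all occur in it. No shelling order enters.\<close>

lemma Mon_partition:
  assumes F: "sfan SS" and gen: "generic SS x"
  shows "Mon SS k = (\<Union>S\<in>SS. {a \<in> expo S k. \<forall>v\<in>neg x S. a v > 0})"
    "S \<in> SS \<Longrightarrow> T \<in> SS \<Longrightarrow> S \<noteq> T \<Longrightarrow>
      {a \<in> expo S k. \<forall>v\<in>neg x S. a v > 0} \<inter> {a \<in> expo T k. \<forall>v\<in>neg x T. a v > 0} = {}"
proof -
  show "Mon SS k = (\<Union>S\<in>SS. {a \<in> expo S k. \<forall>v\<in>neg x S. a v > 0})"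
  proof
    show "(\<Union>S\<in>SS. {a \<in> expo S k. \<forall>v\<in>neg x S. a v > 0}) \<subseteq> Mon SS k" by (auto simp: Mon_def)
    show "Mon SS k \<subseteq> (\<Union>S\<in>SS. {a \<in> expo S k. \<forall>v\<in>neg x S. a v > 0})"
    proof
      fix a assume "a \<in> Mon SS k"
      then obtain S0 where S0: "S0 \<in> SS" "a \<in> expo S0 k" by (auto simp: Mon_def)
      define \<tau> where "\<tau> = {v. a v \<noteq> 0}"
      have t0: "\<tau> \<subseteq> S0" using S0(2) by (auto simp: \<tau>_def expo_def supported_def)
      obtain S where S: "S \<in> SS" "\<tau> \<subseteq> S" "\<forall>v\<in>S - \<tau>. representation S x v \<ge> 0"
        using star_exists[OF F S0(1) t0, of x] by blast
      have "a \<in> supported S" using S(2) by (auto simp: \<tau>_def supported_def)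
      hence "a \<in> expo S k"
        using supported_sum[OF sfanD(5)[OF F S(1)] sfanD(5)[OF F S0(1)]] S0(2) by (auto simp: expo_def)
      moreover have "\<forall>v\<in>neg x S. a v > 0"
      proof (intro ballI, rule ccontr)
        fix v assume v: "v \<in> neg x S" "\<not> a v > 0"
        hence "v \<in> S - \<tau>" by (simp add: neg_def \<tau>_def)
        hence "representation S x v \<ge> 0" using S(3) by blast
        thus False using v by (simp add: neg_def)
      qed
      ultimately show "a \<in> (\<Union>S\<in>SS. {a \<in> expo S k. \<forall>v\<in>neg x S. a v > 0})" using S(1) by blast
    qed
  qed
  assume ST: "S \<in> SS" "T \<in> SS" "S \<noteq> T"
  show "{a \<in> expo S k. \<forall>v\<in>neg x S. a v > 0} \<inter> {a \<in> expo T k. \<forall>v\<in>neg x T. a v > 0} = {}"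
  proof (rule ccontr)
    assume "\<not> ?thesis"
    then obtain a where a: "a \<in> expo S k" "a \<in> expo T k" "\<forall>v\<in>neg x S. a v > 0" "\<forall>v\<in>neg x T. a v > 0" by auto
    have "S = T"
    proof (rule star_unique[OF F ST(1,2), of "{v. a v \<noteq> 0}" x])
      show "{v. a v \<noteq> 0} \<subseteq> S" "{v. a v \<noteq> 0} \<subseteq> T" using a(1,2) by (auto simp: expo_def supported_def)
      have g: "representation U x v > 0" if "U \<in> SS" "v \<in> U" "\<forall>v\<in>neg x U. a v > 0" "a v = 0" for U v
      proof -
        have "v \<notin> neg x U" using that by auto
        moreover have "representation U x v \<noteq> 0" using gen that by (auto simp: generic_def)
        ultimately show ?thesis using that by (auto simp: neg_def)
      qed
      show "\<And>v. v \<in> S - {v. a v \<noteq> 0} \<Longrightarrow> 0 < representation S x v" using g ST a by auto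
      show "\<And>v. v \<in> T - {v. a v \<noteq> 0} \<Longrightarrow> 0 < representation T x v" using g ST a by auto
    qed
    thus False using ST by simp
  qed
qed

context reduction
begin

lemma tf_PPh: assumes "i \<in> TI k" shows "tf i \<in> PPh SS k"
proof -
  obtain u a where ua: "i = (u, a)" "u \<in> \<beta>" "d u \<le> k" "a \<in> expo B (k - d u)" using assms by (auto simp: TI_def)
  from PPh_mult[OF homogeneous_poly_PPh[OF mon_homogeneous[OF B ua(4)]] lf(1)[OF ua(2)]]
  show ?thesis using ua by (simp add: tf_def)
qed

text \<open>Both families are bases of the sections of degree \<open>k\<close>.\<close>

lemma card_Mon: "card (Mon SS k) = card (TI k)"
proof (rule antisym)
  show "card (Mon SS k) \<le> card (TI k)"
  proof (rule card_le_of_independent_family[where f = "fmon SS" and g = tf])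
    show "\<And>i. i \<in> Mon SS k \<Longrightarrow> fmon SS i \<in> fv.span (tf ` TI k)" by (intro generated fmon_PPh F)
    show "\<And>c i. (\<And>y. (\<Sum>i\<in>Mon SS k. c i * fmon SS i y) = 0) \<Longrightarrow> i \<in> Mon SS k \<Longrightarrow> c i = 0"
      by (rule fmon_independent[OF F])
  qed (use finite_Mon[OF F] TI_finite in auto)
  show "card (TI k) \<le> card (Mon SS k)"
  proof (rule card_le_of_independent_family[where f = tf and g = "fmon SS"])
    fix i assume i: "i \<in> TI k"
    obtain c where "tf i = (\<lambda>y. \<Sum>a\<in>Mon SS k. c a * fmon SS a y)" by (rule PPh_fmon_expand[OF F tf_PPh[OF i]])
    hence "tf i = (\<Sum>a\<in>Mon SS k. fscale (c a) (fmon SS a))" by (auto simp: fun_eq_iff fun_sum_apply fscale_def)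
    also have "\<dots> \<in> fv.span (fmon SS ` Mon SS k)" by (intro fv.span_sum fv.span_scale fv.span_base) auto
    finally show "tf i \<in> fv.span (fmon SS ` Mon SS k)" .
  next
    show "\<And>c i. (\<And>y. (\<Sum>i\<in>TI k. c i * tf i y) = 0) \<Longrightarrow> i \<in> TI k \<Longrightarrow> c i = 0"
      by (rule tf_independent)
  qed (use finite_Mon[OF F] TI_finite in auto)
qed

text \<open>The Hilbert function is computed twice: from the partition of Courant monomials among
  the cones, and from the free basis. Both are convolutions with the Hilbert function of the
  polynomial ring, which can be cancelled.\<close>

lemma card_neg_eq: "card {S\<in>SS. card (neg x S) = k} = card {u\<in>\<beta>. d u = k}"
proof (rule count_from_convolution[where N = "\<lambda>j. card (expo B j)"])
  fix k
  have "(\<Sum>S\<in>SS. if card (neg x S) \<le> k then card (expo B (k - card (neg x S))) else 0)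
      = (\<Sum>S\<in>SS. card {a \<in> expo S k. \<forall>v\<in>neg x S. a v > 0})"
  proof (intro sum.cong refl)
    fix S assume S: "S \<in> SS"
    have "card B = card S" using is_basis_dim[OF B] is_basis_dim[OF sfanD(2)[OF F S]] by simp
    from card_expo_cong[OF finite_B sfanD(5)[OF F S] this]
    show "(if card (neg x S) \<le> k then card (expo B (k - card (neg x S))) else 0) = card {a \<in> expo S k. \<forall>v\<in>neg x S. a v > 0}"
      using card_expo_pos[OF sfanD(5)[OF F S], of "neg x S" k] by (simp add: neg_def)
  qed
  also have "\<dots> = card (Mon SS k)"
    unfolding Mon_partition(1)[OF F gen]
  proof (rule card_UN_disjoint[symmetric])
    show "\<forall>S\<in>SS. finite {a \<in> expo S k. \<forall>v\<in>neg x S. a v > 0}" using finite_expo[OF sfanD(5)[OF F]] by simp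
    show "\<forall>S\<in>SS. \<forall>T\<in>SS. S \<noteq> T \<longrightarrow> {a \<in> expo S k. \<forall>v\<in>neg x S. a v > 0} \<inter> {a \<in> expo T k. \<forall>v\<in>neg x T. a v > 0} = {}"
      using Mon_partition(2)[OF F gen] by blast
  qed (rule sfanD(1)[OF F])
  also have "\<dots> = (\<Sum>u\<in>{u\<in>\<beta>. d u \<le> k}. card (expo B (k - d u)))"
    unfolding card_Mon TI_def using beta_finite finite_expo[OF finite_B] by (subst card_SigmaI) auto
  also have "\<dots> = (\<Sum>u\<in>\<beta>. if d u \<le> k then card (expo B (k - d u)) else 0)"
    using beta_finite by (intro sum.mono_neutral_cong_left) auto
  finally show "(\<Sum>S\<in>SS. if card (neg x S) \<le> k then card (expo B (k - card (neg x S))) else 0)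
    = (\<Sum>u\<in>\<beta>. if d u \<le> k then card (expo B (k - d u)) else 0)" .
qed (use sfanD(1)[OF F] beta_finite card_expo_0[OF finite_B] in auto)

lemma dim_Elt_neg: "fv.dim (Elt SS x k) = card {S\<in>SS. card (neg x S) < k}"
proof -
  have split: "card {a\<in>X. f a < k} = (\<Sum>j<k. card {a\<in>X. f a = j})" if X: "finite X" for X :: "'x set" and f :: "'x \<Rightarrow> nat"
  proof -
    have "{a\<in>X. f a < k} = (\<Union>j<k. {a\<in>X. f a = j})" by auto
    moreover have "card \<dots> = (\<Sum>j<k. card {a\<in>X. f a = j})" using X by (intro card_UN_disjoint) auto
    ultimately show ?thesis by simp
  qed
  show ?thesis unfolding dim_Elt split[OF beta_finite] split[OF sfanD(1)[OF F]] card_neg_eq ..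
qed

end

text \<open>A homogeneous section only acquires a sign when it is evaluated at the opposite
  point.\<close>

lemma Elt_minus: assumes F: "sfan SS" shows "Elt SS (- x) k = Elt SS x k"
proof -
  have sub: "ev SS (- x) ` PPh SS j \<subseteq> ev SS x ` PPh SS j" for x j
  proof
    fix u assume "u \<in> ev SS (- x) ` PPh SS j"
    then obtain f where f: "f \<in> PPh SS j" "u = ev SS (- x) f" by auto
    have "u = ev SS x (\<lambda>y. (-1) ^ j * f y)"
    proof
      fix S
      have "pc f S (- x) = (- 1) ^ j * pc f S x" if "S \<in> SS"
        using pc_PPh[OF f(1) that sfanD(2)[OF F that]] by (metis homogeneous_poly_def scaleR_minus1_left)
      thus "u S = ev SS x (\<lambda>y. (-1) ^ j * f y) S"
        unfolding ev_cmult[OF F PPh_PP[OF f(1)]] f(2) by (simp add: ev_def fscale_def)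
    qed
    thus "u \<in> ev SS x ` PPh SS j" using PPh_cmult[OF f(1), of "(-1) ^ j"] by blast
  qed
  have "ev SS (- x) ` PPh SS j = ev SS x ` PPh SS j" for j
    using sub[of x j] sub[of "- x" j] by auto
  thus ?thesis by (simp add: Elt_def)
qed

lemma neg_minus:
  assumes F: "sfan SS" and g: "generic SS x" and S: "S \<in> SS"
  shows "neg (- x) S = S - neg x S"
  using g S sfanD(2)[OF F S] by (force simp: neg_def rep_minus generic_def)

section \<open>Integrality of the localized integral\<close>

definition ker :: "'a::real_vector set \<times> 'a \<Rightarrow> 'a set" where
  "ker i = {y. representation (fst i) y (snd i) = 0}"

text \<open>The weight stands for the absolute volume of the generators of a cone; the volume form
  enters the integrality proof through its change under the exchange of one generator.\<close>

locale weighted_fan =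
  fixes SS :: "'a::real_normed_vector set set" and w :: "'a set \<Rightarrow> real"
  assumes F: "sfan SS" and w_pos: "S \<in> SS \<Longrightarrow> w S > 0"
    and w_adj: "S \<in> SS \<Longrightarrow> T \<in> SS \<Longrightarrow> v \<in> S \<Longrightarrow> u \<in> T \<Longrightarrow> T - {u} = S - {v} \<Longrightarrow>
      w T = w S * \<bar>representation S u v\<bar>"
begin

definition FS :: "'a set \<Rightarrow> 'a \<Rightarrow> real" where
  "FS S y = w S * (\<Prod>v\<in>S. representation S y v)"

definition I :: "('a set \<times> 'a) set" where "I = Sigma SS (\<lambda>S. S)"

definition HH :: "'a set set" where "HH = ker ` I"

text \<open>One linear form is fixed for each hyperplane, so that the denominators \<open>FS S\<close> have a square-free
  common denominator \<open>DD\<close>.\<close>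

definition form :: "'a set \<Rightarrow> 'a \<Rightarrow> real" where
  "form H = (let i = SOME i. i \<in> I \<and> ker i = H in (\<lambda>y. representation (fst i) y (snd i)))"

definition cc :: "'a set \<Rightarrow> 'a \<Rightarrow> real" where
  "cc S v = (SOME c. c \<noteq> 0 \<and> (\<forall>y. representation S y v = c * form (ker (S, v)) y))"

lemma fin: "finite I" "finite HH"
  unfolding HH_def I_def using sfanD(1,5)[OF F] by auto

lemma form_rep:
  assumes "H \<in> HH"
  obtains S v where "S \<in> SS" "v \<in> S" "ker (S, v) = H" "form H = (\<lambda>y. representation S y v)"
proof -
  define i where "i = (SOME i. i \<in> I \<and> ker i = H)"
  have "\<exists>i. i \<in> I \<and> ker i = H" using assms by (auto simp: HH_def)
  hence "i \<in> I \<and> ker i = H" unfolding i_def by (rule someI_ex)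
  moreover have "form H = (\<lambda>y. representation (fst i) y (snd i))" by (simp add: form_def i_def Let_def)
  ultimately show ?thesis using that[of "fst i" "snd i"] by (auto simp: I_def)
qed

lemma form_zero: "H \<in> HH \<Longrightarrow> form H y = 0 \<longleftrightarrow> y \<in> H"
  by (erule form_rep) (auto simp: ker_def)

lemma form_linear: "H \<in> HH \<Longrightarrow> linear (form H)"
  by (erule form_rep) (simp add: rep_linear sfanD(2)[OF F])

lemma form_hom: "H \<in> HH \<Longrightarrow> homogeneous_poly 1 (form H)"
  by (erule form_rep) (simp add: homogeneous_poly_rep[OF sfanD(2)[OF F], simplified])

lemma form_nonzero: "H \<in> HH \<Longrightarrow> \<exists>z. form H z = 1"
proof (erule form_rep)
  fix S v assume "S \<in> SS" "v \<in> S" "form H = (\<lambda>y. representation S y v)"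
  thus ?thesis using rep_basis[OF sfanD(2)[OF F], of S v v] by auto
qed

lemma ker_subspace: "H \<in> HH \<Longrightarrow> subspace H"
proof -
  assume H: "H \<in> HH"
  have "H = {y. form H y = 0}" using form_zero[OF H] by auto
  thus ?thesis using linear_subspace_kernel[OF form_linear[OF H]] by simp
qed

text \<open>Subtracting a multiple of \<open>z\<close> moves any vector into the kernel of the
  second form.\<close>

lemma kernel_proportional:
  fixes l l' :: "'a \<Rightarrow> real"
  assumes "linear l" "linear l'" "l' z = 1" "\<And>y. l' y = 0 \<Longrightarrow> l y = 0"
  shows "l y = l z * l' y"
proof -
  have "l' (y - l' y *\<^sub>R z) = 0" using assms by (simp add: linear_diff linear_scale)
  from assms(4)[OF this] show ?thesis using assms by (simp add: linear_diff linear_scale)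
qed

lemma HH_not_subset:
  assumes H: "H \<in> HH" "H' \<in> HH" "H \<noteq> H'"
  shows "\<exists>y\<in>H'. form H y \<noteq> 0"
proof (rule ccontr)
  assume "\<not> ?thesis"
  hence z: "\<And>y. form H' y = 0 \<Longrightarrow> form H y = 0" using form_zero[OF H(2)] by blast
  obtain z where z1: "form H' z = 1" using form_nonzero[OF H(2)] by blast
  have eq: "form H y = form H z * form H' y" for y
    by (rule kernel_proportional[OF form_linear[OF H(1)] form_linear[OF H(2)] z1]) (rule z)
  obtain y where "form H y = 1" using form_nonzero[OF H(1)] by blast
  hence "form H z \<noteq> 0" using eq[of y] by auto
  hence "form H y = 0 \<longleftrightarrow> form H' y = 0" for y using eq[of y] by simp
  hence "H = H'" using form_zero[OF H(1)] form_zero[OF H(2)] by blast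
  thus False using H by simp
qed

lemma kerHH: "S \<in> SS \<Longrightarrow> v \<in> S \<Longrightarrow> ker (S, v) \<in> HH"
  by (auto simp: HH_def I_def)

lemma cc: assumes S: "S \<in> SS" "v \<in> S"
  shows "cc S v \<noteq> 0" "representation S y v = cc S v * form (ker (S, v)) y"
proof -
  have bS: "is_basis S" using sfanD(2)[OF F S(1)] .
  note H = kerHH[OF S]
  obtain z where z: "form (ker (S, v)) z = 1" using form_nonzero[OF H] by blast
  have eq: "representation S y v = representation S z v * form (ker (S, v)) y" for y
    by (rule kernel_proportional[OF rep_linear[OF bS] form_linear[OF H] z])
      (use form_zero[OF H] in \<open>auto simp: ker_def\<close>)
  have "representation S v v = 1" using rep_basis[OF bS S(2)] by simp
  hence "representation S z v \<noteq> 0" using eq[of v] by auto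
  hence "\<exists>c. c \<noteq> 0 \<and> (\<forall>y. representation S y v = c * form (ker (S, v)) y)" using eq by blast
  from someI_ex[OF this, folded cc_def] show "cc S v \<noteq> 0" "representation S y v = cc S v * form (ker (S, v)) y" by auto
qed

definition KS :: "'a set \<Rightarrow> 'a set set" where "KS S = (\<lambda>v. ker (S, v)) ` S"

lemma KS_sub: "S \<in> SS \<Longrightarrow> KS S \<subseteq> HH" by (auto simp: KS_def kerHH)

lemma ker_inj: "S \<in> SS \<Longrightarrow> inj_on (\<lambda>v. ker (S, v)) S"
proof (rule inj_onI, rule ccontr)
  fix v u assume S: "S \<in> SS" "v \<in> S" "u \<in> S" "ker (S, v) = ker (S, u)" "v \<noteq> u"
  have "v \<in> ker (S, u)" "v \<notin> ker (S, v)"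
    using rep_basis[OF sfanD(2)[OF F S(1)] S(2)] S(5) by (auto simp: ker_def)
  thus False using S(4) by simp
qed

definition \<gamma> :: "'a set \<Rightarrow> real" where "\<gamma> S = w S * (\<Prod>v\<in>S. cc S v)"

lemma gamma_nz: "S \<in> SS \<Longrightarrow> \<gamma> S \<noteq> 0"
  using w_pos[of S] cc(1) sfanD(5)[OF F] by (auto simp: \<gamma>_def)

lemma FS_forms: assumes S: "S \<in> SS" shows "FS S y = \<gamma> S * (\<Prod>H\<in>KS S. form H y)"
proof -
  have "(\<Prod>v\<in>S. representation S y v) = (\<Prod>v\<in>S. cc S v) * (\<Prod>v\<in>S. form (ker (S, v)) y)"
    using cc(2)[OF S] by (simp add: prod.distrib)
  also have "(\<Prod>v\<in>S. form (ker (S, v)) y) = (\<Prod>H\<in>KS S. form H y)"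
    unfolding KS_def by (simp add: prod.reindex[OF ker_inj[OF S]])
  finally show ?thesis by (simp add: FS_def \<gamma>_def)
qed

definition DD :: "'a \<Rightarrow> real" where "DD y = (\<Prod>H\<in>HH. form H y)"

text \<open>The quotient of the common denominator \<open>DD\<close> by \<open>FS S\<close>, written
  as a polynomial.\<close>

definition gS :: "'a set \<Rightarrow> 'a \<Rightarrow> real" where "gS S y = (1 / \<gamma> S) * (\<Prod>H\<in>HH - KS S. form H y)"

lemma gS_FS: assumes S: "S \<in> SS" shows "gS S y * FS S y = DD y"
proof -
  have "DD y = (\<Prod>H\<in>HH - KS S. form H y) * (\<Prod>H\<in>KS S. form H y)"
    unfolding DD_def using prod.subset_diff[OF KS_sub[OF S] fin(2)] by simp
  thus ?thesis unfolding FS_forms[OF S] gS_def using gamma_nz[OF S] by simp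
qed

lemma hom_prod: "finite X \<Longrightarrow> X \<subseteq> HH \<Longrightarrow> homogeneous_poly (card X) (\<lambda>y. \<Prod>H\<in>X. form H y)"
proof (induction X rule: finite_induct)
  case empty show ?case using homogeneous_poly_const[of 1] by simp
next
  case (insert H X)
  thus ?case using homogeneous_poly_mult[OF form_hom[of H], of "card X" "\<lambda>y. \<Prod>H\<in>X. form H y"] by simp
qed

lemma card_KS: "S \<in> SS \<Longrightarrow> card (KS S) = dim (UNIV :: 'a set)"
  unfolding KS_def using card_image[OF ker_inj] is_basis_dim[OF sfanD(2)[OF F]] by simp

lemma gS_hom: assumes S: "S \<in> SS" shows "homogeneous_poly (card HH - dim (UNIV :: 'a set)) (gS S)"
proof -
  have "card (HH - KS S) = card HH - dim (UNIV :: 'a set)"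
    using card_Diff_subset[OF _ KS_sub[OF S]] finite_subset[OF KS_sub[OF S] fin(2)] card_KS[OF S] by simp
  thus ?thesis
    using homogeneous_poly_cmult[OF hom_prod[of "HH - KS S"], of "1 / \<gamma> S"] fin(2) by (simp add: gS_def[abs_def])
qed

text \<open>The forms are divided out one at a time. On another hyperplane the divided form is not
  identically zero, so it can be cancelled there and the quotient still vanishes.\<close>

lemma hom_divide_forms:
  assumes X: "finite X" "X \<subseteq> HH" and P: "homogeneous_poly k P" and z: "\<And>H y. H \<in> X \<Longrightarrow> y \<in> H \<Longrightarrow> P y = 0"
  shows "\<exists>q. homogeneous_poly (k - card X) q \<and> (k < card X \<longrightarrow> q = (\<lambda>_. 0)) \<and> P = (\<lambda>y. (\<Prod>H\<in>X. form H y) * q y)"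
  using X P z
proof (induction X arbitrary: k P rule: finite_induct)
  case empty
  thus ?case by (intro exI[of _ P]) auto
next
  case (insert H X)
  have H: "H \<in> HH" using insert.prems by auto
  obtain S v where Sv: "S \<in> SS" "v \<in> S" "ker (S, v) = H" "form H = (\<lambda>y. representation S y v)" using form_rep[OF H] by metis
  have "\<exists>q. homogeneous_poly (k - card {v}) q \<and> (k < card {v} \<longrightarrow> q = (\<lambda>_. 0)) \<and> P = (\<lambda>y. (\<Prod>v\<in>{v}. representation S y v) * q y)"
  proof (rule hom_divide_prod[OF sfanD(2)[OF F Sv(1)] _ insert.prems(2)])
    fix v' y assume "v' \<in> {v}" "representation S y v' = 0"
    hence "y \<in> H" using Sv(3) by (auto simp: ker_def)
    thus "P y = 0" using insert.prems(3) by blast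
  qed (use Sv in auto)
  then obtain q where q: "homogeneous_poly (k - 1) q" "k < 1 \<longrightarrow> q = (\<lambda>_. 0)" "P = (\<lambda>y. form H y * q y)"
    unfolding Sv(4) by auto
  have qz: "q y = 0" if H': "H' \<in> X" "y \<in> H'" for H' y
  proof -
    have H'2: "H' \<in> HH" "H \<noteq> H'" using H' insert.prems insert.hyps by auto
    obtain z where z: "z \<in> H'" "form H z \<noteq> 0" using HH_not_subset[OF H H'2] by blast
    show ?thesis
    proof (rule poly_mult_zero[OF homogeneous_poly_poly[OF q(1)] homogeneous_poly_poly[OF form_hom[OF H]] ker_subspace[OF H'2(1)] _ z H'(2)])
      fix y assume "y \<in> H'"
      hence "P y = 0" using insert.prems(3) H' by blast
      thus "q y * form H y = 0" using q(3) by (metis mult.commute)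
    qed
  qed
  have "\<exists>r. homogeneous_poly (k - 1 - card X) r \<and> (k - 1 < card X \<longrightarrow> r = (\<lambda>_. 0)) \<and> q = (\<lambda>y. (\<Prod>H\<in>X. form H y) * r y)"
    by (rule insert.IH[OF _ q(1)]) (use insert.prems(1) in blast, rule qz)
  then obtain r where r: "homogeneous_poly (k - 1 - card X) r" "k - 1 < card X \<longrightarrow> r = (\<lambda>_. 0)" "q = (\<lambda>y. (\<Prod>H\<in>X. form H y) * r y)"
    by blast
  show ?case
  proof (cases "k < 1")
    case True
    have "P = (\<lambda>y. (\<Prod>H\<in>insert H X. form H y) * 0)" using q True by auto
    thus ?thesis by (intro exI[of _ "\<lambda>_. 0"]) (auto simp: homogeneous_poly_zero)
  next
    case False
    thus ?thesis using r q(3) insert.hyps by (intro exI[of _ r]) (auto simp: mult.assoc)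
  qed
qed

text \<open>Cancelling the form of the wall in \<open>gS_FS\<close> gives an identity that is still
  meaningful on the wall and whose right side is the same for the adjacent cone.\<close>

lemma gS_wall:
  assumes S: "S \<in> SS" "v \<in> S"
  shows "gS S y * (w S * (\<Prod>t\<in>S - {v}. representation S y t)) * cc S v = (\<Prod>H\<in>HH - {ker (S, v)}. form H y)"
proof -
  define H where "H = ker (S, v)"
  have H: "H \<in> HH" unfolding H_def by (rule kerHH[OF S])
  have bS: "is_basis S" using sfanD(2)[OF F S(1)] .
  have fS: "finite S" using sfanD(5)[OF F S(1)] .
  define P where "P = (\<lambda>y. gS S y * (w S * (\<Prod>t\<in>S - {v}. representation S y t)) * cc S v - (\<Prod>H\<in>HH - {H}. form H y))"
  obtain z where z: "form H z = 1" using form_nonzero[OF H] by blast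
  have "P y = 0"
  proof (rule poly_mult_zero[where P = P and X = "form H" and U = UNIV and x = z])
    show "real_polynomial_function P" unfolding P_def
      using fS fin(2) hom_prod[of "HH - {H}"]
      by (intro real_polynomial_function_diff real_polynomial_function.intros(2,4) real_polynomial_function_prod rep_poly bS
          homogeneous_poly_poly[OF gS_hom[OF S(1)]]) (auto intro: homogeneous_poly_poly form_hom)
    show "real_polynomial_function (form H)" by (rule homogeneous_poly_poly[OF form_hom[OF H]])
    fix y
    have "P y * form H y = gS S y * (w S * ((\<Prod>t\<in>S - {v}. representation S y t) * (cc S v * form H y))) - (\<Prod>H\<in>HH - {H}. form H y) * form H y"
      by (simp add: P_def algebra_simps)
    also have "cc S v * form H y = representation S y v" using cc(2)[OF S] by (simp add: H_def)
    also have "(\<Prod>t\<in>S - {v}. representation S y t) * representation S y v = (\<Prod>t\<in>S. representation S y t)"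
      using fS S(2) by (simp add: prod.remove mult.commute)
    also have "(\<Prod>H\<in>HH - {H}. form H y) * form H y = DD y"
      unfolding DD_def using fin(2) H by (simp add: prod.remove mult.commute)
    finally show "P y * form H y = 0" using gS_FS[OF S(1), of y] by (simp add: FS_def)
  next
    show "form H z \<noteq> 0" using z by simp
  qed auto
  thus ?thesis by (simp add: P_def H_def)
qed

lemma adjacent_rep:
  assumes S: "S \<in> SS" "v \<in> S" and T: "T \<in> SS" "u \<in> T" "T - {u} = S - {v}"
  shows "representation S y v = representation T y u * representation S u v"
proof -
  have b: "is_basis S" "is_basis T" using sfanD(2)[OF F] S T by auto
  have "representation S y v = (\<Sum>t\<in>T. representation T y t * representation S t v)"
    using linear_expand[OF b(2) rep_linear[OF b(1), of v], where y = y] by simp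
  also have "\<dots> = (\<Sum>t\<in>{u}. representation T y t * representation S t v)"
  proof (rule sum.mono_neutral_right)
    show "\<forall>t\<in>T - {u}. representation T y t * representation S t v = 0"
    proof
      fix t assume "t \<in> T - {u}"
      hence "t \<in> S" "t \<noteq> v" using T(3) by auto
      thus "representation T y t * representation S t v = 0" using rep_basis[OF b(1)] by simp
    qed
  qed (use T b in \<open>auto simp: is_basis_def\<close>)
  finally show ?thesis by simp
qed

text \<open>On the hyperplane of a common wall the polynomials of \<open>f\<close> agree, and so do
  the coordinates of the generators of the wall. The residual factors differ by a sign, since the
  coordinate of \<open>u\<close> is negative while the weights change by its absolute value.\<close>

lemma adjacent_cancel:
  assumes f: "f \<in> PP SS" and S: "S \<in> SS" "v \<in> S" and T: "T \<in> SS" "u \<in> T" "T - {u} = S - {v}" "T \<noteq> S"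
    and y: "y \<in> ker (S, v)"
  shows "ker (T, u) = ker (S, v)" "pc f T y * gS T y = - (pc f S y * gS S y)"
proof -
  define H where "H = ker (S, v)"
  have b: "is_basis S" "is_basis T" using sfanD(2)[OF F] S T by auto
  have fS: "finite S" "finite T" using b by (auto simp: is_basis_def)
  note ar = adjacent_rep[OF S T(1-3)]
  have neg: "representation S u v < 0" by (rule wall_opposite[OF F T(1,2) S T(3)[symmetric] T(4)[symmetric]])
  have kz: "representation T y u = 0 \<longleftrightarrow> representation S y v = 0" for y
    by (subst ar) (use neg in simp)
  show K: "ker (T, u) = ker (S, v)" by (simp add: ker_def kz)
  have H: "H \<in> HH" unfolding H_def by (rule kerHH[OF S])
  have repeq: "representation T y t = representation S y t" if t: "t \<in> S - {v}" and y: "y \<in> H" for y t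
  proof -
    have "y = (\<Sum>s\<in>S. representation S y s *\<^sub>R s)" using rep_sum[OF b(1)] by simp
    also have "\<dots> = (\<Sum>s\<in>S - {v}. representation S y s *\<^sub>R s)"
      using fS S(2) y by (simp add: sum.remove[of S v] H_def ker_def)
    finally have "representation T y t = representation T (\<Sum>s\<in>S - {v}. representation S y s *\<^sub>R s) t" by simp
    also have "\<dots> = representation S y t" using t T(3) by (subst rep_lincomb[OF b(2)]) auto
    finally show ?thesis .
  qed
  have ccT: "cc S v = cc T u * representation S u v"
  proof -
    obtain z where z: "form H z = 1" using form_nonzero[OF H] by blast
    have "cc S v = representation S z v" using cc(2)[OF S, of z] z by (simp add: H_def)
    also have "\<dots> = representation T z u * representation S u v" by (rule ar)
    also have "representation T z u = cc T u" using cc(2)[OF T(1,2), of z] z K by (simp add: H_def)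
    finally show ?thesis .
  qed
  \<comment> \<open>Together with \<open>ccT\<close>, the absolute value here and the negative
    coordinate there leave exactly a minus sign.\<close>
  have "w T = w S * \<bar>representation S u v\<bar>" using w_adj[OF S(1) T(1) S(2) T(2,3)] .
  hence wcc: "w T * cc T u = - (w S * cc S v)" using neg ccT by simp
  define X where "X = (\<lambda>y. \<Prod>t\<in>S - {v}. representation S y t)"
  have gsum: "gS S y + gS T y = 0" if yH: "y \<in> H" for y
  proof (rule poly_mult_zero[of "\<lambda>y. gS S y + gS T y" X H])
    show "real_polynomial_function (\<lambda>y. gS S y + gS T y)"
      by (intro real_polynomial_function.intros(3) homogeneous_poly_poly[OF gS_hom] S T)
    show "real_polynomial_function X" unfolding X_def using fS by (intro real_polynomial_function_prod rep_poly b) auto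
    show "subspace H" by (rule ker_subspace[OF H])
    show "(\<Sum>t\<in>S - {v}. 1 *\<^sub>R t) \<in> H"
      unfolding H_def ker_def fst_conv snd_conv mem_Collect_eq by (subst rep_lincomb[OF b(1)]) auto
    show "X (\<Sum>t\<in>S - {v}. 1 *\<^sub>R t) \<noteq> 0"
    proof -
      have "representation S (\<Sum>t\<in>S - {v}. 1 *\<^sub>R t) s = 1" if "s \<in> S - {v}" for s
        using that by (subst rep_lincomb[OF b(1)]) auto
      hence "X (\<Sum>t\<in>S - {v}. 1 *\<^sub>R t) = (\<Prod>s\<in>S - {v}. 1)" unfolding X_def by (intro prod.cong refl)
      thus ?thesis by simp
    qed
    fix y assume y: "y \<in> H"
    have XT: "(\<Prod>t\<in>T - {u}. representation T y t) = X y"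
      unfolding X_def T(3) using repeq[OF _ y] by (intro prod.cong) auto
    have 1: "gS S y * (w S * X y) * cc S v = (\<Prod>H\<in>HH - {H}. form H y)"
      using gS_wall[OF S, of y] by (simp add: X_def H_def)
    have 2: "gS T y * (w T * X y) * cc T u = (\<Prod>H\<in>HH - {H}. form H y)"
      using gS_wall[OF T(1,2), of y] XT K by (simp add: H_def)
    have "gS T y * X y * (w T * cc T u) = gS S y * X y * (w S * cc S v)"
      using 1 2 by (simp add: mult_ac)
    hence "(w S * cc S v) * ((gS S y + gS T y) * X y) = 0" unfolding wcc by (simp add: algebra_simps)
    thus "(gS S y + gS T y) * X y = 0" using w_pos[OF S(1)] cc(1)[OF S] by simp
  qed (rule yH)
  have peq: "pc f S y = pc f T y" if yH: "y \<in> H" for y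
  proof -
    have pz: "pc f S (\<Sum>s\<in>S - {v}. t s *\<^sub>R s) - pc f T (\<Sum>s\<in>S - {v}. t s *\<^sub>R s) = 0" for t
    proof (rule poly_vanish_span[OF b(1), where p = "\<lambda>y. pc f S y - pc f T y"])
      show "real_polynomial_function (\<lambda>y. pc f S y - pc f T y)"
        by (intro real_polynomial_function_diff pc_PP(1)[OF f] S T b)
      fix t :: "'a \<Rightarrow> real" assume t: "\<And>s. s \<in> S - {v} \<Longrightarrow> t s > 0"
      define z where "z = (\<Sum>s\<in>S - {v}. t s *\<^sub>R s)"
      have "z \<in> bcone S" unfolding z_def using t by (intro bcone_lincomb b) (auto simp: less_imp_le)
      moreover have "z \<in> bcone T" unfolding z_def T(3)[symmetric] using t T(3) by (intro bcone_lincomb b) (auto simp: less_imp_le)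
      ultimately show "pc f S (\<Sum>s\<in>S - {v}. t s *\<^sub>R s) - pc f T (\<Sum>s\<in>S - {v}. t s *\<^sub>R s) = 0"
        using pc_PP(2)[OF f S(1) b(1)] pc_PP(2)[OF f T(1) b(2)] by (simp add: z_def)
    qed auto
    have ye: "(\<Sum>s\<in>S - {v}. representation S y s *\<^sub>R s) = y"
    proof -
      have "y = (\<Sum>s\<in>S. representation S y s *\<^sub>R s)" using rep_sum[OF b(1)] by simp
      thus ?thesis using fS S(2) yH by (simp add: sum.remove[of S v] H_def ker_def)
    qed
    show ?thesis using pz[of "representation S y"] unfolding ye by simp
  qed
  have yH: "y \<in> H" using y by (simp add: H_def)
  have "gS T y = - gS S y" using gsum[OF yH] by linarith
  thus "pc f T y * gS T y = - (pc f S y * gS S y)" using peq[OF yH] by simp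
qed

text \<open>Cones with a wall in \<open>H\<close> come in adjacent pairs whose terms cancel on
  \<open>H\<close>; for any other cone the cofactor contains the form of \<open>H\<close>. Adjacency
  across \<open>H\<close> is an involution because walls determine their neighbours.\<close>

lemma numerator_vanishes:
  assumes f: "f \<in> PP SS" and H: "H \<in> HH" and y: "y \<in> H"
  shows "(\<Sum>S\<in>SS. pc f S y * gS S y) = 0"
proof -
  define SH where "SH = {S\<in>SS. H \<in> KS S}"
  have fSH: "finite SH" using sfanD(1)[OF F] by (simp add: SH_def)
  define A where "A = (\<lambda>S T. T \<in> SS \<and> T \<noteq> S \<and> (\<exists>v\<in>S. \<exists>u\<in>T. T - {u} = S - {v} \<and> ker (S, v) = H))"
  define adj where "adj = (\<lambda>S. SOME T. A S T)"
  have A: "A S (adj S)" if S: "S \<in> SH" for S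
  proof -
    obtain v where v: "v \<in> S" "ker (S, v) = H" "S \<in> SS" using S by (auto simp: SH_def KS_def)
    obtain T u where "T \<in> SS" "u \<in> T" "T - {u} = S - {v}" "T \<noteq> S" using wall_exists[OF F v(3,1)] by metis
    hence "\<exists>T. A S T" using v unfolding A_def by blast
    thus ?thesis unfolding adj_def by (rule someI_ex)
  qed
  have sym: "A T S" if S: "S \<in> SH" and AS: "A S T" for S T
  proof -
    obtain v u where vu: "v \<in> S" "u \<in> T" "T - {u} = S - {v}" "ker (S, v) = H" "T \<in> SS" "T \<noteq> S" using AS by (auto simp: A_def)
    have S: "S \<in> SS" using S by (simp add: SH_def)
    have "ker (T, u) = H" using adjacent_cancel(1)[OF f S vu(1,5,2,3,6)] y vu(4) by auto
    thus ?thesis using vu S unfolding A_def by metis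
  qed
  have uniq: "T = T'" if S: "S \<in> SH" and AT: "A S T" and AT': "A S T'" for S T T'
  proof -
    have S: "S \<in> SS" using S by (simp add: SH_def)
    obtain v u where vu: "v \<in> S" "u \<in> T" "T - {u} = S - {v}" "ker (S, v) = H" "T \<in> SS" "T \<noteq> S" using AT by (auto simp: A_def)
    obtain v' u' where vu': "v' \<in> S" "u' \<in> T'" "T' - {u'} = S - {v'}" "ker (S, v') = H" "T' \<in> SS" "T' \<noteq> S" using AT' by (auto simp: A_def)
    have "v = v'" using ker_inj[OF S] vu(1,4) vu'(1,4) by (auto simp: inj_on_def)
    thus ?thesis using wall_unique[OF F S vu(1,5,2,3,6) vu'(5,2)] vu' by blast
  qed
  have adjSH: "adj S \<in> SH" if S: "S \<in> SH" for S
  proof -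
    have "A (adj S) S" using sym[OF S A[OF S]] .
    moreover have "adj S \<in> SS" using A[OF S] by (simp add: A_def)
    ultimately show ?thesis by (auto simp: A_def SH_def KS_def)
  qed
  have inv: "adj (adj S) = S" if S: "S \<in> SH" for S
    using uniq[OF adjSH[OF S] A[OF adjSH[OF S]] sym[OF S A[OF S]]] .
  have flip: "pc f (adj S) y * gS (adj S) y = - (pc f S y * gS S y)" if S: "S \<in> SH" for S
  proof -
    have SS: "S \<in> SS" using S by (simp add: SH_def)
    obtain v u where vu: "v \<in> S" "u \<in> adj S" "adj S - {u} = S - {v}" "ker (S, v) = H" "adj S \<in> SS" "adj S \<noteq> S"
      using A[OF S] by (auto simp: A_def)
    show ?thesis using adjacent_cancel(2)[OF f SS vu(1,5,2,3,6)] y vu(4) by auto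
  qed
  have "(\<Sum>S\<in>SH. pc f S y * gS S y) = (\<Sum>S\<in>SH. pc f (adj S) y * gS (adj S) y)"
    by (rule sum.reindex_bij_witness[of _ adj adj]) (auto simp: inv adjSH)
  also have "\<dots> = - (\<Sum>S\<in>SH. pc f S y * gS S y)" by (simp add: flip sum_negf)
  finally have "(\<Sum>S\<in>SH. pc f S y * gS S y) = 0" by linarith
  moreover have "(\<Sum>S\<in>SS. pc f S y * gS S y) = (\<Sum>S\<in>SH. pc f S y * gS S y)"
  proof (rule sum.mono_neutral_right)
    show "\<forall>S\<in>SS - SH. pc f S y * gS S y = 0"
    proof
      fix S assume "S \<in> SS - SH"
      hence "H \<in> HH - KS S" using H by (auto simp: SH_def)
      moreover have "form H y = 0" using form_zero[OF H] y by simp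
      ultimately have "(\<Prod>H\<in>HH - KS S. form H y) = 0" using fin(2) by (intro prod_zero) auto
      thus "pc f S y * gS S y = 0" by (simp add: gS_def)
    qed
  qed (use sfanD(1)[OF F] in \<open>auto simp: SH_def\<close>)
  ultimately show ?thesis by simp
qed

text \<open>The numerator over the common denominator vanishes on every hyperplane, so it is
  divisible by the product of the forms. The quotient has degree \<open>k - n\<close>; if
  \<open>k < n\<close> it is zero, a case that truncated subtraction would hide.\<close>

theorem zeta_exists:
  assumes f: "f \<in> PPh SS k"
  shows "\<exists>p. homogeneous_poly (k - dim (UNIV :: 'a set)) p \<and> (k < dim (UNIV :: 'a set) \<longrightarrow> p = (\<lambda>_. 0)) \<and>
    (\<forall>y. (\<forall>S\<in>SS. FS S y \<noteq> 0) \<longrightarrow> p y = (\<Sum>S\<in>SS. pc f S y / FS S y))"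
proof -
  define n where "n = dim (UNIV :: 'a set)"
  define m where "m = card HH"
  obtain S0 where S0: "S0 \<in> SS" using sfanD(3)[OF F] by blast
  have nm: "n \<le> m" using card_mono[OF fin(2) KS_sub[OF S0]] card_KS[OF S0] by (simp add: n_def m_def)
  define P where "P = (\<lambda>y. \<Sum>S\<in>SS. pc f S y * gS S y)"
  have P: "homogeneous_poly (k + (m - n)) P"
    unfolding P_def m_def n_def by (intro homogeneous_poly_sum homogeneous_poly_mult gS_hom pc_PPh[OF f] sfanD(2)[OF F])
  have "\<exists>q. homogeneous_poly (k + (m - n) - card HH) q \<and> (k + (m - n) < card HH \<longrightarrow> q = (\<lambda>_. 0)) \<and> P = (\<lambda>y. (\<Prod>H\<in>HH. form H y) * q y)"
    by (rule hom_divide_forms[OF fin(2) order_refl P]) (simp add: P_def numerator_vanishes[OF PPh_PP[OF f]])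
  then obtain q where q: "homogeneous_poly (k + (m - n) - m) q" "k + (m - n) < m \<longrightarrow> q = (\<lambda>_. 0)" "P = (\<lambda>y. DD y * q y)"
    unfolding m_def DD_def by blast
  have "q y = (\<Sum>S\<in>SS. pc f S y / FS S y)" if y: "\<forall>S\<in>SS. FS S y \<noteq> 0" for y
  proof -
    have D: "DD y \<noteq> 0"
    proof
      assume "DD y = 0"
      then obtain H where H: "H \<in> HH" "form H y = 0" using fin(2) by (auto simp: DD_def)
      obtain S v where Sv: "S \<in> SS" "v \<in> S" "ker (S, v) = H" "form H = (\<lambda>y. representation S y v)" using form_rep[OF H(1)] by metis
      have "(\<Prod>v\<in>S. representation S y v) = 0" using H(2) Sv sfanD(5)[OF F Sv(1)] by (intro prod_zero) auto
      thus False using y Sv(1) by (simp add: FS_def)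
    qed
    have "DD y * q y = (\<Sum>S\<in>SS. pc f S y * gS S y)" using fun_cong[OF q(3), of y] by (simp add: P_def)
    also have "\<dots> = (\<Sum>S\<in>SS. DD y * (pc f S y / FS S y))"
    proof (intro sum.cong refl)
      fix S assume S: "S \<in> SS"
      have "gS S y = DD y / FS S y" using gS_FS[OF S, of y] y S by (simp add: field_simps)
      thus "pc f S y * gS S y = DD y * (pc f S y / FS S y)" by simp
    qed
    also have "\<dots> = DD y * (\<Sum>S\<in>SS. pc f S y / FS S y)" by (simp add: sum_distrib_left)
    finally show ?thesis using D by simp
  qed
  moreover have "k + (m - n) - m = k - n" "k + (m - n) < m \<longleftrightarrow> k < n" using nm by auto
  ultimately show ?thesis using q unfolding n_def by auto
qed

end

section \<open>Linear algebra of symmetric forms\<close>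

lemma underdetermined:
  fixes A :: "'j \<Rightarrow> 'k \<Rightarrow> real"
  assumes J: "finite J" and K: "finite K" and lt: "card K < card J"
  shows "\<exists>c. (\<exists>j\<in>J. c j \<noteq> 0) \<and> (\<forall>k\<in>K. (\<Sum>j\<in>J. c j * A j k) = 0)"
proof (rule ccontr)
  assume neg: "\<not> ?thesis"
  have "card J \<le> card K"
  proof (rule card_le_of_independent_family[OF J K, where f = "\<lambda>j k. if k \<in> K then A j k else 0" and g = delta])
    show "\<And>j. j \<in> J \<Longrightarrow> (\<lambda>k. if k \<in> K then A j k else 0) \<in> fv.span (delta ` K)"
      by (rule delta_span[OF K]) auto
    fix c j assume z: "\<And>k. (\<Sum>j\<in>J. c j * (if k \<in> K then A j k else 0)) = 0" and j: "j \<in> J"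
    have "(\<Sum>j\<in>J. c j * A j k) = 0" if "k \<in> K" for k using z[of k] that by simp
    thus "c j = 0" using neg j by blast
  qed
  thus False using lt by simp
qed

definition form2 :: "'j set \<Rightarrow> ('j \<Rightarrow> 'j \<Rightarrow> real) \<Rightarrow> ('j \<Rightarrow> real) \<Rightarrow> ('j \<Rightarrow> real) \<Rightarrow> real" where
  "form2 J G u v = (\<Sum>i\<in>J. \<Sum>j\<in>J. u i * v j * G i j)"

lemma form2_lin1: "form2 J G (\<lambda>i. a * u i + b * u' i) v = a * form2 J G u v + b * form2 J G u' v"
  by (simp add: form2_def algebra_simps sum.distrib sum_distrib_left)

lemma form2_sum1: "finite K \<Longrightarrow> form2 J G (\<lambda>i. \<Sum>k\<in>K. a k * u k i) v = (\<Sum>k\<in>K. a k * form2 J G (u k) v)"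
proof (induction K rule: finite_induct)
  case empty thus ?case by (simp add: form2_def)
next
  case (insert k K)
  have "form2 J G (\<lambda>i. a k * u k i + 1 * (\<Sum>k\<in>K. a k * u k i)) v = a k * form2 J G (u k) v + 1 * form2 J G (\<lambda>i. \<Sum>k\<in>K. a k * u k i) v"
    by (rule form2_lin1)
  thus ?case using insert by simp
qed

lemma form2_sym: "(\<And>i j. i \<in> J \<Longrightarrow> j \<in> J \<Longrightarrow> G i j = G j i) \<Longrightarrow> form2 J G u v = form2 J G v u"
  unfolding form2_def by (subst sum.swap) (auto intro!: sum.cong)

text \<open>The family is extended inside the orthogonal complement \<open>W\<close> of its members.
  If no vector of \<open>W\<close> had a nonzero square, polarization would make the form zero on
  \<open>W\<close>, and a nonzero vector of \<open>W\<close> would lie in the radical.\<close>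

lemma orthogonal_basis:
  fixes G :: "'j \<Rightarrow> 'j \<Rightarrow> real"
  assumes J: "finite J" and sym: "\<And>i j. i \<in> J \<Longrightarrow> j \<in> J \<Longrightarrow> G i j = G j i"
    and nd: "\<And>u. (\<And>j. j \<in> J \<Longrightarrow> (\<Sum>i\<in>J. u i * G i j) = 0) \<Longrightarrow> (\<And>i. i \<in> J \<Longrightarrow> u i = 0)"
  shows "\<exists>e. (\<forall>k<card J. form2 J G (e k) (e k) \<noteq> 0) \<and> (\<forall>k<card J. \<forall>l<card J. k \<noteq> l \<longrightarrow> form2 J G (e k) (e l) = 0)"
proof -
  have fs: "form2 J G u v = form2 J G v u" for u v by (rule form2_sym) (rule sym)
  define ok where "ok = (\<lambda>(m::nat) e. (\<forall>k<m. form2 J G (e k) (e k) \<noteq> 0) \<and> (\<forall>k<m. \<forall>l<m. k \<noteq> l \<longrightarrow> form2 J G (e k) (e l) = 0))"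
  have "\<exists>e. ok m e" if "m \<le> card J" for m
    using that
  proof (induction m)
    case 0 show ?case by (simp add: ok_def)
  next
    case (Suc m)
    then obtain e where e: "ok m e" by auto
    have ne: "form2 J G (e k) (e k) \<noteq> 0" if "k < m" for k using e that by (simp add: ok_def)
    have orth: "form2 J G (e k) (e l) = 0" if "k < m" "l < m" "k \<noteq> l" for k l using e that by (simp add: ok_def)
    define W where "W = {u. \<forall>k<m. form2 J G u (e k) = 0}"
    have "\<exists>u\<in>W. form2 J G u u \<noteq> 0"
    proof (rule ccontr)
      assume "\<not> ?thesis"
      hence Q0: "form2 J G u u = 0" if "u \<in> W" for u using that by blast
      have W0: "form2 J G u v = 0" if uv: "u \<in> W" "v \<in> W" for u v
      proof -
        have "(\<lambda>i. 1 * u i + 1 * v i) \<in> W" using uv unfolding W_def mem_Collect_eq form2_lin1 by simp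
        from Q0[OF this] have "form2 J G u (\<lambda>i. 1 * u i + 1 * v i) + form2 J G v (\<lambda>i. 1 * u i + 1 * v i) = 0"
          by (simp only: form2_lin1)
        also have "form2 J G u (\<lambda>i. 1 * u i + 1 * v i) = form2 J G (\<lambda>i. 1 * u i + 1 * v i) u" by (rule fs)
        also have "form2 J G v (\<lambda>i. 1 * u i + 1 * v i) = form2 J G (\<lambda>i. 1 * u i + 1 * v i) v" by (rule fs)
        finally have "form2 J G u v + form2 J G v u = 0" unfolding form2_lin1 using Q0[OF uv(1)] Q0[OF uv(2)] by simp
        thus ?thesis using fs[of u v] by simp
      qed
      \<comment> \<open>Fewer orthogonality conditions than unknowns leave a nonzero vector in
        \<open>W\<close>.\<close>
      have "card {..<m} < card J" using Suc.prems by simp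
      from underdetermined[OF J finite_lessThan this, of "\<lambda>j k. \<Sum>i\<in>J. e k i * G j i"]
      obtain u where u: "\<exists>j\<in>J. u j \<noteq> 0" "\<And>k. k < m \<Longrightarrow> (\<Sum>j\<in>J. u j * (\<Sum>i\<in>J. e k i * G j i)) = 0" by auto
      have uW: "u \<in> W" unfolding W_def form2_def using u(2) by (simp add: sum_distrib_left mult_ac)
      have uall: "form2 J G u v = 0" for v
      proof -
        define a where "a = (\<lambda>k. form2 J G v (e k) / form2 J G (e k) (e k))"
        define s where "s = (\<lambda>i. \<Sum>k<m. a k * e k i)"
        define r where "r = (\<lambda>i. 1 * v i + (-1) * s i)"
        have "r \<in> W" unfolding W_def
        proof (intro CollectI allI impI)
          fix l assume l: "l < m"
          have "form2 J G s (e l) = (\<Sum>k<m. a k * form2 J G (e k) (e l))" unfolding s_def by (rule form2_sum1) simp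
          also have "\<dots> = (\<Sum>k\<in>{l}. a k * form2 J G (e k) (e l))"
            using l orth by (intro sum.mono_neutral_right) auto
          also have "\<dots> = form2 J G v (e l)" using ne[OF l] by (simp add: a_def)
          finally show "form2 J G r (e l) = 0" unfolding r_def form2_lin1 by simp
        qed
        hence "form2 J G r u = 0" using W0 uW by blast
        hence "form2 J G v u = form2 J G s u" unfolding r_def form2_lin1 by simp
        also have "\<dots> = (\<Sum>k<m. a k * form2 J G (e k) u)" unfolding s_def by (rule form2_sum1) simp
        also have "\<dots> = 0"
        proof (intro sum.neutral ballI)
          fix k assume "k \<in> {..<m}"
          hence "form2 J G u (e k) = 0" using uW by (simp add: W_def)
          thus "a k * form2 J G (e k) u = 0" using fs[of u "e k"] by simp
        qed
        finally show ?thesis using fs[of u v] by simp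
      qed
      have "(\<Sum>i\<in>J. u i * G i j) = 0" if j: "j \<in> J" for j
      proof -
        have "form2 J G u (delta j) = (\<Sum>i\<in>J. \<Sum>l\<in>{j}. u i * delta j l * G i l)"
          unfolding form2_def using J j by (intro sum.cong refl sum.mono_neutral_right) (auto simp: delta_def)
        thus ?thesis using uall[of "delta j"] by (simp add: delta_def)
      qed
      from nd[OF this] u(1) show False by blast
    qed
    then obtain u where u: "u \<in> W" "form2 J G u u \<noteq> 0" by blast
    have uk: "form2 J G u (e k) = 0" "form2 J G (e k) u = 0" if "k < m" for k
      using u(1) that fs[of u "e k"] by (auto simp: W_def)
    have "ok (Suc m) (e(m := u))"
      unfolding ok_def using u(2) uk ne orth by (auto simp: less_Suc_eq)
    thus ?case by blast
  qed
  from this[OF order_refl] show ?thesis by (simp add: ok_def)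
qed

text \<open>A uniform bound is wanted because the vector to which it is applied depends on the
  parameter of the deformation.\<close>

lemma pos_def_lower_bound:
  fixes G :: "nat \<Rightarrow> nat \<Rightarrow> real"
  assumes pos: "\<And>c. \<exists>i<d. c i \<noteq> 0 \<Longrightarrow> form2 {..<d} G c c > 0"
  shows "\<exists>\<mu>>0. \<forall>c. (\<Sum>i<d. \<bar>c i\<bar>) = 1 \<longrightarrow> form2 {..<d} G c c \<ge> \<mu>"
proof (cases "d = 0")
  case True thus ?thesis by (intro exI[of _ 1]) auto
next
  case False
  define K where "K = {u :: nat \<Rightarrow> real. (\<forall>v. v \<notin> {..<d} \<longrightarrow> u v = 0) \<and> (\<Sum>v\<in>{..<d}. \<bar>u v\<bar>) = 1}"
  have cK: "compact K" unfolding K_def by (rule compact_l1_sphere) simp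
  have "delta 0 \<in> K" using False by (auto simp: K_def delta_def if_distrib cong: if_cong)
  hence neK: "K \<noteq> {}" by auto
  have "continuous_on K (\<lambda>c. form2 {..<d} G c c)" unfolding form2_def
    by (intro continuous_intros continuous_on_subset[OF continuous_on_product_coordinates]) auto
  from continuous_attains_inf[OF cK neK this] obtain u where
    u: "u \<in> K" "\<And>c. c \<in> K \<Longrightarrow> form2 {..<d} G u u \<le> form2 {..<d} G c c" by blast
  have "\<exists>i<d. u i \<noteq> 0"
  proof (rule ccontr)
    assume "\<not> ?thesis"
    hence "(\<Sum>v\<in>{..<d}. \<bar>u v\<bar>) = 0" by simp
    thus False using u(1) by (simp add: K_def)
  qed
  hence "form2 {..<d} G u u > 0" by (rule pos)
  moreover have "form2 {..<d} G u u \<le> form2 {..<d} G c c" if c: "(\<Sum>i<d. \<bar>c i\<bar>) = 1" for c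
  proof -
    define c' where "c' = (\<lambda>i. if i < d then c i else 0)"
    have "c' \<in> K" using c by (simp add: K_def c'_def)
    from u(2)[OF this] show ?thesis unfolding form2_def c'_def by simp
  qed
  ultimately show ?thesis by blast
qed

section \<open>Definite subspaces\<close>

text \<open>The homogeneous components are taken cone by cone. On an overlap they agree, being the
  coefficients of the same polynomial in the scaling parameter.\<close>

lemma PP_decompose:
  assumes F: "sfan SS" and f: "f \<in> PP SS"
  shows "\<exists>K g. (\<forall>k. g k \<in> PPh SS k) \<and> f = (\<lambda>y. \<Sum>k\<le>K. g k y)"
proof -
  have "\<exists>c K. \<forall>y. pc f S y = (\<Sum>k\<le>K. \<Sum>a\<in>expo S k. c a * mon S a y)" if S: "S \<in> SS" for S
    by (rule poly_graded_expand[OF sfanD(2)[OF F S] pc_PP(1)[OF f S sfanD(2)[OF F S]]]) blast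
  then obtain c KS where cK: "\<And>S y. S \<in> SS \<Longrightarrow> pc f S y = (\<Sum>k\<le>KS S. \<Sum>a\<in>expo S k. c S a * mon S a y)" by metis
  define K where "K = (\<Sum>S\<in>SS. KS S)"
  define h where "h = (\<lambda>S k y. if k \<le> KS S then \<Sum>a\<in>expo S k. c S a * mon S a y else 0)"
  have h_hom: "homogeneous_poly k (h S k)" if S: "S \<in> SS" for S k
  proof (cases "k \<le> KS S")
    case True
    have "homogeneous_poly k (\<lambda>y. \<Sum>a\<in>expo S k. c S a * mon S a y)"
      by (intro homogeneous_poly_sum homogeneous_poly_cmult mon_homogeneous sfanD(2)[OF F S])
    thus ?thesis using True by (simp add: h_def[abs_def])
  next
    case False thus ?thesis by (simp add: h_def[abs_def] homogeneous_poly_zero)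
  qed
  have pcK: "pc f S y = (\<Sum>k\<le>K. h S k y)" if S: "S \<in> SS" for S y
  proof -
    have "KS S \<le> K" unfolding K_def using S sfanD(1)[OF F] by (intro member_le_sum) auto
    hence "(\<Sum>k\<le>K. h S k y) = (\<Sum>k\<le>KS S. \<Sum>a\<in>expo S k. c S a * mon S a y)"
      by (intro sum.mono_neutral_cong_right) (auto simp: h_def)
    thus ?thesis using cK[OF S] by simp
  qed
  have cons: "h S k y = h T k y" if ST: "S \<in> SS" "T \<in> SS" and y: "y \<in> bcone S" "y \<in> bcone T" for S T k y
  proof (cases "k \<le> K")
    case True
    have "h S k y - h T k y = 0"
    proof (rule poly_zero_of_pos[where n = K and c = "\<lambda>k. h S k y - h T k y", OF _ True])
      fix t :: real assume t: "t > 0"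
      have "f (t *\<^sub>R y) = (\<Sum>k\<le>K. h U k y * t ^ k)" if U: "U \<in> SS" "y \<in> bcone U" for U
      proof -
        have "t *\<^sub>R y \<in> bcone U" using bcone_scale[OF sfanD(2)[OF F U(1)] U(2)] t by simp
        hence "f (t *\<^sub>R y) = (\<Sum>k\<le>K. h U k (t *\<^sub>R y))"
          using pc_PP(2)[OF f U(1) sfanD(2)[OF F U(1)]] pcK[OF U(1)] by metis
        also have "\<dots> = (\<Sum>k\<le>K. h U k y * t ^ k)"
          using h_hom[OF U(1)] by (intro sum.cong refl) (simp add: homogeneous_poly_def mult.commute)
        finally show ?thesis .
      qed
      from this[OF ST(1) y(1)] this[OF ST(2) y(2)]
      show "(\<Sum>i\<le>K. (h S i y - h T i y) * t ^ i) = 0" by (simp add: left_diff_distrib sum_subtractf)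
    qed
    thus ?thesis by simp
  next
    case False
    have "KS S \<le> K" "KS T \<le> K" unfolding K_def using ST sfanD(1)[OF F] by (auto intro: member_le_sum)
    thus ?thesis using False by (simp add: h_def)
  qed
  define g where "g = (\<lambda>k y. h (SOME S. S \<in> SS \<and> y \<in> bcone S) k y)"
  have g: "g k y = h S k y" if S: "S \<in> SS" "y \<in> bcone S" for S k y
  proof -
    have "\<exists>S. S \<in> SS \<and> y \<in> bcone S" using S by blast
    from someI_ex[OF this] show ?thesis unfolding g_def using cons[OF _ S(1) _ S(2)] by blast
  qed
  have "g k \<in> PPh SS k" for k unfolding PPh_def using g h_hom by blast
  moreover have "f = (\<lambda>y. \<Sum>k\<le>K. g k y)"
  proof (rule sfan_ext[OF F])
    fix S y assume S: "S \<in> SS" "y \<in> bcone S"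
    show "f y = (\<Sum>k\<le>K. g k y)"
      using pc_PP(2)[OF f S(1) sfanD(2)[OF F S(1)] S(2)] pcK[OF S(1)] g[OF S] by simp
  qed
  ultimately show ?thesis by blast
qed

lemma PPh_sum_zero:
  assumes F: "sfan SS" and g: "\<And>k. g k \<in> PPh SS k" and z: "\<And>y. (\<Sum>k\<le>K. g k y) = 0" and k: "k \<le> K"
  shows "g k = (\<lambda>_. 0)"
proof (rule sfan_ext[OF F])
  fix S y assume S: "S \<in> SS" "y \<in> bcone S"
  show "g k y = 0"
  proof (rule poly_zero_of_pos[where n = K and c = "\<lambda>k. g k y", OF _ k])
    fix t :: real assume t: "t > 0"
    have "(\<Sum>k\<le>K. g k y * t ^ k) = (\<Sum>k\<le>K. g k (t *\<^sub>R y))"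
      using PPh_scale_point[OF g S(1) sfanD(2)[OF F S(1)] S(2)] t by (intro sum.cong refl) simp
    thus "(\<Sum>k\<le>K. g k y * t ^ k) = 0" using z by simp
  qed
qed

lemma PP_add: assumes "f \<in> PP SS" "g \<in> PP SS" shows "(\<lambda>x. f x + g x) \<in> PP SS"
  unfolding PP_def
proof (intro CollectI ballI)
  fix S assume S: "S \<in> SS"
  obtain p where p: "real_polynomial_function p" "\<forall>y\<in>bcone S. f y = p y" using assms(1) S unfolding PP_def by blast
  obtain q where q: "real_polynomial_function q" "\<forall>y\<in>bcone S. g y = q y" using assms(2) S unfolding PP_def by blast
  show "\<exists>p. real_polynomial_function p \<and> (\<forall>y\<in>bcone S. f y + g y = p y)"
    using p q by (intro exI[of _ "\<lambda>x. p x + q x"] conjI real_polynomial_function.intros(3)) auto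
qed

lemma PP_mult: assumes "f \<in> PP SS" "g \<in> PP SS" shows "(\<lambda>x. f x * g x) \<in> PP SS"
  unfolding PP_def
proof (intro CollectI ballI)
  fix S assume S: "S \<in> SS"
  obtain p where p: "real_polynomial_function p" "\<forall>y\<in>bcone S. f y = p y" using assms(1) S unfolding PP_def by blast
  obtain q where q: "real_polynomial_function q" "\<forall>y\<in>bcone S. g y = q y" using assms(2) S unfolding PP_def by blast
  show "\<exists>p. real_polynomial_function p \<and> (\<forall>y\<in>bcone S. f y * g y = p y)"
    using p q by (intro exI[of _ "\<lambda>x. p x * q x"] conjI real_polynomial_function.intros(4)) auto
qed

lemma PP_cmult: "f \<in> PP SS \<Longrightarrow> (\<lambda>x. c * f x) \<in> PP SS"
  by (rule PP_mult[OF poly_PP[OF real_polynomial_function.intros(2)]])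

lemma PP_sum: "(\<And>i. i \<in> I \<Longrightarrow> f i \<in> PP SS) \<Longrightarrow> (\<lambda>x. \<Sum>i\<in>I. f i x) \<in> PP SS"
  by (induction I rule: infinite_finite_induct) (auto intro: PP_add poly_PP)

text \<open>The ideal that defines cohomology, see \<open>coh_ideal_eq\<close>, with finitely many
  linear generators in place of all polynomials vanishing at 0.\<close>

definition Jideal :: "'a::real_normed_vector set set \<Rightarrow> 'a set \<Rightarrow> ('a \<Rightarrow> real) set" where
  "Jideal SS B = {f. \<exists>g. (\<forall>v\<in>B. g v \<in> PP SS) \<and> f = (\<lambda>y. \<Sum>v\<in>B. representation B y v * g v y)}"

lemma PPm_PP: "h \<in> PPm SS k \<Longrightarrow> h \<in> PP SS"
  unfolding PPm_def using PPh_PP PPh_PP[OF PPh_zero] by (metis singletonD)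

lemma LI_Jideal: "LI SS B B k \<subseteq> Jideal SS B"
  unfolding LI_def Jideal_def using PPm_PP by blast

text \<open>The ideal has homogeneous generators, so the components of its elements lie in it;
  comparing degrees in a representation gives the cofactors.\<close>

lemma Jideal_component:
  assumes F: "sfan SS" and B: "is_basis B" and g: "\<And>k. g k \<in> PPh SS k" and f: "(\<lambda>y. \<Sum>k\<le>K. g k y) \<in> Jideal SS B" and k: "k \<le> K"
  shows "g k \<in> LI SS B B k"
proof -
  obtain h where h: "\<And>v. v \<in> B \<Longrightarrow> h v \<in> PP SS" "(\<lambda>y. \<Sum>k\<le>K. g k y) = (\<lambda>y. \<Sum>v\<in>B. representation B y v * h v y)"
    using f by (auto simp: Jideal_def)
  have fB: "finite B" using B by (simp add: is_basis_def)
  have "\<exists>L q. (\<forall>j. q j \<in> PPh SS j) \<and> h v = (\<lambda>y. \<Sum>j\<le>L. q j y)" if "v \<in> B" for v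
    using PP_decompose[OF F h(1)[OF that]] .
  then obtain L q where Lq: "\<And>v j. v \<in> B \<Longrightarrow> q v j \<in> PPh SS j" "\<And>v. v \<in> B \<Longrightarrow> h v = (\<lambda>y. \<Sum>j\<le>L v. q v j y)" by metis
  define N where "N = K + Suc (\<Sum>v\<in>B. L v)"
  \<comment> \<open>The index is shifted by one because the coordinate in front of the cofactor adds
    one to the degree.\<close>
  define q' where "q' = (\<lambda>v j y. case j of 0 \<Rightarrow> 0 | Suc i \<Rightarrow> if i \<le> L v then q v i y else 0)"
  have q'P: "q' v j \<in> PPm SS j" if "v \<in> B" for v j
  proof (cases j)
    case 0 thus ?thesis by (simp add: q'_def PPm_def)
  next
    case (Suc i)
    thus ?thesis using Lq(1)[OF that, of i] by (cases "i \<le> L v") (simp_all add: q'_def PPm_def PPh_zero)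
  qed
  have hq: "h v y = (\<Sum>j\<le>N. q' v j y)" if v: "v \<in> B" for v y
  proof -
    have "L v \<le> (\<Sum>v\<in>B. L v)" using v fB by (intro member_le_sum) auto
    hence N: "Suc (L v) \<le> N" by (simp add: N_def)
    have "(\<Sum>j\<le>N. q' v j y) = (\<Sum>j\<le>Suc (L v). q' v j y)"
      using N by (intro sum.mono_neutral_right) (auto simp: q'_def split: nat.splits)
    also have "\<dots> = (\<Sum>j\<le>L v. q v j y)" by (subst sum.atMost_Suc_shift) (simp add: q'_def)
    finally show ?thesis using Lq(2)[OF v] by simp
  qed
  define g' where "g' = (\<lambda>j y. if j \<le> K then g j y else 0)"
  have g'P: "g' j \<in> PPh SS j" for j using g[of j] by (cases "j \<le> K") (simp_all add: g'_def PPh_zero)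
  define r where "r = (\<lambda>j y. g' j y - (\<Sum>v\<in>B. representation B y v * q' v j y))"
  have r1: "(\<lambda>y. representation B y v) \<in> PPh SS 1" for v
    by (intro homogeneous_poly_PPh homogeneous_poly_rep B)
  have rP: "r j \<in> PPh SS j" for j unfolding r_def by (intro PPh_diff g'P PPh_sum PPm_linear_mult[OF q'P r1])
  have "(\<Sum>j\<le>N. r j y) = 0" for y
  proof -
    have "(\<Sum>j\<le>N. g' j y) = (\<Sum>j\<le>K. g j y)"
      by (intro sum.mono_neutral_cong_right) (auto simp: g'_def N_def)
    moreover have "(\<Sum>j\<le>N. \<Sum>v\<in>B. representation B y v * q' v j y) = (\<Sum>v\<in>B. representation B y v * h v y)"
      by (subst sum.swap) (simp add: sum_distrib_left[symmetric] hq)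
    ultimately show ?thesis using fun_cong[OF h(2), of y] by (simp add: r_def sum_subtractf)
  qed
  from PPh_sum_zero[where g = r and K = N, OF F rP this, of k] k have "r k = (\<lambda>_. 0)" by (simp add: N_def)
  hence "g k = (\<lambda>y. \<Sum>v\<in>B. representation B y v * q' v k y)"
    using k by (auto simp: r_def g'_def fun_eq_iff)
  moreover have "\<forall>v\<in>B. q' v k \<in> PPm SS k" using q'P by blast
  ultimately show ?thesis unfolding LI_def mem_Collect_eq by (intro exI[of _ "\<lambda>v. q' v k"] conjI)
qed

section \<open>The localized integral as a linear map over the polynomial ring\<close>

context weighted_fan
begin

definition zeta :: "('a \<Rightarrow> real) \<Rightarrow> 'a \<Rightarrow> real" where
  "zeta f = (THE p. real_polynomial_function p \<and>
     (\<forall>y. (\<forall>S\<in>SS. FS S y \<noteq> 0) \<longrightarrow> p y = (\<Sum>S\<in>SS. pc f S y / FS S y)))"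

lemma FS_poly: "S \<in> SS \<Longrightarrow> real_polynomial_function (FS S)"
  unfolding FS_def[abs_def] using sfanD(5)[OF F]
  by (intro real_polynomial_function.intros(2,4) real_polynomial_function_prod rep_poly sfanD(2)[OF F]) auto

lemma FS_nonzero_generic: "(\<forall>S\<in>SS. FS S y \<noteq> 0) \<longleftrightarrow> generic SS y"
proof -
  have "FS S y \<noteq> 0 \<longleftrightarrow> (\<forall>v\<in>S. representation S y v \<noteq> 0)" if S: "S \<in> SS" for S
    using w_pos[OF S] sfanD(5)[OF F S] by (simp add: FS_def)
  thus ?thesis by (auto simp: generic_def)
qed

text \<open>The product of all denominators is nonzero exactly at the generic points, and it is not
  the zero polynomial.\<close>

lemma generic_poly_eq:
  assumes p: "real_polynomial_function p" "real_polynomial_function q" and eq: "\<And>y. generic SS y \<Longrightarrow> p y = q y"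
  shows "p = q"
proof
  fix y
  define X where "X = (\<lambda>y. \<Prod>S\<in>SS. FS S y)"
  obtain x where x: "generic SS x" using reducible_exists[OF F] by blast
  have "p y - q y = 0"
  proof (rule poly_mult_zero[where P = "\<lambda>y. p y - q y" and X = X and U = UNIV and x = x])
    show "real_polynomial_function (\<lambda>y. p y - q y)" using p by (rule real_polynomial_function_diff)
    show "real_polynomial_function X" unfolding X_def using sfanD(1)[OF F] FS_poly by (intro real_polynomial_function_prod) auto
    show "(p y - q y) * X y = 0" for y
    proof (cases "generic SS y")
      case True thus ?thesis using eq by simp
    next
      case False
      hence "X y = 0" unfolding X_def using FS_nonzero_generic[of y] sfanD(1)[OF F] by auto
      thus ?thesis by simp
    qed
    show "X x \<noteq> 0" unfolding X_def using FS_nonzero_generic[of x] sfanD(1)[OF F] x by auto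
  qed auto
  thus "p y = q y" by simp
qed

lemma zeta_eqI:
  assumes "real_polynomial_function p" "\<And>y. generic SS y \<Longrightarrow> p y = (\<Sum>S\<in>SS. pc f S y / FS S y)"
  shows "zeta f = p"
  unfolding zeta_def FS_nonzero_generic
proof (rule the_equality)
  show "real_polynomial_function p \<and> (\<forall>y. generic SS y \<longrightarrow> p y = (\<Sum>S\<in>SS. pc f S y / FS S y))" using assms by blast
  fix q assume "real_polynomial_function q \<and> (\<forall>y. generic SS y \<longrightarrow> q y = (\<Sum>S\<in>SS. pc f S y / FS S y))"
  thus "q = p" using assms by (intro generic_poly_eq) auto
qed

lemma zeta_PPh:
  assumes f: "f \<in> PPh SS k"
  shows "homogeneous_poly (k - dim (UNIV :: 'a set)) (zeta f)" "k < dim (UNIV :: 'a set) \<Longrightarrow> zeta f = (\<lambda>_. 0)"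
    "generic SS y \<Longrightarrow> zeta f y = (\<Sum>S\<in>SS. pc f S y / FS S y)"
proof -
  obtain p where p: "homogeneous_poly (k - dim (UNIV :: 'a set)) p" "k < dim (UNIV :: 'a set) \<longrightarrow> p = (\<lambda>_. 0)"
    "\<forall>y. generic SS y \<longrightarrow> p y = (\<Sum>S\<in>SS. pc f S y / FS S y)"
    using zeta_exists[OF f] unfolding FS_nonzero_generic by blast
  have "zeta f = p" using p by (intro zeta_eqI homogeneous_poly_poly[OF p(1)]) auto
  thus "homogeneous_poly (k - dim (UNIV :: 'a set)) (zeta f)" "k < dim (UNIV :: 'a set) \<Longrightarrow> zeta f = (\<lambda>_. 0)"
    "generic SS y \<Longrightarrow> zeta f y = (\<Sum>S\<in>SS. pc f S y / FS S y)" using p by auto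
qed

lemma pc_sum:
  assumes "finite X" "\<And>i. i \<in> X \<Longrightarrow> f i \<in> PP SS" "S \<in> SS"
  shows "pc (\<lambda>x. \<Sum>i\<in>X. f i x) S y = (\<Sum>i\<in>X. pc (f i) S y)"
  using assms(1,2)
proof (induction X rule: finite_induct)
  case empty
  show ?case using pc_poly[OF real_polynomial_function.intros(2) sfanD(2)[OF F assms(3)], of 0] by simp
next
  case (insert i X)
  thus ?case using pc_add[OF _ PP_sum[of X f] assms(3) sfanD(2)[OF F assms(3)], of "f i"] by simp
qed

lemma zeta_PP:
  assumes f: "f \<in> PP SS"
  shows "real_polynomial_function (zeta f)" "generic SS y \<Longrightarrow> zeta f y = (\<Sum>S\<in>SS. pc f S y / FS S y)"
proof -
  obtain K g where g: "\<And>k. g k \<in> PPh SS k" "f = (\<lambda>y. \<Sum>k\<le>K. g k y)" using PP_decompose[OF F f] by blast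
  define p where "p = (\<lambda>y. \<Sum>k\<le>K. zeta (g k) y)"
  have p: "real_polynomial_function p" unfolding p_def
    by (intro real_polynomial_function_sum homogeneous_poly_poly[OF zeta_PPh(1)[OF g(1)]]) auto
  have pe: "p y = (\<Sum>S\<in>SS. pc f S y / FS S y)" if y: "generic SS y" for y
  proof -
    have "p y = (\<Sum>k\<le>K. \<Sum>S\<in>SS. pc (g k) S y / FS S y)" unfolding p_def using zeta_PPh(3)[OF g(1) y] by simp
    also have "\<dots> = (\<Sum>S\<in>SS. \<Sum>k\<le>K. pc (g k) S y / FS S y)" by (rule sum.swap)
    also have "\<dots> = (\<Sum>S\<in>SS. pc f S y / FS S y)"
      unfolding g(2) by (intro sum.cong refl) (simp add: pc_sum[OF _ PPh_PP[OF g(1)]] sum_divide_distrib)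
    finally show ?thesis .
  qed
  have "zeta f = p" by (rule zeta_eqI[OF p pe])
  thus "real_polynomial_function (zeta f)" "generic SS y \<Longrightarrow> zeta f y = (\<Sum>S\<in>SS. pc f S y / FS S y)" using p pe by auto
qed

lemma zeta_add:
  assumes "f \<in> PP SS" "g \<in> PP SS"
  shows "zeta (\<lambda>x. f x + g x) = (\<lambda>y. zeta f y + zeta g y)"
proof (rule zeta_eqI)
  show "real_polynomial_function (\<lambda>y. zeta f y + zeta g y)"
    by (intro real_polynomial_function.intros(3) zeta_PP(1) assms)
  fix y assume y: "generic SS y"
  show "zeta f y + zeta g y = (\<Sum>S\<in>SS. pc (\<lambda>x. f x + g x) S y / FS S y)"
    unfolding zeta_PP(2)[OF assms(1) y] zeta_PP(2)[OF assms(2) y] sum.distrib[symmetric]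
    by (intro sum.cong refl) (simp add: pc_add[OF assms _ sfanD(2)[OF F]] add_divide_distrib)
qed

lemma zeta_poly_mult:
  assumes p: "real_polynomial_function p" and f: "f \<in> PP SS"
  shows "zeta (\<lambda>x. p x * f x) = (\<lambda>y. p y * zeta f y)"
proof (rule zeta_eqI)
  show "real_polynomial_function (\<lambda>y. p y * zeta f y)"
    by (intro real_polynomial_function.intros(4) zeta_PP(1) assms)
  fix y assume y: "generic SS y"
  show "p y * zeta f y = (\<Sum>S\<in>SS. pc (\<lambda>x. p x * f x) S y / FS S y)"
    unfolding zeta_PP(2)[OF f y] sum_distrib_left
    by (intro sum.cong refl) (simp add: pc_mult[OF poly_PP[OF p] f _ sfanD(2)[OF F]] pc_poly[OF p sfanD(2)[OF F]])
qed

lemma zeta_cmult: "f \<in> PP SS \<Longrightarrow> zeta (\<lambda>x. c * f x) = (\<lambda>y. c * zeta f y)"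
  by (rule zeta_poly_mult[OF real_polynomial_function.intros(2)])

lemma zeta_0: "zeta (\<lambda>x. 0) = (\<lambda>y. 0)"
  using zeta_cmult[OF poly_PP[OF real_polynomial_function.intros(2)[of 0]], of 0] by simp

lemma zeta_sum: "finite X \<Longrightarrow> (\<And>i. i \<in> X \<Longrightarrow> f i \<in> PP SS) \<Longrightarrow> zeta (\<lambda>x. \<Sum>i\<in>X. f i x) = (\<lambda>y. \<Sum>i\<in>X. zeta (f i) y)"
proof (induction X rule: finite_induct)
  case empty show ?case by (simp add: zeta_0)
next
  case (insert i X)
  thus ?case using zeta_add[of "f i" "\<lambda>x. \<Sum>i\<in>X. f i x"] PP_sum[of X f] by simp
qed

text \<open>By linearity over the polynomial ring the coordinates come out of the integral, and they
  vanish at 0. Hence the integral is well defined on classes.\<close>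

lemma zeta_Jideal:
  assumes B: "is_basis B" and f: "f \<in> Jideal SS B"
  shows "zeta f 0 = 0"
proof -
  obtain g where g: "\<And>v. v \<in> B \<Longrightarrow> g v \<in> PP SS" "f = (\<lambda>y. \<Sum>v\<in>B. representation B y v * g v y)"
    using f by (auto simp: Jideal_def)
  have fB: "finite B" using B by (simp add: is_basis_def)
  have "zeta f = (\<lambda>y. \<Sum>v\<in>B. zeta (\<lambda>y. representation B y v * g v y) y)"
    unfolding g(2) by (intro zeta_sum fB PP_mult poly_PP[OF rep_poly[OF B]] g(1))
  also have "\<dots> = (\<lambda>y. \<Sum>v\<in>B. representation B y v * zeta (g v) y)"
    using zeta_poly_mult[OF rep_poly[OF B] g(1)] by (intro ext sum.cong refl) simp
  finally show ?thesis using rep_scale[OF B, of 0 0] by simp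
qed

definition bil :: "('a \<Rightarrow> real) \<Rightarrow> ('a \<Rightarrow> real) \<Rightarrow> 'a \<Rightarrow> real" where
  "bil f g = zeta (\<lambda>x. f x * g x)"

lemma bil_sum:
  assumes J: "finite J" and f: "\<And>i. i \<in> J \<Longrightarrow> f i \<in> PP SS"
  shows "bil (\<lambda>x. \<Sum>i\<in>J. c i * f i x) (\<lambda>x. \<Sum>i\<in>J. e i * f i x) y = form2 J (\<lambda>i j. bil (f i) (f j) y) c e"
proof -
  have P: "(\<lambda>x. f i x * f j x) \<in> PP SS" if "i \<in> J" "j \<in> J" for i j by (intro PP_mult f that)
  have "(\<lambda>x. (\<Sum>i\<in>J. c i * f i x) * (\<Sum>j\<in>J. e j * f j x)) = (\<lambda>x. \<Sum>i\<in>J. \<Sum>j\<in>J. (c i * e j) * (f i x * f j x))"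
    by (simp add: sum_product mult_ac)
  hence "bil (\<lambda>x. \<Sum>i\<in>J. c i * f i x) (\<lambda>x. \<Sum>i\<in>J. e i * f i x) = zeta (\<lambda>x. \<Sum>i\<in>J. \<Sum>j\<in>J. (c i * e j) * (f i x * f j x))"
    by (simp add: bil_def)
  also have "\<dots> = (\<lambda>y. \<Sum>i\<in>J. zeta (\<lambda>x. \<Sum>j\<in>J. (c i * e j) * (f i x * f j x)) y)"
    by (intro zeta_sum J PP_sum PP_cmult P)
  also have "\<dots> = (\<lambda>y. \<Sum>i\<in>J. \<Sum>j\<in>J. (c i * e j) * bil (f i) (f j) y)"
  proof (intro ext sum.cong refl)
    fix y i assume i: "i \<in> J"
    have "zeta (\<lambda>x. \<Sum>j\<in>J. (c i * e j) * (f i x * f j x)) = (\<lambda>y. \<Sum>j\<in>J. zeta (\<lambda>x. (c i * e j) * (f i x * f j x)) y)"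
      by (intro zeta_sum J PP_cmult P i)
    also have "\<dots> = (\<lambda>y. \<Sum>j\<in>J. (c i * e j) * bil (f i) (f j) y)"
      using zeta_cmult[OF P[OF i]] by (intro ext sum.cong refl) (simp add: bil_def)
    finally show "zeta (\<lambda>x. \<Sum>j\<in>J. (c i * e j) * (f i x * f j x)) y = (\<Sum>j\<in>J. (c i * e j) * bil (f i) (f j) y)" by simp
  qed
  finally show ?thesis by (simp add: form2_def)
qed

text \<open>The class of a section is approximated by its restrictions to the points \<open>t *\<^sub>R x\<close>, where
  the form is diagonal; definiteness at the origin is an open condition.\<close>

lemma definite_dim_le:
  assumes gen: "generic SS x" and f: "\<And>i. i < d \<Longrightarrow> f i \<in> PP SS" and s: "s = 1 \<or> s = (-1::real)"
    and pos: "\<And>c. \<exists>i<d. c i \<noteq> 0 \<Longrightarrow> s * bil (\<lambda>x. \<Sum>i<d. c i * f i x) (\<lambda>x. \<Sum>i<d. c i * f i x) 0 > 0"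
  shows "d \<le> card {S\<in>SS. s * FS S x > 0}"
proof (rule ccontr)
  assume neg: "\<not> ?thesis"
  define P where "P = {S\<in>SS. s * FS S x > 0}"
  have lt: "card P < d" using neg by (simp add: P_def)
  have fP: "finite P" using sfanD(1)[OF F] by (simp add: P_def)
  define G where "G = (\<lambda>y i j. s * bil (f i) (f j) y)"
  have form: "s * bil (\<lambda>x. \<Sum>i<d. c i * f i x) (\<lambda>x. \<Sum>i<d. c i * f i x) y = form2 {..<d} (G y) c c" for c y
    using f by (subst bil_sum) (auto simp: form2_def G_def sum_distrib_left mult_ac)
  obtain \<mu> where mu: "\<mu> > 0" "\<And>c. (\<Sum>i<d. \<bar>c i\<bar>) = 1 \<Longrightarrow> form2 {..<d} (G 0) c c \<ge> \<mu>"
    using pos_def_lower_bound[of d "G 0"] pos unfolding form by blast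
  \<comment> \<open>The entrywise distance of the two Gram matrices bounds the change of the form on
    vectors of \<open>l1\<close>-norm 1.\<close>
  define E where "E = (\<lambda>t. \<Sum>i<d. \<Sum>j<d. \<bar>G (t *\<^sub>R x) i j - G 0 i j\<bar>)"
  have "continuous_on UNIV E" unfolding E_def
  proof (intro continuous_intros)
    fix i j assume ij: "i \<in> {..<d}" "j \<in> {..<d}"
    have "real_polynomial_function (bil (f i) (f j))"
      unfolding bil_def using ij f by (intro zeta_PP(1) PP_mult) auto
    hence "continuous_on UNIV (bil (f i) (f j))"
      by (intro continuous_on_polymonial_function) (simp add: real_polynomial_function_eq)
    from continuous_on_compose2[OF this, of UNIV "\<lambda>t::real. t *\<^sub>R x"]
    have "continuous_on UNIV (\<lambda>t. bil (f i) (f j) (t *\<^sub>R x))" by (simp add: continuous_intros)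
    thus "continuous_on UNIV (\<lambda>t. G (t *\<^sub>R x) i j)" unfolding G_def by (intro continuous_intros)
  qed
  hence "(E \<longlongrightarrow> E 0) (at_right 0)" by (simp add: continuous_on_def tendsto_within_subset[where S = UNIV])
  moreover have "E 0 = 0" by (simp add: E_def)
  ultimately have "\<forall>\<^sub>F t in at_right 0. E t < \<mu>" using mu(1) by (auto intro: order_tendstoD)
  hence "\<forall>\<^sub>F t in at_right 0. E t < \<mu> \<and> t > 0" using eventually_at_right_less by (rule eventually_conj)
  then obtain t where t: "E t < \<mu>" "t > 0" using eventually_happens'[OF trivial_limit_at_right_real] by blast
  have "card P < card {..<d}" using lt by simp
  \<comment> \<open>With fewer cones of the given sign than vectors, some combination vanishes at
    the moved point on all those cones; the diagonal form then has only terms of the opposite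
    sign.\<close>
  from underdetermined[OF finite_lessThan fP this, of "\<lambda>i S. pc (f i) S (t *\<^sub>R x)"]
  obtain c0 where c0: "\<exists>i<d. c0 i \<noteq> 0" "\<And>S. S \<in> P \<Longrightarrow> (\<Sum>i<d. c0 i * pc (f i) S (t *\<^sub>R x)) = 0" by auto
  define N where "N = (\<Sum>i<d. \<bar>c0 i\<bar>)"
  have N: "N > 0" unfolding N_def using c0(1) by (auto intro!: sum_pos2)
  define c where "c = (\<lambda>i. c0 i / N)"
  have c1: "(\<Sum>i<d. \<bar>c i\<bar>) = 1" using N by (simp add: c_def N_def sum_divide_distrib[symmetric])
  have cP: "(\<Sum>i<d. c i * pc (f i) S (t *\<^sub>R x)) = 0" if "S \<in> P" for S
    using c0(2)[OF that] by (simp add: c_def sum_divide_distrib[symmetric])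
  define ff where "ff = (\<lambda>x. \<Sum>i<d. c i * f i x)"
  have ffP: "ff \<in> PP SS" unfolding ff_def using f by (intro PP_sum PP_cmult) auto
  have pcff: "pc ff S y = (\<Sum>i<d. c i * pc (f i) S y)" if S: "S \<in> SS" for S y
  proof -
    have "pc ff S y = (\<Sum>i<d. pc (\<lambda>x. c i * f i x) S y)"
      unfolding ff_def using f S by (intro pc_sum PP_cmult) auto
    also have "\<dots> = (\<Sum>i<d. c i * pc (f i) S y)"
      using f pc_mult[OF poly_PP[OF real_polynomial_function.intros(2)] _ S sfanD(2)[OF F S]]
        pc_poly[OF real_polynomial_function.intros(2) sfanD(2)[OF F S]] by (intro sum.cong refl) auto
    finally show ?thesis .
  qed
  have gt: "generic SS (t *\<^sub>R x)"
    using gen t(2) sfanD(2)[OF F] unfolding generic_def by (auto simp: rep_scale)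
  have "s * bil ff ff (t *\<^sub>R x) \<le> 0"
  proof -
    have "s * bil ff ff (t *\<^sub>R x) = (\<Sum>S\<in>SS. s * (pc ff S (t *\<^sub>R x) ^ 2 / FS S (t *\<^sub>R x)))"
      unfolding bil_def zeta_PP(2)[OF PP_mult[OF ffP ffP] gt] sum_distrib_left
      by (intro sum.cong refl) (simp add: pc_mult[OF ffP ffP _ sfanD(2)[OF F]] power2_eq_square)
    also have "\<dots> \<le> 0"
    proof (rule sum_nonpos)
      fix S assume S: "S \<in> SS"
      show "s * (pc ff S (t *\<^sub>R x) ^ 2 / FS S (t *\<^sub>R x)) \<le> 0"
      proof (cases "S \<in> P")
        case True
        thus ?thesis using pcff[OF S] cP by simp
      next
        case False
        have "FS S (t *\<^sub>R x) = t ^ card S * FS S x"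
          by (simp add: FS_def rep_scale[OF sfanD(2)[OF F S]] prod.distrib)
        moreover have "s * FS S x \<le> 0" using False S by (simp add: P_def)
        ultimately have "s * FS S (t *\<^sub>R x) \<le> 0"
          using t(2) mult_nonneg_nonpos[of "t ^ card S" "s * FS S x"] by (simp add: mult.left_commute)
        thus ?thesis using s by (auto simp: divide_simps zero_le_divide_iff)
      qed
    qed
    finally show ?thesis .
  qed
  hence le0: "form2 {..<d} (G (t *\<^sub>R x)) c c \<le> 0" using form[of c] by (simp add: ff_def)
  have "\<bar>form2 {..<d} (G (t *\<^sub>R x)) c c - form2 {..<d} (G 0) c c\<bar> \<le> E t"
  proof -
    have cle: "\<bar>c i\<bar> \<le> 1" if "i < d" for i
      using c1 member_le_sum[of i "{..<d}" "\<lambda>i. \<bar>c i\<bar>"] that by simp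
    have "form2 {..<d} (G (t *\<^sub>R x)) c c - form2 {..<d} (G 0) c c = (\<Sum>i<d. \<Sum>j<d. c i * c j * (G (t *\<^sub>R x) i j - G 0 i j))"
      by (simp add: form2_def sum_subtractf algebra_simps)
    also have "\<bar>\<dots>\<bar> \<le> (\<Sum>i<d. \<Sum>j<d. \<bar>c i * c j * (G (t *\<^sub>R x) i j - G 0 i j)\<bar>)"
      by (rule order_trans[OF sum_abs]) (intro sum_mono sum_abs)
    also have "\<dots> \<le> E t" unfolding E_def
    proof (intro sum_mono)
      fix i j assume ij: "i \<in> {..<d}" "j \<in> {..<d}"
      have "\<bar>c i\<bar> * \<bar>c j\<bar> \<le> 1 * 1" using cle ij by (intro mult_mono) auto
      hence "(\<bar>c i\<bar> * \<bar>c j\<bar>) * \<bar>G (t *\<^sub>R x) i j - G 0 i j\<bar> \<le> 1 * \<bar>G (t *\<^sub>R x) i j - G 0 i j\<bar>"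
        by (intro mult_right_mono) auto
      thus "\<bar>c i * c j * (G (t *\<^sub>R x) i j - G 0 i j)\<bar> \<le> \<bar>G (t *\<^sub>R x) i j - G 0 i j\<bar>" by (simp add: abs_mult)
    qed
    finally show ?thesis .
  qed
  thus False using le0 mu(2)[OF c1] t(1) by linarith
qed

end

section \<open>The Poincare pairing\<close>

context reduction
begin

text \<open>The converse of \<open>low_degree_values_reducible\<close>: at a point the coordinates
  become scalars, and only the cofactors of lower degree remain.\<close>

lemma ev_LI:
  assumes f: "f \<in> LI SS B B k" shows "ev SS x f \<in> Elt SS x k"
proof -
  obtain g where g: "\<And>v. v \<in> B \<Longrightarrow> g v \<in> PPm SS k" "f = (\<lambda>y. \<Sum>v\<in>B. representation B y v * g v y)"
    using f by (auto simp: LI_def)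
  have r: "(\<lambda>y. representation B y v) \<in> PPh SS 1" for v by (rule homogeneous_poly_PPh[OF homogeneous_poly_rep[OF B]])
  have "ev SS x f = (\<Sum>v\<in>B. ev SS x (\<lambda>y. representation B y v * g v y))"
    unfolding g(2) by (rule ev_sum[OF F]) (rule PPm_linear_mult[OF g(1) r])
  also have "\<dots> = (\<Sum>v\<in>B. fscale (representation B x v) (ev SS x (g v)))"
    by (intro sum.cong refl ev_poly_mult[OF F rep_poly[OF B]] PPm_PP[OF g(1)])
  also have "\<dots> \<in> Elt SS x k"
    unfolding Elt_def
  proof (intro fv.span_sum fv.span_scale)
    fix v assume v: "v \<in> B"
    show "ev SS x (g v) \<in> fv.span (\<Union>j<k. ev SS x ` PPh SS j)"
    proof (cases "k = 0")
      case True
      hence "g v = (\<lambda>_. 0)" using g(1)[OF v] by (simp add: PPm_def)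
      thus ?thesis using fv.span_zero by (simp add: ev_zero[OF F])
    next
      case False
      hence "g v \<in> PPh SS (k - 1)" using g(1)[OF v] by (simp add: PPm_def)
      thus ?thesis using False by (intro fv.span_base) (auto intro!: bexI[of _ "k - 1"])
    qed
  qed
  finally show ?thesis .
qed

lemma Jideal_span:
  assumes "f \<in> PPh SS k"
  shows "\<exists>c. (\<lambda>y. f y - (\<Sum>u\<in>{u\<in>\<beta>. d u = k}. c u * lf u y)) \<in> Jideal SS B"
proof -
  obtain c where "(\<lambda>y. f y - (\<Sum>u\<in>{u\<in>\<beta>. d u = k}. c u * lf u y)) \<in> LI SS B B k" by (rule lift_top_part[OF assms])
  thus ?thesis using LI_Jideal by blast
qed

text \<open>An element of the ideal has values coming from degrees below \<open>k\<close>, whereas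
  the vectors of degree \<open>k\<close> are independent modulo those. So the lifts of degree
  \<open>k\<close> give a basis of the component of the cohomology.\<close>

lemma Jideal_independent:
  assumes z: "(\<lambda>y. \<Sum>u\<in>{u\<in>\<beta>. d u = k}. c u * lf u y) \<in> Jideal SS B" and u: "u \<in> \<beta>" "d u = k"
  shows "c u = 0"
proof -
  define h where "h = (\<lambda>y. \<Sum>u\<in>{u\<in>\<beta>. d u = k}. c u * lf u y)"
  have lP: "(\<lambda>y. c v * lf v y) \<in> PPh SS k" if "v \<in> {u\<in>\<beta>. d u = k}" for v
    using PPh_cmult[OF lf(1), of v "c v"] that by auto
  have h: "h \<in> PPh SS k" unfolding h_def by (rule PPh_sum) (rule lP)
  define g where "g = (\<lambda>j. if j = k then h else (\<lambda>_. 0))"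
  have gP: "g j \<in> PPh SS j" for j using h by (simp add: g_def PPh_zero)
  have "(\<lambda>y. \<Sum>j\<le>k. g j y) = h"
  proof
    fix y
    have "(\<Sum>j\<le>k. g j y) = (\<Sum>j\<le>k. if j = k then h y else 0)" by (intro sum.cong) (auto simp: g_def)
    thus "(\<Sum>j\<le>k. g j y) = h y" by simp
  qed
  hence "(\<lambda>y. \<Sum>j\<le>k. g j y) \<in> Jideal SS B" using z by (simp add: h_def)
  from Jideal_component[OF F B gP this order_refl] have "h \<in> LI SS B B k" by (simp add: g_def)
  hence "ev SS x h \<in> Elt SS x k" by (rule ev_LI)
  hence "ev SS x h \<in> fv.span (BB k)" using BB(3) by blast
  then obtain a where a: "ev SS x h = (\<Sum>v\<in>BB k. fscale (a v) v)"
    unfolding fv.span_finite[OF BB_finite] by auto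
  have "ev SS x h = (\<Sum>v\<in>{u\<in>\<beta>. d u = k}. ev SS x (\<lambda>y. c v * lf v y))"
    unfolding h_def by (rule ev_sum[OF F]) (rule lP)
  also have "\<dots> = (\<Sum>v\<in>{u\<in>\<beta>. d u = k}. fscale (c v) v)"
  proof (intro sum.cong refl)
    fix v assume "v \<in> {u\<in>\<beta>. d u = k}"
    thus "ev SS x (\<lambda>y. c v * lf v y) = fscale (c v) v" using ev_cmult[OF F PPh_PP[OF lf(1)], of v x "c v"] lf(2) by auto
  qed
  finally have e: "(\<Sum>v\<in>{u\<in>\<beta>. d u = k}. fscale (c v) v) = (\<Sum>v\<in>BB k. fscale (a v) v)" using a by simp
  define b where "b = (\<lambda>v. if d v = k then c v else - a v)"
  have "(\<Sum>v\<in>{u\<in>\<beta>. d u = k} \<union> BB k. fscale (b v) v) = (\<Sum>v\<in>{u\<in>\<beta>. d u = k}. fscale (b v) v) + (\<Sum>v\<in>BB k. fscale (b v) v)"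
    using beta_finite BB_finite by (intro sum.union_disjoint) (auto simp: BB_eq)
  also have "(\<Sum>v\<in>{u\<in>\<beta>. d u = k}. fscale (b v) v) = (\<Sum>v\<in>{u\<in>\<beta>. d u = k}. fscale (c v) v)"
    by (intro sum.cong refl) (simp add: b_def)
  also have "(\<Sum>v\<in>BB k. fscale (b v) v) = (\<Sum>v\<in>BB k. - fscale (a v) v)"
    by (intro sum.cong refl) (auto simp: b_def fscale_def BB_eq)
  also have "\<dots> = - (\<Sum>v\<in>BB k. fscale (a v) v)" by (rule sum_negf)
  finally have "(\<Sum>v\<in>{u\<in>\<beta>. d u = k} \<union> BB k. fscale (b v) v) = 0" unfolding e by (simp only: add.right_inverse)
  from beta_comb_zero[OF this, of u] u have "b u = 0" by (auto simp: BB_eq)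
  thus ?thesis using u by (simp add: b_def)
qed

end

section \<open>Duality between opposite points and nondegeneracy of the pairing\<close>

locale signed_fan = weighted_fan SS w + reduction SS B x + M: reduction SS B' "- x"
  for SS :: "'a::real_normed_vector set set" and w B x B'
begin

lemma bil_deg:
  assumes f: "f \<in> PPh SS k" and g: "g \<in> PPh SS l"
  shows "k + l < n \<Longrightarrow> bil f g = (\<lambda>_. 0)" "k + l = n \<Longrightarrow> bil f g y = bil f g 0" "k + l > n \<Longrightarrow> bil f g 0 = 0"
proof -
  note P = PPh_mult[OF f g]
  show "k + l < n \<Longrightarrow> bil f g = (\<lambda>_. 0)" unfolding bil_def using zeta_PPh(2)[OF P] by (simp add: n_def)
  have h: "bil f g (t *\<^sub>R y) = t ^ (k + l - n) * bil f g y" for t y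
    unfolding bil_def using zeta_PPh(1)[OF P] by (simp add: n_def homogeneous_poly_def)
  show "k + l = n \<Longrightarrow> bil f g y = bil f g 0" using h[of 0 y] by simp
  show "k + l > n \<Longrightarrow> bil f g 0 = 0" using h[of 0 0] by (simp add: zero_power)
qed

definition Q :: "('a set \<Rightarrow> real) \<Rightarrow> ('a set \<Rightarrow> real) \<Rightarrow> real" where
  "Q u v = (\<Sum>S\<in>SS. u S * v S / FS S x)"

lemma Q_ev:
  assumes "f \<in> PP SS" "g \<in> PP SS" shows "Q (ev SS x f) (ev SS x g) = bil f g x"
  unfolding Q_def bil_def zeta_PP(2)[OF PP_mult[OF assms] gen]
  by (intro sum.cong refl) (simp add: ev_def pc_mult[OF assms _ sfanD(2)[OF F]])

lemma Q_add: "Q (u + u') v = Q u v + Q u' v" "Q u (v + v') = Q u v + Q u v'"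
  by (simp_all add: Q_def sum.distrib[symmetric] add_divide_distrib[symmetric] algebra_simps)

lemma Q_0: "Q 0 v = 0" "Q u 0 = 0" by (simp_all add: Q_def)

lemma Q_scale: "Q (fscale c u) v = c * Q u v" "Q u (fscale c v) = c * Q u v"
  by (simp_all add: Q_def fscale_def sum_distrib_left mult.assoc mult.left_commute)

lemma Q_sum: "Q (\<Sum>i\<in>X. u i) v = (\<Sum>i\<in>X. Q (u i) v)" "Q v (\<Sum>i\<in>X. u i) = (\<Sum>i\<in>X. Q v (u i))"
  by (induction X rule: infinite_finite_induct) (simp_all add: Q_0 Q_add)

text \<open>Degrees below \<open>k\<close> and below \<open>l\<close> add up to at most
  \<open>k + l - 2\<close>, hence to less than \<open>n\<close>, where the integral is zero.\<close>

lemma Q_Elt: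
  assumes u: "u \<in> Elt SS x k" and v: "v \<in> Elt SS x l" and kl: "k + l \<le> Suc n"
  shows "Q u v = 0"
proof -
  obtain f where f: "\<forall>j<k. f j \<in> PPh SS j" "u = (\<Sum>j<k. ev SS x (f j))" using Elt_expand[OF F u] by auto
  obtain g where g: "\<forall>j<l. g j \<in> PPh SS j" "v = (\<Sum>j<l. ev SS x (g j))" using Elt_expand[OF F v] by auto
  have "Q (ev SS x (f i)) (ev SS x (g j)) = 0" if "i < k" "j < l" for i j
  proof -
    have P: "f i \<in> PPh SS i" "g j \<in> PPh SS j" using f g that by auto
    show ?thesis using bil_deg(1)[OF P] that kl by (simp add: Q_ev[OF PPh_PP[OF P(1)] PPh_PP[OF P(2)]])
  qed
  thus ?thesis unfolding f(2) g(2) Q_sum by simp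
qed

lemma FSx: "S \<in> SS \<Longrightarrow> FS S x \<noteq> 0"
  using FS_nonzero_generic gen by blast

text \<open>For \<open>- x\<close> the negative face is the complement of the one for
  \<open>x\<close>, so the second term counts the cones with at least \<open>k\<close> negative
  coordinates for \<open>x\<close>; the filtration itself is the same for both points.\<close>

lemma card_BB: assumes k: "k \<le> Suc n" shows "card (BB k) + card (BB (Suc n - k)) = card SS"
proof -
  have nn: "M.n = n" by (simp add: n_def M.n_def)
  have "fv.dim (Elt SS x (Suc n - k)) = card {S\<in>SS. card (neg (- x) S) < Suc n - k}"
    using M.dim_Elt_neg unfolding Elt_minus[OF F] .
  also have "{S\<in>SS. card (neg (- x) S) < Suc n - k} = {S\<in>SS. \<not> card (neg x S) < k}"
  proof (intro Collect_cong conj_cong refl)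
    fix S assume S: "S \<in> SS"
    have sub: "neg x S \<subseteq> S" by (auto simp: neg_def)
    have "card (neg x S) \<le> n" using card_mono[OF sfanD(5)[OF F S] sub] card_cone[OF S] by simp
    moreover have "card (neg (- x) S) = n - card (neg x S)"
      unfolding neg_minus[OF F gen S] card_cone[OF S, symmetric] by (rule card_Diff_subset[OF finite_subset[OF sub sfanD(5)[OF F S]] sub])
    ultimately show "card (neg (- x) S) < Suc n - k \<longleftrightarrow> \<not> card (neg x S) < k" using k by auto
  qed
  finally have 1: "card (BB (Suc n - k)) = card {S\<in>SS. \<not> card (neg x S) < k}" unfolding BB_eq dim_Elt .
  have 2: "card (BB k) = card {S\<in>SS. card (neg x S) < k}" unfolding BB_eq dim_Elt[symmetric] by (rule dim_Elt_neg)
  have "card {S\<in>SS. card (neg x S) < k} + card {S\<in>SS. \<not> card (neg x S) < k} = card SS"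
    using sfanD(1)[OF F] by (subst card_Un_disjoint[symmetric]) (auto intro!: arg_cong[of _ _ card])
  thus ?thesis unfolding 1 2 .
qed

text \<open>The values in degrees \<open>< k\<close> and \<open>< n + 1 - k\<close> are orthogonal for \<open>Q\<close>, and their dimensions add up
  to the number of cones. A further element orthogonal to the latter would make the families
  \<open>u / FS\<close> and \<open>v\<close> linearly dependent, which contradicts orthogonality.\<close>

lemma Q_pairing_zero:
  assumes k: "k \<le> n" and z: "\<And>v. v \<in> BB (Suc n - k) \<Longrightarrow> Q (\<Sum>u\<in>{u\<in>\<beta>. d u = k}. fscale (c u) u) v = 0"
    and u0: "u0 \<in> \<beta>" "d u0 = k"
  shows "c u0 = 0"
proof (rule ccontr)
  assume cu: "c u0 \<noteq> 0"
  define f where "f = (\<Sum>u\<in>{u\<in>\<beta>. d u = k}. fscale (c u) u)"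
  define X where "X = BB k"
  define Y where "Y = BB (Suc n - k)"
  have fin: "finite X" "finite Y" by (simp_all add: X_def Y_def BB_finite)
  \<comment> \<open>\<open>None\<close> stands for the extra element \<open>f\<close>. By
    \<open>card_BB\<close> the index set has one element more than there are cones, which produces
    the relation.\<close>
  define J where "J = insert None (Some ` X) <+> Y"
  define A :: "(('a set \<Rightarrow> real) option + ('a set \<Rightarrow> real)) \<Rightarrow> 'a set \<Rightarrow> real" where
    "A = (\<lambda>j S. case j of Inl None \<Rightarrow> f S / FS S x | Inl (Some u) \<Rightarrow> u S / FS S x | Inr v \<Rightarrow> v S)"
  have fJ: "finite J" using fin by (simp add: J_def)
  have "card J = Suc (card X + card Y)"
    using fin by (simp add: J_def card_Plus card_image)
  hence "card SS < card J" using card_BB[of k] k by (simp add: X_def Y_def)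
  from underdetermined[OF fJ sfanD(1)[OF F] this, of A]
  obtain a where a: "\<exists>j\<in>J. a j \<noteq> 0" "\<And>S. S \<in> SS \<Longrightarrow> (\<Sum>j\<in>J. a j * A j S) = 0" by auto
  define W where "W = fscale (a (Inl None)) f + (\<Sum>u\<in>X. fscale (a (Inl (Some u))) u)"
  define V where "V = (\<Sum>v\<in>Y. fscale (a (Inr v)) v)"
  have rel: "W S / FS S x + V S = 0" if S: "S \<in> SS" for S
  proof -
    have "(\<Sum>j\<in>J. a j * A j S) = a (Inl None) * A (Inl None) S + (\<Sum>u\<in>X. a (Inl (Some u)) * A (Inl (Some u)) S) + (\<Sum>v\<in>Y. a (Inr v) * A (Inr v) S)"
      unfolding J_def using fin by (simp add: sum.Plus sum.reindex)
    also have "\<dots> = W S / FS S x + V S"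
      by (simp add: A_def W_def V_def fun_sum_apply fscale_def add_divide_distrib sum_divide_distrib)
    finally show ?thesis using a(2)[OF S] by simp
  qed
  have VE: "V \<in> Elt SS x (Suc n - k)"
    unfolding V_def Elt_def by (intro fv.span_sum fv.span_scale) (use BB(2) in \<open>auto simp: Y_def Elt_def\<close>)
  have fV: "Q f V = 0" unfolding V_def Q_sum Q_scale using z by (simp add: f_def Y_def)
  have XV: "Q u V = 0" if "u \<in> X" for u
    using that BB(2)[of k] k by (intro Q_Elt[OF _ VE]) (auto simp: X_def)
  have "Q W V = 0" unfolding W_def Q_add Q_sum Q_scale using fV XV by simp
  \<comment> \<open>The relation says that \<open>W / FS\<close> is minus \<open>V\<close> on every
    cone, so the pairing is minus a sum of squares; orthogonality then kills \<open>V\<close>, and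
    with it \<open>W\<close>.\<close>
  moreover have "Q W V = - (\<Sum>S\<in>SS. (V S)\<^sup>2)"
    unfolding Q_def sum_negf[symmetric]
  proof (intro sum.cong refl)
    fix S assume "S \<in> SS"
    hence "W S / FS S x = - V S" using rel[of S] by linarith
    thus "W S * V S / FS S x = - (V S)\<^sup>2" by (simp add: power2_eq_square) (metis mult_minus_left times_divide_eq_left mult.commute)
  qed
  ultimately have "(\<Sum>S\<in>SS. (V S)\<^sup>2) = 0" by simp
  hence VS: "V S = 0" if "S \<in> SS" for S using that sfanD(1)[OF F] by (simp add: sum_nonneg_eq_0_iff)
  have Yb: "Y \<subseteq> \<beta>" and Xb: "X \<subseteq> \<beta>" by (auto simp: X_def Y_def \<beta>_def)
  have V0: "V = 0"
  proof
    fix S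
    show "V S = 0 S"
    proof (cases "S \<in> SS")
      case False
      thus ?thesis using Yb beta_zero by (auto simp: V_def fun_sum_apply fscale_def intro!: sum.neutral)
    qed (simp add: VS)
  qed
  hence aY: "a (Inr v) = 0" if "v \<in> Y" for v using beta_comb_zero[OF _ Yb that] by (simp add: V_def)
  \<comment> \<open>The element \<open>f\<close> only involves basis vectors of degree
    \<open>k\<close>, which are disjoint from \<open>X\<close>; so \<open>W\<close> is a combination
    of distinct members of \<beta>.\<close>
  define b where "b = (\<lambda>u. if d u = k then a (Inl None) * c u else a (Inl (Some u)))"
  have Wb: "W = (\<Sum>u\<in>{u\<in>\<beta>. d u = k} \<union> X. fscale (b u) u)"
  proof -
    have "(\<Sum>u\<in>{u\<in>\<beta>. d u = k} \<union> X. fscale (b u) u) = (\<Sum>u\<in>{u\<in>\<beta>. d u = k}. fscale (b u) u) + (\<Sum>u\<in>X. fscale (b u) u)"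
      using beta_finite fin by (intro sum.union_disjoint) (auto simp: X_def BB_eq)
    also have "(\<Sum>u\<in>{u\<in>\<beta>. d u = k}. fscale (b u) u) = fscale (a (Inl None)) f"
      unfolding f_def fv.scale_sum_right by (intro sum.cong refl) (simp add: b_def fscale_def mult.assoc)
    also have "(\<Sum>u\<in>X. fscale (b u) u) = (\<Sum>u\<in>X. fscale (a (Inl (Some u))) u)"
      by (intro sum.cong refl) (auto simp: b_def X_def BB_eq)
    finally show ?thesis unfolding W_def ..
  qed
  have Ub: "{u\<in>\<beta>. d u = k} \<union> X \<subseteq> \<beta>" using Xb by auto
  have "W = 0"
  proof
    fix S
    show "W S = 0 S"
    proof (cases "S \<in> SS")
      case True
      thus ?thesis using rel[OF True] FSx[OF True] by (simp add: V0)
    next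
      case False
      have "(\<Sum>u\<in>{u\<in>\<beta>. d u = k} \<union> X. b u * u S) = 0"
      proof (rule sum.neutral, rule ballI)
        fix u assume "u \<in> {u\<in>\<beta>. d u = k} \<union> X"
        hence "u \<in> \<beta>" using Ub by blast
        thus "b u * u S = 0" using beta_zero[OF _ False] by simp
      qed
      thus ?thesis unfolding Wb by (simp add: fun_sum_apply fscale_def)
    qed
  qed
  hence b0: "b u = 0" if "u \<in> {u\<in>\<beta>. d u = k} \<union> X" for u using beta_comb_zero[OF _ Ub that] Wb by simp
  have "a (Inl None) = 0" using b0[of u0] u0 cu by (simp add: b_def)
  moreover have "a (Inl (Some u)) = 0" if "u \<in> X" for u using b0[of u] that by (auto simp: b_def X_def BB_eq)
  ultimately show False using a(1) aY by (auto simp: J_def)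
qed

text \<open>Against a vector of degree \<open>n - k\<close> the pairing at 0 sees only the part of
  degree \<open>k\<close>, and there it is constant, so it may be computed at \<open>x\<close>.
  Against lower degrees both sides are zero. This reduces the claim to
  \<open>Q_pairing_zero\<close>.\<close>

lemma pairing_nondegenerate:
  assumes z: "\<And>v. v \<in> \<beta> \<Longrightarrow> (\<Sum>u\<in>\<beta>. c u * bil (lf u) (lf v) 0) = 0" and u: "u0 \<in> \<beta>"
  shows "c u0 = 0"
proof (rule Q_pairing_zero[OF beta_d[OF u] _ u refl])
  define k where "k = d u0"
  have k: "k \<le> n" using beta_d[OF u] by (simp add: k_def)
  fix v assume "v \<in> BB (Suc n - d u0)"
  hence v: "v \<in> \<beta>" "d v \<le> n - k" using k by (auto simp: BB_eq k_def)
  have Quv: "Q u' v = bil (lf u') (lf v) x" if "u' \<in> \<beta>" for u'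
    using Q_ev[OF PPh_PP[OF lf(1)[OF that]] PPh_PP[OF lf(1)[OF v(1)]]] lf(2)[OF that] lf(2)[OF v(1)] by simp
  have "Q (\<Sum>u\<in>{u\<in>\<beta>. d u = k}. fscale (c u) u) v = (\<Sum>u\<in>{u\<in>\<beta>. d u = k}. c u * bil (lf u) (lf v) x)"
    unfolding Q_sum Q_scale by (intro sum.cong refl) (simp add: Quv)
  also have "\<dots> = 0"
  proof (cases "d v = n - k")
    case True
    have "(\<Sum>u\<in>{u\<in>\<beta>. d u = k}. c u * bil (lf u) (lf v) x) = (\<Sum>u\<in>\<beta>. c u * bil (lf u) (lf v) 0)"
    proof (rule sum.mono_neutral_cong_left[OF beta_finite])
      show "{u \<in> \<beta>. d u = k} \<subseteq> \<beta>" by auto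
      show "\<forall>u\<in>\<beta> - {u \<in> \<beta>. d u = k}. c u * bil (lf u) (lf v) 0 = 0"
      proof
        fix u assume "u \<in> \<beta> - {u \<in> \<beta>. d u = k}"
        hence u: "u \<in> \<beta>" "d u \<noteq> k" by auto
        have "d u + d v < n \<or> d u + d v > n" using u True k by linarith
        thus "c u * bil (lf u) (lf v) 0 = 0" using bil_deg(1,3)[OF lf(1)[OF u(1)] lf(1)[OF v(1)]] by auto
      qed
      fix u assume "u \<in> {u \<in> \<beta>. d u = k}"
      hence u: "u \<in> \<beta>" "d u = k" by auto
      have "d u + d v = n" using u True k by simp
      thus "c u * bil (lf u) (lf v) x = c u * bil (lf u) (lf v) 0"
        using bil_deg(2)[OF lf(1)[OF u(1)] lf(1)[OF v(1)]] by simp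
    qed
    thus ?thesis using z[OF v(1)] by simp
  next
    case False
    show ?thesis
    proof (rule sum.neutral, rule ballI)
      fix u assume "u \<in> {u \<in> \<beta>. d u = k}"
      hence u: "u \<in> \<beta>" "d u = k" by auto
      have "d u + d v < n" using u False v(2) k by linarith
      thus "c u * bil (lf u) (lf v) x = 0"
        using bil_deg(1)[OF lf(1)[OF u(1)] lf(1)[OF v(1)]] by simp
    qed
  qed
  finally show "Q (\<Sum>u\<in>{u\<in>\<beta>. d u = d u0}. fscale (c u) u) v = 0" by (simp add: k_def)
qed

lemma orthogonal_family:
  "\<exists>f. (\<forall>k<card SS. f k \<in> PP SS \<and> bil (f k) (f k) 0 \<noteq> 0) \<and>
     (\<forall>k<card SS. \<forall>l<card SS. k \<noteq> l \<longrightarrow> bil (f k) (f l) 0 = 0)"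
proof -
  define G where "G = (\<lambda>u v. bil (lf u) (lf v) 0)"
  have "\<exists>e. (\<forall>k<card \<beta>. form2 \<beta> G (e k) (e k) \<noteq> 0) \<and> (\<forall>k<card \<beta>. \<forall>l<card \<beta>. k \<noteq> l \<longrightarrow> form2 \<beta> G (e k) (e l) = 0)"
  proof (rule orthogonal_basis[OF beta_finite])
    show "G i j = G j i" for i j by (simp add: G_def bil_def mult.commute)
    fix c i assume "\<And>j. j \<in> \<beta> \<Longrightarrow> (\<Sum>i\<in>\<beta>. c i * G i j) = 0" "i \<in> \<beta>"
    thus "c i = 0" unfolding G_def by (rule pairing_nondegenerate[of c i])
  qed
  from this[unfolded card_beta] obtain e where e: "\<forall>k<card SS. form2 \<beta> G (e k) (e k) \<noteq> 0" "\<forall>k<card SS. \<forall>l<card SS. k \<noteq> l \<longrightarrow> form2 \<beta> G (e k) (e l) = 0"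
    by (elim exE conjE) (rule that)
  define f where "f = (\<lambda>k y. \<Sum>u\<in>\<beta>. e k u * lf u y)"
  have l: "lf u \<in> PP SS" if "u \<in> \<beta>" for u using PPh_PP[OF lf(1)[OF that]] .
  have "bil (f k) (f j) 0 = form2 \<beta> G (e k) (e j)" for k j
    unfolding f_def G_def by (rule bil_sum[OF beta_finite]) (rule l)
  moreover have "f k \<in> PP SS" for k unfolding f_def by (intro PP_sum PP_cmult l)
  ultimately show ?thesis using e by (intro exI[of _ f]) auto
qed

text \<open>An orthogonal family splits into positive and negative squares. Each number is at most
  the number of cones of that sign, and both pairs of numbers add up to the number of cones, so
  equality holds for each sign.\<close>

lemma definite_families:
  assumes s: "s = 1 \<or> s = (-1::real)"
  shows "\<exists>f. (\<forall>i<card {S\<in>SS. s * FS S x > 0}. f i \<in> PP SS) \<and>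
    (\<forall>c. (\<exists>i<card {S\<in>SS. s * FS S x > 0}. c i \<noteq> 0) \<longrightarrow>
      s * bil (\<lambda>y. \<Sum>i<card {S\<in>SS. s * FS S x > 0}. c i * f i y) (\<lambda>y. \<Sum>i<card {S\<in>SS. s * FS S x > 0}. c i * f i y) 0 > 0)"
proof -
  obtain f where f: "\<And>k. k < card SS \<Longrightarrow> f k \<in> PP SS" "\<And>k. k < card SS \<Longrightarrow> bil (f k) (f k) 0 \<noteq> 0"
     "\<And>k l. k < card SS \<Longrightarrow> l < card SS \<Longrightarrow> k \<noteq> l \<Longrightarrow> bil (f k) (f l) 0 = 0"
    using orthogonal_family by (elim exE) (rule that, blast+)
  define K where "K = (\<lambda>s. {k. k < card SS \<and> s * bil (f k) (f k) 0 > 0})"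
  define N where "N = (\<lambda>s. card {S\<in>SS. s * FS S x > 0})"
  have fam: "\<exists>g. (\<forall>i<card (K s). g i \<in> PP SS) \<and>
    (\<forall>c. (\<exists>i<card (K s). c i \<noteq> 0) \<longrightarrow> s * bil (\<lambda>y. \<Sum>i<card (K s). c i * g i y) (\<lambda>y. \<Sum>i<card (K s). c i * g i y) 0 > 0)" for s
  proof -
    have fK: "finite (K s)" by (simp add: K_def)
    obtain h where "bij_betw h {0..<card (K s)} (K s)" using ex_bij_betw_nat_finite[OF fK] by blast
    hence h: "bij_betw h {..<card (K s)} (K s)" by (simp add: atLeast0LessThan)
    have hK: "h i \<in> K s" if "i < card (K s)" for i using bij_betwE[OF h] that by simp
    have hinj: "h i \<noteq> h j" if "i < card (K s)" "j < card (K s)" "i \<noteq> j" for i j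
      using bij_betw_imp_inj_on[OF h] that by (auto simp: inj_on_def)
    define g where "g = (\<lambda>i. f (h i))"
    have g: "g i \<in> PP SS" if "i \<in> {..<card (K s)}" for i using hK[of i] that f(1) by (simp add: g_def K_def)
    have "s * bil (\<lambda>y. \<Sum>i<card (K s). c i * g i y) (\<lambda>y. \<Sum>i<card (K s). c i * g i y) 0 > 0" if c: "\<exists>i<card (K s). c i \<noteq> 0" for c
    proof -
      have "bil (\<lambda>y. \<Sum>i<card (K s). c i * g i y) (\<lambda>y. \<Sum>i<card (K s). c i * g i y) 0
          = form2 {..<card (K s)} (\<lambda>i j. bil (g i) (g j) 0) c c"
        by (rule bil_sum[OF finite_lessThan]) (rule g)
      also have "\<dots> = (\<Sum>i<card (K s). \<Sum>j<card (K s). if j = i then (c i)\<^sup>2 * bil (g i) (g i) 0 else 0)"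
        unfolding form2_def
      proof (intro sum.cong refl)
        fix i j assume "i \<in> {..<card (K s)}" "j \<in> {..<card (K s)}"
        hence ij: "i < card (K s)" "j < card (K s)" by auto
        show "c i * c j * bil (g i) (g j) 0 = (if j = i then (c i)\<^sup>2 * bil (g i) (g i) 0 else 0)"
          using f(3)[of "h i" "h j"] hK[OF ij(1)] hK[OF ij(2)] hinj[OF ij] by (auto simp: g_def K_def power2_eq_square)
      qed
      also have "\<dots> = (\<Sum>i<card (K s). (c i)\<^sup>2 * bil (g i) (g i) 0)" by simp
      finally have "s * bil (\<lambda>y. \<Sum>i<card (K s). c i * g i y) (\<lambda>y. \<Sum>i<card (K s). c i * g i y) 0
        = (\<Sum>i<card (K s). (c i)\<^sup>2 * (s * bil (g i) (g i) 0))" by (simp add: sum_distrib_left mult.left_commute)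
      also have "\<dots> > 0"
      proof -
        obtain i0 where i0: "i0 < card (K s)" "c i0 \<noteq> 0" using c by auto
        have p: "s * bil (g i) (g i) 0 > 0" if "i < card (K s)" for i using hK[OF that] by (simp add: g_def K_def)
        show ?thesis
        proof (rule sum_pos2[of _ i0])
          show "0 < (c i0)\<^sup>2 * (s * bil (g i0) (g i0) 0)" using i0 by (intro mult_pos_pos[OF _ p]) auto
          show "0 \<le> (c i)\<^sup>2 * (s * bil (g i) (g i) 0)" if "i \<in> {..<card (K s)}" for i
            using that by (intro mult_nonneg_nonneg[OF _ less_imp_le[OF p]]) auto
        qed (use i0 in auto)
      qed
      finally show ?thesis .
    qed
    thus ?thesis using g by (intro exI[of _ g]) auto
  qed
  have le: "card (K s) \<le> N s" if s: "s = 1 \<or> s = -1" for s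
  proof -
    obtain g where g: "\<forall>i<card (K s). g i \<in> PP SS"
      "\<forall>c. (\<exists>i<card (K s). c i \<noteq> 0) \<longrightarrow> s * bil (\<lambda>y. \<Sum>i<card (K s). c i * g i y) (\<lambda>y. \<Sum>i<card (K s). c i * g i y) 0 > 0"
      using fam[of s] by (elim exE conjE) (rule that)
    show ?thesis unfolding N_def by (rule definite_dim_le[OF gen _ s, of _ g]) (use g in blast)+
  qed
  have "card (K 1) + card (K (-1)) = card (K 1 \<union> K (-1))"
    by (rule card_Un_disjoint[symmetric]) (auto simp: K_def)
  also have "K 1 \<union> K (-1) = {..<card SS}"
  proof -
    have "0 < bil (f k) (f k) 0 \<or> bil (f k) (f k) 0 < 0" if "k < card SS" for k using f(2)[OF that] by linarith
    thus ?thesis unfolding K_def by auto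
  qed
  finally have 1: "card (K 1) + card (K (-1)) = card SS" by simp
  have "N 1 + N (-1) = card ({S\<in>SS. 1 * FS S x > 0} \<union> {S\<in>SS. -1 * FS S x > 0})"
    unfolding N_def by (rule card_Un_disjoint[symmetric]) (use sfanD(1)[OF F] in auto)
  also have "{S\<in>SS. 1 * FS S x > 0} \<union> {S\<in>SS. -1 * FS S x > 0} = SS"
    using FSx by (auto simp: neq_iff)
  finally have 2: "N 1 + N (-1) = card SS" .
  have "card (K s) = N s" using 1 2 le[of 1] le[of "-1"] s by auto
  thus ?thesis using fam[of s] unfolding N_def by simp
qed

text \<open>The weight is positive, so the sign of the denominator is the parity of the negative
  face; \<open>card_neg_eq\<close> converts the sum over degrees into a sum over cones.\<close>

lemma signature_count:
  "(\<Sum>k\<le>n. (- 1) ^ k * int (card {u\<in>\<beta>. d u = k})) = int (card {S\<in>SS. FS S x > 0}) - int (card {S\<in>SS. - FS S x > 0})"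
proof -
  have sg: "sgn (FS S x) = (- 1) ^ card (neg x S)" if S: "S \<in> SS" for S
  proof -
    have sub: "neg x S \<subseteq> S" by (auto simp: neg_def)
    have "sgn (FS S x) = (\<Prod>v\<in>S. sgn (representation S x v))"
    proof -
      have "sgn (\<Prod>v\<in>X. representation S x v) = (\<Prod>v\<in>X. sgn (representation S x v))" for X
        by (induction X rule: infinite_finite_induct) (auto simp: sgn_mult)
      thus ?thesis unfolding FS_def sgn_mult using w_pos[OF S] by simp
    qed
    also have "\<dots> = (\<Prod>v\<in>S. if v \<in> neg x S then -1 else 1)"
      using gen S by (intro prod.cong refl) (auto simp: neg_def generic_def sgn_if)
    also have "\<dots> = (\<Prod>v\<in>neg x S. -1)" using sub sfanD(5)[OF F S] by (subst prod.inter_restrict[symmetric]) (auto simp: inf_absorb2)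
    finally show ?thesis by simp
  qed
  have le: "card (neg x S) \<le> n" if S: "S \<in> SS" for S
    using card_mono[OF sfanD(5)[OF F S], of "neg x S"] card_cone[OF S] by (auto simp: neg_def)
  have fS: "finite SS" using sfanD(1)[OF F] .
  have "(\<Sum>k\<le>n. (- 1) ^ k * int (card {u\<in>\<beta>. d u = k})) = (\<Sum>k\<le>n. \<Sum>S\<in>{S\<in>SS. card (neg x S) = k}. (- 1) ^ card (neg x S))"
    unfolding card_neg_eq[symmetric] by (intro sum.cong refl) simp
  also have "\<dots> = (\<Sum>S\<in>SS. (- 1) ^ card (neg x S))"
    by (rule sum.group) (use fS le in auto)
  also have "\<dots> = (\<Sum>S\<in>SS. (if FS S x > 0 then 1 else 0) - (if - FS S x > 0 then 1 else 0))"
  proof (intro sum.cong refl)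
    fix S assume S: "S \<in> SS"
    have "real_of_int ((- 1) ^ card (neg x S)) = sgn (FS S x)" using sg[OF S] by simp
    also have "\<dots> = real_of_int ((if FS S x > 0 then 1 else 0) - (if - FS S x > 0 then 1 else 0))"
      using FSx[OF S] by (simp add: sgn_if)
    finally show "(- 1) ^ card (neg x S) = ((if FS S x > 0 then 1 else 0) - (if - FS S x > 0 then 1 else 0) :: int)"
      by (simp only: of_int_eq_iff)
  qed
  also have "\<dots> = int (card {S\<in>SS. FS S x > 0}) - int (card {S\<in>SS. - FS S x > 0})"
    unfolding sum_subtractf using fS by (simp add: sum.If_cases Int_def conj_commute)
  finally show ?thesis .
qed

end

section \<open>Simplicial cones\<close>

definition ccone :: "'a::real_vector set \<Rightarrow> 'a set" where
  "ccone S = {y. \<exists>t. (\<forall>v\<in>S. t v \<ge> 0) \<and> y = (\<Sum>v\<in>S. t v *\<^sub>R v)}"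

definition ray :: "'a::real_vector \<Rightarrow> 'a set" where
  "ray v = {y. \<exists>t\<ge>0. y = t *\<^sub>R v}"

lemma ccone_0: "0 \<in> ccone S"
  unfolding ccone_def by (intro CollectI exI[of _ "\<lambda>_. 0"]) simp

lemma ccone_add: "x \<in> ccone S \<Longrightarrow> y \<in> ccone S \<Longrightarrow> x + y \<in> ccone S"
  unfolding ccone_def
proof (elim CollectE exE conjE, intro CollectI)
  fix s t assume "\<forall>v\<in>S. 0 \<le> s v" "x = (\<Sum>v\<in>S. s v *\<^sub>R v)" "\<forall>v\<in>S. 0 \<le> t v" "y = (\<Sum>v\<in>S. t v *\<^sub>R v)"
  thus "\<exists>t. (\<forall>v\<in>S. t v \<ge> 0) \<and> x + y = (\<Sum>v\<in>S. t v *\<^sub>R v)"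
    by (intro exI[of _ "\<lambda>v. s v + t v"]) (simp add: scaleR_add_left sum.distrib)
qed

lemma ccone_scale: "x \<in> ccone S \<Longrightarrow> c \<ge> 0 \<Longrightarrow> c *\<^sub>R x \<in> ccone S"
  unfolding ccone_def
proof (elim CollectE exE conjE, intro CollectI)
  fix t assume "0 \<le> c" "\<forall>v\<in>S. 0 \<le> t v" "x = (\<Sum>v\<in>S. t v *\<^sub>R v)"
  thus "\<exists>t. (\<forall>v\<in>S. t v \<ge> 0) \<and> c *\<^sub>R x = (\<Sum>v\<in>S. t v *\<^sub>R v)"
    by (intro exI[of _ "\<lambda>v. c * t v"]) (simp add: scaleR_sum_right)
qed

lemma ccone_sum: "(\<And>i. i \<in> X \<Longrightarrow> f i \<in> ccone S) \<Longrightarrow> (\<Sum>i\<in>X. f i) \<in> ccone S"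
  by (induction X rule: infinite_finite_induct) (auto intro: ccone_0 ccone_add)

lemma ccone_base: "finite S \<Longrightarrow> v \<in> S \<Longrightarrow> v \<in> ccone S"
  unfolding ccone_def
proof (intro CollectI exI conjI)
  assume "finite S" "v \<in> S"
  have "(\<Sum>w\<in>S. (if w = v then 1 else 0) *\<^sub>R w) = (\<Sum>w\<in>S. if w = v then v else 0)" by (intro sum.cong) auto
  thus "v = (\<Sum>w\<in>S. (if w = v then 1 else 0) *\<^sub>R w)" using \<open>finite S\<close> \<open>v \<in> S\<close> by simp
qed auto

lemma ccone_minimal:
  assumes "\<And>v. v \<in> S \<Longrightarrow> v \<in> ccone T" shows "ccone S \<subseteq> ccone T"
  using assms by (auto simp: ccone_def[of S] intro!: ccone_sum ccone_scale)

lemma convex_ccone: "convex (ccone S)"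
  by (auto simp: convex_def intro!: ccone_add ccone_scale)

lemma convex_cone_hull_eq: assumes "finite S" shows "convex_cone hull S = ccone S"
proof
  have "convex_cone (ccone S)"
    unfolding convex_cone_def conic_def using convex_ccone ccone_0 ccone_scale by blast
  thus "convex_cone hull S \<subseteq> ccone S"
    by (intro hull_minimal) (auto intro: ccone_base assms)
  show "ccone S \<subseteq> convex_cone hull S"
  proof
    fix y assume "y \<in> ccone S"
    then obtain t where t: "\<forall>v\<in>S. t v \<ge> 0" "y = (\<Sum>v\<in>S. t v *\<^sub>R v)" by (auto simp: ccone_def)
    have "(\<Sum>v\<in>X. t v *\<^sub>R v) \<in> convex_cone hull S" if "finite X" "X \<subseteq> S" for X
      using that
    proof (induction X rule: finite_induct)
      case empty show ?case by (simp add: convex_cone_hull_contains_0)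
    next
      case (insert v X)
      have "t v *\<^sub>R v \<in> convex_cone hull S" using insert.prems t(1) by (intro convex_cone_hull_mul hull_inc) auto
      thus ?case using insert by (simp add: convex_cone_hull_add)
    qed
    thus "y \<in> convex_cone hull S" using assms t(2) by blast
  qed
qed

lemma span_ccone: assumes "finite S" shows "span (ccone S) = span S"
proof
  show "span (ccone S) \<subseteq> span S"
    by (rule span_minimal) (auto simp: ccone_def intro!: span_sum intro: span_scale span_base)
  show "span S \<subseteq> span (ccone S)" by (rule span_mono) (auto intro: ccone_base assms)
qed

lemma ray_base: "v \<in> ray v"
  unfolding ray_def by (intro CollectI exI[of _ 1]) simp

lemma ray_scale: assumes "c > 0" shows "ray (c *\<^sub>R v) = ray v"
proof
  show "ray (c *\<^sub>R v) \<subseteq> ray v" unfolding ray_def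
  proof (clarify)
    fix t :: real assume "t \<ge> 0"
    thus "\<exists>t'\<ge>0. t *\<^sub>R c *\<^sub>R v = t' *\<^sub>R v" using assms by (intro exI[of _ "t * c"]) simp
  qed
  show "ray v \<subseteq> ray (c *\<^sub>R v)" unfolding ray_def
  proof (clarify)
    fix t :: real assume "t \<ge> 0"
    thus "\<exists>t'\<ge>0. t *\<^sub>R v = t' *\<^sub>R c *\<^sub>R v" using assms by (intro exI[of _ "t / c"]) simp
  qed
qed

lemma dim_ray: assumes "v \<noteq> 0" shows "dim (ray v) = 1"
proof -
  have "span (ray v) = span {v}"
  proof
    show "span (ray v) \<subseteq> span {v}" by (rule span_minimal) (auto simp: ray_def intro: span_scale span_base)
    show "span {v} \<subseteq> span (ray v)" by (rule span_mono) (simp add: ray_base)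
  qed
  hence "dim (ray v) = dim {v}" by (metis dim_span)
  thus ?thesis using assms dim_eq_card_independent[of "{v}"] by simp
qed

text \<open>Minimality of the cardinality gives irredundancy; in a pointed cone the elements turn
  out to represent extreme rays.\<close>

definition min_gen :: "'a::real_vector set \<Rightarrow> 'a set \<Rightarrow> bool" where
  "min_gen \<sigma> S \<longleftrightarrow> finite S \<and> \<sigma> = ccone S \<and> (\<forall>T. finite T \<and> \<sigma> = ccone T \<longrightarrow> card S \<le> card T)"

lemma min_gen_exists: assumes "polyhedral_cone \<sigma>" shows "\<exists>S. min_gen \<sigma> S"
proof -
  define A where "A = (\<lambda>k. \<exists>S. finite S \<and> \<sigma> = ccone S \<and> card S = k)"
  have "\<exists>k. A k" using assms by (auto simp: polyhedral_cone_def A_def convex_cone_hull_eq)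
  hence "A (LEAST k. A k)" by (rule LeastI_ex)
  then obtain S where S: "finite S" "\<sigma> = ccone S" "card S = (LEAST k. A k)" by (auto simp: A_def)
  have "card S \<le> card T" if "finite T" "\<sigma> = ccone T" for T
    unfolding S(3) by (rule Least_le) (use that in \<open>auto simp: A_def\<close>)
  thus ?thesis using S by (auto simp: min_gen_def)
qed

lemma min_gen_irredundant:
  assumes S: "min_gen \<sigma> S" and v: "v \<in> S" shows "v \<notin> ccone (S - {v})"
proof
  assume c: "v \<in> ccone (S - {v})"
  have fS: "finite S" and s: "\<sigma> = ccone S" using S by (auto simp: min_gen_def)
  have "\<sigma> = ccone (S - {v})" unfolding s
  proof
    show "ccone S \<subseteq> ccone (S - {v})" by (rule ccone_minimal) (use c fS ccone_base in \<open>metis Diff_iff finite_Diff singletonD\<close>)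
    show "ccone (S - {v}) \<subseteq> ccone S" by (rule ccone_minimal) (use fS ccone_base in blast)
  qed
  hence "card S \<le> card (S - {v})" using S fS by (auto simp: min_gen_def)
  thus False using card_Diff1_less[OF fS v] by simp
qed

text \<open>The origin would be the midpoint of a segment in the cone, contradicting that it is a
  face.\<close>

lemma pointed:
  assumes f: "{0} face_of \<sigma>" and s: "\<sigma> = ccone S" and ab: "a \<in> \<sigma>" "b \<in> \<sigma>" "a + b = 0"
  shows "a = (0::'a::real_vector)"
proof (cases "a = b")
  case True
  hence "2 *\<^sub>R a = 0" using ab(3) by (simp add: scaleR_2)
  thus ?thesis by simp
next
  case False
  have "0 = (1 - 1/2) *\<^sub>R a + (1/2) *\<^sub>R b" using ab(3) by (simp flip: scaleR_add_right)
  hence "0 \<in> open_segment a b" using False by (auto simp: in_segment intro!: exI[of _ "1/2"])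
  thus ?thesis using face_ofD[OF f _ ab(1,2)] by blast
qed

text \<open>In a cone without lines an element of a minimal generating set is not a sum of others, so it
  generates an extreme ray.\<close>

lemma min_gen_ray_face:
  fixes \<sigma> :: "'a::real_vector set"
  assumes f: "{0} face_of \<sigma>" and S: "min_gen \<sigma> S" and v: "v \<in> S"
  shows "ray v face_of \<sigma>"
proof -
  have fS: "finite S" and s: "\<sigma> = ccone S" using S by (auto simp: min_gen_def)
  have n0: "w \<noteq> 0" if "w \<in> S" for w using min_gen_irredundant[OF S that] ccone_0 by metis
  have key: "a \<in> ray v" if a: "a \<in> \<sigma>" and b: "b \<in> \<sigma>" and u: "0 < u" "u < 1" and x: "(1 - u) *\<^sub>R a + u *\<^sub>R b = t *\<^sub>R v" for a b u t
  proof -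
    obtain p where p: "\<forall>w\<in>S. p w \<ge> 0" "a = (\<Sum>w\<in>S. p w *\<^sub>R w)" using a unfolding s by (auto simp: ccone_def)
    obtain q where q: "\<forall>w\<in>S. q w \<ge> 0" "b = (\<Sum>w\<in>S. q w *\<^sub>R w)" using b unfolding s by (auto simp: ccone_def)
    define g where "g = (\<lambda>w. (1 - u) * p w + u * q w)"
    have g: "g w \<ge> 0" if "w \<in> S" for w using p(1) q(1) u that by (simp add: g_def)
    have "(\<Sum>w\<in>S. g w *\<^sub>R w) = t *\<^sub>R v"
      unfolding x[symmetric] p(2) q(2) g_def by (simp add: scaleR_add_left sum.distrib scaleR_sum_right)
    hence e: "g v *\<^sub>R v + (\<Sum>w\<in>S - {v}. g w *\<^sub>R w) = t *\<^sub>R v" using v fS by (simp add: sum.remove)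
    \<comment> \<open>Otherwise \<open>v\<close> would be a nonnegative combination of the other
      generators.\<close>
    have le: "t \<le> g v"
    proof (rule ccontr)
      assume "\<not> t \<le> g v"
      hence pos: "t - g v > 0" by simp
      have "(t - g v) *\<^sub>R v = (\<Sum>w\<in>S - {v}. g w *\<^sub>R w)" using e by (simp add: scaleR_diff_left algebra_simps)
      also have "\<dots> \<in> ccone (S - {v})" unfolding ccone_def using g by auto
      finally have "(1 / (t - g v)) *\<^sub>R (t - g v) *\<^sub>R v \<in> ccone (S - {v})" by (rule ccone_scale) (use pos in simp)
      thus False using pos min_gen_irredundant[OF S v] by simp
    qed
    \<comment> \<open>The remaining terms are elements of the cone with sum zero, so each of them
      vanishes by pointedness.\<close>
    have pw: "p w = 0" if w: "w \<in> S - {v}" for w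
    proof -
      have "g w *\<^sub>R w + ((g v - t) *\<^sub>R v + (\<Sum>w\<in>S - {v} - {w}. g w *\<^sub>R w)) = 0"
        using e sum.remove[of "S - {v}" w "\<lambda>w. g w *\<^sub>R w"] w fS by (simp add: scaleR_diff_left algebra_simps)
      moreover have "g w *\<^sub>R w \<in> \<sigma>" unfolding s using w g fS by (intro ccone_scale ccone_base) auto
      moreover have "(g v - t) *\<^sub>R v + (\<Sum>w\<in>S - {v} - {w}. g w *\<^sub>R w) \<in> \<sigma>"
        unfolding s using v le g fS by (intro ccone_add ccone_sum ccone_scale ccone_base) auto
      ultimately have "g w *\<^sub>R w = 0" using pointed[OF f s] by blast
      hence "g w = 0" using n0 w by auto
      hence "(1 - u) * p w = 0" using p(1) q(1) w u by (simp add: g_def add_nonneg_eq_0_iff)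
      thus ?thesis using u by simp
    qed
    have "a = p v *\<^sub>R v + (\<Sum>w\<in>S - {v}. p w *\<^sub>R w)" unfolding p(2) using v fS by (simp add: sum.remove)
    also have "\<dots> = p v *\<^sub>R v" using pw by simp
    finally show ?thesis using p(1) v by (auto simp: ray_def)
  qed
  show ?thesis
    unfolding face_of_def
  proof (intro conjI ballI impI)
    show "ray v \<subseteq> \<sigma>" unfolding s using ccone_base[OF fS v] by (auto simp: ray_def intro: ccone_scale)
    show "convex (ray v)"
      unfolding convex_def ray_def
    proof clarify
      fix s t u w :: real assume "s \<ge> 0" "t \<ge> 0" "u \<ge> 0" "w \<ge> 0"
      thus "\<exists>r\<ge>0. u *\<^sub>R s *\<^sub>R v + w *\<^sub>R t *\<^sub>R v = r *\<^sub>R v"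
        by (intro exI[of _ "u * s + w * t"]) (simp add: scaleR_add_left)
    qed
    fix a b x assume ab: "a \<in> \<sigma>" "b \<in> \<sigma>" and x: "x \<in> ray v" "x \<in> open_segment a b"
    obtain t where t: "x = t *\<^sub>R v" using x by (auto simp: ray_def)
    obtain u where u: "0 < u" "u < 1" "x = (1 - u) *\<^sub>R a + u *\<^sub>R b" using x(2) by (auto simp: in_segment)
    show "a \<in> ray v" using key[OF ab u(1,2)] u(3) t by metis
    have "(1 - (1 - u)) *\<^sub>R b + (1 - u) *\<^sub>R a = t *\<^sub>R v" using u(3) t by (simp add: add.commute)
    thus "b \<in> ray v" using key[OF ab(2,1), of "1 - u" t] u by simp
  qed
qed

text \<open>Minimal generators give distinct rays, so there are at most as many of them as the
  dimension of their span. They are therefore independent and account for all rays.\<close>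

lemma min_gen_simplicial:
  fixes \<sigma> :: "'a::real_vector set"
  assumes f: "{0} face_of \<sigma>" and S: "min_gen \<sigma> S" and c: "card (cone_rays \<sigma>) = dim \<sigma>" and fin: "finite (cone_rays \<sigma>)"
  shows "independent S" "cone_rays \<sigma> = ray ` S" "inj_on ray S"
proof -
  have fS: "finite S" and s: "\<sigma> = ccone S" using S by (auto simp: min_gen_def)
  have n0: "w \<noteq> 0" if "w \<in> S" for w using min_gen_irredundant[OF S that] ccone_0 by metis
  have sub: "ray ` S \<subseteq> cone_rays \<sigma>"
    using min_gen_ray_face[OF f S] dim_ray[OF n0] ray_base by (auto simp: cone_rays_def cone_face_def)
  show inj: "inj_on ray S"
  proof (rule inj_onI, rule ccontr)
    fix v w assume vw: "v \<in> S" "w \<in> S" "ray v = ray w" "v \<noteq> w"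
    then obtain t where t: "t \<ge> 0" "v = t *\<^sub>R w" using ray_base[of v] by (auto simp: ray_def)
    have "v \<in> ccone (S - {v})" unfolding t(2) using vw t fS by (intro ccone_scale ccone_base) auto
    thus False using min_gen_irredundant[OF S vw(1)] by blast
  qed
  have dS: "dim \<sigma> = dim S" using span_ccone[OF fS] unfolding s by (metis dim_span)
  obtain B where B: "B \<subseteq> S" "independent B" "S \<subseteq> span B" "card B = dim S" using basis_exists by blast
  have "card S \<le> dim \<sigma>" using card_mono[OF fin sub] card_image[OF inj] c by simp
  hence "card S \<le> card B" using dS B(4) by simp
  hence "B = S" by (rule card_seteq[OF fS B(1)])
  thus "independent S" using B(2) by simp
  have "card (cone_rays \<sigma>) \<le> card (ray ` S)" using card_image[OF inj] B(4) \<open>B = S\<close> dS c by simp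
  thus "cone_rays \<sigma> = ray ` S" using card_seteq[OF fin sub] by simp
qed

lemma ccone_bcone: assumes "is_basis S" shows "ccone S = bcone S"
proof
  show "ccone S \<subseteq> bcone S" using bcone_lincomb[OF assms order_refl] by (auto simp: ccone_def)
  show "bcone S \<subseteq> ccone S"
  proof
    fix y assume "y \<in> bcone S"
    thus "y \<in> ccone S" unfolding ccone_def
      by (intro CollectI exI[of _ "representation S y"]) (simp add: rep_sum[OF assms] bcone_rep_nonneg)
  qed
qed

lemma is_basis_of_card:
  fixes S :: "'a::real_vector set"
  assumes B: "is_basis (B::'a set)" and S: "independent S" "card S = dim (UNIV :: 'a set)"
  shows "is_basis S"
proof -
  have fS: "finite S" "card T \<le> card B" if "independent T" for T :: "'a set"
    using independent_span_bound[of B T] independent_span_bound[of B S] S(1) that B by (auto simp: is_basis_def)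
  have "y \<in> span S" for y
  proof (rule ccontr)
    assume y: "y \<notin> span S"
    hence "independent (insert y S)" using S(1) by (simp add: independent_insertI)
    from fS(2)[OF this] have "card (insert y S) \<le> dim (UNIV :: 'a set)" using is_basis_dim[OF B] by simp
    moreover have "y \<notin> S" using y span_base by blast
    ultimately show False using fS(1)[OF S(1)] S(2) by simp
  qed
  thus ?thesis using S(1) fS(1)[OF S(1)] by (auto simp: is_basis_def)
qed

lemma homogeneous_1_linear:
  assumes S: "is_basis (S :: 'a::real_normed_vector set)" and p: "homogeneous_poly 1 p" shows "linear (p :: 'a \<Rightarrow> real)"
proof -
  obtain c where c: "\<And>y. p y = (\<Sum>a\<in>expo S 1. c a * mon S a y)" by (rule hom_expand[OF S p]) (rule that)
  have fS: "finite S" using S by (simp add: is_basis_def)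
  have m: "linear (mon S a)" if "a \<in> expo S 1" for a
  proof -
    have "sum a S = 1" using that by (simp add: expo_def)
    then obtain u where u: "u \<in> S" "a u = 1" "\<forall>w\<in>S. u \<noteq> w \<longrightarrow> a w = 0" using sum_eq_1_iff[OF fS, of a] by blast
    have "mon S a y = representation S y u" for y
    proof -
      have "mon S a y = (\<Prod>w\<in>S. if w = u then representation S y u else 1)"
        unfolding mon_def using u by (intro prod.cong refl) auto
      thus ?thesis using u(1) fS by simp
    qed
    hence "mon S a = (\<lambda>y. representation S y u)" by auto
    thus ?thesis using rep_linear[OF S] by simp
  qed
  have "linear (\<lambda>y. \<Sum>a\<in>expo S 1. c a * mon S a y)"
    using m by (intro linear_compose_sum ballI) (auto simp: linear_iff algebra_simps)
  moreover have "p = (\<lambda>y. \<Sum>a\<in>expo S 1. c a * mon S a y)" using c by auto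
  ultimately show ?thesis by simp
qed


text \<open>Normalising by the value 1 of the Courant function makes a ray contribute the same
  vector to every cone containing it.\<close>

definition gens :: "('a::real_vector set \<Rightarrow> 'a \<Rightarrow> real) \<Rightarrow> 'a set \<Rightarrow> 'a set" where
  "gens \<phi> \<sigma> = ray_vector \<phi> ` cone_rays \<sigma>"

section \<open>Translation of a complete simplicial fan into a set of bases\<close>

locale courant_fan =
  fixes \<Phi> :: "'a::real_normed_vector set set" and \<phi> :: "'a set \<Rightarrow> 'a \<Rightarrow> real"
  assumes fin_dim: "finite_dimensional TYPE('a)" and complete: "complete_fan \<Phi>" and simpl: "simplicial_fan \<Phi>"
    and courant: "\<And>\<rho>. \<rho> \<in> fan_rays \<Phi> \<Longrightarrow> courant_function \<Phi> \<rho> (\<phi> \<rho>)"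
begin

lemma fan_facts:
  "finite \<Phi>" "\<sigma> \<in> \<Phi> \<Longrightarrow> polyhedral_cone \<sigma>" "\<sigma> \<in> \<Phi> \<Longrightarrow> cone_face \<tau> \<sigma> \<Longrightarrow> \<tau> \<in> \<Phi>"
  "\<sigma> \<in> \<Phi> \<Longrightarrow> \<tau> \<in> \<Phi> \<Longrightarrow> cone_face (\<sigma> \<inter> \<tau>) \<sigma>" "\<Union>\<Phi> = UNIV"
  using complete by (auto simp: complete_fan_def fan_def)

lemma basis_ex: "\<exists>B::'a set. is_basis B"
proof -
  obtain A :: "'a set" where A: "finite A" "span A = UNIV" using fin_dim by (auto simp: finite_dimensional_def)
  obtain B where B: "B \<subseteq> A" "independent B" "A \<subseteq> span B" using maximal_independent_subset by blast
  have "span B = UNIV" using span_mono[OF B(3)] A(2) by (simp add: span_span top.extremum_unique)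
  thus ?thesis using B finite_subset[OF B(1) A(1)] unfolding is_basis_def by blast
qed

lemma rays_fan: assumes "\<sigma> \<in> \<Phi>" shows "cone_rays \<sigma> \<subseteq> fan_rays \<Phi>" "finite (cone_rays \<sigma>)"
proof -
  show 1: "cone_rays \<sigma> \<subseteq> fan_rays \<Phi>" using fan_facts(3)[OF assms] by (auto simp: cone_rays_def fan_rays_def)
  show "finite (cone_rays \<sigma>)" by (rule finite_subset[OF 1]) (use fan_facts(1) in \<open>simp add: fan_rays_def\<close>)
qed

lemma courant_poly:
  assumes "\<rho> \<in> fan_rays \<Phi>" "\<sigma> \<in> \<Phi>"
  shows "\<exists>p. homogeneous_poly 1 p \<and> (\<forall>x\<in>\<sigma>. \<phi> \<rho> x = p x)"
  using courant[OF assms(1)] assms(2) by (simp add: courant_function_def cw_homogeneous_def)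

lemma phi_scale:
  assumes r: "ray v \<in> fan_rays \<Phi>" and \<rho>: "\<rho> \<in> fan_rays \<Phi>" and t: "t \<ge> 0"
  shows "\<phi> \<rho> (t *\<^sub>R v) = t * \<phi> \<rho> v"
proof -
  have "ray v \<in> \<Phi>" using r by (simp add: fan_rays_def)
  then obtain p where p: "homogeneous_poly 1 p" "\<And>x. x \<in> ray v \<Longrightarrow> \<phi> \<rho> x = p x"
    using courant_poly[OF \<rho>] by blast
  have "t *\<^sub>R v \<in> ray v" using t by (auto simp: ray_def)
  thus ?thesis using p ray_base[of v] by (simp add: homogeneous_poly_def)
qed

lemma ray_vector_eq:
  assumes r: "ray v \<in> fan_rays \<Phi>" and v: "v \<noteq> 0"
  shows "\<phi> (ray v) v > 0" "ray_vector \<phi> (ray v) = (1 / \<phi> (ray v) v) *\<^sub>R v"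
proof -
  show pos: "\<phi> (ray v) v > 0"
    using courant[OF r] ray_base[of v] v unfolding courant_function_def by blast
  show "ray_vector \<phi> (ray v) = (1 / \<phi> (ray v) v) *\<^sub>R v"
    unfolding ray_vector_def
  proof (rule the_equality)
    show "(1 / \<phi> (ray v) v) *\<^sub>R v \<in> ray v \<and> \<phi> (ray v) ((1 / \<phi> (ray v) v) *\<^sub>R v) = 1"
      using phi_scale[OF r r, of "1 / \<phi> (ray v) v"] pos
      by (auto simp: ray_def intro!: exI[of _ "1 / \<phi> (ray v) v"])
    fix w assume w: "w \<in> ray v \<and> \<phi> (ray v) w = 1"
    then obtain t where t: "t \<ge> 0" "w = t *\<^sub>R v" by (auto simp: ray_def)
    have "t * \<phi> (ray v) v = 1" using w phi_scale[OF r r t(1)] t(2) by simp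
    hence "t = 1 / \<phi> (ray v) v" using pos by (simp add: field_simps)
    thus "w = (1 / \<phi> (ray v) v) *\<^sub>R v" using t(2) by simp
  qed
qed

lemma gens_min:
  assumes s: "\<sigma> \<in> \<Phi>"
  shows "min_gen \<sigma> (gens \<phi> \<sigma>)" "v \<in> gens \<phi> \<sigma> \<Longrightarrow> ray_vector \<phi> (ray v) = v"
    "v \<in> gens \<phi> \<sigma> \<Longrightarrow> \<phi> (ray v) v = 1"
proof -
  have f: "{0} face_of \<sigma>" using fan_facts(2)[OF s] by (simp add: polyhedral_cone_def)
  have c: "card (cone_rays \<sigma>) = dim \<sigma>" using simpl s by (simp add: simplicial_fan_def)
  obtain S where S: "min_gen \<sigma> S" using min_gen_exists[OF fan_facts(2)[OF s]] by blast
  have fS: "finite S" and sS: "\<sigma> = ccone S" using S by (auto simp: min_gen_def)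
  note R = min_gen_simplicial[OF f S c rays_fan(2)[OF s]]
  have n0: "v \<noteq> 0" if "v \<in> S" for v using R(1) that dependent_zero by blast
  have rv: "ray v \<in> fan_rays \<Phi>" if "v \<in> S" for v using that R(2) rays_fan(1)[OF s] by auto
  define g where "g = (\<lambda>v. (1 / \<phi> (ray v) v) *\<^sub>R v)"
  have pos: "\<phi> (ray v) v > 0" if "v \<in> S" for v using ray_vector_eq(1)[OF rv n0] that by blast
  have ge: "gens \<phi> \<sigma> = g ` S"
    unfolding gens_def R(2) image_image g_def using ray_vector_eq(2)[OF rv n0] by (intro image_cong) auto
  have fg: "finite (g ` S)" using fS by simp
  have "\<sigma> = ccone (g ` S)" unfolding sS
  proof
    show "ccone S \<subseteq> ccone (g ` S)"
    proof (rule ccone_minimal)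
      fix v assume v: "v \<in> S"
      have "\<phi> (ray v) v *\<^sub>R g v \<in> ccone (g ` S)" using fg v pos[OF v] by (intro ccone_scale ccone_base) auto
      thus "v \<in> ccone (g ` S)" using pos[OF v] by (simp add: g_def)
    qed
    show "ccone (g ` S) \<subseteq> ccone S"
    proof (rule ccone_minimal)
      fix w assume "w \<in> g ` S"
      then obtain v where v: "v \<in> S" "w = g v" by auto
      show "w \<in> ccone S" unfolding v(2) g_def using pos[OF v(1)] by (intro ccone_scale ccone_base fS v(1)) simp
    qed
  qed
  moreover have "card (g ` S) \<le> card T" if "finite T" "\<sigma> = ccone T" for T
    using S that card_image_le[OF fS, of g] unfolding min_gen_def by fastforce
  ultimately show "min_gen \<sigma> (gens \<phi> \<sigma>)" unfolding ge min_gen_def using fg by blast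
  assume "v \<in> gens \<phi> \<sigma>"
  then obtain u where u: "u \<in> S" "v = g u" using ge by auto
  have r: "ray v = ray u" unfolding u(2) g_def using pos[OF u(1)] by (intro ray_scale) simp
  show "ray_vector \<phi> (ray v) = v"
    unfolding r unfolding ray_vector_eq(2)[OF rv[OF u(1)] n0[OF u(1)]] u(2) g_def ..
  have "\<phi> (ray u) (g u) = (1 / \<phi> (ray u) u) * \<phi> (ray u) u"
    unfolding g_def using pos[OF u(1)] by (intro phi_scale rv u(1)) simp
  thus "\<phi> (ray v) v = 1" unfolding r unfolding u(2) using pos[OF u(1)] by simp
qed

lemma gens:
  assumes s: "\<sigma> \<in> \<Phi>"
  shows "finite (gens \<phi> \<sigma>)" "\<sigma> = ccone (gens \<phi> \<sigma>)" "independent (gens \<phi> \<sigma>)" "cone_rays \<sigma> = ray ` gens \<phi> \<sigma>"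
    "inj_on ray (gens \<phi> \<sigma>)" "card (gens \<phi> \<sigma>) = dim \<sigma>"
proof -
  have f: "{0} face_of \<sigma>" using fan_facts(2)[OF s] by (simp add: polyhedral_cone_def)
  have c: "card (cone_rays \<sigma>) = dim \<sigma>" using simpl s by (simp add: simplicial_fan_def)
  note R = min_gen_simplicial[OF f gens_min(1)[OF s] c rays_fan(2)[OF s]]
  show "finite (gens \<phi> \<sigma>)" "\<sigma> = ccone (gens \<phi> \<sigma>)" using gens_min(1)[OF s] by (auto simp: min_gen_def)
  show "independent (gens \<phi> \<sigma>)" "cone_rays \<sigma> = ray ` gens \<phi> \<sigma>" "inj_on ray (gens \<phi> \<sigma>)" by (fact R)+
  show "card (gens \<phi> \<sigma>) = dim \<sigma>" using R(2,3) c card_image by metis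
qed

lemma max_basis: assumes "\<sigma> \<in> max_cones \<Phi>" shows "\<sigma> \<in> \<Phi>" "is_basis (gens \<phi> \<sigma>)" "\<sigma> = bcone (gens \<phi> \<sigma>)"
proof -
  show s: "\<sigma> \<in> \<Phi>" using assms by (simp add: max_cones_def)
  obtain B :: "'a set" where B: "is_basis B" using basis_ex by blast
  show b: "is_basis (gens \<phi> \<sigma>)"
    using is_basis_of_card[OF B gens(3)[OF s]] gens(6)[OF s] assms by (simp add: max_cones_def)
  show "\<sigma> = bcone (gens \<phi> \<sigma>)" using gens(2)[OF s] ccone_bcone[OF b] by simp
qed

text \<open>On a maximal cone the Courant function is linear, 1 at its own generator and 0 at the
  others. If \<open>v\<close> is not a generator of this cone, both sides are zero.\<close>

lemma courant_coordinate:
  assumes s: "\<sigma> \<in> \<Phi>" and v: "v \<in> gens \<phi> \<sigma>" and t: "\<tau> \<in> max_cones \<Phi>" and y: "y \<in> \<tau>"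
  shows "\<phi> (ray v) y = representation (gens \<phi> \<tau>) y v"
proof -
  note T = max_basis[OF t]
  define T where "T = gens \<phi> \<tau>"
  have bT: "is_basis T" "finite T" using T by (auto simp: T_def is_basis_def)
  have r: "ray v \<in> fan_rays \<Phi>" using gens(4)[OF s] v rays_fan(1)[OF s] by auto
  obtain p where p: "homogeneous_poly 1 p" "\<And>x. x \<in> \<tau> \<Longrightarrow> \<phi> (ray v) x = p x"
    using courant_poly[OF r T(1)] by blast
  have pw: "p w = (if w = v then 1 else 0)" if w: "w \<in> T" for w
  proof -
    have wt: "w \<in> \<tau>" using w gens(1,2)[OF T(1)] ccone_base unfolding T_def by metis
    show ?thesis
    proof (cases "w = v")
      case True
      thus ?thesis using p(2)[OF wt] gens_min(3)[OF s v] by simp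
    next
      case False
      have "ray w \<noteq> ray v" using False gens_min(2)[OF s v] gens_min(2)[OF T(1), of w] w by (auto simp: T_def)
      moreover have "ray w \<in> fan_rays \<Phi>" using gens(4)[OF T(1)] rays_fan(1)[OF T(1)] w by (auto simp: T_def)
      ultimately have "\<phi> (ray v) w = 0" using courant[OF r] ray_base[of w] unfolding courant_function_def by blast
      thus ?thesis using p(2)[OF wt] False by simp
    qed
  qed
  have "p y = (\<Sum>w\<in>T. representation T y w *\<^sub>R p w)"
    by (rule linear_expand[OF bT(1) homogeneous_1_linear[OF bT(1) p(1)]])
  also have "\<dots> = (\<Sum>w\<in>T. if w = v then representation T y v else 0)" using pw by (intro sum.cong) auto
  also have "\<dots> = representation T y v" using bT(2) rep_outside[of v T y] by simp
  finally show ?thesis using p(2)[OF y] by (simp add: T_def)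
qed

text \<open>Every point is a limit of points that avoid the finitely many proper subspaces spanned by the
  cones of lower dimension.\<close>

lemma max_cones_cover: "\<exists>\<sigma>\<in>max_cones \<Phi>. y \<in> \<sigma>"
proof (rule ccontr)
  assume neg: "\<not> ?thesis"
  obtain B :: "'a set" where B: "is_basis B" using basis_ex by blast
  define P where "P = \<Phi> - max_cones \<Phi>"
  \<comment> \<open>Extending the generators of a lower-dimensional cone to a basis adds a vector
    whose coordinate vanishes on the cone.\<close>
  have "\<exists>l :: 'a \<Rightarrow> real. linear l \<and> (\<exists>z. l z \<noteq> 0) \<and> (\<forall>x\<in>\<sigma>. l x = 0)" if s: "\<sigma> \<in> P" for \<sigma>
  proof -
    have sP: "\<sigma> \<in> \<Phi>" and d: "dim \<sigma> \<noteq> dim (UNIV :: 'a set)" using s by (auto simp: P_def max_cones_def)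
    obtain C where C: "gens \<phi> \<sigma> \<subseteq> C" "independent C" "UNIV \<subseteq> span C"
      by (rule maximal_independent_subset_extend[OF subset_UNIV gens(3)[OF sP]]) (rule that)
    have "finite C" using independent_span_bound[of B C] B C(2) by (auto simp: is_basis_def)
    hence bC: "is_basis C" using C by (auto simp: is_basis_def)
    have "C \<noteq> gens \<phi> \<sigma>" using is_basis_dim[OF bC] gens(6)[OF sP] d by auto
    then obtain u where u: "u \<in> C" "u \<notin> gens \<phi> \<sigma>" using C(1) by auto
    have "representation C x u = 0" if "x \<in> \<sigma>" for x
    proof -
      have "x \<in> ccone (gens \<phi> \<sigma>)" using that gens(2)[OF sP] by simp
      then obtain t where t: "x = (\<Sum>v\<in>gens \<phi> \<sigma>. t v *\<^sub>R v)" by (auto simp: ccone_def)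
      show ?thesis unfolding t rep_lincomb[OF bC C(1)] using u by simp
    qed
    moreover have "representation C u u \<noteq> 0" using rep_basis[OF bC u(1)] by simp
    ultimately show ?thesis using rep_linear[OF bC, of u] by blast
  qed
  then obtain l :: "'a set \<Rightarrow> 'a \<Rightarrow> real" where l: "\<And>\<sigma>. \<sigma> \<in> P \<Longrightarrow> linear (l \<sigma>)" "\<And>\<sigma>. \<sigma> \<in> P \<Longrightarrow> \<exists>z. l \<sigma> z \<noteq> 0"
    "\<And>\<sigma> x. \<sigma> \<in> P \<Longrightarrow> x \<in> \<sigma> \<Longrightarrow> l \<sigma> x = 0" by metis
  have "finite (l ` P)" using fan_facts(1) by (simp add: P_def)
  hence "\<exists>z\<in>UNIV. \<forall>f\<in>l ` P. f z \<noteq> 0" by (rule generic_exists) (use l(1,2) in auto)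
  then obtain z where z: "\<And>\<sigma>. \<sigma> \<in> P \<Longrightarrow> l \<sigma> z \<noteq> 0" by auto
  define Y where "Y = (\<lambda>m::nat. y + (1 / real (Suc m)) *\<^sub>R z)"
  have lim: "(\<lambda>m. 1 / real (Suc m) * c) \<longlonglongrightarrow> 0" for c
    using tendsto_mult_left_zero[OF LIMSEQ_inverse_real_of_nat, of c] by (simp add: inverse_eq_divide)
  have "\<forall>\<^sub>F m in sequentially. Y m \<notin> \<sigma>" if s: "\<sigma> \<in> \<Phi>" for \<sigma>
  proof (cases "\<sigma> \<in> P")
    case True
    have lY: "l \<sigma> (Y m) = l \<sigma> y + 1 / real (Suc m) * l \<sigma> z" for m
      unfolding Y_def using l(1)[OF True] by (simp add: linear_add linear_scale)
    have "\<forall>\<^sub>F m in sequentially. l \<sigma> (Y m) \<noteq> 0"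
    proof (cases "l \<sigma> y = 0")
      case True0: True
      thus ?thesis unfolding lY using z[OF True] by simp
    next
      case False
      have "(\<lambda>m. l \<sigma> (Y m)) \<longlonglongrightarrow> l \<sigma> y + 0" unfolding lY by (intro tendsto_add tendsto_const lim)
      thus ?thesis using tendsto_imp_eventually_ne False by force
    qed
    thus ?thesis by (rule eventually_mono) (use l(3)[OF True] in blast)
  next
    case False
    hence t: "\<sigma> \<in> max_cones \<Phi>" using s by (simp add: P_def)
    note S = max_basis[OF t]
    have "y \<notin> bcone (gens \<phi> \<sigma>)" using neg t S(3) by auto
    then obtain v where v: "v \<in> gens \<phi> \<sigma>" "representation (gens \<phi> \<sigma>) y v < 0" by (auto simp: bcone_def not_le)
    have rY: "representation (gens \<phi> \<sigma>) (Y m) v = representation (gens \<phi> \<sigma>) y v + 1 / real (Suc m) * representation (gens \<phi> \<sigma>) z v" for m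
      unfolding Y_def by (simp add: rep_add[OF S(2)] rep_scale[OF S(2)])
    have "(\<lambda>m. representation (gens \<phi> \<sigma>) (Y m) v) \<longlonglongrightarrow> representation (gens \<phi> \<sigma>) y v + 0"
      unfolding rY by (intro tendsto_add tendsto_const lim)
    hence "\<forall>\<^sub>F m in sequentially. representation (gens \<phi> \<sigma>) (Y m) v < 0" using v(2) order_tendstoD(2) by force
    thus ?thesis
    proof (rule eventually_mono)
      fix m assume "representation (gens \<phi> \<sigma>) (Y m) v < 0"
      hence "Y m \<notin> bcone (gens \<phi> \<sigma>)" using v(1) by (auto simp: bcone_def not_le)
      thus "Y m \<notin> \<sigma>" using S(3) by simp
    qed
  qed
  hence "\<forall>\<^sub>F m in sequentially. \<forall>\<sigma>\<in>\<Phi>. Y m \<notin> \<sigma>" using fan_facts(1) by (simp add: eventually_ball_finite)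
  then obtain m where "\<forall>\<sigma>\<in>\<Phi>. Y m \<notin> \<sigma>" using eventually_happens' sequentially_bot by blast
  thus False using fan_facts(5) by blast
qed

text \<open>The sum of the generators lies in the relative interior, hence a face containing it is everything.\<close>

lemma in_max_cone: assumes s: "\<sigma> \<in> \<Phi>" shows "\<exists>\<tau>\<in>max_cones \<Phi>. \<sigma> \<subseteq> \<tau>"
proof -
  define S where "S = gens \<phi> \<sigma>"
  have S: "finite S" "\<sigma> = ccone S" using gens(1,2)[OF s] by (auto simp: S_def)
  define y where "y = (\<Sum>v\<in>S. v)"
  obtain \<tau> where t: "\<tau> \<in> max_cones \<Phi>" "y \<in> \<tau>" using max_cones_cover by blast
  note T = max_basis[OF t(1)]
  have half: "v \<in> \<tau>" if "2 *\<^sub>R v \<in> \<tau>" for v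
    using bcone_scale[OF T(2), of "2 *\<^sub>R v" "1/2"] that T(3) by simp
  have F: "(\<sigma> \<inter> \<tau>) face_of \<sigma>" using fan_facts(4)[OF s T(1)] by (simp add: cone_face_def)
  have yS: "y \<in> \<sigma>" unfolding y_def S(2) using S(1) by (intro ccone_sum ccone_base)
  have "v \<in> \<tau>" if v: "v \<in> S" for v
  proof -
    define a where "a = 2 *\<^sub>R v"
    define b where "b = 2 *\<^sub>R (\<Sum>w\<in>S - {v}. w)"
    \<comment> \<open>The interior point is the midpoint of \<open>a\<close> and \<open>b\<close>,
      so the face through it contains both of them.\<close>
    have y: "y = (1 - 1/2) *\<^sub>R a + (1/2) *\<^sub>R b" unfolding y_def a_def b_def using v S(1) by (simp add: sum.remove)
    have ab: "a \<in> \<sigma>" "b \<in> \<sigma>" unfolding a_def b_def S(2) using v S(1) by (intro ccone_scale ccone_sum ccone_base; simp)+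
    have "a \<in> \<tau>"
    proof (cases "a = b")
      case True
      hence "y = a" using y by (simp flip: scaleR_add_left)
      thus ?thesis using t(2) by simp
    next
      case False
      hence "y \<in> open_segment a b" unfolding in_segment using y by (intro conjI exI[of _ "1/2"]) auto
      thus ?thesis using face_ofD[OF F _ ab] yS t(2) by blast
    qed
    thus ?thesis using half by (simp add: a_def)
  qed
  hence "ccone S \<subseteq> ccone (gens \<phi> \<tau>)" using gens(2)[OF T(1)] by (intro ccone_minimal) auto
  thus ?thesis using t(1) S(2) gens(2)[OF T(1)] by auto
qed

definition FB :: "'a set set" where "FB = gens \<phi> ` max_cones \<Phi>"

lemma gens_inj: "inj_on (gens \<phi>) (max_cones \<Phi>)"
  using max_basis(3) by (metis inj_onI)

text \<open>Coordinates with respect to any maximal cone are values of Courant functions, which do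
  not refer to the cone; hence they agree on overlaps.\<close>

lemma sfan_FB: "sfan FB"
  unfolding sfan_def
proof (intro conjI ballI allI)
  show "finite FB" unfolding FB_def using fan_facts(1) by (simp add: max_cones_def)
  show "is_basis S" if "S \<in> FB" for S using that max_basis(2) by (auto simp: FB_def)
  show "\<exists>S\<in>FB. y \<in> bcone S" for y
  proof -
    obtain \<sigma> where s: "\<sigma> \<in> max_cones \<Phi>" "y \<in> \<sigma>" using max_cones_cover by blast
    hence "y \<in> bcone (gens \<phi> \<sigma>)" using max_basis(3) by blast
    thus ?thesis using s(1) by (auto simp: FB_def)
  qed
  fix S T y assume ST: "S \<in> FB" "T \<in> FB" and y: "y \<in> bcone S \<inter> bcone T"
  obtain \<sigma> \<tau> where s: "\<sigma> \<in> max_cones \<Phi>" "S = gens \<phi> \<sigma>" "\<tau> \<in> max_cones \<Phi>" "T = gens \<phi> \<tau>" using ST by (auto simp: FB_def)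
  have ys: "y \<in> \<sigma>" "y \<in> \<tau>" using y max_basis(3)[OF s(1)] max_basis(3)[OF s(3)] s by auto
  show "representation S y = representation T y"
  proof
    fix v
    consider "v \<in> S" | "v \<in> T" | "v \<notin> S" "v \<notin> T" by blast
    thus "representation S y v = representation T y v"
    proof cases
      case 1
      thus ?thesis using courant_coordinate[OF max_basis(1)[OF s(1)] _ s(1) ys(1)] courant_coordinate[OF max_basis(1)[OF s(1)] _ s(3) ys(2)]
        by (simp add: s)
    next
      case 2
      thus ?thesis using courant_coordinate[OF max_basis(1)[OF s(3)] _ s(1) ys(1)] courant_coordinate[OF max_basis(1)[OF s(3)] _ s(3) ys(2)]
        by (simp add: s)
    qed (simp add: rep_outside)
  qed
qed

lemma closed_bcone: assumes "is_basis (S :: 'a set)" shows "closed (bcone S)"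
proof -
  have "bcone S = (\<Inter>v\<in>S. {y. 0 \<le> representation S y v})" by (auto simp: bcone_def)
  moreover have "closed {y. 0 \<le> representation S y v}" for v
    by (rule closed_Collect_le) (intro continuous_intros assms)+
  ultimately show ?thesis by auto
qed

lemma PP_FB_continuous: assumes f: "f \<in> PP FB" shows "continuous_on UNIV f"
proof -
  have "continuous_on (\<Union>S\<in>FB. bcone S) f"
  proof (rule continuous_on_closed_Union)
    show "finite FB" by (rule sfanD(1)[OF sfan_FB])
    show "closed (bcone S)" if "S \<in> FB" for S by (rule closed_bcone[OF sfanD(2)[OF sfan_FB that]])
    fix S assume S: "S \<in> FB"
    obtain p where p: "real_polynomial_function p" "\<forall>y\<in>bcone S. f y = p y" using f S unfolding PP_def by blast
    have "continuous_on (bcone S) p"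
      by (intro continuous_on_polymonial_function) (use p(1) in \<open>simp add: real_polynomial_function_eq\<close>)
    thus "continuous_on (bcone S) f" using p(2) by (simp add: continuous_on_cong[of "bcone S" _ f p])
  qed
  moreover have "(\<Union>S\<in>FB. bcone S) = UNIV" using sfanD(3)[OF sfan_FB] by blast
  ultimately show ?thesis by simp
qed

lemma on_cones:
  "(\<forall>\<sigma>\<in>\<Phi>. \<exists>p. X p \<and> (\<forall>x\<in>\<sigma>. f x = p x)) \<longleftrightarrow> (\<forall>S\<in>FB. \<exists>p. X p \<and> (\<forall>x\<in>bcone S. f x = p x))" (is "?L \<longleftrightarrow> ?R")
proof
  assume L: ?L
  show ?R
  proof
    fix S assume "S \<in> FB"
    then obtain \<sigma> where s: "\<sigma> \<in> max_cones \<Phi>" "S = gens \<phi> \<sigma>" by (auto simp: FB_def)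
    have "bcone S = \<sigma>" using max_basis(3)[OF s(1)] s(2) by simp
    thus "\<exists>p. X p \<and> (\<forall>x\<in>bcone S. f x = p x)" using L max_basis(1)[OF s(1)] by auto
  qed
next
  assume R: ?R
  show ?L
  proof
    fix \<sigma> assume "\<sigma> \<in> \<Phi>"
    then obtain \<tau> where t: "\<tau> \<in> max_cones \<Phi>" "\<sigma> \<subseteq> \<tau>" using in_max_cone by blast
    have "gens \<phi> \<tau> \<in> FB" using t by (simp add: FB_def)
    then obtain p where "X p" "\<forall>x\<in>bcone (gens \<phi> \<tau>). f x = p x" using R by blast
    thus "\<exists>p. X p \<and> (\<forall>x\<in>\<sigma>. f x = p x)" using t(2) max_basis(3)[OF t(1)] by blast
  qed
qed

lemma cw_poly_eq: "cw_poly \<Phi> = PP FB"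
  using PP_FB_continuous unfolding cw_poly_def PP_def on_cones by blast

lemma cw_homogeneous_eq: "cw_homogeneous \<Phi> k = PPh FB k"
  using PPh_PP[of _ FB k] unfolding cw_homogeneous_def cw_poly_eq unfolding PPh_def on_cones by blast

end

section \<open>Volume forms\<close>

locale volume =
  fixes \<Omega> :: "(nat \<Rightarrow> 'a::real_vector) \<Rightarrow> real"
  assumes volume_form: "volume_form \<Omega>"
begin

definition N :: nat where "N = dim (UNIV :: 'a set)"

lemma vol:
  "(\<And>i. i < N \<Longrightarrow> v i = w i) \<Longrightarrow> \<Omega> v = \<Omega> w" "i < N \<Longrightarrow> linear (\<lambda>x. \<Omega> (v(i := x)))"
  "i < N \<Longrightarrow> j < N \<Longrightarrow> i \<noteq> j \<Longrightarrow> v i = v j \<Longrightarrow> \<Omega> v = 0" "\<exists>v. \<Omega> v \<noteq> 0"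
proof -
  note V = volume_form[unfolded volume_form_def Let_def, folded N_def]
  show "(\<And>i. i < N \<Longrightarrow> v i = w i) \<Longrightarrow> \<Omega> v = \<Omega> w" using V[THEN conjunct1] by simp
  show "i < N \<Longrightarrow> linear (\<lambda>x. \<Omega> (v(i := x)))" using V[THEN conjunct2, THEN conjunct1] by simp
  show "i < N \<Longrightarrow> j < N \<Longrightarrow> i \<noteq> j \<Longrightarrow> v i = v j \<Longrightarrow> \<Omega> v = 0"
    using V[THEN conjunct2, THEN conjunct2, THEN conjunct1] by blast
  show "\<exists>v. \<Omega> v \<noteq> 0" using V by blast
qed

text \<open>An alternating form changes sign under a transposition, as the expansion at
  \<open>a + b\<close> in both places shows; absolute values make the enumeration of a basis
  irrelevant.\<close>

lemma vol_swap:
  assumes ij: "i < N" "j < N"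
  shows "\<bar>\<Omega> (v \<circ> Transposition.transpose i j)\<bar> = \<bar>\<Omega> v\<bar>"
proof (cases "i = j")
  case False
  define a where "a = v i"
  define b where "b = v j"
  define g where "g = (\<lambda>x y. \<Omega> (v(i := x, j := y)))"
  have l1: "g (x + x') y = g x y + g x' y" for x x' y
    using linear_add[OF vol(2)[OF ij(1), of "v(j := y)"]] False by (simp add: g_def fun_upd_twist)
  have l2: "g x (y + y') = g x y + g x y'" for x y y'
    using linear_add[OF vol(2)[OF ij(2), of "v(i := x)"]] by (simp add: g_def)
  have z: "g x x = 0" for x unfolding g_def using False by (intro vol(3)[OF ij]) auto
  have "g (a + b) (a + b) = 0" by (rule z)
  moreover have "g (a + b) (a + b) = (g a a + g a b) + (g b a + g b b)" by (simp only: l1 l2)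
  ultimately have "g a b + g b a = 0" using z[of a] z[of b] by linarith
  moreover have "g a b = \<Omega> v" by (simp add: g_def a_def b_def)
  moreover have "v(i := b, j := a) = v \<circ> Transposition.transpose i j"
    using False by (auto simp: fun_eq_iff a_def b_def transpose_def)
  ultimately show ?thesis by (simp add: g_def)
qed simp

lemma vol_permute:
  assumes "p permutes {..<N}"
  shows "\<bar>\<Omega> (v \<circ> p)\<bar> = \<bar>\<Omega> v\<bar>"
  using assms finite_lessThan
proof (induction arbitrary: v rule: permutes_induct)
  case (swap i j p)
  have "\<bar>\<Omega> (v \<circ> (Transposition.transpose i j \<circ> p))\<bar> = \<bar>\<Omega> ((v \<circ> Transposition.transpose i j) \<circ> p)\<bar>" by (simp add: comp_assoc)
  also have "\<dots> = \<bar>\<Omega> (v \<circ> Transposition.transpose i j)\<bar>" by (rule swap.IH)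
  also have "\<dots> = \<bar>\<Omega> v\<bar>" using swap.hyps by (intro vol_swap) auto
  finally show ?case .
qed auto

lemma vol_enum_eq:
  assumes e: "bij_betw e {..<N} S" and e': "bij_betw e' {..<N} S"
  shows "\<bar>\<Omega> e'\<bar> = \<bar>\<Omega> e\<bar>"
proof -
  define q where "q = (\<lambda>i. inv_into {..<N} e (e' i))"
  define p where "p = (\<lambda>i. if i < N then q i else i)"
  have bq: "bij_betw q {..<N} {..<N}"
    unfolding q_def using bij_betw_trans[OF e' bij_betw_inv_into[OF e]] by (simp add: o_def)
  have "bij_betw p {..<N} {..<N}" using bq bij_betw_cong[of "{..<N}" p q] by (simp add: p_def)
  hence p: "p permutes {..<N}" by (rule bij_imp_permutes) (simp add: p_def)
  have "e (p i) = e' i" if i: "i < N" for i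
  proof -
    have "e' i \<in> e ` {..<N}" using bij_betwE[OF e'] bij_betw_imp_surj_on[OF e] i by auto
    thus ?thesis using i by (simp add: p_def q_def f_inv_into_f)
  qed
  hence "\<Omega> (e \<circ> p) = \<Omega> e'" by (intro vol(1)) simp
  thus ?thesis using vol_permute[OF p, of e] by simp
qed

definition weight :: "'a set \<Rightarrow> real" where
  "weight S = \<bar>\<Omega> (SOME e. bij_betw e {..<N} S)\<bar>"

lemma weight_eq: assumes e: "bij_betw e {..<N} S" shows "weight S = \<bar>\<Omega> e\<bar>"
proof -
  have "bij_betw (SOME e. bij_betw e {..<N} S) {..<N} S"
    by (rule someI[where P = "\<lambda>e. bij_betw e {..<N} S"]) (rule e)
  thus ?thesis unfolding weight_def by (rule vol_enum_eq[OF e])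
qed

lemma enum_exists: assumes "is_basis (S :: 'a set)" shows "\<exists>e. bij_betw e {..<N} S"
  using ex_bij_betw_nat_finite[of S] assms is_basis_dim[OF assms] unfolding is_basis_def N_def atLeast0LessThan by auto

lemma vol_expand:
  assumes S: "is_basis S" and k: "k < N"
  shows "\<Omega> (v(k := y)) = (\<Sum>w\<in>S. representation S y w * \<Omega> (v(k := w)))"
proof -
  define f where "f = (\<lambda>x. \<Omega> (v(k := x)))"
  have "linear f" unfolding f_def by (rule vol(2)[OF k])
  from linear_expand[OF S this, of y] show ?thesis by (simp add: f_def)
qed

text \<open>If the form vanished on one enumeration of the basis, multilinear expansion would make
  it vanish identically.\<close>

lemma weight_pos: assumes S: "is_basis S" shows "weight S > 0"
proof (rule ccontr)
  assume "\<not> weight S > 0"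
  obtain e where e: "bij_betw e {..<N} S" using enum_exists[OF S] by blast
  have e0: "\<Omega> e = 0" using \<open>\<not> weight S > 0\<close> weight_eq[OF e] by simp
  \<comment> \<open>Induction on the number \<open>k\<close> of leading entries that may be
    arbitrary vectors; for \<open>k = 0\<close> all entries are basis vectors.\<close>
  have "\<Omega> v = 0" if "k \<le> N" "\<And>i. k \<le> i \<Longrightarrow> i < N \<Longrightarrow> v i \<in> S" for k v
    using that
  proof (induction k arbitrary: v)
    case 0
    show ?case
    proof (cases "inj_on v {..<N}")
      case True
      have "v ` {..<N} \<subseteq> S" using 0 by auto
      moreover have "card (v ` {..<N}) = card S" using card_image[OF True] is_basis_dim[OF S] by (simp add: N_def)
      ultimately have "v ` {..<N} = S" using card_subset_eq[of S] S by (auto simp: is_basis_def)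
      hence "bij_betw v {..<N} S" using True by (simp add: bij_betw_def)
      thus ?thesis using vol_enum_eq[OF e, of v] e0 by simp
    next
      case False
      thus ?thesis using vol(3) by (auto simp: inj_on_def)
    qed
  next
    case (Suc k)
    have k: "k < N" using Suc.prems(1) by simp
    have "\<Omega> (v(k := w)) = 0" if "w \<in> S" for w
      by (rule Suc.IH) (use k that Suc.prems(2) in auto)
    thus ?case using vol_expand[OF S k, of v "v k"] by simp
  qed
  from this[of N] have "\<Omega> v = 0" for v by simp
  thus False using vol(4) by blast
qed

text \<open>Expanding the new generator in the old basis leaves one term, because every other term
  repeats a vector.\<close>

lemma weight_adjacent:
  assumes S: "is_basis S" and vu: "v \<in> S" "u \<in> T" "T - {u} = S - {v}"
  shows "weight T = weight S * \<bar>representation S u v\<bar>"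
proof -
  obtain e where e: "bij_betw e {..<N} S" using enum_exists[OF S] by blast
  have inj: "inj_on e {..<N}" and im: "e ` {..<N} = S" using e by (auto simp: bij_betw_def)
  obtain i where i: "i < N" "e i = v" using im vu(1) by blast
  have eS: "e j \<in> S - {v}" if "j < N" "j \<noteq> i" for j
    using inj i that im by (auto simp: inj_on_def)
  have "bij_betw (e(i := u)) {..<N} T"
    unfolding bij_betw_def
  proof
    have "e j \<noteq> u" if "j < N" "j \<noteq> i" for j using eS[OF that] vu(3) by blast
    thus "inj_on (e(i := u)) {..<N}" using inj by (auto simp: inj_on_def)
    have "e ` ({..<N} - {i}) = S - {v}" using im i inj_on_image_set_diff[OF inj, of "{..<N}" "{i}"] by auto
    moreover have "(e(i := u)) ` {..<N} = insert u (e ` ({..<N} - {i}))" using i by auto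
    ultimately show "(e(i := u)) ` {..<N} = T" using vu by auto
  qed
  hence "weight T = \<bar>\<Omega> (e(i := u))\<bar>" by (rule weight_eq)
  also have "\<Omega> (e(i := u)) = (\<Sum>w\<in>S. if w = v then representation S u v * \<Omega> e else 0)"
  proof (rule trans[OF vol_expand[OF S i(1)]], intro sum.cong refl)
    fix w assume w: "w \<in> S"
    have "\<Omega> (e(i := w)) = 0" if "w \<noteq> v"
    proof -
      obtain j where j: "j < N" "e j = w" using im w by blast
      have "j \<noteq> i" using j i that by auto
      thus ?thesis using vol(3)[OF i(1) j(1), of "e(i := w)"] j by auto
    qed
    moreover have "e(i := v) = e" using i by auto
    ultimately show "representation S u w * \<Omega> (e(i := w)) = (if w = v then representation S u v * \<Omega> e else 0)" by auto
  qed
  also have "\<dots> = representation S u v * \<Omega> e" using S vu(1) by (simp add: is_basis_def)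
  finally show ?thesis by (simp add: weight_eq[OF e] abs_mult)
qed

end

locale fan_data = courant_fan \<Phi> \<phi> + volume \<Omega>
  for \<Phi> :: "'a::real_normed_vector set set" and \<phi> and \<Omega> :: "(nat \<Rightarrow> 'a) \<Rightarrow> real"
begin

sublocale weighted_fan FB weight
proof
  show "sfan FB" by (rule sfan_FB)
  show "weight S > 0" if "S \<in> FB" for S by (rule weight_pos[OF sfanD(2)[OF sfan_FB that]])
  show "weight T = weight S * \<bar>representation S u v\<bar>"
    if "S \<in> FB" "T \<in> FB" "v \<in> S" "u \<in> T" "T - {u} = S - {v}" for S T u v
    by (rule weight_adjacent[OF sfanD(2)[OF sfan_FB that(1)] that(3-5)])
qed

lemma F_poly_eq:
  assumes s: "\<sigma> \<in> max_cones \<Phi>" shows "F_poly \<Omega> \<phi> \<sigma> = FS (gens \<phi> \<sigma>)"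
proof -
  define S where "S = gens \<phi> \<sigma>"
  note T = max_basis[OF s]
  have S: "is_basis S" "\<sigma> = bcone S" "S \<in> FB" using T s by (auto simp: S_def FB_def)
  have inj: "inj_on (ray_vector \<phi>) (cone_rays \<sigma>)"
    unfolding gens(4)[OF T(1)] using gens_min(2)[OF T(1)] by (auto simp: inj_on_def)
  have rb: "bij_betw (ray_vector \<phi>) (cone_rays \<sigma>) S" using inj by (simp add: S_def gens_def bij_betw_def)
  have val: "FS S x = \<bar>\<Omega> (\<lambda>i. ray_vector \<phi> (\<rho> i))\<bar> * (\<Prod>i<N. \<phi> (\<rho> i) x)"
    if \<rho>: "bij_betw \<rho> {..<N} (cone_rays \<sigma>)" and x: "x \<in> \<sigma>" for \<rho> x
  proof -
    define e where "e = (\<lambda>i. ray_vector \<phi> (\<rho> i))"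
    have e: "bij_betw e {..<N} S" using bij_betw_trans[OF \<rho> rb] by (simp add: e_def o_def)
    have "\<phi> (\<rho> i) x = representation S x (e i)" if i: "i < N" for i
    proof -
      have eS: "e i \<in> S" using bij_betwE[OF e] i by auto
      have "\<rho> i \<in> cone_rays \<sigma>" using bij_betwE[OF \<rho>] i by auto
      then obtain v where v: "v \<in> S" "\<rho> i = ray v" using gens(4)[OF T(1)] by (auto simp: S_def)
      have "e i = v" unfolding e_def v(2) using gens_min(2)[OF T(1)] v(1) by (simp add: S_def)
      thus ?thesis using courant_coordinate[OF T(1) _ s x, of v] v by (simp add: S_def)
    qed
    hence "(\<Prod>i<N. \<phi> (\<rho> i) x) = (\<Prod>i<N. representation S x (e i))" by simp
    also have "\<dots> = (\<Prod>v\<in>S. representation S x v)" by (rule prod.reindex_bij_betw[OF e])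
    finally show ?thesis using weight_eq[OF e] by (simp add: FS_def e_def)
  qed
  obtain e where "bij_betw e {..<N} S" using enum_exists[OF S(1)] by blast
  hence "bij_betw (inv_into (cone_rays \<sigma>) (ray_vector \<phi>) \<circ> e) {..<N} (cone_rays \<sigma>)"
    by (rule bij_betw_trans) (rule bij_betw_inv_into[OF rb])
  then obtain \<rho>0 where r0: "bij_betw \<rho>0 {..<N} (cone_rays \<sigma>)" by blast
  show ?thesis
    unfolding F_poly_def Let_def N_def[symmetric] S_def[symmetric]
  proof (rule the_equality)
    show "real_polynomial_function (FS S) \<and> (\<forall>\<rho>. bij_betw \<rho> {..<N} (cone_rays \<sigma>) \<longrightarrow>
      (\<forall>x\<in>\<sigma>. FS S x = \<bar>\<Omega> (\<lambda>i. ray_vector \<phi> (\<rho> i))\<bar> * (\<Prod>i<N. \<phi> (\<rho> i) x)))"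
      using FS_poly[OF S(3)] val by blast
    fix G assume G: "real_polynomial_function G \<and> (\<forall>\<rho>. bij_betw \<rho> {..<N} (cone_rays \<sigma>) \<longrightarrow>
      (\<forall>x\<in>\<sigma>. G x = \<bar>\<Omega> (\<lambda>i. ray_vector \<phi> (\<rho> i))\<bar> * (\<Prod>i<N. \<phi> (\<rho> i) x)))"
    show "G = FS S"
    proof (rule poly_eq_on_bcone[OF S(1)])
      show "real_polynomial_function G" using G by blast
      show "real_polynomial_function (FS S)" by (rule FS_poly[OF S(3)])
      fix y assume "y \<in> bcone S"
      hence y: "y \<in> \<sigma>" using S(2) by simp
      have "\<forall>x\<in>\<sigma>. G x = \<bar>\<Omega> (\<lambda>i. ray_vector \<phi> (\<rho>0 i))\<bar> * (\<Prod>i<N. \<phi> (\<rho>0 i) x)" using G r0 by blast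
      thus "G y = FS S y" using val[OF r0 y] y by simp
    qed
  qed
qed

lemma brion_zeta_eq: "brion_zeta \<Omega> \<phi> \<Phi> f = zeta f"
proof -
  have 1: "(\<forall>\<sigma>\<in>max_cones \<Phi>. F_poly \<Omega> \<phi> \<sigma> x \<noteq> 0) \<longleftrightarrow> (\<forall>S\<in>FB. FS S x \<noteq> 0)" for x
    by (simp add: FB_def F_poly_eq)
  have 2: "(\<Sum>\<sigma>\<in>max_cones \<Phi>. poly_on f \<sigma> x / F_poly \<Omega> \<phi> \<sigma> x) = (\<Sum>S\<in>FB. pc f S x / FS S x)" for x
    unfolding FB_def sum.reindex[OF gens_inj] o_def
    using max_basis(3) by (intro sum.cong refl) (simp add: F_poly_eq)
  show ?thesis unfolding brion_zeta_def zeta_def 1 2 ..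
qed

end

section \<open>The cohomology ring\<close>

lemma Jideal_add: assumes "f \<in> Jideal SS B" "g \<in> Jideal SS B" shows "(\<lambda>x. f x + g x) \<in> Jideal SS B"
proof -
  obtain u where u: "\<forall>v\<in>B. u v \<in> PP SS" "f = (\<lambda>y. \<Sum>v\<in>B. representation B y v * u v y)" using assms(1) by (auto simp: Jideal_def)
  obtain w where w: "\<forall>v\<in>B. w v \<in> PP SS" "g = (\<lambda>y. \<Sum>v\<in>B. representation B y v * w v y)" using assms(2) by (auto simp: Jideal_def)
  show ?thesis unfolding Jideal_def u(2) w(2) using u(1) w(1)
    by (intro CollectI exI[of _ "\<lambda>v y. u v y + w v y"]) (auto simp: distrib_left sum.distrib intro: PP_add)
qed

lemma Jideal_mult: assumes "f \<in> Jideal SS B" "g \<in> PP SS" shows "(\<lambda>x. g x * f x) \<in> Jideal SS B"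
proof -
  obtain u where u: "\<forall>v\<in>B. u v \<in> PP SS" "f = (\<lambda>y. \<Sum>v\<in>B. representation B y v * u v y)" using assms(1) by (auto simp: Jideal_def)
  show ?thesis unfolding Jideal_def u(2) using u(1) assms(2)
    by (intro CollectI exI[of _ "\<lambda>v y. g y * u v y"]) (auto simp: sum_distrib_left mult_ac intro: PP_mult)
qed

lemma Jideal_zero: "(\<lambda>x. 0) \<in> Jideal SS B"
  unfolding Jideal_def by (intro CollectI exI[of _ "\<lambda>v x. 0"]) (simp add: poly_PP[OF real_polynomial_function.intros(2)])

lemma Jideal_cmult: "f \<in> Jideal SS B \<Longrightarrow> (\<lambda>x. c * f x) \<in> Jideal SS B"
  by (rule Jideal_mult[OF _ poly_PP[OF real_polynomial_function.intros(2)]])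

lemma Jideal_PP: assumes "is_basis B" "f \<in> Jideal SS B" shows "f \<in> PP SS"
  using assms(2) by (auto simp: Jideal_def intro!: PP_sum PP_mult poly_PP[OF rep_poly[OF assms(1)]])

lemma Jideal_at_0: assumes "is_basis B" "f \<in> Jideal SS B" shows "f 0 = 0"
proof -
  have "representation B 0 v = 0" for v using rep_scale[OF assms(1), of 0 0 v] by simp
  thus ?thesis using assms(2) by (auto simp: Jideal_def)
qed

text \<open>Shows that the coordinates generate the polynomials vanishing at 0; products are handled
  by a discrete Leibniz rule.\<close>

lemma poly_minus_const_Jideal:
  assumes B: "is_basis B" and p: "real_polynomial_function p"
  shows "(\<lambda>x. p x - p 0) \<in> Jideal SS B"
  using p
proof induction
  case (linear f)
  have l: "linear f" using linear bounded_linear.linear by blast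
  have "(\<lambda>x. f x - f 0) = (\<lambda>y. \<Sum>v\<in>B. representation B y v * f v)"
  proof
    fix x
    have "f x = (\<Sum>v\<in>B. representation B x v *\<^sub>R f v)" by (rule linear_expand[OF B l])
    thus "f x - f 0 = (\<Sum>v\<in>B. representation B x v * f v)" by (simp add: linear_0[OF l])
  qed
  thus ?case unfolding Jideal_def
    by (intro CollectI exI[of _ "\<lambda>v y. f v"]) (simp add: poly_PP[OF real_polynomial_function.intros(2)])
next
  case (const c)
  show ?case by (simp add: Jideal_zero)
next
  case (add f g)
  from Jideal_add[OF add.IH] show ?case by (simp add: algebra_simps)
next
  case (mult f g)
  have "(\<lambda>x. f x * (g x - g 0) + g 0 * (f x - f 0)) \<in> Jideal SS B"
    by (intro Jideal_add Jideal_mult Jideal_cmult mult.IH poly_PP mult.hyps)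
  thus ?case by (simp add: algebra_simps)
qed

locale coh_setup = fan_data \<Phi> \<phi> \<Omega>
  for \<Phi> :: "'a::real_normed_vector set set" and \<phi> and \<Omega> :: "(nat \<Rightarrow> 'a) \<Rightarrow> real" +
  fixes B :: "'a set" assumes B: "is_basis B"
begin

abbreviation "PPring \<equiv> cw_poly_ring \<Phi>"
abbreviation "J \<equiv> Jideal FB B"
abbreviation "cl \<equiv> coh_class \<Phi>"
abbreviation "scalars \<equiv> coh_scalars \<Phi>"

lemma ring_simps:
  "carrier PPring = PP FB" "f \<otimes>\<^bsub>PPring\<^esub> g = (\<lambda>x. f x * g x)" "\<one>\<^bsub>PPring\<^esub> = (\<lambda>x. 1)" "\<zero>\<^bsub>PPring\<^esub> = (\<lambda>x. 0)" "f \<oplus>\<^bsub>PPring\<^esub> g = (\<lambda>x. f x + g x)"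
  by (simp_all add: cw_poly_ring_def cw_poly_eq)

lemma const_PP: "(\<lambda>x. c) \<in> PP FB"
  by (rule poly_PP[OF real_polynomial_function.intros(2)])

lemma cring_PPring: "cring PPring"
proof (rule cringI)
  show "abelian_group PPring"
  proof (rule abelian_groupI, unfold ring_simps)
    fix f assume "f \<in> PP FB"
    from PP_cmult[OF this, of "-1"] show "\<exists>g\<in>PP FB. (\<lambda>x. g x + f x) = (\<lambda>x. 0)"
      by (intro bexI[of _ "\<lambda>x. -1 * f x"]) auto
  qed (auto intro: PP_add const_PP simp: algebra_simps)
  show "comm_monoid PPring"
    by (rule comm_monoidI) (auto simp: ring_simps const_PP mult_ac intro: PP_mult)
qed (simp add: ring_simps algebra_simps)

sublocale A: cring PPring by (rule cring_PPring)

lemma a_inv_PPring: assumes "f \<in> PP FB" shows "\<ominus>\<^bsub>PPring\<^esub> f = (\<lambda>x. - f x)"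
proof (rule A.minus_equality)
  show "(\<lambda>x. - f x) \<oplus>\<^bsub>PPring\<^esub> f = \<zero>\<^bsub>PPring\<^esub>" by (simp add: ring_simps)
  show "f \<in> carrier PPring" "(\<lambda>x. - f x) \<in> carrier PPring" using assms PP_cmult[OF assms, of "-1"] by (simp_all add: ring_simps)
qed

lemma J_ideal: "ideal J PPring"
proof (rule idealI)
  show "ring PPring" by (rule A.ring_axioms)
  show "subgroup J (add_monoid PPring)"
  proof (rule A.add.subgroupI)
    show "J \<subseteq> carrier PPring" using Jideal_PP[OF B] by (auto simp: ring_simps)
    show "J \<noteq> {}" using Jideal_zero by blast
    fix f assume f: "f \<in> J"
    show "\<ominus>\<^bsub>PPring\<^esub> f \<in> J"
      using a_inv_PPring[OF Jideal_PP[OF B f]] Jideal_cmult[OF f, of "-1"] by simp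
    fix g assume g: "g \<in> J"
    show "f \<oplus>\<^bsub>PPring\<^esub> g \<in> J" using Jideal_add[OF f g] by (simp add: ring_simps)
  qed
  fix f g assume "f \<in> J" "g \<in> carrier PPring"
  hence "(\<lambda>x. g x * f x) \<in> J" by (intro Jideal_mult) (simp_all add: ring_simps)
  thus "g \<otimes>\<^bsub>PPring\<^esub> f \<in> J" "f \<otimes>\<^bsub>PPring\<^esub> g \<in> J" by (simp_all add: ring_simps mult.commute)
qed

lemma coh_ideal_eq: "coh_ideal \<Phi> = J"
proof
  have pp: "poly_plus \<subseteq> carrier PPring" by (auto simp: poly_plus_def ring_simps intro: poly_PP)
  have "poly_plus \<subseteq> J"
  proof
    fix p :: "'a \<Rightarrow> real" assume "p \<in> poly_plus"
    thus "p \<in> J" using poly_minus_const_Jideal[OF B, of p FB] by (simp add: poly_plus_def)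
  qed
  thus "coh_ideal \<Phi> \<subseteq> J" unfolding coh_ideal_def by (rule A.genideal_minimal[OF J_ideal])
  interpret I: ideal "coh_ideal \<Phi>" PPring unfolding coh_ideal_def by (rule A.genideal_ideal[OF pp])
  show "J \<subseteq> coh_ideal \<Phi>"
  proof
    fix f assume "f \<in> J"
    then obtain g where g: "\<forall>v\<in>B. g v \<in> PP FB" "f = (\<lambda>y. \<Sum>v\<in>B. representation B y v * g v y)" by (auto simp: Jideal_def)
    have "(\<lambda>y. \<Sum>v\<in>X. representation B y v * g v y) \<in> coh_ideal \<Phi>" if "finite X" "X \<subseteq> B" for X
      using that
    proof (induction X rule: finite_induct)
      case empty
      show ?case using I.zero_closed by (simp add: ring_simps)
    next
      case (insert v X)
      have "representation B 0 v = 0" using rep_scale[OF B, of 0 0 v] by simp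
      hence "(\<lambda>y. representation B y v) \<in> poly_plus" using rep_poly[OF B] by (simp add: poly_plus_def)
      hence "(\<lambda>y. representation B y v) \<in> coh_ideal \<Phi>" unfolding coh_ideal_def using A.genideal_self[OF pp] by blast
      from I.I_r_closed[OF this, of "g v"] g(1) insert.prems
      have "(\<lambda>y. representation B y v * g v y) \<in> coh_ideal \<Phi>" by (simp add: ring_simps)
      from I.a_closed[OF this insert.IH] insert show ?case by (simp add: ring_simps)
    qed
    thus "f \<in> coh_ideal \<Phi>" using B g(2) by (simp add: is_basis_def)
  qed
qed

sublocale J: ideal J PPring by (rule J_ideal)

lemma coh_eq: "coh \<Phi> = PPring Quot J"
  by (simp add: coh_def coh_ideal_eq)

sublocale C: cring "coh \<Phi>"
  unfolding coh_eq by (rule J.quotient_is_cring[OF cring_PPring])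

lemma cl_hom: "cl \<in> ring_hom PPring (coh \<Phi>)"
  using J.rcos_ring_hom unfolding coh_class_def[abs_def] coh_eq coh_ideal_eq .

lemma cl_add: "f \<in> PP FB \<Longrightarrow> g \<in> PP FB \<Longrightarrow> cl f \<oplus>\<^bsub>coh \<Phi>\<^esub> cl g = cl (\<lambda>x. f x + g x)"
  using ring_hom_add[OF cl_hom] by (simp add: ring_simps)

lemma cl_mult: "f \<in> PP FB \<Longrightarrow> g \<in> PP FB \<Longrightarrow> cl f \<otimes>\<^bsub>coh \<Phi>\<^esub> cl g = cl (\<lambda>x. f x * g x)"
  using ring_hom_mult[OF cl_hom] by (simp add: ring_simps)

lemma cl_one: "\<one>\<^bsub>coh \<Phi>\<^esub> = cl (\<lambda>x. 1)"
  using ring_hom_one[OF cl_hom] by (simp add: ring_simps)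

lemma cl_zero: "\<zero>\<^bsub>coh \<Phi>\<^esub> = cl (\<lambda>x. 0)"
  using ring_hom_zero[OF cl_hom A.ring_axioms C.ring_axioms] by (simp add: ring_simps)

lemma cl_closed: "f \<in> PP FB \<Longrightarrow> cl f \<in> carrier (coh \<Phi>)"
  using ring_hom_closed[OF cl_hom] by (simp add: ring_simps)

lemma cl_surj: assumes "\<alpha> \<in> carrier (coh \<Phi>)" shows "\<exists>f\<in>PP FB. \<alpha> = cl f"
  using assms unfolding coh_eq coh_class_def coh_ideal_eq by (auto simp: FactRing_def A_RCOSETS_def' ring_simps)

lemma cl_eq_iff: assumes "f \<in> PP FB" "g \<in> PP FB" shows "cl f = cl g \<longleftrightarrow> (\<lambda>x. f x - g x) \<in> J"
proof -
  have "f \<ominus>\<^bsub>PPring\<^esub> g = (\<lambda>x. f x - g x)"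
    unfolding a_minus_def using a_inv_PPring[OF assms(2)] by (simp add: ring_simps)
  thus ?thesis unfolding coh_class_def coh_ideal_eq
    using A.quotient_eq_iff_same_a_r_cos[OF J_ideal, of f g] assms by (simp add: ring_simps)
qed

lemma cl_zero_iff: "f \<in> PP FB \<Longrightarrow> cl f = \<zero>\<^bsub>coh \<Phi>\<^esub> \<longleftrightarrow> f \<in> J"
  unfolding cl_zero using cl_eq_iff[OF _ const_PP, of f 0] by simp

lemma cl_const_zero: "cl (\<lambda>x. c) = \<zero>\<^bsub>coh \<Phi>\<^esub> \<longleftrightarrow> c = 0"
  using cl_zero_iff[OF const_PP, of c] Jideal_at_0[OF B, of "\<lambda>x. c" FB] Jideal_zero by auto

lemma scalars_subfield: "subfield scalars (coh \<Phi>)"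
proof (rule C.subfieldI)
  have K: "\<alpha> \<in> scalars \<longleftrightarrow> (\<exists>c. \<alpha> = cl (\<lambda>x. c))" for \<alpha> by (auto simp: coh_scalars_def)
  have sub: "scalars \<subseteq> carrier (coh \<Phi>)" using cl_closed[OF const_PP] by (auto simp: K)
  have "subring scalars (coh \<Phi>)"
  proof (rule C.subringI[OF sub])
    show "\<one>\<^bsub>coh \<Phi>\<^esub> \<in> scalars" by (auto simp: K cl_one)
    fix h assume "h \<in> scalars"
    then obtain c where c: "h = cl (\<lambda>x. c)" by (auto simp: K)
    have "\<ominus>\<^bsub>coh \<Phi>\<^esub> h = cl (\<lambda>x. - c)"
      by (rule C.minus_equality) (simp_all add: c cl_closed const_PP cl_add cl_zero)
    thus "\<ominus>\<^bsub>coh \<Phi>\<^esub> h \<in> scalars" by (auto simp: K)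
    fix h' assume "h' \<in> scalars"
    then obtain c' where c': "h' = cl (\<lambda>x. c')" by (auto simp: K)
    show "h \<otimes>\<^bsub>coh \<Phi>\<^esub> h' \<in> scalars" "h \<oplus>\<^bsub>coh \<Phi>\<^esub> h' \<in> scalars"
      unfolding c c' cl_add[OF const_PP const_PP] cl_mult[OF const_PP const_PP] by (auto simp: K)
  qed
  thus "subcring scalars (coh \<Phi>)" by (rule C.subcringI) (use C.m_comm sub in blast)
  show "Units (coh \<Phi>\<lparr>carrier := scalars\<rparr>) = scalars - {\<zero>\<^bsub>coh \<Phi>\<^esub>}"
  proof
    have ne: "\<one>\<^bsub>coh \<Phi>\<^esub> \<noteq> \<zero>\<^bsub>coh \<Phi>\<^esub>" using cl_const_zero[of 1] by (simp add: cl_one)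
    show "Units (coh \<Phi>\<lparr>carrier := scalars\<rparr>) \<subseteq> scalars - {\<zero>\<^bsub>coh \<Phi>\<^esub>}"
    proof
      fix u assume "u \<in> Units (coh \<Phi>\<lparr>carrier := scalars\<rparr>)"
      then obtain v where v: "u \<in> scalars" "v \<in> scalars" "u \<otimes>\<^bsub>coh \<Phi>\<^esub> v = \<one>\<^bsub>coh \<Phi>\<^esub>" by (auto simp: Units_def)
      have "u \<noteq> \<zero>\<^bsub>coh \<Phi>\<^esub>" using v ne C.l_null[of v] sub by auto
      thus "u \<in> scalars - {\<zero>\<^bsub>coh \<Phi>\<^esub>}" using v(1) by simp
    qed
    show "scalars - {\<zero>\<^bsub>coh \<Phi>\<^esub>} \<subseteq> Units (coh \<Phi>\<lparr>carrier := scalars\<rparr>)"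
    proof
      fix u assume u: "u \<in> scalars - {\<zero>\<^bsub>coh \<Phi>\<^esub>}"
      then obtain c where c: "u = cl (\<lambda>x. c)" by (auto simp: K)
      have c0: "c \<noteq> 0" using u cl_const_zero[of c] by (auto simp: c)
      have "cl (\<lambda>x. 1 / c) \<in> scalars" by (auto simp: K)
      moreover have "cl (\<lambda>x. 1 / c) \<otimes>\<^bsub>coh \<Phi>\<^esub> u = \<one>\<^bsub>coh \<Phi>\<^esub>" "u \<otimes>\<^bsub>coh \<Phi>\<^esub> cl (\<lambda>x. 1 / c) = \<one>\<^bsub>coh \<Phi>\<^esub>"
        unfolding c cl_mult[OF const_PP const_PP] cl_one using c0 by simp_all
      ultimately show "u \<in> Units (coh \<Phi>\<lparr>carrier := scalars\<rparr>)" using u by (auto simp: Units_def)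
    qed
  qed
qed

lemma combine_cl:
  assumes "length cs = length fs" "set fs \<subseteq> PP FB"
  shows "C.combine (map (\<lambda>c. cl (\<lambda>x. c)) cs) (map cl fs) = cl (\<lambda>x. \<Sum>i<length fs. cs ! i * (fs ! i) x)"
  using assms
proof (induction cs fs rule: list_induct2)
  case Nil
  show ?case by (simp add: cl_zero)
next
  case (Cons c cs f fs)
  have f: "f \<in> PP FB" using Cons.prems by simp
  have s: "(\<lambda>x. \<Sum>i<length fs. cs ! i * (fs ! i) x) \<in> PP FB"
    using Cons.prems by (intro PP_sum PP_cmult) auto
  have "C.combine (map (\<lambda>c. cl (\<lambda>x. c)) (c # cs)) (map cl (f # fs))
      = cl (\<lambda>x. c * f x) \<oplus>\<^bsub>coh \<Phi>\<^esub> cl (\<lambda>x. \<Sum>i<length fs. cs ! i * (fs ! i) x)"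
    using Cons cl_mult[OF const_PP f] by simp
  also have "\<dots> = cl (\<lambda>x. \<Sum>i<length (f # fs). (c # cs) ! i * ((f # fs) ! i) x)"
    unfolding cl_add[OF PP_cmult[OF f] s] by (simp add: sum.lessThan_Suc_shift del: sum.lessThan_Suc)
  finally show ?case .
qed

lemma scalar_list: assumes "set Ks \<subseteq> scalars" shows "\<exists>cs. Ks = map (\<lambda>c. cl (\<lambda>x. c)) cs"
  using assms
proof (induction Ks)
  case (Cons k Ks)
  then obtain cs c where "Ks = map (\<lambda>c. cl (\<lambda>x. c)) cs" "k = cl (\<lambda>x. c)" by (auto simp: coh_scalars_def)
  thus ?case by (intro exI[of _ "c # cs"]) simp
qed simp

section \<open>Subspaces of the cohomology ring described by families of sections modulo the
  ideal\<close>

definition lin_indep :: "nat \<Rightarrow> (nat \<Rightarrow> 'a \<Rightarrow> real) \<Rightarrow> bool" where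
  "lin_indep d f \<longleftrightarrow> (\<forall>i<d. f i \<in> PP FB) \<and> (\<forall>c. (\<lambda>x. \<Sum>i<d. c i * f i x) \<in> J \<longrightarrow> (\<forall>i<d. c i = 0))"

definition cl_span :: "nat \<Rightarrow> (nat \<Rightarrow> 'a \<Rightarrow> real) \<Rightarrow> ('a \<Rightarrow> real) set set" where
  "cl_span d f = {cl (\<lambda>x. \<Sum>i<d. c i * f i x) |c. True}"

lemma combine_family:
  assumes f: "\<forall>i<d. f i \<in> PP FB"
  shows "C.combine (map (\<lambda>i. cl (\<lambda>x. c i)) [0..<d]) (map (\<lambda>i. cl (f i)) [0..<d]) = cl (\<lambda>x. \<Sum>i<d. c i * f i x)"
proof -
  have "C.combine (map (\<lambda>c. cl (\<lambda>x. c)) (map c [0..<d])) (map cl (map f [0..<d]))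
    = cl (\<lambda>x. \<Sum>i<length (map f [0..<d]). map c [0..<d] ! i * (map f [0..<d] ! i) x)"
    using f by (intro combine_cl) auto
  thus ?thesis by (simp add: o_def)
qed

lemma family_facts:
  assumes f: "\<forall>i<d. f i \<in> PP FB"
  shows "C.independent scalars (map (\<lambda>i. cl (f i)) [0..<d]) \<longleftrightarrow> lin_indep d f" (is "?L \<longleftrightarrow> ?R")
    "C.Span scalars (map (\<lambda>i. cl (f i)) [0..<d]) = cl_span d f"
proof -
  define Us where "Us = map (\<lambda>i. cl (f i)) [0..<d]"
  have Us: "set Us \<subseteq> carrier (coh \<Phi>)" "length Us = d" using f cl_closed by (auto simp: Us_def)
  have comb: "C.combine (map (\<lambda>i. cl (\<lambda>x. c i)) [0..<d]) Us = cl (\<lambda>x. \<Sum>i<d. c i * f i x)" for c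
    unfolding Us_def by (rule combine_family) (rule f)
  have mem: "set (map (\<lambda>i. cl (\<lambda>x. c i)) [0..<d]) \<subseteq> scalars" for c by (auto simp: coh_scalars_def)
  have rep: "\<exists>c. Ks = map (\<lambda>i. cl (\<lambda>x. c i)) [0..<d]" if "set Ks \<subseteq> scalars" "length Ks = d" for Ks
  proof -
    obtain cs where cs: "Ks = map (\<lambda>c. cl (\<lambda>x. c)) cs" using scalar_list[OF \<open>set Ks \<subseteq> scalars\<close>] by blast
    hence "Ks = map (\<lambda>i. cl (\<lambda>x. cs ! i)) [0..<d]" using that(2) by (intro nth_equalityI) auto
    thus ?thesis by blast
  qed
  have sP: "(\<lambda>x. \<Sum>i<d. c i * f i x) \<in> PP FB" for c using f by (intro PP_sum PP_cmult) auto
  show "C.Span scalars (map (\<lambda>i. cl (f i)) [0..<d]) = cl_span d f"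
    unfolding Us_def[symmetric] C.Span_eq_combine_set_length_version[OF scalars_subfield Us(1)] cl_span_def
  proof (intro equalityI subsetI)
    fix \<alpha> assume "\<alpha> \<in> {C.combine Ks Us |Ks. length Ks = length Us \<and> set Ks \<subseteq> scalars}"
    then obtain Ks where Ks: "\<alpha> = C.combine Ks Us" "length Ks = d" "set Ks \<subseteq> scalars" using Us(2) by auto
    obtain c where "Ks = map (\<lambda>i. cl (\<lambda>x. c i)) [0..<d]" using rep[OF Ks(3,2)] by blast
    thus "\<alpha> \<in> {cl (\<lambda>x. \<Sum>i<d. c i * f i x) |c. True}" using Ks(1) comb by auto
  next
    fix \<alpha> assume "\<alpha> \<in> {cl (\<lambda>x. \<Sum>i<d. c i * f i x) |c. True}"
    then obtain c where "\<alpha> = C.combine (map (\<lambda>i. cl (\<lambda>x. c i)) [0..<d]) Us" using comb by auto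
    thus "\<alpha> \<in> {C.combine Ks Us |Ks. length Ks = length Us \<and> set Ks \<subseteq> scalars}"
      using mem[of c] Us(2) by (intro CollectI exI[of _ "map (\<lambda>i. cl (\<lambda>x. c i)) [0..<d]"]) auto
  qed
  show "?L \<longleftrightarrow> ?R"
    unfolding Us_def[symmetric]
  proof
    assume L: "C.independent scalars Us"
    have "c i = 0" if z: "(\<lambda>x. \<Sum>i<d. c i * f i x) \<in> J" and i: "i < d" for c i
    proof -
      have "C.combine (map (\<lambda>i. cl (\<lambda>x. c i)) [0..<d]) Us = \<zero>\<^bsub>coh \<Phi>\<^esub>"
        unfolding comb using cl_zero_iff[OF sP] z by blast
      from C.independent_imp_trivial_combine[OF scalars_subfield L mem this]
      have "set (map (\<lambda>i. cl (\<lambda>x. c i)) [0..<d]) \<subseteq> {\<zero>\<^bsub>coh \<Phi>\<^esub>}" using Us(2) by simp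
      moreover have "cl (\<lambda>x. c i) \<in> set (map (\<lambda>i. cl (\<lambda>x. c i)) [0..<d])"
        unfolding set_map set_upt using i by (intro image_eqI[of _ _ i]) simp_all
      ultimately have "cl (\<lambda>x. c i) = \<zero>\<^bsub>coh \<Phi>\<^esub>" by blast
      thus ?thesis using cl_const_zero by blast
    qed
    thus "lin_indep d f" using f by (auto simp: lin_indep_def)
  next
    assume R: "lin_indep d f"
    show "C.independent scalars Us"
    proof (rule ccontr)
      assume "\<not> C.independent scalars Us"
      from C.dependent_imp_non_trivial_combine[OF scalars_subfield Us(1) this]
      obtain Ks where Ks: "length Ks = d" "C.combine Ks Us = \<zero>\<^bsub>coh \<Phi>\<^esub>" "set Ks \<subseteq> scalars" "set Ks \<noteq> {\<zero>\<^bsub>coh \<Phi>\<^esub>}"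
        using Us(2) by metis
      have "d \<noteq> 0"
      proof
        assume "d = 0"
        hence "Us = []" by (simp add: Us_def)
        thus False using \<open>\<not> C.independent scalars Us\<close> C.li_Nil by blast
      qed
      obtain c where c: "Ks = map (\<lambda>i. cl (\<lambda>x. c i)) [0..<d]" using rep[OF Ks(3,1)] by blast
      have "(\<lambda>x. \<Sum>i<d. c i * f i x) \<in> J" using Ks(2) unfolding c comb using cl_zero_iff[OF sP] by blast
      hence "\<forall>i<d. c i = 0" using R by (simp add: lin_indep_def)
      hence "set Ks = {\<zero>\<^bsub>coh \<Phi>\<^esub>}" using \<open>d \<noteq> 0\<close> unfolding c by (auto simp: cl_zero)
      thus False using Ks(4) by blast
    qed
  qed
qed

lemma dimension_iff: "C.dimension d scalars W \<longleftrightarrow> (\<exists>f. lin_indep d f \<and> W = cl_span d f)"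
proof
  assume "C.dimension d scalars W"
  from C.exists_base[OF scalars_subfield this]
  obtain Vs where Vs: "set Vs \<subseteq> carrier (coh \<Phi>)" "C.independent scalars Vs" "length Vs = d" "C.Span scalars Vs = W" by blast
  have "\<exists>f\<in>PP FB. Vs ! i = cl f" if "i < d" for i
    using cl_surj[of "Vs ! i"] Vs(1,3) that nth_mem by blast
  then obtain f where f: "\<And>i. i < d \<Longrightarrow> f i \<in> PP FB" "\<And>i. i < d \<Longrightarrow> Vs ! i = cl (f i)" by metis
  have V: "Vs = map (\<lambda>i. cl (f i)) [0..<d]" using f(2) Vs(3) by (intro nth_equalityI) auto
  show "\<exists>f. lin_indep d f \<and> W = cl_span d f"
    using family_facts[of d f] f(1) Vs(2,4) unfolding V by blast
next
  assume "\<exists>f. lin_indep d f \<and> W = cl_span d f"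
  then obtain f where f: "lin_indep d f" "W = cl_span d f" by blast
  have fP: "\<forall>i<d. f i \<in> PP FB" using f(1) by (simp add: lin_indep_def)
  have "C.independent scalars (map (\<lambda>i. cl (f i)) [0..<d])" using family_facts(1)[OF fP] f(1) by blast
  from C.dimensionI[OF scalars_subfield this family_facts(2)[OF fP]] f(2) show "C.dimension d scalars W" by simp
qed

text \<open>The integral is constant on a coset of the ideal, so the image whose only element is
  extracted is indeed a singleton.\<close>

lemma fan_integral_cl: assumes f: "f \<in> PP FB" shows "fan_integral \<Omega> \<phi> \<Phi> (cl f) = zeta f 0"
proof -
  have "(\<lambda>g. brion_zeta \<Omega> \<phi> \<Phi> g 0) ` cl f = {zeta f 0}"
  proof -
    have e: "zeta (\<lambda>x. h x + f x) 0 = zeta f 0" if "h \<in> J" for h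
      using zeta_add[OF Jideal_PP[OF B that] f] zeta_Jideal[OF B that] by simp
    have "cl f = (\<lambda>h x. h x + f x) ` J"
      unfolding coh_class_def coh_ideal_eq a_r_coset_def' by (auto simp: ring_simps)
    hence "(\<lambda>g. brion_zeta \<Omega> \<phi> \<Phi> g 0) ` cl f = (\<lambda>h. zeta f 0) ` J"
      unfolding brion_zeta_eq by (simp add: image_image e cong: image_cong_simp)
    thus ?thesis using image_constant[OF Jideal_zero] by simp
  qed
  thus ?thesis by (simp add: fan_integral_def)
qed

lemma pairing_cl:
  assumes "f \<in> PP FB" "g \<in> PP FB" shows "poincare_pairing \<Omega> \<phi> \<Phi> (cl f) (cl g) = bil f g 0"
  by (simp add: poincare_pairing_def cl_mult assms fan_integral_cl PP_mult bil_def)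

text \<open>The upper bound comes from \<open>definite_dim_le\<close>, the attained dimension from
  \<open>definite_families\<close>. A definite family is independent modulo the ideal because
  elements of the ideal have square zero.\<close>

lemma index_eq:
  assumes x: "signed_fan FB weight B x B'" and s: "s = 1 \<or> s = (-1::real)"
  shows "positive_index (coh \<Phi>) scalars (\<lambda>\<alpha> \<gamma>. s * poincare_pairing \<Omega> \<phi> \<Phi> \<alpha> \<gamma>) = card {S\<in>FB. s * FS S x > 0}"
proof -
  interpret S: signed_fan FB weight B x B' by (rule x)
  define p where "p = card {S\<in>FB. s * FS S x > 0}"
  define DD where "DD = {d. \<exists>W. C.dimension d scalars W \<and> (\<forall>w\<in>W. w \<noteq> \<zero>\<^bsub>coh \<Phi>\<^esub> \<longrightarrow> s * poincare_pairing \<Omega> \<phi> \<Phi> w w > 0)}"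
  have cP: "(\<lambda>x. \<Sum>i<d. c i * f i x) \<in> PP FB" if "\<forall>i<d. f i \<in> PP FB" for c f and d :: nat
    using that by (intro PP_sum PP_cmult) auto
  have le: "d \<le> p" if d: "d \<in> DD" for d
  proof -
    obtain f where f: "lin_indep d f" "\<forall>w\<in>cl_span d f. w \<noteq> \<zero>\<^bsub>coh \<Phi>\<^esub> \<longrightarrow> s * poincare_pairing \<Omega> \<phi> \<Phi> w w > 0"
      using d unfolding DD_def dimension_iff by blast
    have fP: "\<forall>i<d. f i \<in> PP FB" using f(1) by (simp add: lin_indep_def)
    show ?thesis unfolding p_def
    proof (rule definite_dim_le[OF S.gen _ s])
      show "f i \<in> PP FB" if "i < d" for i using fP that by blast
      fix c assume c: "\<exists>i<d. c i \<noteq> (0::real)"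
      define h where "h = (\<lambda>x. \<Sum>i<d. c i * f i x)"
      have h: "h \<in> PP FB" unfolding h_def by (rule cP[OF fP])
      have "h \<notin> J" using f(1) c unfolding h_def lin_indep_def by blast
      hence "cl h \<noteq> \<zero>\<^bsub>coh \<Phi>\<^esub>" using cl_zero_iff[OF h] by blast
      moreover have "cl h \<in> cl_span d f" by (auto simp: cl_span_def h_def)
      ultimately have "s * poincare_pairing \<Omega> \<phi> \<Phi> (cl h) (cl h) > 0" using f(2) by blast
      thus "s * bil h h 0 > 0" by (simp add: pairing_cl[OF h h])
    qed
  qed
  have "p \<in> DD"
  proof -
    obtain f where f: "\<forall>i<p. f i \<in> PP FB" "\<forall>c. (\<exists>i<p. c i \<noteq> 0) \<longrightarrow> s * bil (\<lambda>y. \<Sum>i<p. c i * f i y) (\<lambda>y. \<Sum>i<p. c i * f i y) 0 > 0"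
      using S.definite_families[OF s] unfolding p_def[symmetric] by (elim exE conjE) (rule that)
    have "lin_indep p f" unfolding lin_indep_def
    proof (intro conjI allI impI)
      show "f i \<in> PP FB" if "i < p" for i using f(1) that by blast
      fix c i assume z: "(\<lambda>x. \<Sum>i<p. c i * f i x) \<in> J" and i: "i < p"
      have "bil (\<lambda>x. \<Sum>i<p. c i * f i x) (\<lambda>x. \<Sum>i<p. c i * f i x) 0 = 0"
        unfolding bil_def by (rule zeta_Jideal[OF B Jideal_mult[OF z cP[OF f(1)]]])
      thus "c i = 0" using f(2)[rule_format, of c] i by auto
    qed
    moreover have "\<forall>w\<in>cl_span p f. w \<noteq> \<zero>\<^bsub>coh \<Phi>\<^esub> \<longrightarrow> s * poincare_pairing \<Omega> \<phi> \<Phi> w w > 0"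
    proof (intro ballI impI)
      fix w assume w: "w \<in> cl_span p f" "w \<noteq> \<zero>\<^bsub>coh \<Phi>\<^esub>"
      then obtain c where c: "w = cl (\<lambda>x. \<Sum>i<p. c i * f i x)" by (auto simp: cl_span_def)
      have "\<exists>i<p. c i \<noteq> 0"
      proof (rule ccontr)
        assume "\<not> (\<exists>i<p. c i \<noteq> 0)"
        hence "w = cl (\<lambda>x. 0)" unfolding c by simp
        thus False using w(2) cl_zero by simp
      qed
      hence "s * bil (\<lambda>y. \<Sum>i<p. c i * f i y) (\<lambda>y. \<Sum>i<p. c i * f i y) 0 > 0" using f(2) by blast
      thus "s * poincare_pairing \<Omega> \<phi> \<Phi> w w > 0" unfolding c pairing_cl[OF cP[OF f(1)] cP[OF f(1)]] .
    qed
    ultimately show ?thesis unfolding DD_def dimension_iff by blast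
  qed
  moreover have "finite DD" by (rule finite_subset[of _ "{..p}"]) (use le in auto)
  ultimately have "Max DD = p" using le by (intro Max_eqI) auto
  thus ?thesis unfolding positive_index_def DD_def p_def .
qed

text \<open>The classes of the lifts of degree \<open>k\<close> form a basis: they span by
  \<open>Jideal_span\<close> and are independent by \<open>Jideal_independent\<close>.\<close>

lemma coh_comp_dimension:
  assumes x: "reduction FB B x"
  shows "C.dimension (card {u \<in> reduction.\<beta> FB x. reduction.d FB x u = k}) scalars (coh_comp \<Phi> k)"
proof -
  interpret S: reduction FB B x by (rule x)
  define X where "X = {u\<in>S.\<beta>. S.d u = k}"
  define m where "m = card X"
  have fX: "finite X" using S.beta_finite by (simp add: X_def)
  obtain e where e: "bij_betw e {..<m} X" using ex_bij_betw_nat_finite[OF fX] by (auto simp: m_def atLeast0LessThan)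
  define f where "f = (\<lambda>i. S.lf (e i))"
  have eX: "e i \<in> S.\<beta>" "S.d (e i) = k" if "i < m" for i using bij_betwE[OF e] that by (auto simp: X_def)
  have fh: "f i \<in> PPh FB k" if "i < m" for i using S.lf(1)[OF eX(1)[OF that]] eX(2)[OF that] by (simp add: f_def)
  have sum_eq: "(\<lambda>y. \<Sum>i<m. c (e i) * f i y) = (\<lambda>y. \<Sum>u\<in>X. c u * S.lf u y)" for c
    unfolding f_def using sum.reindex_bij_betw[OF e, of "\<lambda>u. c u * S.lf u _"] by auto
  have li: "lin_indep m f"
    unfolding lin_indep_def
  proof (intro conjI allI impI)
    show "f i \<in> PP FB" if "i < m" for i using PPh_PP[OF fh[OF that]] .
    fix c i assume z: "(\<lambda>x. \<Sum>i<m. c i * f i x) \<in> J" and i: "i < m"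
    define c' where "c' = (\<lambda>u. c (inv_into {..<m} e u))"
    have inv: "c' (e j) = c j" if "j < m" for j
      using bij_betw_inv_into_left[OF e, of j] that by (simp add: c'_def)
    have "(\<lambda>x. \<Sum>i<m. c i * f i x) = (\<lambda>y. \<Sum>u\<in>X. c' u * S.lf u y)"
      unfolding sum_eq[symmetric] using inv by auto
    hence "(\<lambda>y. \<Sum>u\<in>{u\<in>S.\<beta>. S.d u = k}. c' u * S.lf u y) \<in> J" using z by (simp add: X_def)
    from S.Jideal_independent[OF this eX(1)[OF i] eX(2)[OF i]] show "c i = 0" using inv[OF i] by simp
  qed
  have "coh_comp \<Phi> k = cl_span m f"
  proof (intro equalityI subsetI)
    fix \<alpha> assume "\<alpha> \<in> coh_comp \<Phi> k"
    then obtain g where g: "g \<in> PPh FB k" "\<alpha> = cl g" by (auto simp: coh_comp_def cw_homogeneous_eq)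
    obtain c where c: "(\<lambda>y. g y - (\<Sum>u\<in>X. c u * S.lf u y)) \<in> J" using S.Jideal_span[OF g(1)] by (auto simp: X_def)
    have sP: "(\<lambda>y. \<Sum>u\<in>X. c u * S.lf u y) \<in> PP FB" unfolding sum_eq[symmetric]
      using PPh_PP[OF fh] by (intro PP_sum PP_cmult) auto
    have "cl g = cl (\<lambda>y. \<Sum>u\<in>X. c u * S.lf u y)" using cl_eq_iff[OF PPh_PP[OF g(1)] sP] c by blast
    thus "\<alpha> \<in> cl_span m f" unfolding g(2) cl_span_def sum_eq[symmetric] by (auto intro!: exI[of _ "\<lambda>i. c (e i)"])
  next
    fix \<alpha> assume "\<alpha> \<in> cl_span m f"
    then obtain c where c: "\<alpha> = cl (\<lambda>x. \<Sum>i<m. c i * f i x)" by (auto simp: cl_span_def)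
    have "(\<lambda>x. \<Sum>i<m. c i * f i x) \<in> PPh FB k" using fh by (intro PPh_sum PPh_cmult) auto
    thus "\<alpha> \<in> coh_comp \<Phi> k" unfolding c by (auto simp: coh_comp_def cw_homogeneous_eq)
  qed
  thus ?thesis using li dimension_iff unfolding m_def X_def by blast
qed

text \<open>The sum over nonzero components becomes a sum over degrees up to \<open>n\<close>,
  beyond which no lift exists.\<close>

lemma epsilon_eq:
  assumes x: "reduction FB B x"
  shows "fan_epsilon \<Phi> = (\<Sum>k\<le>dim (UNIV :: 'a set). (- 1) ^ k * int (card {u \<in> reduction.\<beta> FB x. reduction.d FB x u = k}))"
proof -
  interpret S: reduction FB B x by (rule x)
  define h where "h = (\<lambda>k. card {u\<in>S.\<beta>. S.d u = k})"
  have dm: "C.dimension (h k) scalars (coh_comp \<Phi> k)" for k unfolding h_def by (rule coh_comp_dimension[OF x])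
  have cd: "coh_dim \<Phi> k = h k" for k
    using C.dimI[OF scalars_subfield dm] by (simp add: coh_dim_def over_def)
  have z: "h k = 0 \<longleftrightarrow> coh_comp \<Phi> k = {\<zero>\<^bsub>coh \<Phi>\<^esub>}" for k
  proof
    assume "h k = 0"
    thus "coh_comp \<Phi> k = {\<zero>\<^bsub>coh \<Phi>\<^esub>}" using C.dimension_zero[OF scalars_subfield] dm[of k] by simp
  next
    assume c: "coh_comp \<Phi> k = {\<zero>\<^bsub>coh \<Phi>\<^esub>}"
    show "h k = 0" using C.dimension_is_inj[OF scalars_subfield dm[of k, unfolded c] C.zero_dim] .
  qed
  have top: "h k = 0" if "k > dim (UNIV :: 'a set)" for k
  proof -
    have "{u\<in>S.\<beta>. S.d u = k} = {}" using S.beta_d that unfolding S.n_def by fastforce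
    thus ?thesis unfolding h_def by (simp only: card.empty)
  qed
  have hk: "card {u\<in>S.\<beta>. S.d u = k} = h k" for k by (simp only: h_def)
  show ?thesis unfolding fan_epsilon_def z[symmetric] cd hk
  proof (rule sum.mono_neutral_left)
    show "{i. h i \<noteq> 0} \<subseteq> {..dim (UNIV :: 'a set)}" using top by (auto simp: not_less[symmetric])
  qed auto
qed

end

theorem theorem6p3:
  fixes \<Phi> :: "'a::real_normed_vector set set"
    and \<Omega> :: "(nat \<Rightarrow> 'a) \<Rightarrow> real"
    and \<phi> :: "'a set \<Rightarrow> 'a \<Rightarrow> real"
  assumes "finite_dimensional TYPE('a)"
    and "complete_fan \<Phi>"
    and "simplicial_fan \<Phi>"
    and "volume_form \<Omega>"
    and "\<And>\<rho>. \<rho> \<in> fan_rays \<Phi> \<Longrightarrow> courant_function \<Phi> \<rho> (\<phi> \<rho>)"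
  shows "fan_signature \<Omega> \<phi> \<Phi> = fan_epsilon \<Phi>"
proof -
  interpret D: fan_data \<Phi> \<phi> \<Omega>
    using assms by unfold_locales
  obtain x B B' where x: "generic D.FB x" "is_basis B" "x \<in> B \<or> B = {}" "reducible_at D.FB B x"
      "is_basis B'" "- x \<in> B' \<or> B' = {}" "reducible_at D.FB B' (- x)"
    using reducible_exists[OF D.sfan_FB] by (elim exE conjE) (rule that)
  interpret coh_setup \<Phi> \<phi> \<Omega> B by unfold_locales (rule x(2))
  have r: "reduction D.FB B x" using x D.sfan_FB by unfold_locales
  have r': "reduction D.FB B' (- x)" using x D.sfan_FB generic_minus by unfold_locales auto
  have s: "signed_fan D.FB D.weight B x B'" using D.weighted_fan_axioms r r' by (simp add: signed_fan_def)
  interpret S: signed_fan D.FB D.weight B x B' by (rule s)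
  have "fan_signature \<Omega> \<phi> \<Phi> = int (card {S\<in>D.FB. D.FS S x > 0}) - int (card {S\<in>D.FB. - D.FS S x > 0})"
    using index_eq[OF s, of 1] index_eq[OF s, of "-1"] by (simp add: fan_signature_def form_signature_def)
  also have "\<dots> = fan_epsilon \<Phi>"
    unfolding epsilon_eq[OF r] using S.signature_count by (simp add: S.n_def)
  finally show ?thesis .
qed

end
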